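(* For every integer $p\ge 3$, every $\beta>0$, every $T>0$ and every sequence of initial points $x_N\in\mathcal S^N$, $\mathbb P$-almost surely the following holds. The laws of $(U_N(t))_{t\in[0,T]}$, where $U_N(t)=(u_N(t),v_N(t))=\big(-H(X_t)/N,\ |\nabla H(X_t)|^2/N\big)$ and $X_0=x_N$, are tight in the space of probability measures on $C([0,T])^2$ (with the product of sup-norm topologies). Moreover, every weak limit point $U(t)=(u(t),v(t))$ is almost surely continuously differentiable and satisfies, for all $t\in[0,T]$, $$\dot u=\mathcal F_1(u,v),\qquad \mathcal F_2^L(u,v)\le \dot v\le \mathcal F_2^U(u,v),$$ where $\mathcal F_1(u,v)=-pu+\beta v$, $\mathcal F_2^L(u,v)=2p(p-1)-2(p-1)v+2pu(pu-\beta v)-2\beta\Lambda_p v$, $\mathcal F_2^U(u,v)=2p(p-1)-2(p-1)v+2pu(pu-\beta v)+2\beta\Lambda_p v$.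
   Context: $\mathcal S^N=\{x\in\mathbb R^N:\sum_i x_i^2=N\}$ with its induced Riemannian metric; $\nabla$, $\nabla^2$ and $\Delta$ denote the spherical (covariant) gradient, Hessian and Laplacian. The $p$-spin Hamiltonian is $H(x)=N^{-(p-1)/2}\sum_{i_1,\dots,i_p=1}^N J_{i_1\dots i_p}x_{i_1}\cdots x_{i_p}$ with $J_{i_1\dots i_p}$ i.i.d. standard Gaussians; $\mathbb P$ is their law. For $\beta>0$, the Langevin dynamics $X_t$ is the solution of $dX_t=\sqrt2\,dB_t-\beta\nabla H(X_t)\,dt$, $X_0=x$, where $B_t$ is Brownian motion on $\mathcal S^N$ (generator $\Delta$); equivalently $X_t$ is the diffusion with generator $L=\Delta-\beta\langle\nabla H,\nabla\cdot\rangle$. $Q_x$ denotes its law started from $x$. $G(x)$ denotes the Euclidean Hessian of $H$ restricted to $T_x\mathcal S^N$, equivalently $G=\nabla^2H+p\frac{H}{N}\mathrm{Id}$. $\Lambda_p$ is any constant satisfying $\Lambda_p>\limsup_{N\to\infty}\mathbb E[\sup_{x\in\mathcal S^N}|G(x)|_{op}]$, where $|G|_{op}$ is the operator norm of $G$ as a bilinear form on $T_x\mathcal S^N$. *)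

theory Defs
  imports "HOL-Probability.Probability"
begin

text \<open>Points of R^N are functions nat => real vanishing at indices >= N.\<close>

definition sphereN :: "nat \<Rightarrow> (nat \<Rightarrow> real) set" where
  "sphereN N = {x. (\<Sum>i<N. (x i)\<^sup>2) = real N \<and> (\<forall>i\<ge>N. x i = 0)}"

definition Ham :: "nat \<Rightarrow> nat \<Rightarrow> (nat list \<Rightarrow> real) \<Rightarrow> (nat \<Rightarrow> real) \<Rightarrow> real" where
  "Ham N p J x = real N powr (- (real p - 1) / 2) *
     (\<Sum>is\<in>{is. length is = p \<and> set is \<subseteq> {..<N}}. J is * (\<Prod>j<p. x (is ! j)))"

definition unitv :: "nat \<Rightarrow> nat \<Rightarrow> real" where
  "unitv i = (\<lambda>j. if j = i then 1 else 0)"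

definition ddir :: "((nat \<Rightarrow> real) \<Rightarrow> real) \<Rightarrow> (nat \<Rightarrow> real) \<Rightarrow> (nat \<Rightarrow> real) \<Rightarrow> real" where
  "ddir f x u = deriv (\<lambda>t. f (\<lambda>i. x i + t * u i)) 0"

definition egrad :: "((nat \<Rightarrow> real) \<Rightarrow> real) \<Rightarrow> (nat \<Rightarrow> real) \<Rightarrow> nat \<Rightarrow> real" where
  "egrad f x i = ddir f x (unitv i)"

definition ehess :: "((nat \<Rightarrow> real) \<Rightarrow> real) \<Rightarrow> (nat \<Rightarrow> real) \<Rightarrow> (nat \<Rightarrow> real) \<Rightarrow> (nat \<Rightarrow> real) \<Rightarrow> real" where
  "ehess f x u w = deriv (\<lambda>s. ddir f (\<lambda>i. x i + s * u i) w) 0"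

text \<open>Spherical gradient on S^N = {|x|^2 = N}: tangential projection of the Euclidean gradient.\<close>
definition sgrad :: "nat \<Rightarrow> ((nat \<Rightarrow> real) \<Rightarrow> real) \<Rightarrow> (nat \<Rightarrow> real) \<Rightarrow> nat \<Rightarrow> real" where
  "sgrad N f x i = egrad f x i - ((\<Sum>j<N. x j * egrad f x j) / real N) * x i"

definition sgrad_norm2 :: "nat \<Rightarrow> ((nat \<Rightarrow> real) \<Rightarrow> real) \<Rightarrow> (nat \<Rightarrow> real) \<Rightarrow> real" where
  "sgrad_norm2 N f x = (\<Sum>i<N. (sgrad N f x i)\<^sup>2)"

text \<open>Laplace--Beltrami operator on the sphere of radius sqrt N in R^N, via an ambient extension f.\<close>
definition slap :: "nat \<Rightarrow> ((nat \<Rightarrow> real) \<Rightarrow> real) \<Rightarrow> (nat \<Rightarrow> real) \<Rightarrow> real" where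
  "slap N f x = (\<Sum>i<N. ehess f x (unitv i) (unitv i)) - ehess f x x x / real N
                 - (real N - 1) / real N * (\<Sum>i<N. x i * egrad f x i)"

definition gen :: "nat \<Rightarrow> nat \<Rightarrow> real \<Rightarrow> (nat list \<Rightarrow> real) \<Rightarrow> ((nat \<Rightarrow> real) \<Rightarrow> real) \<Rightarrow> (nat \<Rightarrow> real) \<Rightarrow> real" where
  "gen N p \<beta> J f x = slap N f x - \<beta> * (\<Sum>i<N. sgrad N (Ham N p J) x i * sgrad N f x i)"

definition tangent_unit :: "nat \<Rightarrow> (nat \<Rightarrow> real) \<Rightarrow> (nat \<Rightarrow> real) set" where
  "tangent_unit N x = {u. (\<Sum>i<N. (u i)\<^sup>2) = 1 \<and> (\<Sum>i<N. x i * u i) = 0 \<and> (\<forall>i\<ge>N. u i = 0)}"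

definition G_opnorm :: "nat \<Rightarrow> nat \<Rightarrow> (nat list \<Rightarrow> real) \<Rightarrow> (nat \<Rightarrow> real) \<Rightarrow> real" where
  "G_opnorm N p J x = Sup {\<bar>ehess (Ham N p J) x u w\<bar> | u w. u \<in> tangent_unit N x \<and> w \<in> tangent_unit N x}"

definition sup_G_opnorm :: "nat \<Rightarrow> nat \<Rightarrow> (nat list \<Rightarrow> real) \<Rightarrow> real" where
  "sup_G_opnorm N p J = Sup {G_opnorm N p J x | x. x \<in> sphereN N}"

definition poly_test :: "nat \<Rightarrow> ((nat \<Rightarrow> real) \<Rightarrow> real) \<Rightarrow> bool" where
  "poly_test N f \<longleftrightarrow> (\<exists>(E :: (nat \<Rightarrow> nat) set) c. finite E \<and>
      f = (\<lambda>x. \<Sum>e\<in>E. c e * (\<Prod>i<N. x i ^ e i)))"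

definition nat_filt :: "'w measure \<Rightarrow> ('w \<Rightarrow> real \<Rightarrow> nat \<Rightarrow> real) \<Rightarrow> nat \<Rightarrow> real \<Rightarrow> 'w measure" where
  "nat_filt M X N s = sigma (space M)
     {(\<lambda>\<omega>. X \<omega> r i) -` A \<inter> space M | r i A. 0 \<le> r \<and> r \<le> s \<and> i < N \<and> A \<in> sets borel}"

definition ct_martingale :: "'w measure \<Rightarrow> (real \<Rightarrow> 'w measure) \<Rightarrow> ('w \<Rightarrow> real \<Rightarrow> real) \<Rightarrow> bool" where
  "ct_martingale M F Y \<longleftrightarrow>
     (\<forall>t\<ge>0. integrable M (\<lambda>\<omega>. Y \<omega> t) \<and> (\<lambda>\<omega>. Y \<omega> t) \<in> borel_measurable (F t)) \<and>
     (\<forall>s t. 0 \<le> s \<and> s \<le> t \<longrightarrow> (AE \<omega> in M. real_cond_exp M (F s) (\<lambda>\<omega>. Y \<omega> t) \<omega> = Y \<omega> s))"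

text \<open>X (on probability space M) is the Langevin dynamics on S^N started at x0:
  a continuous S^N-valued process solving the martingale problem for L.\<close>
definition langevin :: "nat \<Rightarrow> nat \<Rightarrow> real \<Rightarrow> (nat list \<Rightarrow> real) \<Rightarrow> (nat \<Rightarrow> real)
     \<Rightarrow> 'w measure \<Rightarrow> ('w \<Rightarrow> real \<Rightarrow> nat \<Rightarrow> real) \<Rightarrow> bool" where
  "langevin N p \<beta> J x0 M X \<longleftrightarrow>
     prob_space M \<and>
     (\<forall>\<omega>\<in>space M. X \<omega> 0 = x0 \<and> (\<forall>t\<ge>0. X \<omega> t \<in> sphereN N) \<and>
                    (\<forall>i<N. continuous_on {0..} (\<lambda>t. X \<omega> t i))) \<and>
     (\<forall>t\<ge>0. \<forall>i<N. (\<lambda>\<omega>. X \<omega> t i) \<in> borel_measurable M) \<and>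
     (\<forall>f. poly_test N f \<longrightarrow>
        ct_martingale M (nat_filt M X N)
          (\<lambda>\<omega> t. f (X \<omega> t) - f (X \<omega> 0) - integral {0..t} (\<lambda>s. gen N p \<beta> J f (X \<omega> s))))"

text \<open>The path (u_N, v_N) on [0,T], as an element of C([0,T])^2, extended constantly outside [0,T].\<close>
definition Upath :: "nat \<Rightarrow> nat \<Rightarrow> (nat list \<Rightarrow> real) \<Rightarrow> real \<Rightarrow> (real \<Rightarrow> nat \<Rightarrow> real)
     \<Rightarrow> (real, real \<times> real) bcontfun" where
  "Upath N p J T Xw = Bcontfun (\<lambda>t. let s = max 0 (min T t) in
      (- Ham N p J (Xw s) / real N, sgrad_norm2 N (Ham N p J) (Xw s) / real N))"

definition tight_seq :: "(nat \<Rightarrow> 'w measure) \<Rightarrow> (nat \<Rightarrow> 'w \<Rightarrow> 'b::metric_space) \<Rightarrow> bool" where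
  "tight_seq M Y \<longleftrightarrow> (\<forall>\<epsilon>>0. \<exists>K. compact K \<and>
      (\<forall>N. measure (M N) {\<omega>\<in>space (M N). Y N \<omega> \<in> K} \<ge> 1 - \<epsilon>))"

definition weak_limit_point :: "(nat \<Rightarrow> 'w measure) \<Rightarrow> (nat \<Rightarrow> 'w \<Rightarrow> 'b::metric_space) \<Rightarrow> 'b measure \<Rightarrow> bool" where
  "weak_limit_point M Y \<mu> \<longleftrightarrow> prob_space \<mu> \<and> sets \<mu> = sets borel \<and>
     (\<exists>r. strict_mono r \<and>
        (\<forall>g :: 'b \<Rightarrow> real. continuous_on UNIV g \<and> bounded (range g) \<longrightarrow>
           (\<lambda>k. integral\<^sup>L (M (r k)) (\<lambda>\<omega>. g (Y (r k) \<omega>))) \<longlonglongrightarrow> integral\<^sup>L \<mu> g))"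

definition F1 :: "nat \<Rightarrow> real \<Rightarrow> real \<Rightarrow> real \<Rightarrow> real" where
  "F1 p \<beta> u v = - real p * u + \<beta> * v"
definition F2L :: "nat \<Rightarrow> real \<Rightarrow> real \<Rightarrow> real \<Rightarrow> real \<Rightarrow> real" where
  "F2L p \<beta> \<Lambda> u v = 2 * real p * (real p - 1) - 2 * (real p - 1) * v
      + 2 * real p * u * (real p * u - \<beta> * v) - 2 * \<beta> * \<Lambda> * v"
definition F2U :: "nat \<Rightarrow> real \<Rightarrow> real \<Rightarrow> real \<Rightarrow> real \<Rightarrow> real" where
  "F2U p \<beta> \<Lambda> u v = 2 * real p * (real p - 1) - 2 * (real p - 1) * v
      + 2 * real p * u * (real p * u - \<beta> * v) + 2 * \<beta> * \<Lambda> * v"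

definition C1_ode :: "nat \<Rightarrow> real \<Rightarrow> real \<Rightarrow> real \<Rightarrow> (real, real \<times> real) bcontfun \<Rightarrow> bool" where
  "C1_ode p \<beta> \<Lambda> T f \<longleftrightarrow> (\<exists>u' v'. continuous_on {0..T} u' \<and> continuous_on {0..T} v' \<and>
     (\<forall>t\<in>{0..T}.
        ((\<lambda>s. fst (apply_bcontfun f s)) has_real_derivative u' t) (at t within {0..T}) \<and>
        ((\<lambda>s. snd (apply_bcontfun f s)) has_real_derivative v' t) (at t within {0..T}) \<and>
        u' t = F1 p \<beta> (fst (apply_bcontfun f t)) (snd (apply_bcontfun f t)) \<and>
        F2L p \<beta> \<Lambda> (fst (apply_bcontfun f t)) (snd (apply_bcontfun f t)) \<le> v' t \<and>
        v' t \<le> F2U p \<beta> \<Lambda> (fst (apply_bcontfun f t)) (snd (apply_bcontfun f t))))"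

end

(*
  The observables u = -H/N, v = |grad H|^2/N and w = G(grad H, grad H)/N coincide on the sphere with
  polynomials, so the martingale problem applies to them and to their squares.  By Euler's identity the
  drift of u is F_1(u,v), up to an error from tr Hess H / N, and the drift of v is
  2p(p-1) - 2(p-1)v + 2pu(pu - beta v) - 2 beta w, up to errors from tr Hess H and from the deviation of
  the Hilbert-Schmidt norm |Hess H|^2/N from its mean p(p-1).  Gaussian concentration (by rotations, in
  the style of Maurey and Pisier) and nets on the sphere make these errors vanish uniformly in x, almost
  surely, and give |w| <= Lambda v.  The carre du champ of u, v, w is O(1/N), so the martingale parts
  vanish by Kolmogorov's inequality, and u_N, v_N, w_N are Lipschitz up to a vanishing error.  This gives
  tightness.  It also shows that the integrated drift of v differs from its explicit part by the integral
  of a Lipschitz function bounded by 2 beta Lambda v; as a statement on second differences of v this is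
  a closed condition on (u,v) alone, so it passes to weak limits, where it forces v to be C^1.
*)
theory Submission
  imports Defs "HOL-Probability.Probability" "HOL-Complex_Analysis.Great_Picard"
begin

text \<open>The drift of v contains w, which is not a function of (u,v). Limit points therefore only
  solve a differential inclusion, and in integrated form that alone would make v Lipschitz, not C^1.
  Some regularity of the unknown part of the drift has to be carried through the limit; w can supply
  it because w is itself an observable with bounded drift.

  Every estimate must be uniform in N. Restricted to a line, all functions involved are polynomials
  in one variable whose degree is bounded in terms of p, so a supremum controls derivatives with a
  constant free of N. One random bound, |H| \<le> C N on the ball of radius 4 sqrt N, thus bounds
  the gradient and Hessian of H and the generator and carre du champ on all three observables. Apart
  from it, the disorder enters only through tr Hess H, |Hess H|^2 and sup |G|.

  The dynamics is given by a martingale problem with polynomial test functions, so quadratic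
  variations come from testing with f and f^2, not from stochastic integrals.\<close>

section \<open>Polynomial functions and their derivatives\<close>

text \<open>The constants in the derivative estimates depend on the degree alone, so an upper bound
  \<open>d\<close> for it is carried along, while \<open>N\<close> only limits the admissible
  variables. The slack \<open>d + e \<le> m\<close> in the product rule lets weakening of the degree
  be derived by induction instead of being a rule of its own.\<close>

inductive pol :: "nat \<Rightarrow> nat \<Rightarrow> ((nat \<Rightarrow> real) \<Rightarrow> real) \<Rightarrow> bool" for N :: nat where
  pol_const: "pol N d (\<lambda>x. c)"
| pol_var: "i < N \<Longrightarrow> 1 \<le> d \<Longrightarrow> pol N d (\<lambda>x. x i)"
| pol_add: "pol N d f \<Longrightarrow> pol N d g \<Longrightarrow> pol N d (\<lambda>x. f x + g x)"
| pol_mult_le: "pol N d f \<Longrightarrow> pol N e g \<Longrightarrow> d + e \<le> m \<Longrightarrow> pol N m (\<lambda>x. f x * g x)"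

lemma pol_mono: "pol N d f \<Longrightarrow> d \<le> e \<Longrightarrow> pol N e f"
proof (induction arbitrary: e rule: pol.induct)
  case (pol_mult_le d f k g m)
  show ?case
    by (rule pol.pol_mult_le[OF pol_mult_le(1,2)]) (use pol_mult_le in linarith)
qed (auto intro: pol.intros)

lemmas pol_mult = pol_mult_le[OF _ _ order_refl]

lemma pol_cmult: "pol N d f \<Longrightarrow> pol N d (\<lambda>x. c * f x)"
  using pol_mult_le[OF pol_const[of N 0 c], of d f d] by simp

lemma pol_minus: "pol N d f \<Longrightarrow> pol N d (\<lambda>x. - f x)"
  using pol_cmult[of N d f "-1"] by simp

lemma pol_diff: "pol N d f \<Longrightarrow> pol N d g \<Longrightarrow> pol N d (\<lambda>x. f x - g x)"
  using pol_add[OF _ pol_minus, of N d f g] by simp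

lemma pol_divide: "pol N d f \<Longrightarrow> pol N d (\<lambda>x. f x / c)"
  using pol_cmult[of N d f "1/c"] by simp

lemma pol_sum: "(\<And>i. i \<in> I \<Longrightarrow> pol N d (f i)) \<Longrightarrow> pol N d (\<lambda>x. \<Sum>i\<in>I. f i x)"
  by (induction I rule: infinite_finite_induct) (auto intro: pol.intros)

lemma pol_power: "pol N d f \<Longrightarrow> pol N (d * k) (\<lambda>x. f x ^ k)"
  by (induction k) (auto intro: pol.intros)

lemma pol_prod: "finite I \<Longrightarrow> (\<And>i. i \<in> I \<Longrightarrow> pol N d (f i)) \<Longrightarrow> pol N (d * card I) (\<lambda>x. \<Prod>i\<in>I. f i x)"
  by (induction I rule: finite_induct) (auto intro: pol_const intro!: pol_mult)

lemma pol_cong_dep: "pol N d f \<Longrightarrow> (\<And>i. i < N \<Longrightarrow> x i = y i) \<Longrightarrow> f x = f y"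
  by (induction rule: pol.induct) auto

abbreviation (input) pd :: "nat \<Rightarrow> ((nat \<Rightarrow> real) \<Rightarrow> real) \<Rightarrow> (nat \<Rightarrow> real) \<Rightarrow> real" where
  "pd i f \<equiv> \<lambda>x. egrad f x i"

abbreviation (input) lin :: "(nat \<Rightarrow> real) \<Rightarrow> real \<Rightarrow> (nat \<Rightarrow> real) \<Rightarrow> nat \<Rightarrow> real" where
  "lin x t u \<equiv> \<lambda>i. x i + t * u i"

text \<open>\<open>egrad\<close> is built on \<open>deriv\<close>, which says nothing before
  differentiability is known. The induction therefore produces candidate partial derivatives
  \<open>D\<close> together with the chain rule along every line; they are identified with
  \<open>egrad\<close> only afterwards. Their degree bound is not lowered, as only its independence
  of \<open>N\<close> counts.\<close>

lemma pol_ex_deriv: "pol N d f \<Longrightarrow> \<exists>D. (\<forall>i. pol N d (D i)) \<and>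
   (\<forall>x u t. ((\<lambda>t. f (lin x t u)) has_real_derivative (\<Sum>i<N. u i * D i (lin x t u))) (at t))"
proof (induction rule: pol.induct)
  case (pol_const d c)
  show ?case by (rule exI[of _ "\<lambda>i x. 0"]) (auto intro!: pol.intros)
next
  case (pol_var j d)
  show ?case
  proof (rule exI[of _ "\<lambda>i x. if i = j then 1 else 0"], intro conjI allI)
    fix i show "pol N d (\<lambda>x. if i = j then 1 else 0)" by (auto intro: pol.intros)
  next
    fix x u :: "nat \<Rightarrow> real" and t :: real
    have "(\<Sum>i<N. u i * (if i = j then 1 else 0)) = u j"
      using pol_var by (simp add: if_distrib cong: if_cong)
    moreover have "((\<lambda>t. x j + t * u j) has_real_derivative u j) (at t)"
      by (auto intro!: derivative_eq_intros)
    ultimately show "((\<lambda>t. lin x t u j) has_real_derivative (\<Sum>i<N. u i * (if i = j then 1 else 0))) (at t)"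
      by simp
  qed
next
  case (pol_add d f g)
  obtain D where D: "\<And>i. pol N d (D i)"
    "\<And>x u t. ((\<lambda>t. f (lin x t u)) has_real_derivative (\<Sum>i<N. u i * D i (lin x t u))) (at t)"
    using pol_add.IH(1) by (elim exE conjE) blast
  obtain E where E: "\<And>i. pol N d (E i)"
    "\<And>x u t. ((\<lambda>t. g (lin x t u)) has_real_derivative (\<Sum>i<N. u i * E i (lin x t u))) (at t)"
    using pol_add.IH(2) by (elim exE conjE) blast
  show ?case
    by (rule exI[of _ "\<lambda>i x. D i x + E i x"])
      (auto intro!: pol.intros D(1) E(1) derivative_eq_intros D(2) E(2) simp: algebra_simps sum.distrib)
next
  case (pol_mult_le d f e g m)
  obtain D where D: "\<And>i. pol N d (D i)"
    "\<And>x u t. ((\<lambda>t. f (lin x t u)) has_real_derivative (\<Sum>i<N. u i * D i (lin x t u))) (at t)"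
    using pol_mult_le.IH(1) by (elim exE conjE) blast
  obtain E where E: "\<And>i. pol N e (E i)"
    "\<And>x u t. ((\<lambda>t. g (lin x t u)) has_real_derivative (\<Sum>i<N. u i * E i (lin x t u))) (at t)"
    using pol_mult_le.IH(2) by (elim exE conjE) blast
  show ?case
  proof (rule exI[of _ "\<lambda>i x. D i x * g x + f x * E i x"], intro conjI allI)
    fix i show "pol N m (\<lambda>x. D i x * g x + f x * E i x)"
      using pol_mult_le D(1)[of i] E(1)[of i] by (auto intro!: pol.intros)
  next
    fix x u :: "nat \<Rightarrow> real" and t :: real
    show "((\<lambda>t. f (lin x t u) * g (lin x t u)) has_real_derivative
       (\<Sum>i<N. u i * (D i (lin x t u) * g (lin x t u) + f (lin x t u) * E i (lin x t u)))) (at t)"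
      by (auto intro!: derivative_eq_intros D(2) E(2) simp: algebra_simps sum.distrib sum_distrib_left sum_distrib_right)
  qed
qed

lemma sum_unitv: "(\<Sum>i<N. unitv j i * f i) = (if j < N then f j else 0)"
  by (simp add: unitv_def if_distrib[of "\<lambda>a. a * _"] cong: if_cong)

lemma sum_unitv': "(\<Sum>i<N. f i * unitv j i) = (if j < N then f j else 0)"
  using sum_unitv[of j f N] by (simp add: mult.commute)

text \<open>The directions \<open>unitv i\<close> with \<open>i < N\<close> single out
  \<open>D i\<close>; for \<open>i \<ge> N\<close> the function is constant in that direction and
  the derivative vanishes.\<close>

lemma
  assumes "pol N d f"
  shows pol_pd: "pol N d (pd i f)"
    and pol_line_deriv: "((\<lambda>t. f (lin x t u)) has_real_derivative (\<Sum>i<N. u i * pd i f (lin x t u))) (at t)"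
    and ddir_pol: "ddir f x u = (\<Sum>i<N. u i * pd i f x)"
proof -
  obtain D where D: "\<And>i. pol N d (D i)"
    "\<And>x u t. ((\<lambda>t. f (lin x t u)) has_real_derivative (\<Sum>i<N. u i * D i (lin x t u))) (at t)"
    using pol_ex_deriv[OF assms] by (elim exE conjE) blast
  have 1: "ddir f x u = (\<Sum>i<N. u i * D i x)" for x u
    unfolding ddir_def using D(2)[of x u 0] by (auto intro!: DERIV_imp_deriv)
  have 2: "pd i f x = (if i < N then D i x else 0)" for i x
    unfolding egrad_def 1 sum_unitv ..
  show "pol N d (pd i f)" unfolding 2 using D(1)[of i] by (cases "i < N") (auto intro: pol_const)
  show "((\<lambda>t. f (lin x t u)) has_real_derivative (\<Sum>i<N. u i * pd i f (lin x t u))) (at t)"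
    using D(2)[of x u t] by (simp add: 2)
  show "ddir f x u = (\<Sum>i<N. u i * pd i f x)" by (simp add: 1 2)
qed

lemma ehess_pol:
  assumes "pol N d f"
  shows "ehess f x u w = (\<Sum>i<N. \<Sum>j<N. u i * w j * pd i (pd j f) x)"
proof -
  have "ehess f x u w = deriv (\<lambda>s. \<Sum>j<N. w j * pd j f (lin x s u)) 0"
    unfolding ehess_def by (simp add: ddir_pol[OF assms])
  also have "\<dots> = (\<Sum>j<N. w j * (\<Sum>i<N. u i * pd i (pd j f) x))"
    using pol_line_deriv[OF pol_pd[OF assms], of x u _ 0]
    by (intro DERIV_imp_deriv DERIV_sum DERIV_cmult) simp
  also have "\<dots> = (\<Sum>i<N. \<Sum>j<N. u i * w j * pd i (pd j f) x)"
    by (subst sum.swap) (simp add: sum_distrib_left algebra_simps)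
  finally show ?thesis .
qed

lemma pd_eqI:
  assumes "((\<lambda>t. f (lin x t (unitv i))) has_real_derivative D) (at 0)"
  shows "pd i f x = D"
  unfolding egrad_def ddir_def using assms by (rule DERIV_imp_deriv)

lemma pd_line:
  assumes "pol N d f"
  shows "((\<lambda>t. f (lin x t (unitv i))) has_real_derivative pd i f x) (at 0)"
proof (cases "i < N")
  case True then show ?thesis using pol_line_deriv[OF assms, of x "unitv i" 0] by (simp add: sum_unitv)
next
  case False
  then have "pd i f x = 0" by (subst egrad_def, subst ddir_pol[OF assms], simp add: sum_unitv)
  with False show ?thesis using pol_line_deriv[OF assms, of x "unitv i" 0] by (simp add: sum_unitv)
qed

lemma pd_const: "pd i (\<lambda>x. c) x = 0"
  by (rule pd_eqI) simp

lemma pd_var: "pd i (\<lambda>x. x j) x = (if i = j then 1 else 0)"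
  by (rule pd_eqI) (auto intro!: derivative_eq_intros simp: unitv_def)

lemma pd_add: "pol N d f \<Longrightarrow> pol N e g \<Longrightarrow> pd i (\<lambda>x. f x + g x) x = pd i f x + pd i g x"
  by (rule pd_eqI) (auto intro!: derivative_eq_intros pd_line)

lemma pd_diff: "pol N d f \<Longrightarrow> pol N e g \<Longrightarrow> pd i (\<lambda>x. f x - g x) x = pd i f x - pd i g x"
  by (rule pd_eqI) (auto intro!: derivative_eq_intros pd_line)

lemma pd_mult: "pol N d f \<Longrightarrow> pol N e g \<Longrightarrow> pd i (\<lambda>x. f x * g x) x = pd i f x * g x + f x * pd i g x"
  by (rule pd_eqI) (auto intro!: derivative_eq_intros pd_line)

lemma pd_cmult: "pol N d f \<Longrightarrow> pd i (\<lambda>x. c * f x) x = c * pd i f x"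
  by (rule pd_eqI) (auto intro!: derivative_eq_intros pd_line)

lemma pd_minus: "pol N d f \<Longrightarrow> pd i (\<lambda>x. - f x) x = - pd i f x"
  by (rule pd_eqI) (auto intro!: derivative_eq_intros pd_line)

lemma pd_divide: "pol N d f \<Longrightarrow> pd i (\<lambda>x. f x / c) x = pd i f x / c"
  by (rule pd_eqI, rule DERIV_cdivide, rule pd_line)

lemma pd_power: "pol N d f \<Longrightarrow> pd i (\<lambda>x. f x ^ k) x = real k * f x ^ (k - 1) * pd i f x"
  by (rule pd_eqI) (auto intro!: derivative_eq_intros pd_line)

lemma pd_sum: "(\<And>j. j \<in> I \<Longrightarrow> pol N d (f j)) \<Longrightarrow> pd i (\<lambda>x. \<Sum>j\<in>I. f j x) x = (\<Sum>j\<in>I. pd i (f j) x)"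
  by (rule pd_eqI) (auto intro!: DERIV_sum pd_line)

lemma pd_commute: "pol N d f \<Longrightarrow> pd i (pd j f) x = pd j (pd i f) x"
proof (induction arbitrary: x rule: pol.induct)
  case (pol_add d f g)
  have "pd i (\<lambda>x. f x + g x) = (\<lambda>x. pd i f x + pd i g x)" for i
    using pd_add[OF pol_add(1,2)] by auto
  then show ?case using pol_add pd_add[OF pol_pd[OF pol_add(1)] pol_pd[OF pol_add(2)]] by simp
next
  case (pol_mult_le d f e g m)
  note p = pol_mult_le(1,2)
  have *: "pd i (\<lambda>x. f x * g x) = (\<lambda>x. pd i f x * g x + f x * pd i g x)" for i
    using pd_mult[OF p] by auto
  have "pd i (\<lambda>x. pd j f x * g x + f x * pd j g x) x
     = pd i (pd j f) x * g x + pd j f x * pd i g x + (pd i f x * pd j g x + f x * pd i (pd j g) x)" for i j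
    using p by (subst pd_add[OF pol_mult[OF pol_pd[OF p(1)] p(2)] pol_mult[OF p(1) pol_pd[OF p(2)]]],
        subst pd_mult[OF pol_pd[OF p(1)] p(2)], subst pd_mult[OF p(1) pol_pd[OF p(2)]]) simp
  then show ?case unfolding * using pol_mult_le by simp
qed (simp_all add: pd_const pd_var)

definition hom :: "nat \<Rightarrow> ((nat \<Rightarrow> real) \<Rightarrow> real) \<Rightarrow> bool" where
  "hom k f \<longleftrightarrow> (\<forall>c>0. \<forall>x. f (\<lambda>i. c * x i) = c ^ k * f x)"

text \<open>Differentiate f(cx + t e_i) = c^(k+1) f(x + (t/c) e_i) at t = 0: the inner factor 1/c
  lowers the degree by one.\<close>

lemma hom_pd:
  assumes f: "pol N d f" and h: "hom (Suc k) f"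
  shows "hom k (pd i f)"
  unfolding hom_def
proof (intro allI impI)
  fix c :: real and x :: "nat \<Rightarrow> real" assume c: "c > 0"
  have "f (lin (\<lambda>i. c * x i) t (unitv i)) = c ^ Suc k * f (lin x (t / c) (unitv i))" for t
  proof -
    have "lin (\<lambda>i. c * x i) t (unitv i) = (\<lambda>j. c * (lin x (t/c) (unitv i) j))"
      using c by (auto simp: algebra_simps)
    then show ?thesis using h c unfolding hom_def by metis
  qed
  moreover have "((\<lambda>t. f (lin x (t / c) (unitv i))) has_real_derivative pd i f x * (1/c)) (at 0)"
    using c pd_line[OF f, of x i]
    by (intro DERIV_chain'[where g="\<lambda>t. f (lin x t (unitv i))" and f="\<lambda>t. t / c"])
       (auto intro!: derivative_eq_intros)
  then have "((\<lambda>t. c ^ Suc k * f (lin x (t / c) (unitv i))) has_real_derivative c ^ Suc k * (pd i f x * (1/c))) (at 0)"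
    by (rule DERIV_cmult)
  ultimately show "pd i f (\<lambda>i. c * x i) = c ^ k * pd i f x"
    using c by (intro pd_eqI) (simp add: field_simps)
qed

text \<open>The function t -> f(tx) is differentiated at t = 1 twice, by the chain rule and as t^k
  f(x); homogeneity for positive factors covers a neighbourhood of 1.\<close>

lemma euler:
  assumes f: "pol N d f" and h: "hom k f"
  shows "(\<Sum>i<N. x i * pd i f x) = real k * f x"
proof -
  have 1: "((\<lambda>t. f (lin (\<lambda>_. 0) t x)) has_real_derivative (\<Sum>i<N. x i * pd i f x)) (at 1)"
    using pol_line_deriv[OF f, of "\<lambda>_. 0" x 1] by simp
  have "((\<lambda>t. t ^ k * f x) has_real_derivative real k * f x) (at 1)"
    by (auto intro!: derivative_eq_intros)
  then have "((\<lambda>t. f (lin (\<lambda>_. 0) t x)) has_real_derivative real k * f x) (at 1)"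
    by (rule has_field_derivative_transform_within_open[of _ _ _ "{0<..}"]) (use h in \<open>auto simp: hom_def\<close>)
  with 1 show ?thesis by (rule DERIV_unique)
qed

lemma hessian_euler:
  assumes f: "pol N d f" and h: "hom (Suc k) f"
  shows "(\<Sum>i<N. x i * pd i (pd j f) x) = real k * pd j f x"
  using euler[OF pol_pd[OF f] hom_pd[OF f h]] .

lemma ehess_euler:
  assumes f: "pol N d f" and h: "hom (Suc k) f"
  shows "ehess f x x x = real (Suc k) * real k * f x"
proof -
  have "ehess f x x x = (\<Sum>j<N. x j * (\<Sum>i<N. x i * pd i (pd j f) x))"
    unfolding ehess_pol[OF f] by (subst sum.swap) (simp add: sum_distrib_left algebra_simps)
  also have "\<dots> = real k * (\<Sum>j<N. x j * pd j f x)"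
    unfolding hessian_euler[OF f h] by (simp add: sum_distrib_left algebra_simps)
  also have "\<dots> = real (Suc k) * real k * f x"
    unfolding euler[OF f h] by simp
  finally show ?thesis .
qed

section \<open>Derivative bounds with constants independent of the dimension\<close>

lemma pol_line_poly: "pol N d f \<Longrightarrow> \<exists>q. degree q \<le> d \<and> (\<forall>t. f (lin x t u) = poly q t)"
proof (induction rule: pol.induct)
  case (pol_const d c)
  show ?case by (rule exI[of _ "[:c:]"]) simp
next
  case (pol_var i d)
  then show ?case by (intro exI[of _ "[:x i, u i:]"]) (auto simp: algebra_simps)
next
  case (pol_add d f g)
  then obtain q r where "degree q \<le> d" "\<forall>t. f (lin x t u) = poly q t"
    "degree r \<le> d" "\<forall>t. g (lin x t u) = poly r t" by auto
  then show ?case by (intro exI[of _ "q + r"]) (auto intro: degree_add_le)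
next
  case (pol_mult_le d f e g m)
  then obtain q r where "degree q \<le> d" "\<forall>t. f (lin x t u) = poly q t"
    "degree r \<le> e" "\<forall>t. g (lin x t u) = poly r t" by auto
  then show ?case using pol_mult_le(3) degree_mult_le[of q r] by (intro exI[of _ "q * r"]) auto
qed

text \<open>Passing from \<open>q(t)\<close> to \<open>q(t) - 2\<^sup>d q(t/2)\<close> kills the top coefficient and does not
  decrease the modulus of the others.\<close>

lemma poly_coeff_bound:
  "\<exists>B\<ge>1. \<forall>(q :: real poly) C. degree q \<le> d \<longrightarrow> (\<forall>t. \<bar>t\<bar> \<le> 1 \<longrightarrow> \<bar>poly q t\<bar> \<le> C) \<longrightarrow> (\<forall>k. \<bar>coeff q k\<bar> \<le> B * C)"
proof (induction d)
  case 0
  show ?case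
  proof (intro exI[of _ 1] conjI allI impI)
    fix q :: "real poly" and C k
    assume q: "degree q \<le> 0" and C: "\<forall>t. \<bar>t\<bar> \<le> 1 \<longrightarrow> \<bar>poly q t\<bar> \<le> C"
    from q obtain c where "q = [:c:]" by (metis degree_eq_zeroE le_zero_eq)
    then show "\<bar>coeff q k\<bar> \<le> 1 * C" using C[rule_format, of 0] by (cases k) auto
  qed simp
next
  case (Suc d)
  then obtain B where B: "B \<ge> 1" "\<And>(q :: real poly) C k. degree q \<le> d \<Longrightarrow> (\<forall>t. \<bar>t\<bar> \<le> 1 \<longrightarrow> \<bar>poly q t\<bar> \<le> C) \<Longrightarrow> \<bar>coeff q k\<bar> \<le> B * C"
    by metis
  let ?m = "2 ^ Suc d :: real"
  define B' where "B' = 1 + (real d + 1) * (B * (1 + ?m))"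
  have m1: "?m \<ge> 1" by (rule one_le_power) simp
  have B1: "1 \<le> B * (1 + ?m)" using mult_mono[of 1 B 1 "1 + ?m"] B(1) m1 by simp
  have "1 * (B * (1 + ?m)) \<le> (real d + 1) * (B * (1 + ?m))"
    using B1 by (intro mult_right_mono) auto
  then have B'1: "B' \<ge> 1" "B' \<ge> B * (1 + ?m)" unfolding B'_def using B1 by linarith+
  show ?case
  proof (intro exI[of _ B'] conjI allI impI)
    fix q :: "real poly" and C k
    assume q: "degree q \<le> Suc d" and C: "\<forall>t. \<bar>t\<bar> \<le> 1 \<longrightarrow> \<bar>poly q t\<bar> \<le> C"
    have C0: "C \<ge> 0" using C[rule_format, of 0] by simp
    define r where "r = q - smult ?m (pcompose q [:0, 1/2:])"
    have cr: "coeff r k = coeff q k * (1 - ?m * (1/2)^k)" for k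
      unfolding r_def by (simp add: coeff_pcompose_linear algebra_simps)
    have dr: "degree r \<le> d"
    proof (rule degree_le, intro allI impI)
      fix i assume "d < i"
      show "coeff r i = 0"
      proof (cases "i = Suc d")
        case True
        then show ?thesis unfolding cr by (simp add: power_one_over)
      next
        case False
        with \<open>d < i\<close> q have "coeff q i = 0" by (intro coeff_eq_0) auto
        then show ?thesis unfolding cr by simp
      qed
    qed
    have "\<bar>poly r t\<bar> \<le> (1 + ?m) * C" if t: "\<bar>t\<bar> \<le> 1" for t
    proof -
      have "\<bar>poly r t\<bar> \<le> \<bar>poly q t\<bar> + ?m * \<bar>poly q (t/2)\<bar>"
        unfolding r_def by (simp add: poly_pcompose abs_mult algebra_simps)
           (use abs_triangle_ineq4[of "poly q t" "2 * (poly q (t / 2) * 2 ^ d)"] in \<open>simp add: abs_mult ac_simps\<close>)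
      also have "\<dots> \<le> C + ?m * C"
        using C[rule_format, of t] C[rule_format, of "t/2"] t by (intro add_mono mult_left_mono) auto
      finally show ?thesis by (simp add: algebra_simps)
    qed
    then have r: "\<bar>coeff r k\<bar> \<le> B * ((1 + ?m) * C)" for k using B(2)[OF dr] by blast
    have low: "\<bar>coeff q k\<bar> \<le> B * (1 + ?m) * C" if k: "k \<le> d" for k
    proof -
      have "1 \<le> (2::real) ^ d * (1/2)^k"
        using power_increasing[OF k, of "2::real"] by (simp add: power_one_over field_simps)
      moreover have "1 - ?m * (1/2)^k = 1 - 2 * ((2::real) ^ d * (1/2)^k)" by simp
      ultimately have "1 \<le> \<bar>1 - ?m * (1/2)^k\<bar>" by linarith
      then have "\<bar>coeff q k\<bar> * 1 \<le> \<bar>coeff q k\<bar> * \<bar>1 - ?m * (1/2)^k\<bar>" by (intro mult_left_mono) auto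
      also have "\<dots> = \<bar>coeff r k\<bar>" unfolding cr abs_mult ..
      finally show ?thesis using r[of k] by (simp add: algebra_simps)
    qed
    consider "k \<le> d" | "k = Suc d" | "k > Suc d" by linarith
    then show "\<bar>coeff q k\<bar> \<le> B' * C"
    proof cases
      case 1 then show ?thesis using low[OF 1] mult_right_mono[OF B'1(2) C0] by linarith
    next
      case 3 then show ?thesis using q B'1 C0 by (simp add: coeff_eq_0)
    next
      case 2
      \<comment> \<open>The top coefficient, lost in \<open>r\<close>, is recovered from the value
        at 1, which is the sum of all coefficients; the lower ones produce the factor
        \<open>real d + 1\<close> in \<open>B'\<close>.\<close>
      have "poly q 1 = (\<Sum>i\<le>Suc d. coeff q i)"
        unfolding poly_altdef using q
        by (subst sum.mono_neutral_left[of "{..Suc d}" "{..degree q}"]) (auto simp: coeff_eq_0)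
      then have "\<bar>coeff q (Suc d)\<bar> \<le> \<bar>poly q 1\<bar> + \<bar>\<Sum>i\<le>d. coeff q i\<bar>" by simp
      also have "\<dots> \<le> C + (\<Sum>i\<le>d. B * (1 + ?m) * C)"
        using C[rule_format, of 1] low by (intro add_mono order_trans[OF sum_abs] sum_mono) auto
      also have "\<dots> = B' * C" unfolding B'_def by (simp add: algebra_simps)
      finally show ?thesis using 2 by simp
    qed
  qed (rule B'1)
qed

abbreviation nrm :: "nat \<Rightarrow> (nat \<Rightarrow> real) \<Rightarrow> real" where
  "nrm N x \<equiv> L2_set x {..<N}"

lemma nrm_lin: "nrm N (lin x t u) \<le> nrm N x + \<bar>t\<bar> * nrm N u"
proof -
  have "nrm N (lin x t u) \<le> nrm N x + nrm N (\<lambda>i. t * u i)"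
    by (rule L2_set_triangle_ineq)
  also have "nrm N (\<lambda>i. t * u i) = \<bar>t\<bar> * nrm N u"
    unfolding L2_set_def by (simp add: power_mult_distrib sum_distrib_left[symmetric] real_sqrt_mult)
  finally show ?thesis .
qed

text \<open>A non-optimal constant of Markov brothers type: it bounds the coefficients of a
  polynomial of degree at most \<open>d\<close> by its supremum on [-1,1]. Being chosen from
  \<open>d\<close> alone, it is free of the dimension.\<close>

definition Mk :: "nat \<Rightarrow> real" where
  "Mk d = (SOME B. B \<ge> 1 \<and> (\<forall>(q :: real poly) C. degree q \<le> d \<longrightarrow> (\<forall>t. \<bar>t\<bar> \<le> 1 \<longrightarrow> \<bar>poly q t\<bar> \<le> C) \<longrightarrow> (\<forall>k. \<bar>coeff q k\<bar> \<le> B * C)))"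

lemma Mk: "Mk d \<ge> 1"
  "degree q \<le> d \<Longrightarrow> (\<And>t. \<bar>t\<bar> \<le> 1 \<Longrightarrow> \<bar>poly q t\<bar> \<le> C) \<Longrightarrow> \<bar>coeff q k\<bar> \<le> Mk d * C"
  using someI_ex[OF poly_coeff_bound[of d]] unfolding Mk_def[symmetric] by auto

text \<open>A Cauchy estimate along a real line: rescaling the segment of half-length r about x to
  [-1,1] multiplies the k-th coefficient by r^k, and the coefficients of orders 1 and 2 are the
  first derivative and half the second one.\<close>

lemma line_bound:
  assumes f: "pol N d f" and C: "\<And>y. nrm N y \<le> R \<Longrightarrow> \<bar>f y\<bar> \<le> C"
    and x: "nrm N x + r \<le> R" and r: "r > 0" and u: "nrm N u \<le> 1"
  shows "\<bar>ddir f x u\<bar> \<le> Mk d * C / r" "\<bar>ehess f x u u\<bar> \<le> 2 * Mk d * C / r\<^sup>2"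
proof -
  obtain q where q: "degree q \<le> d" "\<And>t. f (lin x t u) = poly q t"
    using pol_line_poly[OF f, of x u] by auto
  define q' where "q' = pcompose q [:0, r:]"
  have c: "coeff q' k = coeff q k * r ^ k" for k
    unfolding q'_def by (simp add: coeff_pcompose_linear)
  have "degree q' \<le> d"
    using q(1) unfolding q'_def by (simp add: degree_pcompose)
  moreover have "\<bar>poly q' t\<bar> \<le> C" if t: "\<bar>t\<bar> \<le> 1" for t
  proof -
    have "poly q' t = f (lin x (t * r) u)" unfolding q(2) q'_def by (simp add: poly_pcompose algebra_simps)
    moreover have "\<bar>t * r\<bar> * nrm N u \<le> r * 1"
      using t u r by (intro mult_mono) (auto simp: abs_mult mult_le_cancel_right1)
    then have "nrm N (lin x (t * r) u) \<le> R" using nrm_lin[of x "t*r" u N] x by linarith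
    ultimately show ?thesis using C by metis
  qed
  ultimately have b: "\<bar>coeff q k\<bar> * r ^ k \<le> Mk d * C" for k
    using Mk(2)[of q' d C k] r unfolding c by (simp add: abs_mult)
  have "ddir f x u = poly (pderiv q) 0"
    unfolding ddir_def q(2) by (rule DERIV_imp_deriv) (rule poly_DERIV)
  then have "ddir f x u = coeff q 1" by (simp add: poly_0_coeff_0 coeff_pderiv)
  then show "\<bar>ddir f x u\<bar> \<le> Mk d * C / r" using b[of 1] r by (simp add: field_simps)
  have "ddir f (lin x s u) u = poly (pderiv q) s" for s
  proof -
    have "((\<lambda>t. f (lin x t u)) has_real_derivative ddir f (lin x s u) u) (at s)"
      using pol_line_deriv[OF f, of x u s] by (simp add: ddir_pol[OF f])
    then show ?thesis unfolding q(2) by (rule DERIV_unique) (rule poly_DERIV)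
  qed
  then have "ehess f x u u = poly (pderiv (pderiv q)) 0"
    unfolding ehess_def by (auto intro!: DERIV_imp_deriv poly_DERIV)
  then have "ehess f x u u = 2 * coeff q 2"
    by (simp add: poly_0_coeff_0 coeff_pderiv numeral_2_eq_2)
  then show "\<bar>ehess f x u u\<bar> \<le> 2 * Mk d * C / r\<^sup>2" using b[of 2] r by (simp add: field_simps abs_mult)
qed


section \<open>Euclidean norms and symmetric bilinear forms\<close>

lemma nrm_sq: "(nrm N x)\<^sup>2 = (\<Sum>i<N. (x i)\<^sup>2)"
  unfolding L2_set_def by (simp add: sum_nonneg)

lemma nrm_scale: "nrm N (\<lambda>i. c * x i) = \<bar>c\<bar> * nrm N x"
  unfolding L2_set_def by (simp add: power_mult_distrib sum_distrib_left[symmetric] real_sqrt_mult)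

lemma nrm_eq_0: "nrm N x = 0 \<Longrightarrow> i < N \<Longrightarrow> x i = 0"
  by (simp add: L2_set_eq_0_iff)

lemma inner_le_nrm: "\<bar>\<Sum>i<N. x i * y i\<bar> \<le> nrm N x * nrm N y"
proof -
  have "\<bar>\<Sum>i<N. x i * y i\<bar> \<le> (\<Sum>i<N. \<bar>x i\<bar> * \<bar>y i\<bar>)"
    by (rule order_trans[OF sum_abs]) (simp add: abs_mult)
  also have "\<dots> \<le> nrm N x * nrm N y" by (rule L2_set_mult_ineq)
  finally show ?thesis .
qed

lemma inner_unit_bound:
  assumes "\<And>u. nrm N u \<le> 1 \<Longrightarrow> \<bar>\<Sum>i<N. u i * g i\<bar> \<le> M"
  shows "nrm N g \<le> M"
proof (cases "nrm N g = 0")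
  case True
  then show ?thesis using assms[of "\<lambda>_. 0"] by (simp add: L2_set_def)
next
  case False
  then have p: "nrm N g > 0" using L2_set_nonneg[of g "{..<N}"] by linarith
  have "nrm N (\<lambda>i. inverse (nrm N g) * g i) = 1"
    using p by (subst nrm_scale) simp
  then have "\<bar>\<Sum>i<N. (inverse (nrm N g) * g i) * g i\<bar> \<le> M" using assms by simp
  moreover have "(\<Sum>i<N. (inverse (nrm N g) * g i) * g i) = inverse (nrm N g) * (nrm N g)\<^sup>2"
    unfolding nrm_sq by (simp add: sum_distrib_left power2_eq_square mult.assoc)
  ultimately show ?thesis using p by (simp add: power2_eq_square mult.assoc[symmetric])
qed

definition bil :: "nat \<Rightarrow> (nat \<Rightarrow> nat \<Rightarrow> real) \<Rightarrow> (nat \<Rightarrow> real) \<Rightarrow> (nat \<Rightarrow> real) \<Rightarrow> real" where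
  "bil N a u w = (\<Sum>i<N. \<Sum>j<N. u i * w j * a i j)"

lemma bil_scale: "bil N a (\<lambda>i. s * u i) (\<lambda>i. t * w i) = s * t * bil N a u w"
  unfolding bil_def by (simp add: sum_distrib_left algebra_simps)

lemma bil_commute: "(\<And>i j. a i j = a j i) \<Longrightarrow> bil N a u w = bil N a w u"
  unfolding bil_def by (subst sum.swap) (simp add: algebra_simps)

lemma bil_polarize:
  assumes "\<And>i j. a i j = a j i"
  shows "4 * bil N a u w = bil N a (\<lambda>i. u i + w i) (\<lambda>i. u i + w i) - bil N a (\<lambda>i. u i - w i) (\<lambda>i. u i - w i)"
proof -
  have "bil N a (\<lambda>i. u i + w i) (\<lambda>i. u i + w i) - bil N a (\<lambda>i. u i - w i) (\<lambda>i. u i - w i)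
     = 2 * bil N a u w + 2 * bil N a w u"
    unfolding bil_def by (simp add: sum_subtractf[symmetric] sum.distrib[symmetric] sum_distrib_left) (simp add: algebra_simps)
  then show ?thesis using bil_commute[of a N u w, OF assms] by simp
qed

text \<open>A symmetric form is determined by its quadratic form. For unit vectors, polarization and
  the parallelogram law, |u+w|^2 + |u-w|^2 = 4, give the same bound \<open>M\<close> off the
  diagonal; the general case follows by scaling.\<close>

lemma bil_bound:
  assumes sym: "\<And>i j. a i j = a j i" and M: "\<And>u. nrm N u \<le> 1 \<Longrightarrow> \<bar>bil N a u u\<bar> \<le> M"
  shows "\<bar>bil N a u w\<bar> \<le> M * nrm N u * nrm N w"
proof -
  have Q: "\<bar>bil N a z z\<bar> \<le> M * (nrm N z)\<^sup>2" for z
  proof (cases "nrm N z = 0")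
    case True
    then show ?thesis using nrm_eq_0[OF True] by (simp add: bil_def)
  next
    case False
    then have p: "nrm N z > 0" using L2_set_nonneg[of z "{..<N}"] by linarith
    have "nrm N (\<lambda>i. inverse (nrm N z) * z i) = 1"
      using p by (subst nrm_scale) simp
    from M[OF eq_refl[OF this]] show ?thesis
      using p unfolding bil_scale by (simp add: abs_mult field_simps power2_eq_square)
  qed
  have U: "\<bar>bil N a u w\<bar> \<le> M" if u: "nrm N u = 1" and w: "nrm N w = 1" for u w
  proof -
    have "(nrm N (\<lambda>i. u i + w i))\<^sup>2 + (nrm N (\<lambda>i. u i - w i))\<^sup>2 = 2 * (nrm N u)\<^sup>2 + 2 * (nrm N w)\<^sup>2"
      unfolding nrm_sq by (simp add: sum.distrib[symmetric] sum_distrib_left power2_sum power2_diff)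
    then have e: "(nrm N (\<lambda>i. u i + w i))\<^sup>2 + (nrm N (\<lambda>i. u i - w i))\<^sup>2 = 4" using u w by simp
    have "4 * \<bar>bil N a u w\<bar> \<le> M * (nrm N (\<lambda>i. u i + w i))\<^sup>2 + M * (nrm N (\<lambda>i. u i - w i))\<^sup>2"
      using bil_polarize[where a=a and N=N and u=u and w=w, OF sym] Q[of "\<lambda>i. u i + w i"] Q[of "\<lambda>i. u i - w i"] by linarith
    also have "\<dots> = M * 4" using e by (metis distrib_left)
    finally show ?thesis by simp
  qed
  show ?thesis
  proof (cases "nrm N u = 0 \<or> nrm N w = 0")
    case True
    then have "bil N a u w = 0" using nrm_eq_0[of u N] nrm_eq_0[of w N] by (auto simp: bil_def)
    then show ?thesis using True by auto
  next
    case False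
    then have p: "nrm N u > 0" "nrm N w > 0"
      using L2_set_nonneg[of u "{..<N}"] L2_set_nonneg[of w "{..<N}"] by linarith+
    have "nrm N (\<lambda>i. inverse (nrm N u) * u i) = 1" "nrm N (\<lambda>i. inverse (nrm N w) * w i) = 1"
      using p by (simp_all add: nrm_scale)
    from U[OF this] show ?thesis
      using p unfolding bil_scale by (simp add: abs_mult field_simps)
  qed
qed

lemma nrm_unitv: "i < N \<Longrightarrow> nrm N (unitv i) = 1"
proof -
  assume "i < N"
  then have "(\<Sum>j<N. (unitv i j)\<^sup>2) = 1" unfolding power2_eq_square sum_unitv by (simp add: unitv_def)
  then show ?thesis by (simp add: L2_set_def)
qed

lemma bil_unitv: "i < N \<Longrightarrow> bil N a (unitv i) w = (\<Sum>j<N. w j * a i j)"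
proof -
  assume "i < N"
  have "bil N a (unitv i) w = (\<Sum>k<N. unitv i k * (\<Sum>j<N. w j * a k j))"
    unfolding bil_def by (simp add: sum_distrib_left mult.assoc)
  then show ?thesis using \<open>i < N\<close> by (simp add: sum_unitv)
qed

text \<open>Testing with \<open>unitv i\<close> shows that each row has length at most
  \<open>M\<close> and each diagonal entry modulus at most \<open>M\<close>. A Hessian with bounded
  operator norm therefore has trace and squared Hilbert-Schmidt norm of order
  \<open>N\<close>.\<close>

lemma bil_frob_bound:
  assumes M: "\<And>u w. \<bar>bil N a u w\<bar> \<le> M * nrm N u * nrm N w"
  shows "(\<Sum>i<N. \<Sum>j<N. (a i j)\<^sup>2) \<le> real N * M\<^sup>2" "\<bar>\<Sum>i<N. a i i\<bar> \<le> real N * M"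
proof -
  have M0: "M \<ge> 0" if "i < N" for i
    using order_trans[OF abs_ge_zero M[of "unitv i" "unitv i"]] that by (simp add: nrm_unitv)
  have "(\<Sum>j<N. (a i j)\<^sup>2) \<le> M\<^sup>2" if i: "i < N" for i
  proof -
    have "nrm N (\<lambda>j. a i j) \<le> M"
    proof (rule inner_unit_bound)
      fix u assume u: "nrm N u \<le> 1"
      have "\<bar>bil N a (unitv i) u\<bar> \<le> M * 1 * nrm N u" using M[of "unitv i" u] nrm_unitv[OF i] by simp
      also have "\<dots> \<le> M * 1 * 1" using u M0[OF i] by (intro mult_left_mono) auto
      finally show "\<bar>\<Sum>j<N. u j * a i j\<bar> \<le> M" using i by (simp add: bil_unitv)
    qed
    then show ?thesis using M0[OF i] by (simp add: nrm_sq[symmetric])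
  qed
  then have "(\<Sum>i<N. \<Sum>j<N. (a i j)\<^sup>2) \<le> (\<Sum>i<N. M\<^sup>2)" by (intro sum_mono) auto
  then show "(\<Sum>i<N. \<Sum>j<N. (a i j)\<^sup>2) \<le> real N * M\<^sup>2" by simp
  have "\<bar>a i i\<bar> \<le> M" if i: "i < N" for i
    using M[of "unitv i" "unitv i"] i by (simp add: bil_unitv sum_unitv nrm_unitv)
  then have "\<bar>\<Sum>i<N. a i i\<bar> \<le> (\<Sum>i<N. M)" by (intro order_trans[OF sum_abs] sum_mono) auto
  then show "\<bar>\<Sum>i<N. a i i\<bar> \<le> real N * M" by simp
qed

lemma grad_bound:
  assumes f: "pol N d f" and C: "\<And>y. nrm N y \<le> R \<Longrightarrow> \<bar>f y\<bar> \<le> C"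
    and x: "nrm N x + r \<le> R" and r: "r > 0"
  shows "nrm N (\<lambda>i. pd i f x) \<le> Mk d * C / r"
  using line_bound(1)[OF f C x r] by (intro inner_unit_bound) (simp add: ddir_pol[OF f])

lemma hess_bound:
  assumes f: "pol N d f" and C: "\<And>y. nrm N y \<le> R \<Longrightarrow> \<bar>f y\<bar> \<le> C"
    and x: "nrm N x + r \<le> R" and r: "r > 0"
  shows "\<bar>bil N (\<lambda>i j. pd i (pd j f) x) u w\<bar> \<le> 2 * Mk d * C / r\<^sup>2 * nrm N u * nrm N w"
proof (rule bil_bound)
  show "pd i (pd j f) x = pd j (pd i f) x" for i j by (rule pd_commute[OF f])
  show "\<bar>bil N (\<lambda>i j. pd i (pd j f) x) u u\<bar> \<le> 2 * Mk d * C / r\<^sup>2" if "nrm N u \<le> 1" for u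
    using line_bound(2)[OF f C x r that] unfolding bil_def ehess_pol[OF f] by simp
qed

text \<open>Mean value theorem on the segment from y to x. Both end points have norm at most R - r,
  hence by convexity so has the whole segment, and the gradient estimate applies at each of its
  points.\<close>

lemma lip_bound:
  assumes f: "pol N d f" and C: "\<And>y. nrm N y \<le> R \<Longrightarrow> \<bar>f y\<bar> \<le> C"
    and x: "nrm N x + r \<le> R" and y: "nrm N y + r \<le> R" and r: "r > 0"
  shows "\<bar>f x - f y\<bar> \<le> Mk d * C / r * nrm N (\<lambda>i. x i - y i)"
proof -
  let ?u = "\<lambda>i. x i - y i"
  have 1: "((\<lambda>t. f (lin y t ?u)) has_real_derivative (\<Sum>i<N. ?u i * pd i f (lin y t ?u))) (at t)" for t
    by (rule pol_line_deriv[OF f])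
  obtain z where z: "0 < z" "z < 1" "f (lin y 1 ?u) - f (lin y 0 ?u) = (1 - 0) * (\<Sum>i<N. ?u i * pd i f (lin y z ?u))"
    using MVT2[of 0 1 "\<lambda>t. f (lin y t ?u)" "\<lambda>t. \<Sum>i<N. ?u i * pd i f (lin y t ?u)"] 1 by auto
  have e: "f x - f y = (\<Sum>i<N. ?u i * pd i f (lin y z ?u))" using z(3) by simp
  have "lin y z ?u = (\<lambda>i. (1 - z) * y i + z * x i)" by (auto simp: algebra_simps)
  then have "nrm N (lin y z ?u) \<le> nrm N (\<lambda>i. (1 - z) * y i) + nrm N (\<lambda>i. z * x i)"
    using L2_set_triangle_ineq by metis
  also have "\<dots> = (1 - z) * nrm N y + z * nrm N x" using z by (simp add: nrm_scale)
  also have "\<dots> \<le> (1 - z) * (R - r) + z * (R - r)"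
    using z x y by (intro add_mono mult_left_mono) auto
  finally have "nrm N (lin y z ?u) + r \<le> R" by (simp add: algebra_simps)
  from grad_bound[OF f C this r] have g: "nrm N (\<lambda>i. pd i f (lin y z ?u)) \<le> Mk d * C / r" .
  have "\<bar>f x - f y\<bar> \<le> nrm N ?u * nrm N (\<lambda>i. pd i f (lin y z ?u))"
    unfolding e by (rule inner_le_nrm)
  also have "\<dots> \<le> nrm N ?u * (Mk d * C / r)" by (intro mult_left_mono g) simp
  finally show ?thesis by (simp add: algebra_simps)
qed

section \<open>The Hamiltonian as a polynomial\<close>

abbreviation idx :: "nat \<Rightarrow> nat \<Rightarrow> nat list set" where
  "idx N p \<equiv> {is. length is = p \<and> set is \<subseteq> {..<N}}"

definition mon :: "nat \<Rightarrow> nat list \<Rightarrow> (nat \<Rightarrow> real) \<Rightarrow> real" where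
  "mon p is x = (\<Prod>j<p. x (is ! j))"

lemma finite_idx: "finite (idx N p)"
  using finite_lists_length_eq[of "{..<N}" p] by (simp add: conj_commute)

lemma pol_mon: "is \<in> idx N p \<Longrightarrow> pol N p (mon p is)"
proof -
  assume i: "is \<in> idx N p"
  have "pol N (1 * card {..<p}) (\<lambda>x. \<Prod>j\<in>{..<p}. x (is ! j))"
    using i by (intro pol_prod pol_var) (auto simp: subset_eq)
  then show ?thesis by (simp add: mon_def[abs_def])
qed

lemma mon_Cons: "mon (Suc p) (i # is) z = z i * mon p is z"
  unfolding mon_def by (subst prod.lessThan_Suc_shift) simp

text \<open>Expansion of a power of the inner product over all index lists. For i.i.d. standard
  Gaussian coefficients the left side is the covariance of the unnormalized Hamiltonian at x and
  y.\<close>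

lemma kernel_power:
  "(\<Sum>is\<in>idx N p. mon p is x * mon p is y) = (\<Sum>i<N. x i * y i) ^ p"
proof (induction p)
  case 0
  have "idx N 0 = {[]}" by auto
  then show ?case by (simp add: mon_def)
next
  case (Suc p)
  have e: "idx N (Suc p) = (\<lambda>(i, is). i # is) ` ({..<N} \<times> idx N p)"
    by (auto simp: length_Suc_conv image_iff)
  have "(\<Sum>is\<in>idx N (Suc p). mon (Suc p) is x * mon (Suc p) is y)
      = (\<Sum>(i, is)\<in>{..<N} \<times> idx N p. (x i * y i) * (mon p is x * mon p is y))"
    unfolding e by (subst sum.reindex) (auto simp: inj_on_def mon_Cons algebra_simps intro!: sum.cong)
  also have "\<dots> = (\<Sum>i<N. x i * y i) * (\<Sum>is\<in>idx N p. mon p is x * mon p is y)"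
    by (simp add: sum.cartesian_product[symmetric] sum_product)
  finally show ?case using Suc by simp
qed

text \<open>The coefficients are arbitrary because not only the disorder will be inserted: with
  \<open>mon p is y\<close>, or contractions of its second derivatives, as coefficients,
  \<open>HT\<close> is the covariance kernel or a derivative of it. One set of differentiation rules
  then covers both.\<close>

definition HT :: "nat \<Rightarrow> nat \<Rightarrow> (nat list \<Rightarrow> real) \<Rightarrow> (nat \<Rightarrow> real) \<Rightarrow> real" where
  "HT N p c x = (\<Sum>is\<in>idx N p. c is * mon p is x)"

lemma pol_HT: "pol N p (HT N p c)"
  unfolding HT_def[abs_def] by (intro pol_sum pol_cmult pol_mon)

lemma pd_HT: "pd i (HT N p c) x = (\<Sum>is\<in>idx N p. c is * pd i (mon p is) x)"
  unfolding HT_def[abs_def]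
  by (subst pd_sum[where d=p and N=N], auto intro!: pol_cmult pol_mon sum.cong pd_cmult[where d=p and N=N])

lemma pd2_HT: "pd i (pd j (HT N p c)) x = (\<Sum>is\<in>idx N p. c is * pd i (pd j (mon p is)) x)"
  unfolding pd_HT
  by (subst pd_sum[where d=p and N=N], auto intro!: pol_cmult pol_mon pol_pd sum.cong pd_cmult[where d=p and N=N])

lemma hom_HT: "hom p (HT N p c)"
  unfolding hom_def HT_def mon_def by (simp add: prod.distrib sum_distrib_left algebra_simps)

section \<open>The covariance of the Hessian\<close>

lemma pol_inner: "pol N 1 (\<lambda>x. \<Sum>i<N. y i * x i)"
  by (intro pol_sum pol_cmult pol_var) auto

lemma pd_inner: "k < N \<Longrightarrow> pd k (\<lambda>x. \<Sum>i<N. y i * x i) x = y k"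
  by (subst pd_sum[where d=1 and N=N], auto intro!: pol_cmult pol_var)
     (subst sum.cong[OF refl pd_cmult[where d=1 and N=N]], auto intro!: pol_var simp: pd_var if_distrib cong: if_cong)

lemma pol_inner_power: "pol N n (\<lambda>x. (\<Sum>i<N. y i * x i) ^ n)"
  using pol_power[where N=N and d=1 and k=n, OF pol_inner[where y=y]] by simp

lemma pd_inner_power:
  "k < N \<Longrightarrow> pd k (\<lambda>x. (\<Sum>i<N. y i * x i) ^ n) x = real n * (\<Sum>i<N. y i * x i) ^ (n - 1) * y k"
  by (subst pd_power[OF pol_inner]) (simp add: pd_inner)

lemma pd2_inner_power:
  assumes "k < N" "l < N"
  shows "pd k (pd l (\<lambda>x. (\<Sum>i<N. y i * x i) ^ n)) x
    = real n * real (n - 1) * (\<Sum>i<N. y i * x i) ^ (n - 2) * y k * y l"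
proof -
  have "pd l (\<lambda>x. (\<Sum>i<N. y i * x i) ^ n) = (\<lambda>x. (real n * y l) * (\<Sum>i<N. y i * x i) ^ (n - 1))"
    by (rule ext, subst pd_inner_power[OF assms(2)], simp)
  then show ?thesis using assms
    by simp (subst pd_cmult[OF pol_inner_power], simp add: pd_inner_power numeral_2_eq_2)
qed

definition qf :: "nat \<Rightarrow> (nat \<Rightarrow> nat \<Rightarrow> real) \<Rightarrow> (nat \<Rightarrow> real) \<Rightarrow> real" where
  "qf N b x = (\<Sum>k<N. \<Sum>l<N. b k l * (x k * x l))"

lemma pol_qf: "pol N 2 (qf N b)"
  unfolding qf_def[abs_def] by (intro pol_sum pol_cmult pol_mult_le[where d=1 and e=1] pol_var) auto

lemma pd_qf:
  assumes "j < N"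
  shows "pd j (qf N b) x = (\<Sum>k<N. (b j k + b k j) * x k)"
proof -
  have p: "pol N 2 (\<lambda>x. x k * x l)" if "k < N" "l < N" for k l
    using that by (intro pol_mult_le[where d=1 and e=1] pol_var) auto
  have m: "pd j (\<lambda>x. x k * x l) x = (if j = k then x l else 0) + (if j = l then x k else 0)" if "k < N" "l < N" for k l
    using that by (subst pd_mult[OF pol_var pol_var, of k N 1 l 1]) (auto simp: pd_var)
  have "pd j (qf N b) x = (\<Sum>k<N. \<Sum>l<N. b k l * ((if j = k then x l else 0) + (if j = l then x k else 0)))"
    unfolding qf_def[abs_def]
    apply (subst pd_sum[where d=2 and N=N], rule pol_sum, rule pol_cmult, rule p, simp, simp)
    apply (rule sum.cong, rule refl)
    apply (subst pd_sum[where d=2 and N=N], rule pol_cmult, rule p, simp, simp)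
    apply (rule sum.cong, rule refl)
    apply (subst pd_cmult[where d=2 and N=N], rule p, simp, simp)
    apply (subst m, simp_all)
    done
  also have "\<dots> = (\<Sum>k<N. \<Sum>l<N. if j = k then b k l * x l else 0) + (\<Sum>k<N. \<Sum>l<N. if j = l then b k l * x k else 0)"
    unfolding sum.distrib[symmetric] by (intro sum.cong refl) (auto simp: algebra_simps)
  also have "(\<Sum>k<N. \<Sum>l<N. if j = k then b k l * x l else 0) = (\<Sum>l<N. b j l * x l)"
    using assms by (subst sum.swap) simp
  also have "(\<Sum>k<N. \<Sum>l<N. if j = l then b k l * x k else 0) = (\<Sum>k<N. b k j * x k)"
    using assms by simp
  finally show ?thesis by (simp add: sum.distrib algebra_simps)
qed

lemma pd2_qf:
  assumes "i < N" "j < N"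
  shows "pd i (pd j (qf N b)) x = b i j + b j i"
proof -
  have "pd j (qf N b) = (\<lambda>x. \<Sum>k<N. (b j k + b k j) * x k)" using pd_qf[OF assms(2)] by auto
  then show ?thesis using assms by (simp add: pd_inner)
qed

text \<open>Contraction of the Hessian of a monomial with a matrix \<open>b\<close>. The identity
  matrix gives the trace, a rank-one matrix a value of the bilinear form, and the normalized Hessian
  its own Hilbert-Schmidt norm, so the Gaussian estimates for all three follow from one
  computation.\<close>

definition D2m :: "nat \<Rightarrow> nat \<Rightarrow> (nat \<Rightarrow> nat \<Rightarrow> real) \<Rightarrow> nat list \<Rightarrow> (nat \<Rightarrow> real) \<Rightarrow> real" where
  "D2m N p b is x = (\<Sum>i<N. \<Sum>j<N. b i j * pd i (pd j (mon p is)) x)"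

lemma sum_D2m:
  "(\<Sum>is\<in>idx N p. c is * D2m N p b is x) = (\<Sum>i<N. \<Sum>j<N. b i j * pd i (pd j (HT N p c)) x)"
proof -
  have "(\<Sum>is\<in>idx N p. c is * D2m N p b is x) = (\<Sum>is\<in>idx N p. \<Sum>i<N. \<Sum>j<N. c is * (b i j * pd i (pd j (mon p is)) x))"
    unfolding D2m_def by (simp add: sum_distrib_left)
  also have "\<dots> = (\<Sum>i<N. \<Sum>is\<in>idx N p. \<Sum>j<N. c is * (b i j * pd i (pd j (mon p is)) x))"
    by (rule sum.swap)
  also have "\<dots> = (\<Sum>i<N. \<Sum>j<N. \<Sum>is\<in>idx N p. c is * (b i j * pd i (pd j (mon p is)) x))"
    by (rule sum.cong[OF refl], rule sum.swap)
  finally show ?thesis unfolding pd2_HT by (simp add: sum_distrib_left algebra_simps)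
qed

lemma HT_mon: "HT N p (\<lambda>is. mon p is y) = (\<lambda>x. (\<Sum>i<N. y i * x i) ^ p)"
  unfolding HT_def using kernel_power[where N=N and p=p and x=y] by (auto simp: fun_eq_iff)

text \<open>By symmetry of the kernel, the second derivatives at y can be taken of z -> (x . z)^p,
  which is \<open>HT\<close> with \<open>mon p is x\<close> as coefficients.\<close>

lemma HT_D2m:
  "HT N p (\<lambda>is. D2m N p b is y) x = real p * real (p - 1) * ((\<Sum>i<N. y i * x i) ^ (p - 2) * qf N b x)"
proof -
  have c: "(\<Sum>i<N. x i * y i) = (\<Sum>i<N. y i * x i)" by (simp add: mult.commute)
  have "HT N p (\<lambda>is. D2m N p b is y) x = (\<Sum>is\<in>idx N p. mon p is x * D2m N p b is y)"
    unfolding HT_def by (simp add: mult.commute)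
  also have "\<dots> = (\<Sum>i<N. \<Sum>j<N. b i j * (real p * real (p - 1) * (\<Sum>i<N. x i * y i) ^ (p - 2) * x i * x j))"
    unfolding sum_D2m HT_mon by (intro sum.cong refl) (simp add: pd2_inner_power)
  also have "\<dots> = real p * real (p - 1) * ((\<Sum>i<N. y i * x i) ^ (p - 2) * qf N b x)"
    unfolding qf_def c sum_distrib_left by (intro sum.cong refl) (simp only: mult_ac)
  finally show ?thesis .
qed

text \<open>The covariance of the Gaussian Hessian: \<open>\<Sum>\<^sub>i\<^sub>s mon is x \<cdot> mon is y = (x \<cdot> y)\<^sup>p\<close>,
  differentiated twice in \<open>y\<close> and then twice in \<open>x\<close>, on the diagonal \<open>y = x\<close>.\<close>

lemma sum_D2m_sq:
  fixes N :: nat and x :: "nat \<Rightarrow> real" and b :: "nat \<Rightarrow> nat \<Rightarrow> real"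
  defines "r \<equiv> \<Sum>i<N. (x i)\<^sup>2" and "s \<equiv> \<lambda>j. \<Sum>k<N. (b j k + b k j) * x k"
  shows "(\<Sum>is\<in>idx N p. (D2m N p b is x)\<^sup>2) = real p * real (p - 1) *
    (real (p - 2) * real (p - 3) * r ^ (p - 4) * (qf N b x)\<^sup>2
     + real (p - 2) * r ^ (p - 3) * (\<Sum>i<N. (s i)\<^sup>2)
     + r ^ (p - 2) * (\<Sum>i<N. \<Sum>j<N. b i j * (b i j + b j i)))"
proof -
  let ?g = "\<lambda>z. (\<Sum>i<N. x i * z i) ^ (p - 2)"
  have pg: "pol N (p - 2) ?g" by (rule pol_inner_power)
  have r: "(\<Sum>i<N. x i * x i) = r" unfolding r_def by (simp add: power2_eq_square)
  \<comment> \<open>Product rule for (x . z)^(p-2) times the quadratic form, evaluated at z = x.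
    Where the exponent p - 4 or p - 3 is truncated at 0, one of the factors
    \<open>real (p - 2)\<close>, \<open>real (p - 3)\<close> in front of it vanishes.\<close>
  have d2: "pd i (pd j (\<lambda>z. ?g z * qf N b z)) x
     = real (p - 2) * real (p - 3) * r ^ (p - 4) * qf N b x * (x i * x j)
       + real (p - 2) * r ^ (p - 3) * (x j * s i + x i * s j) + r ^ (p - 2) * (b i j + b j i)"
    if ij: "i < N" "j < N" for i j
  proof -
    have 1: "pd j (\<lambda>z. ?g z * qf N b z) = (\<lambda>z. pd j ?g z * qf N b z + ?g z * pd j (qf N b) z)"
      using pd_mult[OF pg pol_qf] by auto
    have "pd i (pd j (\<lambda>z. ?g z * qf N b z)) x =
        (pd i (pd j ?g) x * qf N b x + pd j ?g x * pd i (qf N b) x) + (pd i ?g x * pd j (qf N b) x + ?g x * pd i (pd j (qf N b)) x)"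
      unfolding 1
      by (subst pd_add[OF pol_mult[OF pol_pd[OF pg] pol_qf] pol_mult[OF pg pol_pd[OF pol_qf]]],
          subst pd_mult[OF pol_pd[OF pg] pol_qf], subst pd_mult[OF pg pol_pd[OF pol_qf]]) simp
    moreover have "pd i (pd j ?g) x = real (p - 2) * real (p - 3) * r ^ (p - 4) * (x i * x j)"
      using pd2_inner_power[OF ij, of x "p - 2" x] by (simp add: r)
    moreover have "pd k ?g x = real (p - 2) * r ^ (p - 3) * x k" if "k < N" for k
      using pd_inner_power[OF that, of x "p - 2" x] by (simp add: r)
    moreover have "pd k (qf N b) x = s k" if "k < N" for k unfolding s_def by (rule pd_qf[OF that])
    moreover have "?g x = r ^ (p - 2)" by (simp add: r)
    ultimately show ?thesis
      using ij by (simp add: pd2_qf) (simp add: algebra_simps)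
  qed
  have "(\<Sum>is\<in>idx N p. (D2m N p b is x)\<^sup>2) = (\<Sum>i<N. \<Sum>j<N. b i j * pd i (pd j (HT N p (\<lambda>is. D2m N p b is x))) x)"
    unfolding sum_D2m[symmetric] by (simp add: power2_eq_square)
  also have "\<dots> = (\<Sum>i<N. \<Sum>j<N. b i j * (real p * real (p - 1) * pd i (pd j (\<lambda>z. ?g z * qf N b z)) x))"
  proof -
    have pgq: "pol N (p - 2 + 2) (\<lambda>z. ?g z * qf N b z)" by (rule pol_mult[OF pg pol_qf])
    have "HT N p (\<lambda>is. D2m N p b is x) = (\<lambda>z. real p * real (p - 1) * (?g z * qf N b z))"
      by (rule ext) (rule HT_D2m)
    moreover have "pd j (\<lambda>z. real p * real (p - 1) * (?g z * qf N b z)) = (\<lambda>z. real p * real (p - 1) * pd j (\<lambda>z. ?g z * qf N b z) z)" for j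
      using pd_cmult[OF pgq] by auto
    ultimately show ?thesis by (simp add: pd_cmult[OF pol_pd[OF pgq]])
  qed
  also have "\<dots> = real p * real (p - 1) * (\<Sum>i<N. \<Sum>j<N. real (p - 2) * real (p - 3) * r ^ (p - 4) * qf N b x * (b i j * (x i * x j))
       + real (p - 2) * r ^ (p - 3) * (b i j * (x j * s i + x i * s j)) + r ^ (p - 2) * (b i j * (b i j + b j i)))"
    unfolding sum_distrib_left by (intro sum.cong refl, subst d2) (auto simp: algebra_simps)
  also have "\<dots> = real p * real (p - 1) * (real (p - 2) * real (p - 3) * r ^ (p - 4) * qf N b x * qf N b x
       + real (p - 2) * r ^ (p - 3) * (\<Sum>i<N. \<Sum>j<N. b i j * (x j * s i + x i * s j)) + r ^ (p - 2) * (\<Sum>i<N. \<Sum>j<N. b i j * (b i j + b j i)))"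
    by (simp only: sum.distrib sum_distrib_left[symmetric] qf_def)
  also have "(\<Sum>i<N. \<Sum>j<N. b i j * (x j * s i + x i * s j)) = (\<Sum>i<N. (s i)\<^sup>2)"
  proof -
    have "(\<Sum>i<N. \<Sum>j<N. b i j * (x j * s i + x i * s j)) = (\<Sum>i<N. \<Sum>j<N. b i j * x j * s i) + (\<Sum>j<N. \<Sum>i<N. b i j * x i * s j)"
      by (subst (2) sum.swap) (simp add: sum.distrib[symmetric] algebra_simps)
    also have "\<dots> = (\<Sum>i<N. (\<Sum>j<N. b i j * x j + b j i * x j) * s i)"
      by (simp add: sum.distrib sum_distrib_right distrib_right)
    also have "\<dots> = (\<Sum>i<N. s i * s i)"
      unfolding s_def by (simp add: distrib_right)
    finally show ?thesis by (simp add: power2_eq_square)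
  qed
  finally show ?thesis by (simp add: power2_eq_square mult.assoc)
qed

text \<open>Cauchy-Schwarz bounds each of the three summands by a multiple of r^(p-2) |b|^2, with r
  = |x|^2. Up to normalization this is the variance of a contraction of the Hessian, that is, its
  squared Lipschitz constant in the disorder.\<close>

lemma sum_D2m_sq_le:
  fixes N :: nat and x :: "nat \<Rightarrow> real" and b :: "nat \<Rightarrow> nat \<Rightarrow> real"
  assumes p: "p \<ge> 3"
  shows "(\<Sum>is\<in>idx N p. (D2m N p b is x)\<^sup>2) \<le> (real p * real (p - 1))\<^sup>2 * (\<Sum>i<N. (x i)\<^sup>2) ^ (p - 2) * (\<Sum>i<N. \<Sum>j<N. (b i j)\<^sup>2)"
proof -
  define r where "r = (\<Sum>i<N. (x i)\<^sup>2)"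
  define B where "B = (\<Sum>i<N. \<Sum>j<N. (b i j)\<^sup>2)"
  define s where "s = (\<lambda>j. \<Sum>k<N. (b j k + b k j) * x k)"
  have r0: "r \<ge> 0" and B0: "B \<ge> 0" unfolding r_def B_def by (auto intro!: sum_nonneg)
  have rn: "(nrm N x)\<^sup>2 = r" by (simp add: nrm_sq r_def)
  have row: "(\<Sum>k<N. c k * x k)\<^sup>2 \<le> (\<Sum>k<N. (c k)\<^sup>2) * r" for c
  proof -
    have "(\<Sum>k<N. c k * x k)\<^sup>2 \<le> (nrm N c * nrm N x)\<^sup>2"
      using inner_le_nrm[of c x N] by (metis abs_le_square_iff abs_mult abs_of_nonneg L2_set_nonneg)
    then show ?thesis by (simp add: power_mult_distrib nrm_sq rn r_def)
  qed
  have sq2: "(a + c)\<^sup>2 \<le> 2 * a\<^sup>2 + 2 * c\<^sup>2" for a c :: real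
    using sum_squares_bound[of a c] by (simp add: power2_sum)
  have Bs: "(\<Sum>i<N. \<Sum>j<N. (b j i)\<^sup>2) = B" unfolding B_def by (rule sum.swap)
  have q: "(qf N b x)\<^sup>2 \<le> B * r\<^sup>2"
  proof -
    have "qf N b x = (\<Sum>k<N. (\<Sum>l<N. b k l * x l) * x k)"
      unfolding qf_def sum_distrib_right by (intro sum.cong refl) (simp add: mult_ac)
    then have "(qf N b x)\<^sup>2 \<le> (\<Sum>k<N. (\<Sum>l<N. b k l * x l)\<^sup>2) * r" using row[of "\<lambda>k. \<Sum>l<N. b k l * x l"] by simp
    also have "\<dots> \<le> (\<Sum>k<N. (\<Sum>l<N. (b k l)\<^sup>2) * r) * r"
      using r0 by (intro mult_right_mono sum_mono row) auto
    also have "\<dots> = B * r\<^sup>2" unfolding B_def by (simp add: sum_distrib_right power2_eq_square mult.assoc)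
    finally show ?thesis .
  qed
  have ss: "(\<Sum>i<N. (s i)\<^sup>2) \<le> 4 * B * r"
  proof -
    have "(s i)\<^sup>2 \<le> (\<Sum>k<N. 2 * (b i k)\<^sup>2 + 2 * (b k i)\<^sup>2) * r" for i
    proof -
      have "(s i)\<^sup>2 \<le> (\<Sum>k<N. (b i k + b k i)\<^sup>2) * r" unfolding s_def by (rule row)
      also have "\<dots> \<le> (\<Sum>k<N. 2 * (b i k)\<^sup>2 + 2 * (b k i)\<^sup>2) * r"
        using r0 by (intro mult_right_mono sum_mono) (auto intro: sq2)
      finally show ?thesis .
    qed
    then have "(\<Sum>i<N. (s i)\<^sup>2) \<le> (\<Sum>i<N. (\<Sum>k<N. 2 * (b i k)\<^sup>2 + 2 * (b k i)\<^sup>2) * r)" by (rule sum_mono)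
    also have "\<dots> = (2 * B + 2 * B) * r"
      by (subst Bs[symmetric], subst B_def) (simp only: sum.distrib sum_distrib_left[symmetric] sum_distrib_right[symmetric])
    finally show ?thesis by simp
  qed
  have bb: "(\<Sum>i<N. \<Sum>j<N. b i j * (b i j + b j i)) \<le> 2 * B"
  proof -
    have "2 * (b i j * (b i j + b j i)) \<le> 3 * (b i j)\<^sup>2 + (b j i)\<^sup>2" for i j
      using sum_squares_bound[of "b i j" "b j i"] by (simp add: power2_eq_square algebra_simps)
    then have "(\<Sum>i<N. \<Sum>j<N. 2 * (b i j * (b i j + b j i))) \<le> (\<Sum>i<N. \<Sum>j<N. 3 * (b i j)\<^sup>2 + (b j i)\<^sup>2)"
      by (intro sum_mono)
    also have "\<dots> = 3 * B + B" by (simp only: sum.distrib sum_distrib_left[symmetric] Bs B_def[symmetric])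
    finally show ?thesis by (simp add: sum_distrib_left[symmetric])
  qed
  have "real (p - 2) * real (p - 3) * r ^ (p - 4) * (qf N b x)\<^sup>2 \<le> real (p - 2) * real (p - 3) * (r ^ (p - 2) * B)"
  proof (cases "p = 3")
    case False
    then have "p - 2 = Suc (Suc (p - 4))" using p by linarith
    then have "r ^ (p - 2) = r ^ (p - 4) * r\<^sup>2" by (simp add: power2_eq_square)
    moreover have "real (p - 2) * real (p - 3) * r ^ (p - 4) * (qf N b x)\<^sup>2 \<le> real (p - 2) * real (p - 3) * r ^ (p - 4) * (B * r\<^sup>2)"
      using q r0 by (intro mult_left_mono) auto
    ultimately show ?thesis by (simp add: mult_ac)
  qed simp
  moreover have "real (p - 2) * r ^ (p - 3) * (\<Sum>i<N. (s i)\<^sup>2) \<le> real (p - 2) * (4 * (r ^ (p - 2) * B))"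
  proof -
    have e: "r ^ (p - 2) = r ^ (p - 3) * r" using p by (metis Suc_diff_Suc diff_Suc_1 numeral_2_eq_2 numeral_3_eq_3 power_Suc2 less_eq_Suc_le)
    have "real (p - 2) * r ^ (p - 3) * (\<Sum>i<N. (s i)\<^sup>2) \<le> real (p - 2) * r ^ (p - 3) * (4 * B * r)"
      using ss r0 by (intro mult_left_mono) auto
    then show ?thesis unfolding e by (simp add: algebra_simps)
  qed
  moreover have "r ^ (p - 2) * (\<Sum>i<N. \<Sum>j<N. b i j * (b i j + b j i)) \<le> 2 * (r ^ (p - 2) * B)"
    using mult_left_mono[OF bb, of "r ^ (p - 2)"] r0 by (simp add: algebra_simps)
  ultimately have "real p * real (p - 1) * (real (p - 2) * real (p - 3) * r ^ (p - 4) * (qf N b x)\<^sup>2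
     + real (p - 2) * r ^ (p - 3) * (\<Sum>i<N. (s i)\<^sup>2) + r ^ (p - 2) * (\<Sum>i<N. \<Sum>j<N. b i j * (b i j + b j i)))
     \<le> real p * real (p - 1) * (real (p - 2) * real (p - 3) * (r ^ (p - 2) * B) + real (p - 2) * (4 * (r ^ (p - 2) * B)) + 2 * (r ^ (p - 2) * B))"
    by (intro mult_left_mono add_mono) auto
  also have "\<dots> = real p * real (p - 1) * (real (p - 2) * real (p - 3) + 4 * real (p - 2) + 2) * (r ^ (p - 2) * B)"
    by (simp add: algebra_simps)
  \<comment> \<open>The three multiplicities add up to the prefactor itself, which is how the square
    arises.\<close>
  also have "real (p - 2) * real (p - 3) + 4 * real (p - 2) + 2 = real p * real (p - 1)"
    using p by (simp add: of_nat_diff algebra_simps)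
  finally have fin: "real p * real (p - 1) * (real (p - 2) * real (p - 3) * r ^ (p - 4) * (qf N b x)\<^sup>2
     + real (p - 2) * r ^ (p - 3) * (\<Sum>i<N. (s i)\<^sup>2) + r ^ (p - 2) * (\<Sum>i<N. \<Sum>j<N. b i j * (b i j + b j i)))
     \<le> real p * real (p - 1) * (real p * real (p - 1)) * (r ^ (p - 2) * B)" .
  have "(\<Sum>is\<in>idx N p. (D2m N p b is x)\<^sup>2) = real p * real (p - 1) * (real (p - 2) * real (p - 3) * r ^ (p - 4) * (qf N b x)\<^sup>2
     + real (p - 2) * r ^ (p - 3) * (\<Sum>i<N. (s i)\<^sup>2) + r ^ (p - 2) * (\<Sum>i<N. \<Sum>j<N. b i j * (b i j + b j i)))"
    unfolding s_def r_def by (rule sum_D2m_sq)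
  also note fin
  also have "real p * real (p - 1) * (real p * real (p - 1)) * (r ^ (p - 2) * B) = (real p * real (p - 1))\<^sup>2 * r ^ (p - 2) * B"
    by (simp only: power2_eq_square mult.assoc)
  finally show ?thesis unfolding r_def B_def .
qed

text \<open>Elementary matrices \<open>b\<close> turn the covariance formula into the second moment
  of each entry of the Hessian. On |x|^2 = N and after normalization the sum is N p(p-1) (1 +
  O(1/N)): this is where the constant 2p(p-1) in the drift of v comes from.\<close>

lemma sum_hess_mon_sq:
  fixes N :: nat and x :: "nat \<Rightarrow> real"
  assumes p: "p \<ge> 3"
  defines "r \<equiv> \<Sum>i<N. (x i)\<^sup>2"
  shows "(\<Sum>i<N. \<Sum>j<N. \<Sum>is\<in>idx N p. (pd i (pd j (mon p is)) x)\<^sup>2) = real p * real (p - 1) * r ^ (p - 2) *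
    (real (p - 2) * real (p - 3) + real (p - 2) * (2 * real N + 2) + (real N)\<^sup>2 + real N)"
proof -
  have trm: "(\<Sum>is\<in>idx N p. (pd i (pd j (mon p is)) x)\<^sup>2) = real p * real (p - 1) *
    (real (p - 2) * real (p - 3) * r ^ (p - 4) * ((x i)\<^sup>2 * (x j)\<^sup>2)
     + real (p - 2) * r ^ (p - 3) * ((x i)\<^sup>2 + (x j)\<^sup>2 + (if i = j then 2 * (x i)\<^sup>2 else 0))
     + r ^ (p - 2) * (1 + (if i = j then 1 else 0)))" if ij: "i < N" "j < N" for i j
  proof -
    define b :: "nat \<Rightarrow> nat \<Rightarrow> real" where "b = (\<lambda>k l. unitv i k * unitv j l)"
    have bs: "(\<Sum>k<N. \<Sum>l<N. b k l * f k l) = f i j" for f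
      unfolding b_def using ij by (simp add: mult.assoc sum_distrib_left[symmetric] sum_unitv)
    have D: "D2m N p b is x = pd i (pd j (mon p is)) x" for "is" unfolding D2m_def by (rule bs)
    have q: "qf N b x = x i * x j" unfolding qf_def by (rule bs)
    have s: "(\<Sum>k<N. (b a k + b k a) * x k) = unitv i a * x j + unitv j a * x i" if "a < N" for a
    proof -
      have "(\<Sum>k<N. (b a k + b k a) * x k) = (\<Sum>k<N. unitv j k * (unitv i a * x k)) + (\<Sum>k<N. unitv i k * (unitv j a * x k))"
        unfolding b_def sum.distrib[symmetric] by (intro sum.cong) (auto simp: algebra_simps)
      then show ?thesis using ij by (simp add: sum_unitv)
    qed
    have "(\<Sum>a<N. (\<Sum>k<N. (b a k + b k a) * x k)\<^sup>2) = (\<Sum>a<N. (unitv i a * x j + unitv j a * x i)\<^sup>2)"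
      by (intro sum.cong) (auto simp: s)
    also have "\<dots> = (\<Sum>a<N. unitv i a * (unitv i a * (x j)\<^sup>2 + 2 * x j * x i * unitv j a) + unitv j a * (unitv j a * (x i)\<^sup>2))"
      by (intro sum.cong) (auto simp: power2_eq_square algebra_simps)
    also have "\<dots> = (x i)\<^sup>2 + (x j)\<^sup>2 + (if i = j then 2 * (x i)\<^sup>2 else 0)"
      using ij by (simp only: sum.distrib sum_unitv) (simp add: unitv_def power2_eq_square)
    finally have S: "(\<Sum>a<N. (\<Sum>k<N. (b a k + b k a) * x k)\<^sup>2) = (x i)\<^sup>2 + (x j)\<^sup>2 + (if i = j then 2 * (x i)\<^sup>2 else 0)" .
    have "(\<Sum>k<N. \<Sum>l<N. b k l * (b k l + b l k)) = b i j + b j i" by (rule bs)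
    also have "\<dots> = 1 + (if i = j then 1 else 0)" unfolding b_def by (simp add: unitv_def)
    finally show ?thesis
      using sum_D2m_sq[of N p b x] unfolding D q S r_def[symmetric] by (simp add: power_mult_distrib)
  qed
  have n1: "(\<Sum>i<N. \<Sum>j<N. (x i)\<^sup>2 * (x j)\<^sup>2) = r\<^sup>2" unfolding r_def by (simp add: power2_eq_square sum_product)
  have n2: "(\<Sum>i<N. \<Sum>j<N. (x i)\<^sup>2 + (x j)\<^sup>2 + (if i = j then 2 * (x i)\<^sup>2 else 0)) = 2 * real N * r + 2 * r"
    unfolding r_def by (simp add: sum.distrib sum_distrib_left algebra_simps)
  have n3: "(\<Sum>i<N. \<Sum>j<N. 1 + (if i = j then 1 else 0 :: real)) = (real N)\<^sup>2 + real N"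
    by (simp add: sum.distrib power2_eq_square algebra_simps)
  have "(\<Sum>i<N. \<Sum>j<N. \<Sum>is\<in>idx N p. (pd i (pd j (mon p is)) x)\<^sup>2) =
    (\<Sum>i<N. \<Sum>j<N. real p * real (p - 1) *
    (real (p - 2) * real (p - 3) * r ^ (p - 4) * ((x i)\<^sup>2 * (x j)\<^sup>2)
     + real (p - 2) * r ^ (p - 3) * ((x i)\<^sup>2 + (x j)\<^sup>2 + (if i = j then 2 * (x i)\<^sup>2 else 0))
     + r ^ (p - 2) * (1 + (if i = j then 1 else 0))))"
    by (intro sum.cong refl trm) auto
  also have "\<dots> = real p * real (p - 1) * (real (p - 2) * real (p - 3) * r ^ (p - 4) * r\<^sup>2
     + real (p - 2) * r ^ (p - 3) * (2 * real N * r + 2 * r) + r ^ (p - 2) * ((real N)\<^sup>2 + real N))"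
    unfolding n1[symmetric] n2[symmetric] n3[symmetric] by (simp only: sum.distrib[symmetric] sum_distrib_left)
  also have "real (p - 2) * real (p - 3) * r ^ (p - 4) * r\<^sup>2 = real (p - 2) * real (p - 3) * r ^ (p - 2)"
  proof (cases "p = 3")
    case False
    then have "p - 2 = Suc (Suc (p - 4))" using p by linarith
    then have "r ^ (p - 2) = r ^ (p - 4) * r\<^sup>2" by (simp add: power2_eq_square)
    then show ?thesis by simp
  qed simp
  also have "real (p - 2) * r ^ (p - 3) * (2 * real N * r + 2 * r) = real (p - 2) * (r ^ (p - 2) * (2 * real N + 2))"
  proof -
    have "p - 2 = Suc (p - 3)" using p by simp
    then show ?thesis by (simp add: algebra_simps)
  qed
  finally show ?thesis by (simp add: algebra_simps)
qed

section \<open>Drifts of the observables\<close>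

text \<open>With this factor the covariance is (x . y)^p / N^(p-1), so H has variance N on the
  sphere.\<close>

definition Hscale :: "nat \<Rightarrow> nat \<Rightarrow> real" where
  "Hscale N p = real N powr (- (real p - 1) / 2)"

lemma Ham_HT: "Ham N p J = (\<lambda>x. Hscale N p * HT N p J x)"
  unfolding Ham_def HT_def Hscale_def mon_def by simp

lemma pol_Ham: "pol N p (Ham N p J)"
  unfolding Ham_HT by (intro pol_cmult pol_HT)

lemma hom_Ham: "hom p (Ham N p J)"
  using hom_HT[of p N J] unfolding Ham_HT hom_def by simp

lemma pd_Ham: "pd i (Ham N p J) x = Hscale N p * pd i (HT N p J) x"
  unfolding Ham_HT by (rule pd_cmult[OF pol_HT])

lemma pd2_Ham: "pd i (pd j (Ham N p J)) x = Hscale N p * pd i (pd j (HT N p J)) x"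
  unfolding pd_Ham by (rule pd_cmult[OF pol_pd[OF pol_HT]])

lemma slap_pol:
  assumes f: "pol N d f"
  shows "slap N f x = (\<Sum>i<N. pd i (pd i f) x) - ehess f x x x / real N - (real N - 1) / real N * (\<Sum>i<N. x i * pd i f x)"
proof -
  have "ehess f x (unitv i) (unitv i) = pd i (pd i f) x" if "i < N" for i
    unfolding ehess_pol[OF f] using that by (simp add: mult.assoc sum_distrib_left[symmetric] sum_unitv)
  then show ?thesis unfolding slap_def by simp
qed

text \<open>Euler's identity, applied to f and to its Hessian, replaces both radial derivatives by
  multiples of f.\<close>

lemma slap_hom:
  assumes f: "pol N d f" and h: "hom k f" and k: "k \<ge> 1"
  shows "slap N f x = (\<Sum>i<N. pd i (pd i f) x) - real k * (real k - 1) * f x / real N - (real N - 1) / real N * (real k * f x)"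
proof -
  obtain n where n: "k = Suc n" using k by (cases k) auto
  show ?thesis unfolding slap_pol[OF f] euler[OF f h] ehess_euler[OF f h[unfolded n]] by (simp add: n)
qed

definition uh :: "nat \<Rightarrow> nat \<Rightarrow> (nat list \<Rightarrow> real) \<Rightarrow> (nat \<Rightarrow> real) \<Rightarrow> real" where
  "uh N p J x = - Ham N p J x / real N"

text \<open>Only on the sphere do \<open>vh\<close> and \<open>wh\<close> equal \<open>\<bar>\<nabla>H\<bar>\<^sup>2/N\<close> and \<open>G(\<nabla>H, \<nabla>H)/N\<close>; elsewhere they are polynomial extensions.\<close>

definition vh :: "nat \<Rightarrow> nat \<Rightarrow> (nat list \<Rightarrow> real) \<Rightarrow> (nat \<Rightarrow> real) \<Rightarrow> real" where
  "vh N p J x = (\<Sum>k<N. (pd k (Ham N p J) x)\<^sup>2) / real N - (real p)\<^sup>2 * (Ham N p J x)\<^sup>2 / (real N)\<^sup>2"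

text \<open>On the sphere these are the components of the spherical gradient of H: by Euler's
  identity the radial part of the Euclidean gradient is p H / N times x. The formula is polynomial
  in x, so it can be differentiated in the ambient space.\<close>

definition gv :: "nat \<Rightarrow> nat \<Rightarrow> (nat list \<Rightarrow> real) \<Rightarrow> nat \<Rightarrow> (nat \<Rightarrow> real) \<Rightarrow> real" where
  "gv N p J i x = pd i (Ham N p J) x - real p * Ham N p J x / real N * x i"

definition wh :: "nat \<Rightarrow> nat \<Rightarrow> (nat list \<Rightarrow> real) \<Rightarrow> (nat \<Rightarrow> real) \<Rightarrow> real" where
  "wh N p J x = (\<Sum>i<N. \<Sum>j<N. gv N p J i x * gv N p J j x * pd i (pd j (Ham N p J)) x) / real N"

definition trH :: "nat \<Rightarrow> nat \<Rightarrow> (nat list \<Rightarrow> real) \<Rightarrow> (nat \<Rightarrow> real) \<Rightarrow> real" where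
  "trH N p J x = (\<Sum>i<N. pd i (pd i (Ham N p J)) x)"

definition frobH :: "nat \<Rightarrow> nat \<Rightarrow> (nat list \<Rightarrow> real) \<Rightarrow> (nat \<Rightarrow> real) \<Rightarrow> real" where
  "frobH N p J x = (\<Sum>i<N. \<Sum>j<N. (pd i (pd j (Ham N p J)) x)\<^sup>2)"

lemma pol_uh: "pol N p (uh N p J)"
  unfolding uh_def[abs_def] by (intro pol_divide pol_minus pol_Ham)

lemma pol_gradsq: "pol N (2 * p) (\<lambda>x. \<Sum>k<N. (pd k (Ham N p J) x)\<^sup>2)"
  by (intro pol_sum pol_mono[OF pol_power[OF pol_pd[OF pol_Ham]]]) simp

lemma pol_Hsq: "pol N (2 * p) (\<lambda>x. (Ham N p J x)\<^sup>2)"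
  by (intro pol_mono[OF pol_power[OF pol_Ham]]) simp

lemma pol_vh: "pol N (2 * p) (vh N p J)"
  unfolding vh_def[abs_def] by (intro pol_diff pol_divide pol_cmult pol_gradsq pol_Hsq)

lemma pol_gv: "i < N \<Longrightarrow> pol N (p + 1) (gv N p J i)"
  unfolding gv_def[abs_def]
  by (intro pol_diff pol_mult_le[where d=p and e=1] pol_divide pol_cmult pol_Ham pol_var pol_mono[OF pol_pd[OF pol_Ham]]) auto

lemma pol_wh: "pol N (3 * p + 2) (wh N p J)"
  unfolding wh_def[abs_def]
  by (intro pol_divide pol_sum pol_mult_le[where d="2*p+2" and e=p] pol_mult_le[where d="p+1" and e="p+1"] pol_gv pol_pd pol_Ham) auto

lemma pol_trH: "pol N p (trH N p J)"
  unfolding trH_def[abs_def] by (intro pol_sum pol_pd pol_Ham)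

lemma pol_frobH: "pol N (2 * p) (frobH N p J)"
  unfolding frobH_def[abs_def] power2_eq_square
  by (intro pol_sum pol_mult_le[where d=p and e=p] pol_pd pol_Ham) auto

context
  fixes N p :: nat and \<beta> :: real and J :: "nat list \<Rightarrow> real" and x :: "nat \<Rightarrow> real"
  assumes p: "p \<ge> 3" and N: "N \<ge> 1" and x: "(\<Sum>i<N. (x i)\<^sup>2) = real N"
begin

private abbreviation (input) "H \<equiv> Ham N p J"
private abbreviation (input) "a \<equiv> \<lambda>i. pd i (Ham N p J) x"
private abbreviation (input) "A \<equiv> \<lambda>i j. pd i (pd j (Ham N p J)) x"
private abbreviation (input) "g \<equiv> \<lambda>i. gv N p J i x"

lemma xx: "(\<Sum>i<N. x i * x i) = real N" using x by (simp add: power2_eq_square)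

lemma euler_Ham: "(\<Sum>i<N. x i * a i) = real p * H x"
  by (rule euler[OF pol_Ham hom_Ham])

lemma hessian_euler_Ham: "(\<Sum>i<N. x i * A i j) = (real p - 1) * a j"
  using hessian_euler[of N p "Ham N p J" "p - 1" x j] pol_Ham hom_Ham[of p N J] p by (simp add: of_nat_diff)

lemma sgrad_gv: "sgrad N H x i = g i"
  unfolding sgrad_def gv_def euler_Ham ..

lemma x_gv: "(\<Sum>i<N. x i * g i) = 0"
proof -
  define c where c_eq: "c = real p * H x / real N"
  have c: "c = real p * H x / real N" "\<And>i. g i = a i - c * x i" by (simp_all add: gv_def c_eq)
  have "(\<Sum>i<N. x i * g i) = (\<Sum>i<N. x i * a i) - c * (\<Sum>i<N. x i * x i)"
    unfolding c(2) by (simp add: sum_subtractf sum_distrib_left algebra_simps)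
  then show ?thesis unfolding euler_Ham xx c(1) using N by simp
qed

lemma gv_a: "(\<Sum>i<N. g i * a i) = (\<Sum>i<N. (g i)\<^sup>2)"
proof -
  define c where c_eq: "c = real p * H x / real N"
  have c: "c = real p * H x / real N" "\<And>i. g i = a i - c * x i" by (simp_all add: gv_def c_eq)
  have "(\<Sum>i<N. g i * a i) = (\<Sum>i<N. (g i)\<^sup>2 + c * (x i * g i))"
    unfolding c(2) by (intro sum.cong) (auto simp: power2_eq_square algebra_simps)
  also have "\<dots> = (\<Sum>i<N. (g i)\<^sup>2)" by (simp add: sum.distrib sum_distrib_left[symmetric] x_gv)
  finally show ?thesis .
qed

lemma gv_sq: "(\<Sum>i<N. (g i)\<^sup>2) = real N * vh N p J x"
proof -
  define c where c_eq: "c = real p * H x / real N"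
  have c: "c = real p * H x / real N" "\<And>i. g i = a i - c * x i" by (simp_all add: gv_def c_eq)
  have "(\<Sum>i<N. (g i)\<^sup>2) = (\<Sum>i<N. (a i)\<^sup>2 - c * (x i * a i))"
  proof -
    have "(\<Sum>i<N. g i * a i) = (\<Sum>i<N. (a i)\<^sup>2 - c * (x i * a i))"
      unfolding c(2) by (simp add: power2_eq_square algebra_simps)
    then show ?thesis unfolding gv_a .
  qed
  also have "\<dots> = (\<Sum>i<N. (a i)\<^sup>2) - c * (real p * H x)"
    by (simp add: sum_subtractf sum_distrib_left[symmetric] euler_Ham)
  also have "\<dots> = real N * vh N p J x" unfolding vh_def c(1) using N by (simp add: field_simps power2_eq_square)
  finally show ?thesis .
qed

lemma sgrad_norm2_vh: "sgrad_norm2 N H x / real N = vh N p J x"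
  unfolding sgrad_norm2_def sgrad_gv gv_sq using N by simp

text \<open>The spherical gradient of H is tangent, so the radial correction in the spherical
  gradient of f drops out of the inner product.\<close>

lemma gen_pol:
  assumes f: "pol N d f"
  shows "gen N p \<beta> J f x = slap N f x - \<beta> * (\<Sum>i<N. g i * pd i f x)"
proof -
  have aux: "(\<Sum>i<N. g i * (pd i f x - c * x i)) = (\<Sum>i<N. g i * pd i f x) - c * (\<Sum>i<N. x i * g i)" for c
    by (simp add: sum_subtractf sum_distrib_left algebra_simps)
  have "(\<Sum>i<N. sgrad N H x i * sgrad N f x i)
      = (\<Sum>i<N. g i * pd i f x) - ((\<Sum>j<N. x j * pd j f x) / real N) * (\<Sum>i<N. x i * g i)"
    unfolding sgrad_gv sgrad_def[of N f] by (rule aux)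
  then show ?thesis unfolding gen_def x_gv by simp
qed

text \<open>The radial first-order term of the Laplacian yields -pu up to a factor (N-1)/N; the
  excess and the radial second derivative combine to the error -p(p-2)u/N.\<close>

lemma gen_uh:
  "gen N p \<beta> J (uh N p J) x = F1 p \<beta> (uh N p J x) (vh N p J x) + (- trH N p J x / real N - real p * (real p - 2) * uh N p J x / real N)"
proof -
  have h: "hom p (uh N p J)" using hom_Ham[of p N J] unfolding hom_def uh_def by simp
  have p1: "p \<ge> 1" using p by simp
  have 1: "pd i (uh N p J) y = - pd i H y / real N" for i y
    unfolding uh_def[abs_def] by (subst pd_divide[OF pol_minus[OF pol_Ham]], subst pd_minus[OF pol_Ham], rule refl)
  then have e: "pd i (uh N p J) = (\<lambda>y. - pd i H y / real N)" for i by auto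
  have 2: "pd i (pd i (uh N p J)) x = - A i i / real N" for i
    by (subst e, subst pd_divide[OF pol_minus[OF pol_pd[OF pol_Ham]]], subst pd_minus[OF pol_pd[OF pol_Ham]], rule refl)
  have 3: "(\<Sum>i<N. g i * pd i (uh N p J) x) = - vh N p J x"
  proof -
    have "(\<Sum>i<N. g i * pd i (uh N p J) x) = - (\<Sum>i<N. g i * a i) / real N"
      unfolding 1 by (simp add: sum_negf sum_divide_distrib)
    then show ?thesis unfolding gv_a gv_sq using N by simp
  qed
  have 4: "(\<Sum>i<N. pd i (pd i (uh N p J)) x) = - trH N p J x / real N"
    unfolding 2 trH_def by (simp add: sum_negf sum_divide_distrib)
  show ?thesis unfolding gen_pol[OF pol_uh] slap_hom[OF pol_uh h p1] 3 4 F1_def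
    using N by (simp add: field_simps)
qed

lemma pd_gradsq: "pd i (\<lambda>x. \<Sum>k<N. (pd k H x)\<^sup>2) y = (\<Sum>k<N. 2 * (pd k H y * pd i (pd k H) y))"
proof -
  have pp: "pol N (p * 2) (\<lambda>x. (pd k H x)\<^sup>2)" for k by (rule pol_power[OF pol_pd[OF pol_Ham]])
  show ?thesis by (subst pd_sum[OF pp]) (simp add: pd_power[OF pol_pd[OF pol_Ham]] mult.assoc)
qed

lemma pd_Hsq: "pd i (\<lambda>x. (H x)\<^sup>2) y = 2 * (H y * pd i H y)"
  by (simp add: pd_power[OF pol_Ham])

text \<open>Bochner's formula in flat space. Since partial derivatives commute, third derivatives of
  H occur only in the gradient of its Laplacian, and that gradient is small as soon as the Laplacian
  is small on a ball.\<close>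

lemma tr_gradsq: "(\<Sum>i<N. pd i (pd i (\<lambda>x. \<Sum>k<N. (pd k H x)\<^sup>2)) x) = 2 * frobH N p J x + 2 * (\<Sum>k<N. a k * pd k (trH N p J) x)"
proof -
  have pk: "pol N p (pd k H)" for k by (rule pol_pd[OF pol_Ham])
  have pik: "pol N p (pd i (pd k H))" for i k by (rule pol_pd[OF pk])
  have "pd i (\<lambda>x. \<Sum>k<N. (pd k H x)\<^sup>2) = (\<lambda>y. \<Sum>k<N. 2 * (pd k H y * pd i (pd k H) y))" for i
    using pd_gradsq by auto
  then have 1: "pd i (pd i (\<lambda>x. \<Sum>k<N. (pd k H x)\<^sup>2)) x = (\<Sum>k<N. 2 * ((A i k)\<^sup>2 + a k * pd i (pd i (pd k H)) x))" for i
    by (simp add: pd_sum[OF pol_cmult[OF pol_mult[OF pk pik]]] pd_cmult[OF pol_mult[OF pk pik]] pd_mult[OF pk pik] power2_eq_square)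
  have c: "pd k (trH N p J) x = (\<Sum>i<N. pd i (pd i (pd k H)) x)" for k
  proof -
    have "pd i (pd k H) = pd k (pd i H)" for i by (rule ext) (rule pd_commute[OF pol_Ham])
    moreover have "pd i (pd k (pd i H)) x = pd k (pd i (pd i H)) x" for i by (rule pd_commute[OF pk])
    moreover have "pd k (trH N p J) x = (\<Sum>i<N. pd k (pd i (pd i H)) x)"
      unfolding trH_def[abs_def] by (rule pd_sum[OF pik])
    ultimately show ?thesis by simp
  qed
  show ?thesis
    unfolding 1 frobH_def c
    by (subst (3) sum_distrib_left, subst (3) sum.swap)
       (simp add: sum.distrib sum_distrib_left distrib_left mult.assoc)
qed

lemma tr_Hsq: "(\<Sum>i<N. pd i (pd i (\<lambda>x. (H x)\<^sup>2)) x) = 2 * (\<Sum>i<N. (a i)\<^sup>2) + 2 * H x * trH N p J x"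
proof -
  have "pd i (\<lambda>x. (H x)\<^sup>2) = (\<lambda>y. 2 * (H y * pd i H y))" for i using pd_Hsq by auto
  then have "pd i (pd i (\<lambda>x. (H x)\<^sup>2)) x = 2 * ((a i)\<^sup>2 + H x * A i i)" for i
    by (simp add: pd_cmult[OF pol_mult[OF pol_Ham pol_pd[OF pol_Ham]]] pd_mult[OF pol_Ham pol_pd[OF pol_Ham]] power2_eq_square)
  then show ?thesis unfolding trH_def by (simp add: sum.distrib sum_distrib_left distrib_left mult.assoc)
qed

text \<open>Split the full gradient into \<open>gv\<close> and a multiple of x. Against the
  tangential part the Hessian gives \<open>wh\<close>; on x it acts, by Euler's identity, as p - 1
  times the gradient.\<close>

lemma g_A_a: "(\<Sum>i<N. g i * (\<Sum>k<N. a k * A i k)) = real N * wh N p J x + real p * (real p - 1) * H x * vh N p J x"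
proof -
  define c where c_eq: "c = real p * H x / real N"
  have c: "c = real p * H x / real N" "\<And>i. g i = a i - c * x i" by (simp_all add: gv_def c_eq)
  have "(\<Sum>i<N. g i * (\<Sum>k<N. a k * A i k)) = (\<Sum>i<N. g i * ((\<Sum>k<N. g k * A i k) + c * (\<Sum>k<N. x k * A k i)))"
  proof (intro sum.cong refl arg_cong2[where f="(*)"])
    fix i
    have "(\<Sum>k<N. a k * A i k) = (\<Sum>k<N. g k * A i k + c * (x k * A i k))"
      unfolding c(2) by (intro sum.cong) (auto simp: algebra_simps)
    also have "\<dots> = (\<Sum>k<N. g k * A i k) + c * (\<Sum>k<N. x k * A i k)"
      by (simp add: sum.distrib sum_distrib_left)
    also have "(\<Sum>k<N. x k * A i k) = (\<Sum>k<N. x k * A k i)"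
      by (simp add: pd_commute[OF pol_Ham])
    finally show "(\<Sum>k<N. a k * A i k) = (\<Sum>k<N. g k * A i k) + c * (\<Sum>k<N. x k * A k i)" .
  qed
  also have "\<dots> = (\<Sum>i<N. \<Sum>k<N. g i * g k * A i k) + c * (real p - 1) * (\<Sum>i<N. g i * a i)"
    unfolding hessian_euler_Ham by (simp add: distrib_left sum.distrib sum_distrib_left mult_ac)
  also have "\<dots> = real N * wh N p J x + real p * (real p - 1) * H x * vh N p J x"
    unfolding gv_a gv_sq wh_def c(1) using N by simp
  finally show ?thesis .
qed

text \<open>Both |grad H|^2 and H^2 are homogeneous, of degrees 2p-2 and 2p, so their spherical
  Laplacians reduce to Euclidean ones plus multiples of the functions themselves. The
  Hilbert-Schmidt norm of the Hessian is centred at p(p-1), which moves 2p(p-1) into the main part;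
  the last summand collects the terms with an extra factor 1/N.\<close>

lemma gen_vh:
  fixes u v w defines "u \<equiv> uh N p J x" and "v \<equiv> vh N p J x" and "w \<equiv> wh N p J x"
  shows "gen N p \<beta> J (vh N p J) x = 2 * real p * (real p - 1) - 2 * (real p - 1) * v + 2 * real p * u * (real p * u - \<beta> * v) - 2 * \<beta> * w
    + (2 * (frobH N p J x / real N - real p * (real p - 1)) + 2 * (\<Sum>k<N. a k * pd k (trH N p J) x) / real N
       + 2 * (real p)\<^sup>2 * u * trH N p J x / real N
       + ((2 * real p - 2) * (v + (real p)\<^sup>2 * u\<^sup>2) - (2 * real p - 2) * (2 * real p - 3) * (v + (real p)\<^sup>2 * u\<^sup>2)
          - 2 * (real p)\<^sup>2 * (v + (real p)\<^sup>2 * u\<^sup>2) + (real p)^3 * (4 * real p - 4) * u\<^sup>2) / real N)"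
proof -
  let ?f = "\<lambda>x. \<Sum>k<N. (pd k H x)\<^sup>2" and ?q = "\<lambda>x. (H x)\<^sup>2"
  have vh_eq: "vh N p J = (\<lambda>x. ?f x / real N - (real p)\<^sup>2 / (real N)\<^sup>2 * ?q x)" by (auto simp: vh_def)
  have pdv: "pd i (vh N p J) y = pd i ?f y / real N - (real p)\<^sup>2 / (real N)\<^sup>2 * pd i ?q y" for i y
    unfolding vh_eq by (subst pd_diff[OF pol_divide[OF pol_gradsq] pol_cmult[OF pol_Hsq]], subst pd_divide[OF pol_gradsq], subst pd_cmult[OF pol_Hsq], rule refl)
  have ev: "pd i (vh N p J) = (\<lambda>y. pd i ?f y / real N - (real p)\<^sup>2 / (real N)\<^sup>2 * pd i ?q y)" for i using pdv by auto
  have pdv2: "pd j (pd i (vh N p J)) x = pd j (pd i ?f) x / real N - (real p)\<^sup>2 / (real N)\<^sup>2 * pd j (pd i ?q) x" for i j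
    by (subst ev, subst pd_diff[OF pol_divide[OF pol_pd[OF pol_gradsq]] pol_cmult[OF pol_pd[OF pol_Hsq]]],
       subst pd_divide[OF pol_pd[OF pol_gradsq]], subst pd_cmult[OF pol_pd[OF pol_Hsq]], rule refl)
  have hk: "hom (p - 1) (pd k H)" for k
    using hom_pd[OF pol_Ham, of "p - 1" N p J k] hom_Ham[of p N J] p by simp
  have hf: "hom (2 * p - 2) ?f"
    unfolding hom_def
  proof (intro allI impI)
    fix c :: real and y :: "nat \<Rightarrow> real" assume c: "c > 0"
    have "pd k H (\<lambda>i. c * y i) = c ^ (p - 1) * pd k H y" for k using hk c unfolding hom_def by blast
    moreover have "2 * p - 2 = (p - 1) * 2" using p by linarith
    then have "(c ^ (p - 1))\<^sup>2 = c ^ (2 * p - 2)" by (simp only: power_mult)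
    ultimately show "?f (\<lambda>i. c * y i) = c ^ (2 * p - 2) * ?f y" by (simp add: power_mult_distrib sum_distrib_left)
  qed
  have hq: "hom (2 * p) ?q"
    using hom_Ham[of p N J] unfolding hom_def by (simp add: power_mult_distrib power_mult[symmetric] mult.commute)
  have slv: "slap N (vh N p J) x = slap N ?f x / real N - (real p)\<^sup>2 / (real N)\<^sup>2 * slap N ?q x"
  proof -
    have e: "ehess (vh N p J) x x x = ehess ?f x x x / real N - (real p)\<^sup>2 / (real N)\<^sup>2 * ehess ?q x x x"
      unfolding ehess_pol[OF pol_vh] ehess_pol[OF pol_gradsq] ehess_pol[OF pol_Hsq] pdv2
      by (simp add: right_diff_distrib sum_subtractf sum_divide_distrib sum_distrib_left mult_ac)
    have t: "(\<Sum>i<N. pd i (pd i (vh N p J)) x) = (\<Sum>i<N. pd i (pd i ?f) x) / real N - (real p)\<^sup>2 / (real N)\<^sup>2 * (\<Sum>i<N. pd i (pd i ?q) x)"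
      unfolding pdv2 by (simp add: sum_subtractf sum_divide_distrib sum_distrib_left)
    have r: "(\<Sum>i<N. x i * pd i (vh N p J) x) = (\<Sum>i<N. x i * pd i ?f x) / real N - (real p)\<^sup>2 / (real N)\<^sup>2 * (\<Sum>i<N. x i * pd i ?q x)"
      unfolding pdv by (simp add: right_diff_distrib sum_subtractf sum_divide_distrib sum_distrib_left mult_ac)
    have aux: "(T1 / n - q * T2) - (E1 / n - q * E2) / n - (n - 1) / n * (R1 / n - q * R2)
      = (T1 - E1 / n - (n - 1) / n * R1) / n - q * (T2 - E2 / n - (n - 1) / n * R2)" if "n \<noteq> 0" for n q T1 T2 E1 E2 R1 R2 :: real
      using that by (simp add: field_simps)
    show ?thesis unfolding slap_pol[OF pol_vh] slap_pol[OF pol_gradsq] slap_pol[OF pol_Hsq] e t r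
      using N by (intro aux) simp
  qed
  have fv: "?f x = real N * (v + (real p)\<^sup>2 * u\<^sup>2)"
    unfolding v_def u_def vh_def uh_def using N by (simp add: field_simps power2_eq_square)
  have Hu: "H x = - (real N * u)" unfolding u_def uh_def using N by simp
  have r2: "real (2 * p - 2) = 2 * real p - 2" using p by (simp add: of_nat_diff)
  have drift: "(\<Sum>i<N. g i * pd i (vh N p J) x) = 2 * w + 2 * real p * u * v"
  proof -
    have "(\<Sum>i<N. g i * pd i (vh N p J) x) = 2 * (\<Sum>i<N. g i * (\<Sum>k<N. a k * A i k)) / real N - (real p)\<^sup>2 / (real N)\<^sup>2 * (2 * H x * (\<Sum>i<N. g i * a i))"
      unfolding pdv pd_gradsq pd_Hsq
      by (simp add: right_diff_distrib sum_subtractf sum_divide_distrib sum_distrib_left mult_ac)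
    also have "\<dots> = 2 * w + 2 * real p * u * v"
      unfolding g_A_a gv_a gv_sq Hu w_def[symmetric] v_def[symmetric] using N
      by (simp add: field_simps power2_eq_square)
    finally show ?thesis .
  qed
  have k1: "2 * p - 2 \<ge> 1" and k2: "2 * p \<ge> 1" using p by auto
  define D where "D = (\<Sum>k<N. a k * pd k (trH N p J) x)"
  have R: "real N * v + real N * (real p)\<^sup>2 * u\<^sup>2 = real N * (v + (real p)\<^sup>2 * u\<^sup>2)" by (simp add: algebra_simps)
  show ?thesis
    unfolding gen_pol[OF pol_vh] slv slap_hom[OF pol_gradsq hf k1] slap_hom[OF pol_Hsq hq k2] tr_gradsq tr_Hsq drift
      fv Hu r2 D_def[symmetric]
    using N by (simp add: field_simps power2_eq_square power3_eq_cube)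
qed

end

section \<open>Gaussian concentration\<close>

abbreviation gauss :: "real measure" where
  "gauss \<equiv> density lborel (\<lambda>x. ennreal (std_normal_density x))"

lemma sets_gauss [measurable_cong, simp]: "sets gauss = sets borel" by simp

lemma space_gauss [simp]: "space gauss = UNIV" by simp

lemma prob_space_gauss: "prob_space gauss"
  by (rule prob_space_normal_density) simp

text \<open>Fubini and two affine substitutions in one variable: with a = cx + sy in place of x, the
  second coordinate becomes -(s/c) a + y/c, which is then substituted for y; the Jacobian factors
  1/c and c cancel. The angles used later lie in [0, pi/2), so that their cosine is
  positive.\<close>

lemma lborel_rotation:
  fixes c s :: real
  assumes [measurable]: "G \<in> borel_measurable (borel \<Otimes>\<^sub>M borel)" and c: "c > 0" and cs: "c\<^sup>2 + s\<^sup>2 = 1"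
  shows "(\<integral>\<^sup>+x. \<integral>\<^sup>+y. G (c * x + s * y, - s * x + c * y) \<partial>lborel \<partial>lborel) = (\<integral>\<^sup>+x. \<integral>\<^sup>+y. G (x, y) \<partial>lborel \<partial>lborel)"
proof -
  have A: "(\<integral>\<^sup>+x. G (c * x + s * y, - s * x + c * y) \<partial>lborel) = ennreal (1/c) * (\<integral>\<^sup>+a. G (a, (- s / c) * a + (1/c) * y) \<partial>lborel)" for y
  proof -
    have e: "- s * x + c * y = (- s / c) * (s * y + c * x) + (1/c) * y" for x
    proof -
      have "s * s + c * c = 1" using cs by (simp add: power2_eq_square)
      then have "y = (s * s + c * c) * y" by simp
      then show ?thesis using c by (simp add: field_simps)
    qed
    have "(\<integral>\<^sup>+a. G (a, (- s / c) * a + (1/c) * y) \<partial>lborel) = ennreal \<bar>c\<bar> * (\<integral>\<^sup>+x. G (s * y + c * x, (- s / c) * (s * y + c * x) + (1/c) * y) \<partial>lborel)"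
      using c by (intro nn_integral_real_affine) auto
    also have "\<dots> = ennreal c * (\<integral>\<^sup>+x. G (c * x + s * y, - s * x + c * y) \<partial>lborel)"
      using c unfolding e[symmetric] by (simp add: add.commute)
    finally show ?thesis using c by (simp add: mult.assoc[symmetric] ennreal_mult[symmetric])
  qed
  have B: "ennreal (1/c) * (\<integral>\<^sup>+y. G (a, (- s / c) * a + (1/c) * y) \<partial>lborel) = (\<integral>\<^sup>+y. G (a, y) \<partial>lborel)" for a
    using c nn_integral_real_affine[of "\<lambda>y. G (a, y)" "1/c" "(- s / c) * a"] by simp
  have "(\<integral>\<^sup>+x. \<integral>\<^sup>+y. G (c * x + s * y, - s * x + c * y) \<partial>lborel \<partial>lborel) = (\<integral>\<^sup>+y. \<integral>\<^sup>+x. G (c * x + s * y, - s * x + c * y) \<partial>lborel \<partial>lborel)"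
    by (rule lborel_pair.Fubini'[symmetric]) measurable
  also have "\<dots> = ennreal (1/c) * (\<integral>\<^sup>+y. \<integral>\<^sup>+a. G (a, (- s / c) * a + (1/c) * y) \<partial>lborel \<partial>lborel)"
    unfolding A by (rule nn_integral_cmult) measurable
  also have "\<dots> = ennreal (1/c) * (\<integral>\<^sup>+a. \<integral>\<^sup>+y. G (a, (- s / c) * a + (1/c) * y) \<partial>lborel \<partial>lborel)"
    by (rule arg_cong[where f="(*) _"], rule lborel_pair.Fubini') measurable
  also have "\<dots> = (\<integral>\<^sup>+a. ennreal (1/c) * (\<integral>\<^sup>+y. G (a, (- s / c) * a + (1/c) * y) \<partial>lborel) \<partial>lborel)"
    by (rule nn_integral_cmult[symmetric]) measurable
  finally show ?thesis unfolding B .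
qed

text \<open>The joint density depends on x^2 + y^2 only, so it can be moved inside the rotated
  integrand.\<close>

lemma gauss_rotation:
  fixes c s :: real
  assumes [measurable]: "G \<in> borel_measurable (borel \<Otimes>\<^sub>M borel)" and c: "c > 0" and cs: "c\<^sup>2 + s\<^sup>2 = 1"
  shows "(\<integral>\<^sup>+x. \<integral>\<^sup>+y. G (c * x + s * y, - s * x + c * y) \<partial>gauss \<partial>gauss) = (\<integral>\<^sup>+x. \<integral>\<^sup>+y. G (x, y) \<partial>gauss \<partial>gauss)"
proof -
  define K where "K = (\<lambda>(x, y). ennreal (std_normal_density x) * (ennreal (std_normal_density y) * G (x, y)))"
  have [measurable]: "K \<in> borel_measurable (borel \<Otimes>\<^sub>M borel)" unfolding K_def by measurable
  have d: "ennreal (std_normal_density x) * ennreal (std_normal_density y)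
    = ennreal (std_normal_density (c * x + s * y)) * ennreal (std_normal_density (- s * x + c * y))" for x y
  proof -
    have "(c * x + s * y)\<^sup>2 + (- s * x + c * y)\<^sup>2 = (c\<^sup>2 + s\<^sup>2) * (x\<^sup>2 + y\<^sup>2)" by (simp add: power2_eq_square algebra_simps)
    then have "x\<^sup>2 + y\<^sup>2 = (c * x + s * y)\<^sup>2 + (- s * x + c * y)\<^sup>2" using cs by simp
    moreover have "std_normal_density a * std_normal_density b = (1 / sqrt (2 * pi))\<^sup>2 * exp (- (a\<^sup>2 + b\<^sup>2) / 2)" for a b
      by (simp add: std_normal_density_def power2_eq_square exp_add[symmetric] add_divide_distrib)
    ultimately show ?thesis by (simp add: ennreal_mult[symmetric])
  qed
  have e: "(\<integral>\<^sup>+x. \<integral>\<^sup>+y. f (x, y) \<partial>gauss \<partial>gauss)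
      = (\<integral>\<^sup>+x. \<integral>\<^sup>+y. (ennreal (std_normal_density x) * ennreal (std_normal_density y)) * f (x, y) \<partial>lborel \<partial>lborel)"
    if [measurable]: "f \<in> borel_measurable (borel \<Otimes>\<^sub>M borel)" for f
    by (simp add: nn_integral_density nn_integral_cmult[symmetric] mult.assoc)
  have "(\<integral>\<^sup>+x. \<integral>\<^sup>+y. G (c * x + s * y, - s * x + c * y) \<partial>gauss \<partial>gauss)
      = (\<integral>\<^sup>+x. \<integral>\<^sup>+y. (ennreal (std_normal_density x) * ennreal (std_normal_density y)) * G (c * x + s * y, - s * x + c * y) \<partial>lborel \<partial>lborel)"
    using e[of "\<lambda>(x, y). G (c * x + s * y, - s * x + c * y)"] by simp
  also have "\<dots> = (\<integral>\<^sup>+x. \<integral>\<^sup>+y. K (c * x + s * y, - s * x + c * y) \<partial>lborel \<partial>lborel)"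
    by (intro nn_integral_cong, subst d) (simp add: K_def mult.assoc)
  also have "\<dots> = (\<integral>\<^sup>+x. \<integral>\<^sup>+y. K (x, y) \<partial>lborel \<partial>lborel)" by (rule lborel_rotation) (use c cs in measurable)
  also have "\<dots> = (\<integral>\<^sup>+x. \<integral>\<^sup>+y. G (x, y) \<partial>gauss \<partial>gauss)"
    using e[of G] unfolding K_def by (simp add: mult.assoc)
  finally show ?thesis .
qed

abbreviation gaussn :: "'i set \<Rightarrow> ('i \<Rightarrow> real) measure" where
  "gaussn I \<equiv> PiM I (\<lambda>_. gauss)"

text \<open>Restricted to \<open>I\<close> because points of the product space are extensional
  functions.\<close>

definition lcomb :: "'i set \<Rightarrow> real \<Rightarrow> real \<Rightarrow> ('i \<Rightarrow> real) \<Rightarrow> ('i \<Rightarrow> real) \<Rightarrow> 'i \<Rightarrow> real" where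
  "lcomb I c s X Y = (\<lambda>i\<in>I. c * X i + s * Y i)"

lemma measurable_lcomb [measurable]:
  assumes [measurable]: "f \<in> measurable M (gaussn I)" "g \<in> measurable M (gaussn I)"
  shows "(\<lambda>z. lcomb I c s (f z) (g z)) \<in> measurable M (gaussn I)"
  unfolding lcomb_def
proof (rule measurable_restrict)
  fix i assume i: "i \<in> I"
  have [measurable]: "(\<lambda>z. f z i) \<in> borel_measurable M" "(\<lambda>z. g z i) \<in> borel_measurable M"
    using measurable_compose[OF assms(1) measurable_component_singleton[OF i]] measurable_compose[OF assms(2) measurable_component_singleton[OF i]]
    by simp_all
  show "(\<lambda>z. c * f z i + s * g z i) \<in> measurable M gauss" by simp
qed

interpretation gauss: prob_space gauss by (rule prob_space_gauss)

interpretation gaussn: product_sigma_finite "\<lambda>_. gauss" ..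

lemma prob_space_gaussn: "prob_space (gaussn I)" by (rule prob_space_PiM) (rule prob_space_gauss)

text \<open>Induction on the index set, rotating one coordinate plane at a time.\<close>

lemma gaussn_rotation:
  fixes c s :: real
  assumes fin: "finite I" and c: "c > 0" and cs: "c\<^sup>2 + s\<^sup>2 = 1"
  shows "\<And>\<phi>. \<phi> \<in> borel_measurable (gaussn I \<Otimes>\<^sub>M gaussn I) \<Longrightarrow>
    (\<integral>\<^sup>+X. \<integral>\<^sup>+Y. \<phi> (lcomb I c s X Y, lcomb I (- s) c X Y) \<partial>gaussn I \<partial>gaussn I) = (\<integral>\<^sup>+X. \<integral>\<^sup>+Y. \<phi> (X, Y) \<partial>gaussn I \<partial>gaussn I)"
  using fin
proof (induction I rule: finite_induct)
  case empty
  have "X = (\<lambda>_. undefined)" if "X \<in> space (gaussn {})" for X :: "'a \<Rightarrow> real"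
    using that by (simp add: space_PiM)
  moreover have "lcomb {} a b X Y = (\<lambda>_. undefined)" for a b and X Y :: "'a \<Rightarrow> real" by (auto simp: lcomb_def)
  ultimately have "\<phi> (lcomb {} c s X Y, lcomb {} (- s) c X Y) = \<phi> (X, Y)"
    if "X \<in> space (gaussn {})" "Y \<in> space (gaussn {})" for X Y
    using that by metis
  then show ?case by (intro nn_integral_cong) auto
next
  case (insert i I)
  note [measurable] = insert.prems
  let ?P = "gaussn I" and ?P' = "gaussn (insert i I)"
  interpret P: prob_space ?P by (rule prob_space_gaussn)
  interpret P': prob_space ?P' by (rule prob_space_gaussn)
  interpret PG: pair_sigma_finite gauss ?P ..
  have upd [measurable]: "(\<lambda>z. (f z)(i := g z)) \<in> measurable M ?P'"
    if "f \<in> measurable M ?P" "g \<in> borel_measurable M" for f g M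
    using that by (intro measurable_fun_upd[where J=I]) auto
  \<comment> \<open>Splits coordinate \<open>i\<close> off both copies and moves the two new
    one-dimensional integrals innermost, where the planar rotation applies.\<close>
  have two: "(\<integral>\<^sup>+X'. \<integral>\<^sup>+Y'. f (X', Y') \<partial>?P' \<partial>?P') = (\<integral>\<^sup>+X. \<integral>\<^sup>+Y. \<integral>\<^sup>+x. \<integral>\<^sup>+y. f (X(i := x), Y(i := y)) \<partial>gauss \<partial>gauss \<partial>?P \<partial>?P)"
    if [measurable]: "f \<in> borel_measurable (?P' \<Otimes>\<^sub>M ?P')" for f
  proof -
    have "(\<integral>\<^sup>+X'. \<integral>\<^sup>+Y'. f (X', Y') \<partial>?P' \<partial>?P') = (\<integral>\<^sup>+X. \<integral>\<^sup>+x. \<integral>\<^sup>+Y'. f (X(i := x), Y') \<partial>?P' \<partial>gauss \<partial>?P)"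
      by (rule gaussn.product_nn_integral_insert[OF insert.hyps(1,2)]) measurable
    also have "\<dots> = (\<integral>\<^sup>+X. \<integral>\<^sup>+x. \<integral>\<^sup>+Y. \<integral>\<^sup>+y. f (X(i := x), Y(i := y)) \<partial>gauss \<partial>?P \<partial>gauss \<partial>?P)"
    proof (intro nn_integral_cong)
      fix X x assume [measurable]: "X \<in> space ?P"
      have [measurable]: "X(i := x) \<in> space ?P'" using \<open>X \<in> space ?P\<close> insert.hyps
        by (auto simp: space_PiM PiE_def extensional_def)
      show "(\<integral>\<^sup>+Y'. f (X(i := x), Y') \<partial>?P') = (\<integral>\<^sup>+Y. \<integral>\<^sup>+y. f (X(i := x), Y(i := y)) \<partial>gauss \<partial>?P)"
        by (rule gaussn.product_nn_integral_insert[OF insert.hyps(1,2)]) measurable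
    qed
    also have "\<dots> = (\<integral>\<^sup>+X. \<integral>\<^sup>+Y. \<integral>\<^sup>+x. \<integral>\<^sup>+y. f (X(i := x), Y(i := y)) \<partial>gauss \<partial>gauss \<partial>?P \<partial>?P)"
    proof (intro nn_integral_cong)
      fix X assume [measurable]: "X \<in> space ?P"
      show "(\<integral>\<^sup>+x. \<integral>\<^sup>+Y. \<integral>\<^sup>+y. f (X(i := x), Y(i := y)) \<partial>gauss \<partial>?P \<partial>gauss) = (\<integral>\<^sup>+Y. \<integral>\<^sup>+x. \<integral>\<^sup>+y. f (X(i := x), Y(i := y)) \<partial>gauss \<partial>gauss \<partial>?P)"
        by (rule PG.Fubini'[symmetric]) measurable
    qed
    finally show ?thesis .
  qed
  define \<theta> where "\<theta> = (\<lambda>(X, Y). \<integral>\<^sup>+x. \<integral>\<^sup>+y. \<phi> (X(i := x), Y(i := y)) \<partial>gauss \<partial>gauss)"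
  have [measurable]: "\<theta> \<in> borel_measurable (?P \<Otimes>\<^sub>M ?P)" unfolding \<theta>_def by measurable
  have l: "lcomb (insert i I) a b (X(i := x)) (Y(i := y)) = (lcomb I a b X Y)(i := a * x + b * y)" for a b X Y x y
    using insert.hyps by (auto simp: lcomb_def)
  have "(\<integral>\<^sup>+X. \<integral>\<^sup>+Y. \<phi> (lcomb (insert i I) c s X Y, lcomb (insert i I) (- s) c X Y) \<partial>?P' \<partial>?P')
     = (\<integral>\<^sup>+X. \<integral>\<^sup>+Y. \<integral>\<^sup>+x. \<integral>\<^sup>+y. \<phi> ((lcomb I c s X Y)(i := c * x + s * y), (lcomb I (- s) c X Y)(i := - s * x + c * y)) \<partial>gauss \<partial>gauss \<partial>?P \<partial>?P)"
    using two[of "\<lambda>(X, Y). \<phi> (lcomb (insert i I) c s X Y, lcomb (insert i I) (- s) c X Y)"] unfolding split_beta fst_conv snd_conv l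
    by simp
  also have "\<dots> = (\<integral>\<^sup>+X. \<integral>\<^sup>+Y. \<theta> (lcomb I c s X Y, lcomb I (- s) c X Y) \<partial>?P \<partial>?P)"
  proof (intro nn_integral_cong)
    fix X Y assume "X \<in> space ?P" "Y \<in> space ?P"
    have sp [measurable]: "lcomb I a b X Y \<in> space ?P" for a b by (auto simp: lcomb_def space_PiM)
    show "(\<integral>\<^sup>+x. \<integral>\<^sup>+y. \<phi> ((lcomb I c s X Y)(i := c * x + s * y), (lcomb I (- s) c X Y)(i := - s * x + c * y)) \<partial>gauss \<partial>gauss)
        = \<theta> (lcomb I c s X Y, lcomb I (- s) c X Y)"
      using gauss_rotation[OF _ c cs, of "\<lambda>(x, y). \<phi> ((lcomb I c s X Y)(i := x), (lcomb I (- s) c X Y)(i := y))"]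
      unfolding \<theta>_def by simp
  qed
  also have "\<dots> = (\<integral>\<^sup>+X. \<integral>\<^sup>+Y. \<theta> (X, Y) \<partial>?P \<partial>?P)" by (rule insert.IH) measurable
  also have "\<dots> = (\<integral>\<^sup>+X'. \<integral>\<^sup>+Y'. \<phi> (X', Y') \<partial>?P' \<partial>?P')"
    using two[of \<phi>] unfolding \<theta>_def by simp
  finally show ?case .
qed

section \<open>Exponential moments and concentration\<close>

lemma gauss_mgf: "(\<integral>\<^sup>+z. ennreal (exp (t * z)) \<partial>gauss) = ennreal (exp (t\<^sup>2 / 2))"
proof -
  have e: "std_normal_density z * exp (t * z) = exp (t\<^sup>2 / 2) * normal_density t 1 z" for z
    by (simp add: normal_density_def exp_add[symmetric] power2_eq_square field_simps)
  interpret D: prob_space "density lborel (normal_density t 1)" by (rule prob_space_normal_density) simp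
  have one: "(\<integral>\<^sup>+z. ennreal (normal_density t 1 z) \<partial>lborel) = 1"
    using D.emeasure_space_1 by (simp add: emeasure_density)
  have "(\<integral>\<^sup>+z. ennreal (exp (t * z)) \<partial>gauss) = (\<integral>\<^sup>+z. ennreal (exp (t\<^sup>2 / 2)) * ennreal (normal_density t 1 z) \<partial>lborel)"
    by (simp add: nn_integral_density ennreal_mult[symmetric] e)
  then show ?thesis by (simp add: nn_integral_cmult one)
qed

lemma gaussn_mgf:
  assumes "finite I"
  shows "(\<integral>\<^sup>+X. ennreal (exp (\<Sum>i\<in>I. a i * X i)) \<partial>gaussn I) = ennreal (exp ((\<Sum>i\<in>I. (a i)\<^sup>2) / 2))"
proof -
  have "(\<integral>\<^sup>+X. ennreal (exp (\<Sum>i\<in>I. a i * X i)) \<partial>gaussn I) = (\<integral>\<^sup>+X. (\<Prod>i\<in>I. ennreal (exp (a i * X i))) \<partial>gaussn I)"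
    using assms by (intro nn_integral_cong) (simp add: exp_sum prod_ennreal)
  also have "\<dots> = (\<Prod>i\<in>I. ennreal (exp ((a i)\<^sup>2 / 2)))"
    using assms by (subst gaussn.product_nn_integral_prod) (auto simp: gauss_mgf)
  also have "\<dots> = ennreal (exp (\<Sum>i\<in>I. (a i)\<^sup>2 / 2))" using assms by (simp add: exp_sum prod_ennreal)
  finally show ?thesis by (simp add: sum_divide_distrib)
qed

text \<open>Convexity gives exp(b |z|) \<le> 1 + b exp |z| for b in [0,1]. What matters is that the
  bound tends to 1 as \<open>b\<close> tends to 0, so that the second-order cost of a small rotation
  disappears in the limit.\<close>

lemma gaussn_abs_mgf:
  assumes "finite I" "0 \<le> b" "b \<le> 1"
  shows "(\<integral>\<^sup>+X. ennreal (exp (b * (\<Sum>i\<in>I. \<bar>X i\<bar>))) \<partial>gaussn I) \<le> ennreal ((1 + b * (2 * exp (1/2))) ^ card I)"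
proof -
  have 1: "(\<integral>\<^sup>+z. ennreal (exp (b * \<bar>z\<bar>)) \<partial>gauss) \<le> ennreal (1 + b * (2 * exp (1/2)))"
  proof -
    have "exp (b * \<bar>z\<bar>) \<le> 1 + b * (exp (1 * z) + exp ((- 1) * z))" for z :: real
    proof -
      have "exp (b * \<bar>z\<bar>) = exp ((1 - b) *\<^sub>R 0 + b *\<^sub>R \<bar>z\<bar>)" by simp
      also have "\<dots> \<le> (1 - b) * exp 0 + b * exp \<bar>z\<bar>"
        using assms exp_convex by (intro convex_onD[of UNIV exp]) auto
      also have "\<dots> \<le> 1 + b * exp \<bar>z\<bar>" using assms by simp
      also have "exp \<bar>z\<bar> \<le> exp (1 * z) + exp ((- 1) * z)" by (simp add: abs_if)
      finally show ?thesis using assms by (simp add: mult_left_mono)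
    qed
    then have "(\<integral>\<^sup>+z. ennreal (exp (b * \<bar>z\<bar>)) \<partial>gauss) \<le> (\<integral>\<^sup>+z. ennreal 1 + ennreal b * (ennreal (exp (1 * z)) + ennreal (exp ((- 1) * z))) \<partial>gauss)"
      using assms by (intro nn_integral_mono) (simp add: ennreal_plus[symmetric] ennreal_mult[symmetric] del: ennreal_plus ennreal_1)
    also have "\<dots> = ennreal 1 + ennreal b * (ennreal (exp (1/2)) + ennreal (exp (1/2)))"
      using gauss_mgf[of 1] gauss_mgf[of "-1"] gauss.emeasure_space_1
      by (simp add: nn_integral_add nn_integral_cmult)
    also have "\<dots> = ennreal (1 + b * (2 * exp (1/2)))" using assms
      by (simp add: ennreal_plus[symmetric] ennreal_mult[symmetric] del: ennreal_plus ennreal_1)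
    finally show ?thesis .
  qed
  have le: "(\<Prod>i\<in>I. (\<integral>\<^sup>+z. ennreal (exp (b * \<bar>z\<bar>)) \<partial>gauss)) \<le> (\<Prod>i\<in>I. ennreal (1 + b * (2 * exp (1/2))))"
    using 1 by (intro prod_mono_ennreal)
  have "(\<integral>\<^sup>+X. ennreal (exp (b * (\<Sum>i\<in>I. \<bar>X i\<bar>))) \<partial>gaussn I) = (\<integral>\<^sup>+X. (\<Prod>i\<in>I. ennreal (exp (b * \<bar>X i\<bar>))) \<partial>gaussn I)"
    using assms by (intro nn_integral_cong) (simp add: exp_sum prod_ennreal sum_distrib_left)
  also have "\<dots> = (\<Prod>i\<in>I. (\<integral>\<^sup>+z. ennreal (exp (b * \<bar>z\<bar>)) \<partial>gauss))"
    using assms by (subst gaussn.product_nn_integral_prod) auto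
  also have "\<dots> \<le> (\<Prod>i\<in>I. ennreal (1 + b * (2 * exp (1/2))))" by (rule le)
  also have "\<dots> = ennreal ((1 + b * (2 * exp (1/2))) ^ card I)" using assms by (subst ennreal_power[symmetric]) auto
  finally show ?thesis .
qed


text \<open>The Maurey--Pisier argument: turn \<open>X\<close> into \<open>Y\<close> by \<open>n\<close> rotations of angle \<open>\<pi>/(2n)\<close>.  Convexity of
  \<open>exp\<close> reduces to a single small rotation, and there the increment of \<open>F\<close> is bounded by its
  subgradient at the rotated point \<open>Z\<close>, paired with a direction that is nearly independent of \<open>Z\<close>.\<close>

lemma gaussn_mgf_diff:
  fixes F :: "('i \<Rightarrow> real) \<Rightarrow> real" and a :: "'i \<Rightarrow> ('i \<Rightarrow> real) \<Rightarrow> real"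
  assumes fin: "finite I"
    and F [measurable]: "F \<in> borel_measurable (gaussn I)"
    and a [measurable]: "\<And>i. i \<in> I \<Longrightarrow> a i \<in> borel_measurable (gaussn I)"
    and sub: "\<And>X Z. F X \<ge> F Z + (\<Sum>i\<in>I. a i Z * (X i - Z i))"
    and L: "\<And>Z. (\<Sum>i\<in>I. (a i Z)\<^sup>2) \<le> L\<^sup>2" "L \<ge> 0" and l: "l \<ge> 0"
  shows "(\<integral>\<^sup>+X. \<integral>\<^sup>+Y. ennreal (exp (l * (F Y - F X))) \<partial>gaussn I \<partial>gaussn I) \<le> ennreal (exp (l\<^sup>2 * L\<^sup>2 * pi\<^sup>2 / 8))"
proof -
  let ?P = "gaussn I"
  interpret P: prob_space ?P by (rule prob_space_gaussn)
  \<comment> \<open>The bound obtained with \<open>n\<close> rotations; its first factor tends to 1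
    as \<open>n\<close> grows, its second is the final bound.\<close>
  define B where "B n = (1 + l * L * pi\<^sup>2 / (8 * real n) * (2 * exp (1/2))) ^ card I * exp (l\<^sup>2 * L\<^sup>2 * pi\<^sup>2 / 8)" for n
  have small: "(\<integral>\<^sup>+X. \<integral>\<^sup>+Y. ennreal (exp (real n * l * (F (lcomb I (cos h) (sin h) X Y) - F X))) \<partial>?P \<partial>?P) \<le> ennreal (B n)"
    if n: "n \<ge> 2" "l * L * pi\<^sup>2 / (8 * real n) \<le> 1" and h: "h = pi / (2 * real n)" for n h
  proof -
    \<comment> \<open>The integrand in terms of the rotated point Z and its orthogonal companion Z',
      which are again independent Gaussian vectors; the original point is Z rotated back.\<close>
    define \<phi> where "\<phi> = (\<lambda>(Z, Z'). ennreal (exp (real n * l * (F Z - F (lcomb I (cos h) (- sin h) Z Z')))))"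
    have [measurable]: "\<phi> \<in> borel_measurable (?P \<Otimes>\<^sub>M ?P)" unfolding \<phi>_def by measurable
    have hp: "0 < h" "h < pi / 2" "h \<le> pi / 4" using n unfolding h by (auto simp: field_simps)
    have c0: "cos h > 0" using hp by (intro cos_gt_zero_pi) auto
    have s0: "sin h \<ge> 0" "sin h \<le> h" using hp sin_x_le_x by (auto intro!: sin_ge_zero)
    have c1: "1 - cos h \<le> h\<^sup>2 / 2" "1 - cos h \<ge> 0"
    proof -
      have "1 - cos h = 2 * (sin (h/2))\<^sup>2" using cos_double_sin[of "h/2"] by simp
      moreover have "sin (h/2) \<ge> 0" "sin (h/2) \<le> h/2" using hp sin_x_le_x[of "h/2"] by (auto intro!: sin_ge_zero)
      then have "(sin (h/2))\<^sup>2 \<le> (h/2)\<^sup>2" by (intro power_mono) auto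
      ultimately show "1 - cos h \<le> h\<^sup>2 / 2" "1 - cos h \<ge> 0" by (auto simp: power2_eq_square)
    qed
    \<comment> \<open>Rotating back shortens Z by the factor cos h. The loss 1 - cos h is of order
      h^2, so even multiplied by \<open>n\<close> it is of order 1/n.\<close>
    define b where "b = real n * l * ((1 - cos h) * L)"
    have b: "0 \<le> b" "b \<le> l * L * pi\<^sup>2 / (8 * real n)"
    proof -
      show "0 \<le> b" unfolding b_def using l L c1 by simp
      have "b \<le> real n * l * ((h\<^sup>2 / 2) * L)" unfolding b_def using l L c1 by (intro mult_left_mono mult_right_mono) auto
      also have "\<dots> = l * L * pi\<^sup>2 / (8 * real n)" using n unfolding h by (simp add: field_simps power2_eq_square)
      finally show "b \<le> l * L * pi\<^sup>2 / (8 * real n)" .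
    qed
    have bck: "lcomb I (cos h) (- sin h) (lcomb I (cos h) (sin h) X Y) (lcomb I (- sin h) (cos h) X Y) = X" if "X \<in> space ?P" for X Y
    proof
      fix i show "lcomb I (cos h) (- sin h) (lcomb I (cos h) (sin h) X Y) (lcomb I (- sin h) (cos h) X Y) i = X i"
      proof (cases "i \<in> I")
        case True
        have "cos h * (cos h * X i) + sin h * (sin h * X i) = ((cos h)\<^sup>2 + (sin h)\<^sup>2) * X i"
          by (simp only: power2_eq_square distrib_right mult.assoc)
        also have "\<dots> = X i" by simp
        finally show ?thesis using True by (simp add: lcomb_def algebra_simps)
      next
        case False then show ?thesis using that by (auto simp: lcomb_def space_PiM PiE_def extensional_def)
      qed
    qed
    have "(\<integral>\<^sup>+X. \<integral>\<^sup>+Y. ennreal (exp (real n * l * (F (lcomb I (cos h) (sin h) X Y) - F X))) \<partial>?P \<partial>?P)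
        = (\<integral>\<^sup>+X. \<integral>\<^sup>+Y. \<phi> (lcomb I (cos h) (sin h) X Y, lcomb I (- sin h) (cos h) X Y) \<partial>?P \<partial>?P)"
      by (intro nn_integral_cong) (simp add: \<phi>_def bck)
    also have "\<dots> = (\<integral>\<^sup>+X. \<integral>\<^sup>+Y. \<phi> (X, Y) \<partial>?P \<partial>?P)"
      by (rule gaussn_rotation[OF fin c0]) (simp_all)
    also have "\<dots> \<le> (\<integral>\<^sup>+Z. ennreal (exp (b * (\<Sum>i\<in>I. \<bar>Z i\<bar>))) * ennreal (exp (l\<^sup>2 * L\<^sup>2 * pi\<^sup>2 / 8)) \<partial>?P)"
    proof (rule nn_integral_mono)
      fix Z assume Z: "Z \<in> space ?P"
      have aL: "\<bar>a i Z\<bar> \<le> L" if "i \<in> I" for i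
      proof -
        have "(a i Z)\<^sup>2 \<le> (\<Sum>i\<in>I. (a i Z)\<^sup>2)" using that fin by (intro member_le_sum) auto
        also have "\<dots> \<le> L\<^sup>2" by (rule L)
        finally show ?thesis using L(2) by (simp add: abs_le_square_iff[symmetric])
      qed
      have "(\<integral>\<^sup>+Y. \<phi> (Z, Y) \<partial>?P) \<le> (\<integral>\<^sup>+Y. ennreal (exp (b * (\<Sum>i\<in>I. \<bar>Z i\<bar>))) * ennreal (exp (\<Sum>i\<in>I. (real n * l * sin h * a i Z) * Y i)) \<partial>?P)"
      proof (rule nn_integral_mono)
        fix Y
        have "F Z - F (lcomb I (cos h) (- sin h) Z Y) \<le> - (\<Sum>i\<in>I. a i Z * (lcomb I (cos h) (- sin h) Z Y i - Z i))"
          using sub[of Z "lcomb I (cos h) (- sin h) Z Y"] by linarith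
        also have "\<dots> = (\<Sum>i\<in>I. (1 - cos h) * (a i Z * Z i) + sin h * (a i Z * Y i))"
          unfolding sum_negf[symmetric] by (intro sum.cong) (auto simp: lcomb_def algebra_simps)
        also have "\<dots> \<le> (\<Sum>i\<in>I. (1 - cos h) * (L * \<bar>Z i\<bar>) + sin h * (a i Z * Y i))"
        proof (rule sum_mono)
          fix i assume "i \<in> I"
          have "a i Z * Z i \<le> \<bar>a i Z\<bar> * \<bar>Z i\<bar>" by (simp add: abs_mult[symmetric])
          also have "\<dots> \<le> L * \<bar>Z i\<bar>" using aL[OF \<open>i \<in> I\<close>] by (intro mult_right_mono) auto
          finally show "(1 - cos h) * (a i Z * Z i) + sin h * (a i Z * Y i) \<le> (1 - cos h) * (L * \<bar>Z i\<bar>) + sin h * (a i Z * Y i)"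
            using c1(2) by (intro add_right_mono mult_left_mono)
        qed
        finally have "real n * l * (F Z - F (lcomb I (cos h) (- sin h) Z Y)) \<le> real n * l * (\<Sum>i\<in>I. (1 - cos h) * (L * \<bar>Z i\<bar>) + sin h * (a i Z * Y i))"
          using l by (intro mult_left_mono) auto
        also have "\<dots> = b * (\<Sum>i\<in>I. \<bar>Z i\<bar>) + (\<Sum>i\<in>I. (real n * l * sin h * a i Z) * Y i)"
        proof -
          have "real n * l * (\<Sum>i\<in>I. d * (L * \<bar>Z i\<bar>) + e * (a i Z * Y i)) = real n * l * (d * L) * (\<Sum>i\<in>I. \<bar>Z i\<bar>) + (\<Sum>i\<in>I. (real n * l * e * a i Z) * Y i)" for d e
            by (simp add: sum.distrib sum_distrib_left algebra_simps)
          then show ?thesis unfolding b_def .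
        qed
        finally show "\<phi> (Z, Y) \<le> ennreal (exp (b * (\<Sum>i\<in>I. \<bar>Z i\<bar>))) * ennreal (exp (\<Sum>i\<in>I. (real n * l * sin h * a i Z) * Y i))"
          unfolding \<phi>_def by (simp add: ennreal_mult[symmetric] exp_add[symmetric])
      qed
      also have "\<dots> = ennreal (exp (b * (\<Sum>i\<in>I. \<bar>Z i\<bar>))) * ennreal (exp ((\<Sum>i\<in>I. (real n * l * sin h * a i Z)\<^sup>2) / 2))"
        by (subst nn_integral_cmult) (auto simp: gaussn_mgf[OF fin])
      also have "\<dots> \<le> ennreal (exp (b * (\<Sum>i\<in>I. \<bar>Z i\<bar>))) * ennreal (exp (l\<^sup>2 * L\<^sup>2 * pi\<^sup>2 / 8))"
      proof -
        have "(\<Sum>i\<in>I. (real n * l * sin h * a i Z)\<^sup>2) = (real n * sin h)\<^sup>2 * (l\<^sup>2 * (\<Sum>i\<in>I. (a i Z)\<^sup>2))"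
          by (simp add: power_mult_distrib sum_distrib_left mult_ac)
        also have "\<dots> \<le> (real n * h)\<^sup>2 * (l\<^sup>2 * L\<^sup>2)"
          using s0 L by (intro mult_mono power_mono mult_left_mono) (auto intro!: mult_nonneg_nonneg sum_nonneg)
        \<comment> \<open>A quarter turn in total; with the 1/2 from the Gaussian exponential moment
          this produces pi^2/8.\<close>
        also have "real n * h = pi / 2" using n unfolding h by simp
        finally have "(\<Sum>i\<in>I. (real n * l * sin h * a i Z)\<^sup>2) / 2 \<le> l\<^sup>2 * L\<^sup>2 * pi\<^sup>2 / 8"
          by (simp add: power2_eq_square algebra_simps)
        then show ?thesis by (intro mult_left_mono ennreal_leI) auto
      qed
      finally show "(\<integral>\<^sup>+Y. \<phi> (Z, Y) \<partial>?P) \<le> ennreal (exp (b * (\<Sum>i\<in>I. \<bar>Z i\<bar>))) * ennreal (exp (l\<^sup>2 * L\<^sup>2 * pi\<^sup>2 / 8))" .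
    qed
    also have "\<dots> = (\<integral>\<^sup>+Z. ennreal (exp (b * (\<Sum>i\<in>I. \<bar>Z i\<bar>))) \<partial>?P) * ennreal (exp (l\<^sup>2 * L\<^sup>2 * pi\<^sup>2 / 8))"
      by (rule nn_integral_multc) measurable
    also have "\<dots> \<le> ennreal ((1 + b * (2 * exp (1/2))) ^ card I) * ennreal (exp (l\<^sup>2 * L\<^sup>2 * pi\<^sup>2 / 8))"
      using b order_trans[OF b(2) n(2)] by (intro mult_right_mono gaussn_abs_mgf fin) auto
    also have "\<dots> \<le> ennreal (B n)"
    proof -
      have "(1 + b * (2 * exp (1/2))) ^ card I \<le> (1 + l * L * pi\<^sup>2 / (8 * real n) * (2 * exp (1/2))) ^ card I"
        using b by (intro power_mono add_mono mult_right_mono) auto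
      then show ?thesis unfolding B_def using b by (simp add: ennreal_mult[symmetric] ennreal_leI)
    qed
    finally show ?thesis .
  qed
  have main: "(\<integral>\<^sup>+X. \<integral>\<^sup>+Y. ennreal (exp (l * (F Y - F X))) \<partial>?P \<partial>?P) \<le> ennreal (B n)"
    if n: "n \<ge> 2" "l * L * pi\<^sup>2 / (8 * real n) \<le> 1" for n
  proof -
    define h where "h = pi / (2 * real n)"
    define R where "R k X Y = lcomb I (cos (real k * h)) (sin (real k * h)) X Y" for k X Y
    have [measurable]: "(\<lambda>z. R k (f z) (g z)) \<in> measurable M ?P" if "f \<in> measurable M ?P" "g \<in> measurable M ?P" for k f g M
      unfolding R_def using that by measurable
    have nh: "real n * h = pi / 2" using n unfolding h_def by simp
    have sp: "X i = undefined" if "X \<in> space ?P" "i \<notin> I" for X i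
      using that by (auto simp: space_PiM PiE_def extensional_def)
    have R0: "R 0 X Y = X" "R n X Y = Y" if "X \<in> space ?P" "Y \<in> space ?P" for X Y
      using that unfolding R_def nh by (auto simp: lcomb_def fun_eq_iff sp)
    have step: "lcomb I (cos h) (sin h) (R k X Y) (lcomb I (- sin (real k * h)) (cos (real k * h)) X Y) = R (Suc k) X Y" for k X Y
    proof -
      have "real (Suc k) * h = h + real k * h" by (simp add: algebra_simps)
      then show ?thesis unfolding R_def
        by (auto simp: lcomb_def fun_eq_iff cos_add sin_add algebra_simps)
    qed
    have one: "(\<integral>\<^sup>+X. \<integral>\<^sup>+Y. ennreal (exp (real n * l * (F (R (Suc k) X Y) - F (R k X Y)))) \<partial>?P \<partial>?P) \<le> ennreal (B n)" if k: "k < n" for k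
    proof -
      define \<phi> where "\<phi> = (\<lambda>(X, Y). ennreal (exp (real n * l * (F (lcomb I (cos h) (sin h) X Y) - F X))))"
      have [measurable]: "\<phi> \<in> borel_measurable (?P \<Otimes>\<^sub>M ?P)" unfolding \<phi>_def by measurable
      have h0: "h > 0" using n unfolding h_def by simp
      have "real k * h < real n * h" using k h0 by simp
      then have "real k * h < pi / 2" unfolding nh .
      moreover have "0 \<le> real k * h" using h0 by simp
      then have "- (pi / 2) < real k * h" using pi_half_gt_zero by linarith
      ultimately have c0: "cos (real k * h) > 0" by (intro cos_gt_zero_pi)
      have "(\<integral>\<^sup>+X. \<integral>\<^sup>+Y. ennreal (exp (real n * l * (F (R (Suc k) X Y) - F (R k X Y)))) \<partial>?P \<partial>?P)
          = (\<integral>\<^sup>+X. \<integral>\<^sup>+Y. \<phi> (R k X Y, lcomb I (- sin (real k * h)) (cos (real k * h)) X Y) \<partial>?P \<partial>?P)"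
        unfolding \<phi>_def by (simp add: step)
      also have "\<dots> = (\<integral>\<^sup>+X. \<integral>\<^sup>+Y. \<phi> (X, Y) \<partial>?P \<partial>?P)"
        unfolding R_def by (rule gaussn_rotation[OF fin c0]) (simp_all)
      also have "\<dots> \<le> ennreal (B n)" unfolding \<phi>_def using small[OF n h_def] by simp
      finally show ?thesis .
    qed
    have "(\<integral>\<^sup>+X. \<integral>\<^sup>+Y. ennreal (exp (l * (F Y - F X))) \<partial>?P \<partial>?P)
      \<le> (\<integral>\<^sup>+X. \<integral>\<^sup>+Y. (\<Sum>k<n. ennreal (1 / real n) * ennreal (exp (real n * l * (F (R (Suc k) X Y) - F (R k X Y))))) \<partial>?P \<partial>?P)"
    proof (intro nn_integral_mono)
      fix X Y assume XY: "X \<in> space ?P" "Y \<in> space ?P"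
      have "F Y - F X = (\<Sum>k<n. F (R (Suc k) X Y) - F (R k X Y))"
        using R0[OF XY] by (subst sum_lessThan_telescope) simp
      then have eq: "l * (F Y - F X) = (\<Sum>k<n. (1 / real n) *\<^sub>R (real n * l * (F (R (Suc k) X Y) - F (R k X Y))))"
        using n by (simp add: sum_distrib_left)
      have "exp (\<Sum>k<n. (1 / real n) *\<^sub>R (real n * l * (F (R (Suc k) X Y) - F (R k X Y)))) \<le> (\<Sum>k<n. (1 / real n) * exp (real n * l * (F (R (Suc k) X Y) - F (R k X Y))))"
        using n exp_convex by (intro convex_on_sum[where C=UNIV and f=exp]) (auto simp: lessThan_empty_iff)
      then have "exp (l * (F Y - F X)) \<le> (\<Sum>k<n. (1 / real n) * exp (real n * l * (F (R (Suc k) X Y) - F (R k X Y))))"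
        unfolding eq .
      then show "ennreal (exp (l * (F Y - F X))) \<le> (\<Sum>k<n. ennreal (1 / real n) * ennreal (exp (real n * l * (F (R (Suc k) X Y) - F (R k X Y)))))"
        by (simp add: ennreal_mult[symmetric] ennreal_leI sum_ennreal)
    qed
    also have "\<dots> = (\<Sum>k<n. ennreal (1 / real n) * (\<integral>\<^sup>+X. \<integral>\<^sup>+Y. ennreal (exp (real n * l * (F (R (Suc k) X Y) - F (R k X Y)))) \<partial>?P \<partial>?P))"
    proof -
      let ?G = "\<lambda>k X Y. ennreal (exp (real n * l * (F (R (Suc k) X Y) - F (R k X Y))))"
      have i: "(\<integral>\<^sup>+Y. (\<Sum>k<n. ennreal (1 / real n) * ?G k X Y) \<partial>?P) = (\<Sum>k<n. ennreal (1 / real n) * (\<integral>\<^sup>+Y. ?G k X Y \<partial>?P))"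
        if [measurable]: "X \<in> space ?P" for X
      proof -
        have [measurable]: "?G k X \<in> borel_measurable ?P" for k by measurable
        show ?thesis by (subst nn_integral_sum, measurable, subst nn_integral_cmult, measurable)
      qed
      have [measurable]: "(\<lambda>X. \<integral>\<^sup>+Y. ?G k X Y \<partial>?P) \<in> borel_measurable ?P" for k by measurable
      have "(\<integral>\<^sup>+X. \<integral>\<^sup>+Y. (\<Sum>k<n. ennreal (1 / real n) * ?G k X Y) \<partial>?P \<partial>?P) = (\<integral>\<^sup>+X. (\<Sum>k<n. ennreal (1 / real n) * (\<integral>\<^sup>+Y. ?G k X Y \<partial>?P)) \<partial>?P)"
        by (intro nn_integral_cong i)
      also have "\<dots> = (\<Sum>k<n. ennreal (1 / real n) * (\<integral>\<^sup>+X. \<integral>\<^sup>+Y. ?G k X Y \<partial>?P \<partial>?P))"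
        by (subst nn_integral_sum, measurable, subst nn_integral_cmult, measurable)
      finally show ?thesis .
    qed
    also have "\<dots> \<le> (\<Sum>k<n. ennreal (1 / real n) * ennreal (B n))"
      by (intro sum_mono mult_left_mono one) auto
    also have "\<dots> = ennreal (B n)"
    proof -
      have "B n \<ge> 0" unfolding B_def using l L(2) by (intro mult_nonneg_nonneg zero_le_power add_nonneg_nonneg divide_nonneg_nonneg) auto
      then show ?thesis using n by (simp add: ennreal_of_nat_eq_real_of_nat ennreal_mult[symmetric])
    qed
    finally show ?thesis .
  qed
  have lim0: "(\<lambda>n. l * L * pi\<^sup>2 / (8 * real n)) \<longlonglongrightarrow> 0"
    by (intro real_tendsto_divide_at_top[OF tendsto_const] filterlim_tendsto_pos_mult_at_top[OF tendsto_const _ filterlim_real_sequentially]) auto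
  then have "B \<longlonglongrightarrow> (1 + 0 * (2 * exp (1/2))) ^ card I * exp (l\<^sup>2 * L\<^sup>2 * pi\<^sup>2 / 8)"
    unfolding B_def by (intro tendsto_intros)
  then have lim: "(\<lambda>n. ennreal (B n)) \<longlonglongrightarrow> ennreal (exp (l\<^sup>2 * L\<^sup>2 * pi\<^sup>2 / 8))"
    by (intro tendsto_ennrealI) simp
  have "\<forall>\<^sub>F n in sequentially. l * L * pi\<^sup>2 / (8 * real n) < 1" using order_tendstoD(2)[OF lim0, of 1] by simp
  then have "\<forall>\<^sub>F n in sequentially. (\<integral>\<^sup>+X. \<integral>\<^sup>+Y. ennreal (exp (l * (F Y - F X))) \<partial>?P \<partial>?P) \<le> ennreal (B n)"
    using eventually_ge_at_top[of 2] by eventually_elim (rule main, auto)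
  then show ?thesis by (rule tendsto_lowerbound[OF lim]) simp
qed


text \<open>Hypothesis \<open>sub\<close> says that F is convex with subgradient \<open>a\<close>, a
  form that covers norms and maxima of linear forms. Jensen's inequality in the independent copy
  replaces F X by its mean, negative \<open>l\<close> is treated by exchanging the copies, and pi <
  4 turns pi^2/8 into the constant 2. Integrability holds because the subgradient inequality limits
  the growth of F to linear.\<close>

lemma gaussn_concentration:
  fixes F :: "('i \<Rightarrow> real) \<Rightarrow> real" and a :: "'i \<Rightarrow> ('i \<Rightarrow> real) \<Rightarrow> real"
  assumes fin: "finite I"
    and F [measurable]: "F \<in> borel_measurable (gaussn I)"
    and a [measurable]: "\<And>i. i \<in> I \<Longrightarrow> a i \<in> borel_measurable (gaussn I)"
    and sub: "\<And>X Z. F X \<ge> F Z + (\<Sum>i\<in>I. a i Z * (X i - Z i))"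
    and L: "\<And>Z. (\<Sum>i\<in>I. (a i Z)\<^sup>2) \<le> L\<^sup>2" "L \<ge> 0"
  shows "integrable (gaussn I) F"
    and "(\<integral>\<^sup>+Y. ennreal (exp (l * (F Y - integral\<^sup>L (gaussn I) F))) \<partial>gaussn I) \<le> ennreal (exp (2 * l\<^sup>2 * L\<^sup>2))"
proof -
  let ?P = "gaussn I"
  interpret P: prob_space ?P by (rule prob_space_gaussn)
  interpret PP: pair_sigma_finite ?P ?P ..
  have aL: "\<bar>a i Z\<bar> \<le> L" if "i \<in> I" for i Z
  proof -
    have "(a i Z)\<^sup>2 \<le> (\<Sum>i\<in>I. (a i Z)\<^sup>2)" using that fin by (intro member_le_sum) auto
    also have "\<dots> \<le> L\<^sup>2" by (rule L)
    finally show ?thesis using L(2) by (simp add: abs_le_square_iff[symmetric])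
  qed
  have bd: "\<bar>\<Sum>i\<in>I. a i Z * X i\<bar> \<le> L * exp (1 * (\<Sum>i\<in>I. \<bar>X i\<bar>))" for X Z
  proof -
    have "\<bar>\<Sum>i\<in>I. a i Z * X i\<bar> \<le> (\<Sum>i\<in>I. L * \<bar>X i\<bar>)"
      using aL by (intro order_trans[OF sum_abs] sum_mono) (auto simp: abs_mult mult_right_mono)
    also have "\<dots> = L * (\<Sum>i\<in>I. \<bar>X i\<bar>)" by (simp add: sum_distrib_left)
    also have "\<dots> \<le> L * exp (1 * (\<Sum>i\<in>I. \<bar>X i\<bar>))"
    proof (rule mult_left_mono[OF _ L(2)])
      show "(\<Sum>i\<in>I. \<bar>X i\<bar>) \<le> exp (1 * (\<Sum>i\<in>I. \<bar>X i\<bar>))"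
        using exp_ge_add_one_self[of "1 * (\<Sum>i\<in>I. \<bar>X i\<bar>)"] by linarith
    qed
    finally show ?thesis .
  qed
  have Fb: "\<bar>F X\<bar> \<le> \<bar>F (\<lambda>_. 0)\<bar> + L * exp (1 * (\<Sum>i\<in>I. \<bar>X i\<bar>))" for X
    using sub[of "\<lambda>_. 0" X] sub[of X "\<lambda>_. 0"] bd[of "\<lambda>_. 0" X] bd[of X X]
    by (simp add: sum_negf)
  show int: "integrable ?P F"
  proof (rule integrableI_bounded)
    have "(\<integral>\<^sup>+X. ennreal (norm (F X)) \<partial>?P) \<le> (\<integral>\<^sup>+X. ennreal \<bar>F (\<lambda>_. 0)\<bar> + ennreal L * ennreal (exp (1 * (\<Sum>i\<in>I. \<bar>X i\<bar>))) \<partial>?P)"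
      using Fb L(2) by (intro nn_integral_mono) (simp add: ennreal_mult[symmetric] ennreal_plus[symmetric] ennreal_leI del: ennreal_plus)
    also have "\<dots> = ennreal \<bar>F (\<lambda>_. 0)\<bar> + ennreal L * (\<integral>\<^sup>+X. ennreal (exp (1 * (\<Sum>i\<in>I. \<bar>X i\<bar>))) \<partial>?P)"
      using P.emeasure_space_1 by (simp add: nn_integral_add nn_integral_cmult)
    also have "\<dots> \<le> ennreal \<bar>F (\<lambda>_. 0)\<bar> + ennreal L * ennreal ((1 + 1 * (2 * exp (1/2))) ^ card I)"
      by (intro add_left_mono mult_left_mono gaussn_abs_mgf fin) auto
    also have "\<dots> < \<infinity>" by (simp add: ennreal_mult_less_top)
    finally show "(\<integral>\<^sup>+X. ennreal (norm (F X)) \<partial>?P) < \<infinity>" .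
  qed simp
  define E where "E = integral\<^sup>L ?P F"
  have bound: "(\<integral>\<^sup>+Y. \<integral>\<^sup>+X. ennreal (exp (l * (F Y - F X))) \<partial>?P \<partial>?P) \<le> ennreal (exp (l\<^sup>2 * L\<^sup>2 * pi\<^sup>2 / 8))"
  proof (cases "l \<ge> 0")
    case True
    have "(\<integral>\<^sup>+Y. \<integral>\<^sup>+X. ennreal (exp (l * (F Y - F X))) \<partial>?P \<partial>?P) = (\<integral>\<^sup>+X. \<integral>\<^sup>+Y. ennreal (exp (l * (F Y - F X))) \<partial>?P \<partial>?P)"
      by (rule PP.Fubini') measurable
    then show ?thesis using gaussn_mgf_diff[OF fin F a sub L True] by simp
  next
    case False
    then have "- l \<ge> 0" by simp
    have e: "l * (F Y - F X) = - l * (F X - F Y)" for X Y by (simp add: algebra_simps)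
    show ?thesis unfolding e using gaussn_mgf_diff[OF fin F a sub L \<open>- l \<ge> 0\<close>] by (simp only: power2_minus)
  qed
  have "(\<integral>\<^sup>+Y. ennreal (exp (l * (F Y - E))) \<partial>?P) \<le> (\<integral>\<^sup>+Y. \<integral>\<^sup>+X. ennreal (exp (l * (F Y - F X))) \<partial>?P \<partial>?P)"
  proof (rule nn_integral_mono)
    fix Y
    let ?f = "\<lambda>X. exp (l * (F Y - F X))"
    show "ennreal (exp (l * (F Y - E))) \<le> (\<integral>\<^sup>+X. ennreal (?f X) \<partial>?P)"
    proof (cases "(\<integral>\<^sup>+X. ennreal (?f X) \<partial>?P) = \<infinity>")
      case False
      then have fi: "integrable ?P ?f" by (intro integrableI_nonneg) (auto simp: top.not_eq_extremum)
      \<comment> \<open>Jensen's inequality by the tangent to exp: the integrand dominates exp(l (F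
        Y - E)) times an affine function of F X with mean 1.\<close>
      have gi: "integrable ?P (\<lambda>X. exp (l * (F Y - E)) * (1 + l * (E - F X)))" using int by simp
      have "exp (l * (F Y - E)) = integral\<^sup>L ?P (\<lambda>X. exp (l * (F Y - E)) * (1 + l * (E - F X)))"
        using int by (simp add: P.prob_space E_def)
      also have "\<dots> \<le> integral\<^sup>L ?P ?f"
      proof (rule integral_mono[OF gi fi])
        fix X
        have "exp (l * (F Y - E)) * (1 + l * (E - F X)) \<le> exp (l * (F Y - E)) * exp (l * (E - F X))"
          by (intro mult_left_mono exp_ge_add_one_self) auto
        then show "exp (l * (F Y - E)) * (1 + l * (E - F X)) \<le> ?f X" by (simp add: exp_add[symmetric] algebra_simps)
      qed
      finally show ?thesis using nn_integral_eq_integral[OF fi] by (simp add: ennreal_leI)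
    qed simp
  qed
  also note bound
  also have "ennreal (exp (l\<^sup>2 * L\<^sup>2 * pi\<^sup>2 / 8)) \<le> ennreal (exp (2 * l\<^sup>2 * L\<^sup>2))"
  proof -
    have "pi\<^sup>2 \<le> 4\<^sup>2" using pi_less_4 pi_gt_zero by (intro power_mono) auto
    then have "l\<^sup>2 * L\<^sup>2 * pi\<^sup>2 \<le> l\<^sup>2 * L\<^sup>2 * 4\<^sup>2" by (intro mult_left_mono) auto
    then show ?thesis by (intro ennreal_leI) simp
  qed
  finally show "(\<integral>\<^sup>+Y. ennreal (exp (l * (F Y - integral\<^sup>L ?P F))) \<partial>?P) \<le> ennreal (exp (2 * l\<^sup>2 * L\<^sup>2))"
    unfolding E_def .
qed

text \<open>Chernoff's bound; \<open>l = e / (4 L^2)\<close> minimizes 2 l^2 L^2 - l e.\<close>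

lemma (in prob_space) subgaussian_tail:
  assumes [measurable]: "Y \<in> borel_measurable M"
    and mgf: "\<And>l. (\<integral>\<^sup>+d. ennreal (exp (l * Y d)) \<partial>M) \<le> ennreal (exp (2 * l\<^sup>2 * L\<^sup>2))" and L: "L > 0" and e: "e \<ge> 0"
  shows "prob {d\<in>space M. Y d \<ge> e} \<le> exp (- (e\<^sup>2 / (8 * L\<^sup>2)))"
proof -
  define l where "l = e / (4 * L\<^sup>2)"
  have l0: "l \<ge> 0" unfolding l_def using e by simp
  have "emeasure M {d\<in>space M. Y d \<ge> e} = (\<integral>\<^sup>+d. indicator {d\<in>space M. Y d \<ge> e} d \<partial>M)"
    by simp
  also have "\<dots> \<le> (\<integral>\<^sup>+d. ennreal (exp (- l * e)) * ennreal (exp (l * Y d)) \<partial>M)"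
  proof (rule nn_integral_mono)
    fix d show "indicator {d\<in>space M. Y d \<ge> e} d \<le> ennreal (exp (- l * e)) * ennreal (exp (l * Y d))"
    proof (cases "Y d \<ge> e")
      case True
      then have "0 \<le> l * (Y d - e)" using l0 by simp
      then have "1 \<le> exp (- l * e + l * Y d)" by (simp add: algebra_simps)
      then show ?thesis by (simp add: ennreal_mult[symmetric] exp_add[symmetric] indicator_def)
    qed (simp add: indicator_def)
  qed
  also have "\<dots> = ennreal (exp (- l * e)) * (\<integral>\<^sup>+d. ennreal (exp (l * Y d)) \<partial>M)" by (rule nn_integral_cmult) simp
  also have "\<dots> \<le> ennreal (exp (- l * e)) * ennreal (exp (2 * l\<^sup>2 * L\<^sup>2))" by (intro mult_left_mono mgf) simp
  also have "\<dots> = ennreal (exp (- (e\<^sup>2 / (8 * L\<^sup>2))))"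
  proof -
    have "- l * e + 2 * l\<^sup>2 * L\<^sup>2 = - (e\<^sup>2 / (8 * L\<^sup>2))" using L unfolding l_def by (simp add: field_simps power2_eq_square)
    then show ?thesis by (simp add: ennreal_mult[symmetric] exp_add[symmetric])
  qed
  finally show ?thesis by (simp add: emeasure_eq_measure)
qed

text \<open>From z^2 \<le> exp z + exp (-z) with z = Y / L, and the exponential moments at 1/L and
  -1/L.\<close>

lemma (in prob_space) subgaussian_variance:
  assumes [measurable]: "Y \<in> borel_measurable M"
    and mgf: "\<And>l. (\<integral>\<^sup>+d. ennreal (exp (l * Y d)) \<partial>M) \<le> ennreal (exp (2 * l\<^sup>2 * L\<^sup>2))" and L: "L > 0"
  shows "integrable M (\<lambda>d. (Y d)\<^sup>2)" "expectation (\<lambda>d. (Y d)\<^sup>2) \<le> 2 * exp 2 * L\<^sup>2"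
proof -
  have pt: "(Y d)\<^sup>2 \<le> L\<^sup>2 * (exp (1 / L * Y d) + exp (- (1 / L) * Y d))" for d
  proof -
    have c: "z\<^sup>2 \<le> exp z + exp (- z)" for z :: real
    proof -
      have p: "z\<^sup>2 \<le> exp z" if "z \<ge> 0" for z :: real
      proof -
        have "z\<^sup>2 = 4 * (z/2)\<^sup>2" by (simp add: power2_eq_square)
        have "z/2 \<le> exp (z/2 - 1)" using exp_ge_add_one_self[of "z/2 - 1"] by simp
        then have "(z/2)\<^sup>2 \<le> (exp (z/2 - 1))\<^sup>2" using that by (intro power_mono) auto
        also have "\<dots> = exp z * exp (-2)" by (simp add: power2_eq_square exp_add[symmetric])
        also have "exp (- 2 :: real) \<le> 1 / 4"
        proof -
          have "(2::real)\<^sup>2 \<le> (exp 1)\<^sup>2" using exp_ge_add_one_self[of 1] by (intro power_mono) auto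
          also have "(exp 1)\<^sup>2 = exp (2::real)" by (simp add: power2_eq_square exp_add[symmetric])
          finally show ?thesis by (simp add: exp_minus field_simps)
        qed
        finally show ?thesis by (simp add: power2_eq_square)
      qed
      have "z\<^sup>2 \<le> exp z \<or> z\<^sup>2 \<le> exp (- z)" using p[of z] p[of "-z"] by (cases "z \<ge> 0") auto
      then show ?thesis using exp_gt_zero[of z] exp_gt_zero[of "-z"] by linarith
    qed
    have "(Y d)\<^sup>2 = L\<^sup>2 * (1 / L * Y d)\<^sup>2" using L by (simp add: power2_eq_square)
    also have "\<dots> \<le> L\<^sup>2 * (exp (1 / L * Y d) + exp (- (1 / L * Y d)))" by (intro mult_left_mono c) simp
    finally show ?thesis by simp
  qed
  have "(\<integral>\<^sup>+d. ennreal ((Y d)\<^sup>2) \<partial>M) \<le> (\<integral>\<^sup>+d. ennreal (L\<^sup>2) * (ennreal (exp (1 / L * Y d)) + ennreal (exp (- (1 / L) * Y d))) \<partial>M)"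
    using pt by (intro nn_integral_mono) (simp add: ennreal_mult[symmetric] ennreal_plus[symmetric] ennreal_leI del: ennreal_plus)
  also have "\<dots> = ennreal (L\<^sup>2) * ((\<integral>\<^sup>+d. ennreal (exp (1 / L * Y d)) \<partial>M) + (\<integral>\<^sup>+d. ennreal (exp (- (1 / L) * Y d)) \<partial>M))"
    by (simp add: nn_integral_cmult nn_integral_add)
  also have "\<dots> \<le> ennreal (L\<^sup>2) * (ennreal (exp (2 * (1 / L)\<^sup>2 * L\<^sup>2)) + ennreal (exp (2 * (- (1 / L))\<^sup>2 * L\<^sup>2)))"
    by (intro mult_left_mono add_mono mgf) auto
  also have "\<dots> = ennreal (2 * exp 2 * L\<^sup>2)"
    using L by (simp add: ennreal_mult[symmetric] ennreal_plus[symmetric] power_divide algebra_simps del: ennreal_plus)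
  finally have *: "(\<integral>\<^sup>+d. ennreal ((Y d)\<^sup>2) \<partial>M) \<le> ennreal (2 * exp 2 * L\<^sup>2)" .
  show i: "integrable M (\<lambda>d. (Y d)\<^sup>2)"
    using le_less_trans[OF * ennreal_less_top] by (intro integrableI_nonneg) auto
  show "expectation (\<lambda>d. (Y d)\<^sup>2) \<le> 2 * exp 2 * L\<^sup>2"
    using * nn_integral_eq_integral[OF i] by simp
qed

text \<open>One family of couplings serves all system sizes: an almost sure statement about N
  tending to infinity needs all Hamiltonians on a common space. For each N a finite subfamily
  \<open>I\<close> of \<open>S\<close> is used.\<close>

locale gaussian_family = prob_space +
  fixes J :: "'a \<Rightarrow> 'i \<Rightarrow> real" and S :: "'i set"
  assumes indepJ: "indep_vars (\<lambda>_. borel) (\<lambda>i d. J d i) S"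
    and normalJ: "\<And>i. i \<in> S \<Longrightarrow> distributed M lborel (\<lambda>d. J d i) std_normal_density"
begin

lemma measurable_J: "i \<in> S \<Longrightarrow> (\<lambda>d. J d i) \<in> borel_measurable M"
  using distributed_measurable[OF normalJ] by simp

lemma restrict_measurable:
  assumes "I \<subseteq> S"
  shows "(\<lambda>d. \<lambda>i\<in>I. J d i) \<in> measurable M (gaussn I)"
  using assms measurable_J by (intro measurable_restrict) (auto cong: measurable_cong_sets)

lemma distr_J:
  assumes I: "I \<subseteq> S" "I \<noteq> {}"
  shows "distr M (gaussn I) (\<lambda>d. \<lambda>i\<in>I. J d i) = gaussn I"
proof -
  have "distr M (PiM I (\<lambda>_. borel)) (\<lambda>d. \<lambda>i\<in>I. J d i) = PiM I (\<lambda>i. distr M borel (\<lambda>d. J d i))"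
    using indep_vars_subset[OF indepJ I(1)] measurable_J I
    by (subst indep_vars_iff_distr_eq_PiM'[symmetric]) auto
  also have "\<dots> = gaussn I"
  proof (rule PiM_cong)
    fix i assume "i \<in> I"
    then have "distr M lborel (\<lambda>d. J d i) = gauss" using distributed_distr_eq_density[OF normalJ] I by auto
    then show "distr M borel (\<lambda>d. J d i) = gauss" by (metis distr_cong sets_lborel)
  qed simp
  also have "distr M (PiM I (\<lambda>_. borel)) (\<lambda>d. \<lambda>i\<in>I. J d i) = distr M (gaussn I) (\<lambda>d. \<lambda>i\<in>I. J d i)"
    by (intro distr_cong refl sets_PiM_cong) auto
  finally show ?thesis .
qed

lemma concentration:
  fixes F :: "('i \<Rightarrow> real) \<Rightarrow> real" and a :: "'i \<Rightarrow> ('i \<Rightarrow> real) \<Rightarrow> real"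
  assumes fin: "finite I" "I \<subseteq> S" "I \<noteq> {}"
    and F: "F \<in> borel_measurable (gaussn I)"
    and a: "\<And>i. i \<in> I \<Longrightarrow> a i \<in> borel_measurable (gaussn I)"
    and sub: "\<And>X Z. F X \<ge> F Z + (\<Sum>i\<in>I. a i Z * (X i - Z i))"
    and L: "\<And>Z. (\<Sum>i\<in>I. (a i Z)\<^sup>2) \<le> L\<^sup>2" "L > 0"
    and dep: "\<And>X. F (restrict X I) = F X"
  shows "integrable M (\<lambda>d. F (J d))" (is ?int)
    and "e \<ge> 0 \<Longrightarrow> prob {d\<in>space M. F (J d) - expectation (\<lambda>d. F (J d)) \<ge> e} \<le> exp (- (e\<^sup>2 / (8 * L\<^sup>2)))" (is "_ \<Longrightarrow> ?up")
    and "e \<ge> 0 \<Longrightarrow> prob {d\<in>space M. expectation (\<lambda>d. F (J d)) - F (J d) \<ge> e} \<le> exp (- (e\<^sup>2 / (8 * L\<^sup>2)))" (is "_ \<Longrightarrow> ?dn")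
    and "expectation (\<lambda>d. (F (J d) - expectation (\<lambda>d. F (J d)))\<^sup>2) \<le> 2 * exp 2 * L\<^sup>2" (is ?var)
    and "integrable M (\<lambda>d. (F (J d) - expectation (\<lambda>d. F (J d)))\<^sup>2)" (is ?varint)
proof -
  note D = restrict_measurable[OF fin(2)]
  note conc = gaussn_concentration[OF fin(1) F a sub L(1) less_imp_le[OF L(2)]]
  have FJ: "(\<lambda>d. F (J d)) = (\<lambda>d. F (\<lambda>i\<in>I. J d i))" using dep by auto
  have [measurable]: "(\<lambda>d. F (J d)) \<in> borel_measurable M"
    unfolding FJ by (rule measurable_compose[OF D F])
  show ?int unfolding FJ
    using integrable_distr[OF D, of F] conc(1) distr_J[OF fin(2,3)] by simp
  have E: "expectation (\<lambda>d. F (J d)) = integral\<^sup>L (gaussn I) F"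
    unfolding FJ using integral_distr[OF D F] distr_J[OF fin(2,3)] by simp
  have mgf: "(\<integral>\<^sup>+d. ennreal (exp (l * (F (J d) - expectation (\<lambda>d. F (J d))))) \<partial>M) \<le> ennreal (exp (2 * l\<^sup>2 * L\<^sup>2))" for l
  proof -
    have "(\<integral>\<^sup>+d. ennreal (exp (l * (F (J d) - expectation (\<lambda>d. F (J d))))) \<partial>M)
       = (\<integral>\<^sup>+Y. ennreal (exp (l * (F Y - integral\<^sup>L (gaussn I) F))) \<partial>distr M (gaussn I) (\<lambda>d. \<lambda>i\<in>I. J d i))"
      unfolding E using D F by (subst nn_integral_distr) (auto simp: dep)
    then show ?thesis using conc(2) distr_J[OF fin(2,3)] by simp
  qed
  have mgf': "(\<integral>\<^sup>+d. ennreal (exp (l * (expectation (\<lambda>d. F (J d)) - F (J d)))) \<partial>M) \<le> ennreal (exp (2 * l\<^sup>2 * L\<^sup>2))" for l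
    using mgf[of "- l"] by (simp add: algebra_simps)
  show ?up if "e \<ge> 0" by (rule subgaussian_tail[OF _ mgf L(2) that]) simp
  show ?dn if "e \<ge> 0" by (rule subgaussian_tail[OF _ mgf' L(2) that]) simp
  show ?var by (rule subgaussian_variance(2)[OF _ mgf L(2)]) simp
  show ?varint by (rule subgaussian_variance(1)[OF _ mgf L(2)]) simp
qed

end

section \<open>Nets on the sphere\<close>

lemma sum_half_powers: "(\<Sum>j\<in>{- int M..int M}. (1/2::real) ^ nat \<bar>j\<bar>) \<le> 3"
proof -
  have "(\<Sum>j\<in>{- int M..int M}. (1/2::real) ^ nat \<bar>j\<bar>) = 3 - 2 * (1/2) ^ M"
  proof (induction M)
    case (Suc M)
    have "{- int (Suc M)..int (Suc M)} = insert (int (Suc M)) (insert (- int (Suc M)) {- int M..int M})" by auto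
    then show ?case using Suc by (simp add: nat_add_distrib)
  qed simp
  then show ?thesis by simp
qed

text \<open>Give each lattice point the weight 2 to the power minus its l1 norm. The total weight is
  at most 3^N, and every point counted has weight at least 2^(-mN).\<close>

lemma card_lattice_points:
  "finite {k \<in> PiE {..<N} (\<lambda>_. UNIV :: int set). (\<Sum>i<N. \<bar>k i\<bar>) \<le> int (m * N)}" (is "finite ?K")
  "real (card {k \<in> PiE {..<N} (\<lambda>_. UNIV :: int set). (\<Sum>i<N. \<bar>k i\<bar>) \<le> int (m * N)}) \<le> (3 * 2 ^ m) ^ N"
proof -
  let ?B = "{- int (m * N)..int (m * N)}"
  have sub: "?K \<subseteq> PiE {..<N} (\<lambda>_. ?B)"
  proof
    fix k assume k: "k \<in> ?K"
    have "\<bar>k i\<bar> \<le> int (m * N)" if "i < N" for i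
      using k that member_le_sum[of i "{..<N}" "\<lambda>i. \<bar>k i\<bar>"] by auto
    then have "k i \<in> ?B" if "i < N" for i using that by (metis abs_le_iff atLeastAtMost_iff minus_le_iff)
    then show "k \<in> PiE {..<N} (\<lambda>_. ?B)" using k by (simp add: PiE_iff)
  qed
  have finB: "finite (PiE {..<N} (\<lambda>_. ?B))" by (intro finite_PiE) auto
  show fin: "finite ?K" by (rule finite_subset[OF sub finB])
  have "real (card ?K) * (1/2) ^ (m * N) = (\<Sum>k\<in>?K. (1/2) ^ (m * N))" by simp
  also have "\<dots> \<le> (\<Sum>k\<in>?K. \<Prod>i<N. (1/2) ^ nat \<bar>k i\<bar>)"
  proof (rule sum_mono)
    fix k assume k: "k \<in> ?K"
    have "int (\<Sum>i<N. nat \<bar>k i\<bar>) = (\<Sum>i<N. \<bar>k i\<bar>)" by simp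
    then have "(\<Sum>i<N. nat \<bar>k i\<bar>) \<le> m * N" using k by (metis (mono_tags, lifting) mem_Collect_eq of_nat_le_iff)
    then have "(1/2 :: real) ^ (m * N) \<le> (1/2) ^ (\<Sum>i<N. nat \<bar>k i\<bar>)" by (intro power_decreasing) auto
    then show "(1/2 :: real) ^ (m * N) \<le> (\<Prod>i<N. (1/2) ^ nat \<bar>k i\<bar>)" by (simp add: power_sum)
  qed
  also have "\<dots> \<le> (\<Sum>k\<in>PiE {..<N} (\<lambda>_. ?B). \<Prod>i<N. (1/2) ^ nat \<bar>k i\<bar>)"
    using sub finB by (intro sum_mono2) (auto intro!: prod_nonneg)
  also have "\<dots> = (\<Prod>i<N. \<Sum>j\<in>?B. (1/2) ^ nat \<bar>j\<bar>)"
    by (subst prod_sum_PiE) auto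
  also have "\<dots> \<le> (\<Prod>i<N. 3)" by (intro prod_mono) (use sum_half_powers[of "m * N"] in \<open>auto intro!: sum_nonneg\<close>)
  also have "\<dots> = 3 ^ N" by simp
  finally have "real (card ?K) \<le> 3 ^ N * 2 ^ (m * N)" by (simp add: power_divide field_simps)
  then show "real (card ?K) \<le> (3 * 2 ^ m) ^ N" by (simp add: power_mult_distrib power_mult)
qed

text \<open>Points whose coordinates round down to the same multiples of \<delta> are at sup
  distance at most \<delta>, hence at Euclidean distance at most \<delta> sqrt N. By Cauchy-Schwarz
  the l1 norm on the ball is at most N, so the number of cells is exponential in N with a base
  depending on \<delta> only. One point of S is taken from each cell that meets S, which keeps the
  net inside S.\<close>

lemma sphere_net:
  fixes \<delta> :: real
  assumes \<delta>: "\<delta> > 0"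
  shows "\<exists>A\<ge>1. \<forall>N S. S \<subseteq> {x. nrm N x \<le> sqrt (real N)} \<longrightarrow>
     (\<exists>T\<subseteq>S. finite T \<and> real (card T) \<le> A ^ N \<and> (\<forall>x\<in>S. \<exists>y\<in>T. nrm N (\<lambda>i. x i - y i) \<le> \<delta> * sqrt (real N)))"
proof -
  define m where "m = nat \<lceil>1 / \<delta>\<rceil> + 1"
  have m: "1 / \<delta> + 1 \<le> real m" unfolding m_def using \<delta> by (simp add: of_nat_ceiling)
  have "1 \<le> 3 * (2 :: real) ^ m" using one_le_power[of "2::real" m] by linarith
  moreover have "\<exists>T\<subseteq>S. finite T \<and> real (card T) \<le> (3 * 2 ^ m) ^ N \<and> (\<forall>x\<in>S. \<exists>y\<in>T. nrm N (\<lambda>i. x i - y i) \<le> \<delta> * sqrt (real N))"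
    if S: "S \<subseteq> {x. nrm N x \<le> sqrt (real N)}" for N S
  proof -
    let ?K = "{k \<in> PiE {..<N} (\<lambda>_. UNIV :: int set). (\<Sum>i<N. \<bar>k i\<bar>) \<le> int (m * N)}"
    define c where "c x = (\<lambda>i\<in>{..<N}. \<lfloor>x i / \<delta>\<rfloor>)" for x :: "nat \<Rightarrow> real"
    have c: "c ` S \<subseteq> ?K"
    proof (intro image_subsetI)
      fix x assume x: "x \<in> S"
      have "(\<Sum>i<N. \<bar>x i\<bar>) \<le> real N"
      proof -
        have "(\<Sum>i<N. \<bar>x i\<bar>) = (\<Sum>i<N. \<bar>1\<bar> * \<bar>x i\<bar>)" by simp
        also have "\<dots> \<le> nrm N (\<lambda>_. 1) * nrm N x" by (rule L2_set_mult_ineq)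
        also have "\<dots> \<le> sqrt (real N) * sqrt (real N)" using S x by (intro mult_mono) (auto simp: L2_set_constant)
        finally show ?thesis by simp
      qed
      then have 1: "(\<Sum>i<N. \<bar>x i\<bar>) / \<delta> \<le> real N / \<delta>" using \<delta> by (simp add: divide_right_mono)
      have fl: "real_of_int \<bar>\<lfloor>y\<rfloor>\<bar> \<le> \<bar>y\<bar> + 1" for y :: real by linarith
      have "real_of_int \<bar>c x i\<bar> \<le> \<bar>x i / \<delta>\<bar> + 1" if "i < N" for i
        using that fl[of "x i / \<delta>"] by (simp add: c_def)
      then have "real_of_int (\<Sum>i<N. \<bar>c x i\<bar>) \<le> (\<Sum>i<N. \<bar>x i / \<delta>\<bar> + 1)"
        unfolding of_int_sum by (intro sum_mono) simp
      also have "\<dots> = (\<Sum>i<N. \<bar>x i\<bar>) / \<delta> + real N"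
        using \<delta> by (simp add: sum.distrib sum_divide_distrib)
      also have "\<dots> \<le> (1 / \<delta> + 1) * real N" using 1 by (simp add: algebra_simps)
      also have "\<dots> \<le> real m * real N" using m by (intro mult_right_mono) auto
      finally have "(\<Sum>i<N. \<bar>c x i\<bar>) \<le> int (m * N)" by (metis of_int_le_iff of_int_of_nat_eq of_nat_mult)
      then show "c x \<in> ?K" by (auto simp: c_def)
    qed
    define f where "f k = (SOME x. x \<in> S \<and> c x = k)" for k
    have f: "f k \<in> S \<and> c (f k) = k" if "k \<in> c ` S" for k
      unfolding f_def using that by (intro someI_ex[of "\<lambda>x. x \<in> S \<and> c x = k"]) auto
    have fin: "finite (c ` S)" by (rule finite_subset[OF c card_lattice_points(1)])
    show ?thesis
    proof (intro exI[of _ "f ` c ` S"] conjI ballI)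
      show "f ` c ` S \<subseteq> S" using f by auto
      show "finite (f ` c ` S)" using fin by simp
      have "card (f ` c ` S) \<le> card ?K"
        using card_image_le[OF fin, of f] card_mono[OF card_lattice_points(1) c] by linarith
      then show "real (card (f ` c ` S)) \<le> (3 * 2 ^ m) ^ N"
        using card_lattice_points(2)[of N m] by linarith
    next
      fix x assume x: "x \<in> S"
      let ?y = "f (c x)"
      have cc: "c ?y = c x" using f x by auto
      have "\<bar>x i - ?y i\<bar> \<le> \<delta>" if "i < N" for i
      proof -
        have "\<lfloor>x i / \<delta>\<rfloor> = \<lfloor>?y i / \<delta>\<rfloor>" using fun_cong[OF cc, of i] that by (simp add: c_def)
        then have "\<bar>x i / \<delta> - ?y i / \<delta>\<bar> \<le> 1" by linarith
        then show ?thesis using \<delta> by (simp add: diff_divide_distrib[symmetric] field_simps abs_le_iff)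
      qed
      then have "(x i - ?y i)\<^sup>2 \<le> \<delta>\<^sup>2" if "i < N" for i
        using that \<delta> abs_le_square_iff[of "x i - ?y i" \<delta>] by auto
      then have "(\<Sum>i<N. (x i - ?y i)\<^sup>2) \<le> (\<Sum>i<N. \<delta>\<^sup>2)" by (intro sum_mono) auto
      then have "nrm N (\<lambda>i. x i - ?y i) \<le> sqrt (real N * \<delta>\<^sup>2)" unfolding L2_set_def by simp
      also have "\<dots> = \<delta> * sqrt (real N)" using \<delta> by (simp add: real_sqrt_mult)
      finally show "\<exists>y\<in>f ` c ` S. nrm N (\<lambda>i. x i - y i) \<le> \<delta> * sqrt (real N)" using x by auto
    qed
  qed
  ultimately show ?thesis by blast
qed

text \<open>Borel-Cantelli. The property \<open>Q\<close> will quantify over uncountably many points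
  of the sphere, so its measurability is left open; it only has to hold off a measurable set
  \<open>B\<close>.\<close>

lemma (in prob_space) AE_eventually_outside_summable:
  fixes h :: "nat \<Rightarrow> real"
  assumes h: "summable h" and B: "\<And>N. N \<ge> N0 \<Longrightarrow> \<exists>B\<in>events. prob B \<le> h N \<and> (\<forall>d\<in>space M - B. Q N d)"
  shows "AE d in M. eventually (\<lambda>N. Q N d) sequentially"
proof -
  obtain B where B: "\<And>N. N \<ge> N0 \<Longrightarrow> B N \<in> events \<and> prob (B N) \<le> h N \<and> (\<forall>d\<in>space M - B N. Q N d)"
    using B by metis
  define C where "C N = (if N \<ge> N0 then B N else {})" for N
  have "summable (\<lambda>N. prob (C N))"
    using B by (intro summable_comparison_test'[OF h, of N0]) (auto simp: C_def)
  then have "AE d in M. eventually (\<lambda>N. d \<in> space M - C N) sequentially"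
    using B by (intro borel_cantelli_AE1) (auto simp: C_def emeasure_eq_measure)
  then show ?thesis
  proof (eventually_elim)
    fix d assume "eventually (\<lambda>N. d \<in> space M - C N) sequentially"
    then show "eventually (\<lambda>N. Q N d) sequentially" using eventually_ge_at_top[of N0]
      by eventually_elim (use B in \<open>auto simp: C_def\<close>)
  qed
qed

lemma summable_exp_neg: "a > 0 \<Longrightarrow> summable (\<lambda>N. c * exp (- (a * real N)))"
proof -
  assume "a > 0"
  moreover have "exp (- (a * real N)) = exp (- a) ^ N" for N by (simp add: exp_of_nat_mult[symmetric] mult.commute)
  ultimately show ?thesis by (simp add: summable_mult summable_geometric)
qed

lemma (in prob_space) AE_eventually_outside:
  assumes B: "\<And>N. N \<ge> N0 \<Longrightarrow> \<exists>B\<in>events. prob B \<le> 2 * exp (- real N) \<and> (\<forall>d\<in>space M - B. Q N d)"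
  shows "AE d in M. eventually (\<lambda>N. Q N d) sequentially"
  by (rule AE_eventually_outside_summable[where h="\<lambda>N. 2 * exp (- real N)", OF _ B])
     (use summable_exp_neg[of 1 2] in auto)

context gaussian_family
begin

text \<open>Union bound over both tails and all points of the net: in the exponent,
  \<open>ln A\<close> pays for the at most A^N points and the added 1 leaves exp(-N).\<close>

lemma net_event:
  fixes F :: "'t \<Rightarrow> ('i \<Rightarrow> real) \<Rightarrow> real" and a :: "'t \<Rightarrow> 'i \<Rightarrow> ('i \<Rightarrow> real) \<Rightarrow> real"
  assumes fin: "finite I" "I \<subseteq> S" "I \<noteq> {}"
    and T: "finite T" "real (card T) \<le> A ^ N" "A \<ge> 1"
    and F: "\<And>y. y \<in> T \<Longrightarrow> F y \<in> borel_measurable (gaussn I)"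
    and a: "\<And>y i. y \<in> T \<Longrightarrow> i \<in> I \<Longrightarrow> a y i \<in> borel_measurable (gaussn I)"
    and sub: "\<And>y X Z. y \<in> T \<Longrightarrow> F y X \<ge> F y Z + (\<Sum>i\<in>I. a y i Z * (X i - Z i))"
    and L: "\<And>y Z. y \<in> T \<Longrightarrow> (\<Sum>i\<in>I. (a y i Z)\<^sup>2) \<le> L\<^sup>2" "L > 0"
    and dep: "\<And>y X. y \<in> T \<Longrightarrow> F y (restrict X I) = F y X"
    and e: "e \<ge> 0" "real N * (ln A + 1) \<le> e\<^sup>2 / (8 * L\<^sup>2)"
  shows "\<exists>B\<in>events. prob B \<le> 2 * exp (- real N) \<and> (\<forall>d\<in>space M - B. \<forall>y\<in>T. \<bar>F y (J d) - expectation (\<lambda>d. F y (J d))\<bar> < e)"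
proof -
  have m [measurable]: "(\<lambda>d. F y (J d)) \<in> borel_measurable M" if y: "y \<in> T" for y
    using concentration(1)[OF fin F[OF y] a[OF y] sub[OF y] L(1)[OF y] L(2) dep[OF y]] by auto
  define B1 where "B1 y = {d\<in>space M. F y (J d) - expectation (\<lambda>d. F y (J d)) \<ge> e}" for y
  define B2 where "B2 y = {d\<in>space M. expectation (\<lambda>d. F y (J d)) - F y (J d) \<ge> e}" for y
  have m1: "B1 y \<in> events" "B2 y \<in> events" if [simp]: "y \<in> T" for y unfolding B1_def B2_def by measurable
  have "prob (\<Union>y\<in>T. B1 y \<union> B2 y) \<le> (\<Sum>y\<in>T. prob (B1 y \<union> B2 y))"
    using T(1) m1 by (intro finite_measure_subadditive_finite) auto
  also have "\<dots> \<le> (\<Sum>y\<in>T. 2 * exp (- (e\<^sup>2 / (8 * L\<^sup>2))))"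
  proof (rule sum_mono)
    fix y assume y: "y \<in> T"
    have "prob (B1 y \<union> B2 y) \<le> prob (B1 y) + prob (B2 y)" using m1[OF y] by (intro measure_Un_le) auto
    also have "\<dots> \<le> 2 * exp (- (e\<^sup>2 / (8 * L\<^sup>2)))"
      using concentration(2,3)[OF fin F[OF y] a[OF y] sub[OF y] L(1)[OF y] L(2) dep[OF y] e(1)] unfolding B1_def B2_def by simp
    finally show "prob (B1 y \<union> B2 y) \<le> 2 * exp (- (e\<^sup>2 / (8 * L\<^sup>2)))" .
  qed
  also have "\<dots> = real (card T) * (2 * exp (- (e\<^sup>2 / (8 * L\<^sup>2))))" by simp
  also have "\<dots> \<le> A ^ N * (2 * exp (- (real N * (ln A + 1))))"
    using T e by (intro mult_mono) auto
  also have "A ^ N = exp (real N * ln A)" using T(3) by (simp add: exp_of_nat_mult)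
  also have "exp (real N * ln A) * (2 * exp (- (real N * (ln A + 1)))) = 2 * exp (- real N)"
    by (simp add: mult_exp_exp algebra_simps)
  finally have "prob (\<Union>y\<in>T. B1 y \<union> B2 y) \<le> 2 * exp (- real N)" .
  moreover have "(\<Union>y\<in>T. B1 y \<union> B2 y) \<in> events" using T(1) m1 by auto
  moreover have "\<bar>F y (J d) - expectation (\<lambda>d. F y (J d))\<bar> < e" if "d \<in> space M - (\<Union>y\<in>T. B1 y \<union> B2 y)" "y \<in> T" for d y
    using that unfolding B1_def B2_def by (auto simp: not_le abs_less_iff)
  ultimately show ?thesis by blast
qed

lemma measurable_linear:
  "finite I \<Longrightarrow> (\<lambda>X. \<Sum>i\<in>I. X i * c i) \<in> borel_measurable (gaussn I)"
  by (intro borel_measurable_sum borel_measurable_times measurable_compose[OF measurable_component_singleton] borel_measurable_const)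
     (auto cong: measurable_cong_sets)

lemma integrable_J: "i \<in> S \<Longrightarrow> integrable M (\<lambda>d. J d i)"
  using distributed_integrable[OF normalJ, of i "\<lambda>x. x"] integrable_std_normal_moment[of 1] by simp

text \<open>A linear form is convex with its coefficients as subgradient, and has mean 0, so its
  deviation from the mean is the form itself.\<close>

lemma net_event_linear:
  fixes c :: "'t \<Rightarrow> 'i \<Rightarrow> real"
  assumes fin: "finite I" "I \<subseteq> S" "I \<noteq> {}"
    and T: "finite T" "real (card T) \<le> A ^ N" "A \<ge> 1"
    and L: "\<And>y. y \<in> T \<Longrightarrow> (\<Sum>i\<in>I. (c y i)\<^sup>2) \<le> L\<^sup>2" "L > 0"
    and e: "e \<ge> 0" "real N * (ln A + 1) \<le> e\<^sup>2 / (8 * L\<^sup>2)"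
  shows "\<exists>B\<in>events. prob B \<le> 2 * exp (- real N) \<and> (\<forall>d\<in>space M - B. \<forall>y\<in>T. \<bar>\<Sum>i\<in>I. J d i * c y i\<bar> < e)"
proof -
  have E: "expectation (\<lambda>d. \<Sum>i\<in>I. J d i * c y i) = 0" for y
    using fin(2) standard_normal_distributed_expectation[OF normalJ]
    by (subst Bochner_Integration.integral_sum) (auto intro!: integrable_J sum.neutral)
  show ?thesis
    using net_event[OF fin T, where F="\<lambda>y X. \<Sum>i\<in>I. X i * c y i" and a="\<lambda>y i X. c y i", OF _ _ _ L _ e]
    by (simp add: E measurable_linear[OF fin(1)] sum.distrib[symmetric] algebra_simps cong: sum.cong)
qed

lemma expectation_J_mult:
  assumes "i \<in> S" "j \<in> S"
  shows "integrable M (\<lambda>d. J d i * J d j)" "expectation (\<lambda>d. J d i * J d j) = (if i = j then 1 else 0)"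
proof -
  have "integrable M (\<lambda>d. J d i * J d j) \<and> expectation (\<lambda>d. J d i * J d j) = (if i = j then 1 else 0)"
  proof (cases "i = j")
    case True
    have "integrable M (\<lambda>d. (J d i)\<^sup>2)"
      using distributed_integrable[OF normalJ[OF assms(1)], of "\<lambda>x. x\<^sup>2"] integrable_std_normal_moment[of 2]
      by (simp add: mult.commute)
    moreover have "expectation (\<lambda>d. (J d i)\<^sup>2) = 1"
      using standard_normal_distributed_variance[OF normalJ[OF assms(1)]] standard_normal_distributed_expectation[OF normalJ[OF assms(1)]]
      by simp
    ultimately show ?thesis using True by (simp add: power2_eq_square)
  next
    case False
    have iv: "indep_vars (\<lambda>_. borel) (\<lambda>i d. J d i) {i, j}" using indep_vars_subset[OF indepJ] assms by auto
    have ij: "k \<in> {i, j} \<Longrightarrow> integrable M (\<lambda>d. J d k)" for k using assms integrable_J by auto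
    show ?thesis using indep_vars_lebesgue_integral[OF _ iv ij] indep_vars_integrable[OF _ iv ij] False
        standard_normal_distributed_expectation[OF normalJ[OF assms(1)]] by simp
  qed
  then show "integrable M (\<lambda>d. J d i * J d j)" "expectation (\<lambda>d. J d i * J d j) = (if i = j then 1 else 0)" by auto
qed

lemma expectation_linear_sq:
  assumes "finite I" "I \<subseteq> S"
  shows "integrable M (\<lambda>d. (\<Sum>i\<in>I. J d i * c i)\<^sup>2)" "expectation (\<lambda>d. (\<Sum>i\<in>I. J d i * c i)\<^sup>2) = (\<Sum>i\<in>I. (c i)\<^sup>2)"
proof -
  have e: "(\<Sum>i\<in>I. J d i * c i)\<^sup>2 = (\<Sum>i\<in>I. \<Sum>j\<in>I. (c i * c j) * (J d i * J d j))" for d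
    by (simp add: power2_eq_square sum_product mult_ac)
  show "integrable M (\<lambda>d. (\<Sum>i\<in>I. J d i * c i)\<^sup>2)"
    unfolding e using assms by (intro Bochner_Integration.integrable_sum integrable_mult_right expectation_J_mult) auto
  have "expectation (\<lambda>d. (\<Sum>i\<in>I. J d i * c i)\<^sup>2) = (\<Sum>i\<in>I. \<Sum>j\<in>I. (c i * c j) * expectation (\<lambda>d. J d i * J d j))"
  proof -
    have ij: "integrable M (\<lambda>d. (c i * c j) * (J d i * J d j))" if "i \<in> I" "j \<in> I" for i j
      using that assms by (intro integrable_mult_right expectation_J_mult) auto
    have "expectation (\<lambda>d. \<Sum>i\<in>I. \<Sum>j\<in>I. (c i * c j) * (J d i * J d j)) = (\<Sum>i\<in>I. expectation (\<lambda>d. \<Sum>j\<in>I. (c i * c j) * (J d i * J d j)))"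
      by (rule Bochner_Integration.integral_sum) (intro Bochner_Integration.integrable_sum ij)
    also have "\<dots> = (\<Sum>i\<in>I. \<Sum>j\<in>I. expectation (\<lambda>d. (c i * c j) * (J d i * J d j)))"
      by (intro sum.cong refl, rule Bochner_Integration.integral_sum) (rule ij)
    finally show ?thesis unfolding e by simp
  qed
  also have "\<dots> = (\<Sum>i\<in>I. \<Sum>j\<in>I. if i = j then c i * c j else 0)"
    using assms by (intro sum.cong refl) (subst expectation_J_mult(2), auto)
  also have "\<dots> = (\<Sum>i\<in>I. (c i)\<^sup>2)" using assms by (simp add: power2_eq_square)
  finally show "expectation (\<lambda>d. (\<Sum>i\<in>I. J d i * c i)\<^sup>2) = (\<Sum>i\<in>I. (c i)\<^sup>2)" .
qed

end


section \<open>Variances of linear functionals, and consequences of a uniform bound on H\<close>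

lemma Hscale_sq: "N \<ge> 1 \<Longrightarrow> p \<ge> 1 \<Longrightarrow> (Hscale N p)\<^sup>2 * real N ^ (p - 1) = 1"
proof -
  assume N: "N \<ge> 1" and p: "p \<ge> 1"
  have "(Hscale N p)\<^sup>2 = real N powr (- real (p - 1))"
    unfolding Hscale_def power2_eq_square using N p by (simp add: powr_add[symmetric] of_nat_diff)
  then show ?thesis using N by (simp add: powr_minus powr_realpow)
qed

lemma Ham_linear: "Ham N p J y = (\<Sum>is\<in>idx N p. J is * (Hscale N p * mon p is y))"
  unfolding Ham_HT HT_def by (simp add: sum_distrib_left mult_ac)

lemma hess_Ham_linear: "pd i (pd j (Ham N p J)) y = (\<Sum>is\<in>idx N p. J is * (Hscale N p * pd i (pd j (mon p is)) y))"
  unfolding pd2_Ham pd2_HT by (simp add: sum_distrib_left mult_ac)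

lemma bil_Ham_linear: "(\<Sum>i<N. \<Sum>j<N. b i j * pd i (pd j (Ham N p J)) y) = (\<Sum>is\<in>idx N p. J is * (Hscale N p * D2m N p b is y))"
proof -
  have "(\<Sum>i<N. \<Sum>j<N. b i j * pd i (pd j (Ham N p J)) y) = Hscale N p * (\<Sum>i<N. \<Sum>j<N. b i j * pd i (pd j (HT N p J)) y)"
    unfolding pd2_Ham by (simp add: sum_distrib_left mult_ac)
  then show ?thesis unfolding sum_D2m[symmetric] by (simp add: sum_distrib_left mult_ac)
qed

lemma Ham_coeff_sq_le:
  assumes N: "N \<ge> 1" and p: "p \<ge> 1" and y: "nrm N y \<le> sqrt (real N)"
  shows "(\<Sum>is\<in>idx N p. (Hscale N p * mon p is y)\<^sup>2) \<le> (sqrt (real N))\<^sup>2"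
proof -
  have "(nrm N y)\<^sup>2 \<le> (sqrt (real N))\<^sup>2" using y by (intro power_mono) auto
  then have y2: "(\<Sum>i<N. y i * y i) \<le> real N" unfolding nrm_sq by (simp add: power2_eq_square)
  have "(\<Sum>is\<in>idx N p. (Hscale N p * mon p is y)\<^sup>2) = (Hscale N p)\<^sup>2 * (\<Sum>is\<in>idx N p. mon p is y * mon p is y)"
    by (simp add: sum_distrib_left power_mult_distrib power2_eq_square mult_ac)
  also have "\<dots> \<le> (Hscale N p)\<^sup>2 * real N ^ p"
    unfolding kernel_power using y2 by (intro mult_left_mono power_mono) (auto intro!: sum_nonneg)
  also have "\<dots> = ((Hscale N p)\<^sup>2 * real N ^ (p - 1)) * real N" using p by (cases p) auto
  finally show ?thesis using Hscale_sq[OF N p] by simp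
qed

text \<open>The variance of a contraction of the Hessian at a point of the sphere. It is of order
  1/N for a normalized matrix and of order 1 for the identity, while the Hilbert-Schmidt norm and
  the trace have to be controlled on the much larger scales sqrt N and N.\<close>

lemma D2m_coeff_sq_le:
  assumes N: "N \<ge> 1" and p: "p \<ge> 3" and y: "(\<Sum>i<N. (y i)\<^sup>2) = real N"
  shows "(\<Sum>is\<in>idx N p. (Hscale N p * D2m N p b is y)\<^sup>2) \<le> (real p * real (p - 1))\<^sup>2 / real N * (\<Sum>i<N. \<Sum>j<N. (b i j)\<^sup>2)"
proof -
  have "(\<Sum>is\<in>idx N p. (Hscale N p * D2m N p b is y)\<^sup>2) = (Hscale N p)\<^sup>2 * (\<Sum>is\<in>idx N p. (D2m N p b is y)\<^sup>2)"
    by (simp add: sum_distrib_left power_mult_distrib)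
  also have "\<dots> \<le> (Hscale N p)\<^sup>2 * ((real p * real (p - 1))\<^sup>2 * real N ^ (p - 2) * (\<Sum>i<N. \<Sum>j<N. (b i j)\<^sup>2))"
    using sum_D2m_sq_le[OF p, of N b y] unfolding y by (intro mult_left_mono) auto
  also have "\<dots> = ((Hscale N p)\<^sup>2 * real N ^ (p - 1)) * ((real p * real (p - 1))\<^sup>2 / real N * (\<Sum>i<N. \<Sum>j<N. (b i j)\<^sup>2))"
  proof -
    have "p - 1 = Suc (p - 2)" using p by simp
    then show ?thesis using N by simp
  qed
  also have "\<dots> = (real p * real (p - 1))\<^sup>2 / real N * (\<Sum>i<N. \<Sum>j<N. (b i j)\<^sup>2)" using Hscale_sq[of N p] N p by simp
  finally show ?thesis .
qed

text \<open>The factor 4 leaves room for two rounds of Cauchy estimates: from radius 4 sqrt N to 2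
  sqrt N for the derivatives of H, which bound the observables there, and from 2 sqrt N to the
  sphere for the derivatives of the observables.\<close>

definition Hbounded :: "nat \<Rightarrow> nat \<Rightarrow> (nat list \<Rightarrow> real) \<Rightarrow> real \<Rightarrow> bool" where
  "Hbounded N p J C \<longleftrightarrow> (\<forall>y. nrm N y \<le> 4 * sqrt (real N) \<longrightarrow> \<bar>Ham N p J y\<bar> \<le> C * real N)"

lemma Ham_scale: "c > 0 \<Longrightarrow> Ham N p J (\<lambda>i. c * y i) = c ^ p * Ham N p J y"
  using hom_Ham[of p N J] unfolding hom_def by blast

text \<open>Absorption: on twice the radius H is bounded by 2^p S, so with the given mesh the
  Lipschitz estimate loses at most half of the supremum S itself, and S \<le> t N + S/2. Homogeneity
  then extends the bound to radius 4 sqrt N.\<close>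

lemma Hbounded_of_net:
  assumes N: "N \<ge> 1" and p: "p \<ge> 1" and t: "t \<ge> 0"
    and T: "T \<subseteq> {x. nrm N x \<le> sqrt (real N)}"
    and net: "\<And>x. nrm N x \<le> sqrt (real N) \<Longrightarrow> \<exists>y\<in>T. nrm N (\<lambda>i. x i - y i) \<le> 1 / (2 * Mk p * 2 ^ p) * sqrt (real N)"
    and H: "\<And>y. y \<in> T \<Longrightarrow> \<bar>Ham N p J y\<bar> \<le> t * real N"
  shows "Hbounded N p J (4 ^ p * (2 * t))"
proof -
  let ?B = "{x. nrm N x \<le> sqrt (real N)}"
  have sN: "sqrt (real N) > 0" using N by simp
  define S where "S = (SUP x\<in>?B. \<bar>Ham N p J x\<bar>)"
  \<comment> \<open>S has to be finite before it can be absorbed; a bound depending on J and N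
    suffices for this.\<close>
  have bdd: "bdd_above ((\<lambda>x. \<bar>Ham N p J x\<bar>) ` ?B)"
  proof (rule bdd_aboveI2)
    fix x assume "x \<in> ?B"
    then have x: "nrm N x \<le> sqrt (real N)" by simp
    have "\<bar>Ham N p J x\<bar> \<le> (\<Sum>is\<in>idx N p. \<bar>J is\<bar> * \<bar>Hscale N p * mon p is x\<bar>)"
      unfolding Ham_linear by (rule order_trans[OF sum_abs]) (simp add: abs_mult)
    also have "\<dots> \<le> L2_set J (idx N p) * L2_set (\<lambda>is. Hscale N p * mon p is x) (idx N p)" by (rule L2_set_mult_ineq)
    also have "\<dots> \<le> L2_set J (idx N p) * sqrt (real N)"
      using real_sqrt_le_mono[OF Ham_coeff_sq_le[OF N p x]] by (intro mult_left_mono L2_set_nonneg) (simp add: L2_set_def[of "\<lambda>is. Hscale N p * mon p is x"])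
    finally show "\<bar>Ham N p J x\<bar> \<le> L2_set J (idx N p) * sqrt (real N)" .
  qed
  have S: "\<bar>Ham N p J x\<bar> \<le> S" if "nrm N x \<le> sqrt (real N)" for x
    unfolding S_def using that bdd by (intro cSUP_upper) auto
  have S2: "\<bar>Ham N p J x\<bar> \<le> c ^ p * S" if "nrm N x \<le> c * sqrt (real N)" "c > 0" for x c
  proof -
    have "nrm N (\<lambda>i. (1/c) * x i) \<le> sqrt (real N)" using that by (subst nrm_scale) (simp add: field_simps)
    from S[OF this] have z: "\<bar>Ham N p J (\<lambda>i. (1/c) * x i)\<bar> \<le> S" .
    have "Ham N p J x = c ^ p * Ham N p J (\<lambda>i. (1/c) * x i)"
      using Ham_scale[OF that(2), of N p J "\<lambda>i. (1/c) * x i"] that by simp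
    then have "\<bar>Ham N p J x\<bar> = c ^ p * \<bar>Ham N p J (\<lambda>i. (1/c) * x i)\<bar>" using that by (simp add: abs_mult)
    also have "\<dots> \<le> c ^ p * S" using z that by (intro mult_left_mono) auto
    finally show ?thesis .
  qed
  have "S \<le> t * real N + S / 2"
    unfolding S_def
  proof (rule cSUP_least)
    show "?B \<noteq> {}" using sN by (auto intro!: exI[of _ "\<lambda>_. 0"] simp: L2_set_def)
    fix x assume "x \<in> ?B"
    then have x: "nrm N x \<le> sqrt (real N)" by simp
    obtain y where y: "y \<in> T" "nrm N (\<lambda>i. x i - y i) \<le> 1 / (2 * Mk p * 2 ^ p) * sqrt (real N)" using net[OF x] by blast
    have Mp: "Mk p > 0" using Mk(1)[of p] by simp
    have S0: "S \<ge> 0" using order_trans[OF abs_ge_zero S[OF x]] .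
    have "\<bar>Ham N p J x - Ham N p J y\<bar> \<le> Mk p * (2 ^ p * S) / sqrt (real N) * nrm N (\<lambda>i. x i - y i)"
      using x y T by (intro lip_bound[OF pol_Ham, of N "2 * sqrt (real N)"] S2 sN) auto
    also have "\<dots> \<le> Mk p * (2 ^ p * S) / sqrt (real N) * (1 / (2 * Mk p * 2 ^ p) * sqrt (real N))"
      using y(2) S0 Mp by (intro mult_left_mono) auto
    also have "\<dots> = S / 2" using Mp sN by (simp add: field_simps)
    finally show "\<bar>Ham N p J x\<bar> \<le> t * real N + (SUP x\<in>?B. \<bar>Ham N p J x\<bar>) / 2"
      using H[OF y(1)] unfolding S_def by linarith
  qed
  then have "S \<le> 2 * t * real N" by simp
  show ?thesis unfolding Hbounded_def
  proof (intro allI impI)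
    fix y assume "nrm N y \<le> 4 * sqrt (real N)"
    then have "\<bar>Ham N p J y\<bar> \<le> 4 ^ p * S" by (intro S2) auto
    also have "\<dots> \<le> 4 ^ p * (2 * t * real N)" using \<open>S \<le> 2 * t * real N\<close> by (intro mult_left_mono) auto
    finally show "\<bar>Ham N p J y\<bar> \<le> 4 ^ p * (2 * t) * real N" by simp
  qed
qed

lemma hess_Ham_bound:
  assumes "Hbounded N p J C" "N \<ge> 1" "nrm N x \<le> 2 * sqrt (real N)"
  shows "\<bar>bil N (\<lambda>i j. pd i (pd j (Ham N p J)) x) u w\<bar> \<le> Mk p * C / 2 * nrm N u * nrm N w"
proof -
  have "\<bar>bil N (\<lambda>i j. pd i (pd j (Ham N p J)) x) u w\<bar> \<le> 2 * Mk p * (C * real N) / (2 * sqrt (real N))\<^sup>2 * nrm N u * nrm N w"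
    using assms by (intro hess_bound[OF pol_Ham, where R="4 * sqrt (real N)"]) (auto simp: Hbounded_def)
  also have "2 * Mk p * (C * real N) / (2 * sqrt (real N))\<^sup>2 = Mk p * C / 2" using assms(2) by (simp add: power_mult_distrib)
  finally show ?thesis .
qed

lemma grad_Ham_bound:
  assumes "Hbounded N p J C" "N \<ge> 1" "nrm N x \<le> 2 * sqrt (real N)"
  shows "nrm N (\<lambda>i. pd i (Ham N p J) x) \<le> Mk p * C / 2 * sqrt (real N)"
proof -
  have "nrm N (\<lambda>i. pd i (Ham N p J) x) \<le> Mk p * (C * real N) / (2 * sqrt (real N))"
    using assms by (intro grad_bound[OF pol_Ham, where R="4 * sqrt (real N)"]) (auto simp: Hbounded_def)
  also have "\<dots> = Mk p * C / 2 * sqrt (real N)" using assms(2) by (simp add: field_simps)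
  finally show ?thesis .
qed

lemma Hbounded_nonneg: "Hbounded N p J C \<Longrightarrow> N \<ge> 1 \<Longrightarrow> C \<ge> 0"
proof -
  assume "Hbounded N p J C" "N \<ge> 1"
  then have "\<bar>Ham N p J (\<lambda>_. 0)\<bar> \<le> C * real N" unfolding Hbounded_def by (simp add: L2_set_def)
  then have "0 \<le> C * real N" using abs_ge_zero order_trans by blast
  then show ?thesis using \<open>N \<ge> 1\<close> by (simp add: zero_le_mult_iff)
qed

lemma trH_frobH_bound:
  assumes "Hbounded N p J C" "N \<ge> 1" "nrm N x \<le> 2 * sqrt (real N)"
  shows "\<bar>trH N p J x\<bar> \<le> real N * (Mk p * C / 2)" "frobH N p J x \<le> real N * (Mk p * C / 2)\<^sup>2" "0 \<le> frobH N p J x"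
  using bil_frob_bound[OF hess_Ham_bound[OF assms]] unfolding trH_def frobH_def by (auto intro!: sum_nonneg)

lemma nrm_sphere: "(\<Sum>i<N. (x i)\<^sup>2) = real N \<Longrightarrow> nrm N x = sqrt (real N)"
  by (simp add: L2_set_def)

text \<open>Between the sphere and radius 2 sqrt N there is room for a Cauchy estimate at depth sqrt
  N. The factor sqrt N in the mesh of the net cancels it, and the loss is free of N.\<close>

lemma lip_sphere:
  assumes f: "pol N d f" and N: "N \<ge> 1" and C: "\<And>y. nrm N y \<le> 2 * sqrt (real N) \<Longrightarrow> \<bar>f y\<bar> \<le> C"
    and x: "(\<Sum>i<N. (x i)\<^sup>2) = real N" and y: "(\<Sum>i<N. (y i)\<^sup>2) = real N" and \<delta>: "nrm N (\<lambda>i. x i - y i) \<le> \<delta> * sqrt (real N)"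
  shows "\<bar>f x - f y\<bar> \<le> Mk d * C * \<delta>"
proof -
  have s: "sqrt (real N) > 0" using N by simp
  have C0: "C \<ge> 0" using C[of x] nrm_sphere[OF x] s by (intro order_trans[OF abs_ge_zero C[of x]]) simp
  have "\<bar>f x - f y\<bar> \<le> Mk d * C / sqrt (real N) * nrm N (\<lambda>i. x i - y i)"
    using s nrm_sphere[OF x] nrm_sphere[OF y] by (intro lip_bound[OF f C]) auto
  also have "\<dots> \<le> Mk d * C / sqrt (real N) * (\<delta> * sqrt (real N))"
    using \<delta> s C0 Mk(1)[of d] by (intro mult_left_mono) auto
  also have "\<dots> = Mk d * C * \<delta>" using s by simp
  finally show ?thesis .
qed

section \<open>Almost sure bounds, uniformly over the sphere\<close>

lemma idx_nonempty: "N \<ge> 1 \<Longrightarrow> idx N p \<noteq> {}"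
  by (auto intro!: exI[of _ "replicate p 0"])

lemma Dirac_matrix_sum:
  fixes N :: nat
  shows "(\<Sum>i<N. \<Sum>j<N. (if i = j then 1 else 0 :: real) * f i j) = (\<Sum>i<N. f i i)"
proof -
  have *: "(if i = j then 1 else 0) * f i j = (if i = j then f i i else 0)" for i j by auto
  show ?thesis unfolding * by simp
qed

locale spin_glass = gaussian_family M J "{is. length is = p}"
  for M :: "'a measure" and J :: "'a \<Rightarrow> nat list \<Rightarrow> real" and p :: nat +
  assumes p: "p \<ge> 3"
begin

text \<open>The Hilbert-Schmidt norm of the Hessian is a norm composed with a linear map of the
  disorder, hence convex, with Lipschitz constant of order N^(-1/2). It concentrates about its mean.
  The mean square is known exactly and the variance is at most of order 1/N, so the squared mean
  divided by N is close to p(p-1).\<close>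

lemma frobH_event:
  assumes \<eta>: "0 < \<eta>" "\<eta> \<le> 1" and A: "A \<ge> 1"
  shows "\<exists>N0\<ge>1. \<forall>N\<ge>N0. \<forall>T. finite T \<longrightarrow> real (card T) \<le> A ^ N \<longrightarrow> T \<subseteq> {x. (\<Sum>i<N. (x i)\<^sup>2) = real N} \<longrightarrow>
    (\<exists>B\<in>events. prob B \<le> 2 * exp (- real N) \<and>
      (\<forall>d\<in>space M - B. \<forall>y\<in>T. \<bar>frobH N p (J d) y / real N - real p * (real p - 1)\<bar> \<le> \<eta> * (2 * (real p * (real p - 1)) + 4)))"
proof -
  define c where "c = real p * (real p - 1)"
  have c: "c \<ge> 1" "c = real p * real (p - 1)" using p unfolding c_def by (auto simp: of_nat_diff intro: mult_ge1_I)
  define K where "K = c * ((real p)\<^sup>2 + 4 * real p + 1) + 2 * exp 2 * c\<^sup>2"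
  obtain N0 where N0: "real N0 \<ge> 8 * c\<^sup>2 * (ln A + 1) / \<eta>\<^sup>2" "real N0 \<ge> K / \<eta>" "N0 \<ge> 1"
  proof -
    obtain n where "real n \<ge> max (8 * c\<^sup>2 * (ln A + 1) / \<eta>\<^sup>2) (K / \<eta>)" using real_arch_simple by blast
    then show ?thesis by (intro that[of "max n 1"]) auto
  qed
  show ?thesis
  proof (intro exI[of _ N0] conjI allI impI)
    fix N and T :: "(nat \<Rightarrow> real) set"
    assume N: "N0 \<le> N" and T: "finite T" "real (card T) \<le> A ^ N" "T \<subseteq> {x. (\<Sum>i<N. (x i)\<^sup>2) = real N}"
    have N1: "N \<ge> 1" and Nr: "real N0 \<le> real N" using N N0 by auto
    let ?I = "idx N p"
    let ?al = "\<lambda>y i j is. Hscale N p * pd i (pd j (mon p is)) y"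
    let ?A = "\<lambda>y X i j. pd i (pd j (Ham N p X)) y"
    \<comment> \<open>The norm and not its square, because the norm is Lipschitz in the
      couplings.\<close>
    define F where "F y X = L2_set (\<lambda>(i, j). ?A y X i j) ({..<N} \<times> {..<N})" for y X
    have F2: "(F y X)\<^sup>2 = frobH N p X y" for y X
      unfolding F_def L2_set_def frobH_def by (simp add: sum_nonneg sum.cartesian_product split_beta)
    have F0: "F y X \<ge> 0" for y X unfolding F_def by simp
    \<comment> \<open>The subgradient is given by the normalized Hessian. Where the Hessian
      vanishes, division by zero gives 0, which is a subgradient of the norm as well.\<close>
    define b where "b y Z i j = ?A y Z i j / F y Z" for y Z i j
    define a where "a y is Z = Hscale N p * D2m N p (b y Z) is y" for y "is" Z
    have b1: "(\<Sum>i<N. \<Sum>j<N. (b y Z i j)\<^sup>2) \<le> 1" for y Z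
    proof -
      have "(\<Sum>i<N. \<Sum>j<N. (b y Z i j)\<^sup>2) = (\<Sum>i<N. \<Sum>j<N. (?A y Z i j)\<^sup>2) / (F y Z)\<^sup>2"
        unfolding b_def by (simp add: power_divide sum_divide_distrib)
      also have "\<dots> \<le> 1" unfolding F2 frobH_def by (simp add: divide_le_eq_1)
      finally show ?thesis .
    qed
    have ax: "(\<Sum>is\<in>?I. a y is Z * X is) = (\<Sum>i<N. \<Sum>j<N. b y Z i j * ?A y X i j)" for y Z X
      unfolding bil_Ham_linear a_def by (simp add: mult.commute)
    have sub: "F y X \<ge> F y Z + (\<Sum>is\<in>?I. a y is Z * (X is - Z is))" for y X Z
    proof -
      have "(\<Sum>is\<in>?I. a y is Z * X is) \<le> (\<Sum>(i,j)\<in>{..<N} \<times> {..<N}. \<bar>b y Z i j\<bar> * \<bar>?A y X i j\<bar>)"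
        unfolding ax sum.cartesian_product by (intro sum_mono) (auto simp: abs_mult[symmetric])
      also have "\<dots> \<le> L2_set (\<lambda>(i,j). b y Z i j) ({..<N} \<times> {..<N}) * F y X"
        unfolding F_def split_beta by (rule L2_set_mult_ineq)
      also have "\<dots> \<le> 1 * F y X"
        using b1[of y Z] by (intro mult_right_mono F0) (simp add: L2_set_def sum.cartesian_product split_beta)
      finally have 1: "(\<Sum>is\<in>?I. a y is Z * X is) \<le> F y X" by simp
      have "(\<Sum>is\<in>?I. a y is Z * Z is) = (F y Z)\<^sup>2 / F y Z"
        unfolding ax F2 frobH_def b_def by (simp add: power2_eq_square sum_divide_distrib)
      also have "\<dots> = F y Z" by (simp add: power2_eq_square)
      finally show ?thesis using 1 by (simp add: right_diff_distrib sum_subtractf)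
    qed
    have La: "(\<Sum>is\<in>?I. (a y is Z)\<^sup>2) \<le> (c / sqrt (real N))\<^sup>2" if "y \<in> T" for y Z
    proof -
      have "(\<Sum>is\<in>?I. (a y is Z)\<^sup>2) \<le> (real p * real (p - 1))\<^sup>2 / real N * (\<Sum>i<N. \<Sum>j<N. (b y Z i j)\<^sup>2)"
        unfolding a_def using T that by (intro D2m_coeff_sq_le N1 p) auto
      also have "\<dots> \<le> (real p * real (p - 1))\<^sup>2 / real N * 1" by (intro mult_left_mono b1) auto
      finally show ?thesis unfolding c(2) by (simp add: power_divide)
    qed
    have Am [measurable]: "(\<lambda>X. ?A y X i j) \<in> borel_measurable (gaussn ?I)" for y i j
      unfolding hess_Ham_linear by (rule measurable_linear[OF finite_idx])
    have Fm [measurable]: "F y \<in> borel_measurable (gaussn ?I)" for y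
      unfolding F_def[abs_def] L2_set_def split_beta by measurable
    have am: "a y is \<in> borel_measurable (gaussn ?I)" for y "is"
      unfolding a_def[abs_def] D2m_def b_def by measurable
    have dep: "F y (restrict X ?I) = F y X" for y X
    proof -
      have r: "(\<Sum>is\<in>?I. restrict X ?I is * q is) = (\<Sum>is\<in>?I. X is * q is)" for q by (rule sum.cong) auto
      show ?thesis unfolding F_def hess_Ham_linear r ..
    qed
    have I: "?I \<subseteq> {is. length is = p}" by auto
    note In = idx_nonempty[OF N1, of p]
    have L0: "c / sqrt (real N) > 0" using c(1) N1 by simp
    \<comment> \<open>The exponent is of order N^2 against N for the logarithm of the size of the
      net, so every base \<open>A\<close> is beaten once N is large.\<close>
    have e: "real N * (ln A + 1) \<le> (\<eta> * sqrt (real N))\<^sup>2 / (8 * (c / sqrt (real N))\<^sup>2)"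
    proof -
      have "8 * c\<^sup>2 * (ln A + 1) \<le> real N * \<eta>\<^sup>2"
      proof -
        have "8 * c\<^sup>2 * (ln A + 1) \<le> real N0 * \<eta>\<^sup>2" using N0(1) \<eta> by (simp add: field_simps)
        also have "\<dots> \<le> real N * \<eta>\<^sup>2" using Nr by (intro mult_right_mono) auto
        finally show ?thesis .
      qed
      then have "real N * (8 * c\<^sup>2 * (ln A + 1)) \<le> real N * (real N * \<eta>\<^sup>2)" by (rule mult_left_mono) simp
      moreover have "(\<eta> * sqrt (real N))\<^sup>2 / (8 * (c / sqrt (real N))\<^sup>2) = (real N * (real N * \<eta>\<^sup>2)) / (8 * c\<^sup>2)"
        using c(1) N1 by (simp add: power_mult_distrib power_divide)
      moreover have "0 < 8 * c\<^sup>2" using c(1) by simp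
      ultimately show ?thesis by (simp only: pos_le_divide_eq mult_ac)
    qed
    have "\<exists>B\<in>events. prob B \<le> 2 * exp (- real N) \<and> (\<forall>d\<in>space M - B. \<forall>y\<in>T. \<bar>F y (J d) - expectation (\<lambda>d. F y (J d))\<bar> < \<eta> * sqrt (real N))"
      by (rule net_event[OF finite_idx I In T(1,2) A, where a=a and L="c / sqrt (real N)", OF Fm am sub La L0 dep _ e])
         (use \<eta> in simp_all)
    then obtain B where B: "B \<in> events" "prob B \<le> 2 * exp (- real N)" "\<And>d y. d \<in> space M - B \<Longrightarrow> y \<in> T \<Longrightarrow> \<bar>F y (J d) - expectation (\<lambda>d. F y (J d))\<bar> < \<eta> * sqrt (real N)"
      by blast
    have mean: "\<bar>(expectation (\<lambda>d. F y (J d)))\<^sup>2 / real N - c\<bar> \<le> \<eta>" if y: "y \<in> T" for y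
    proof -
      let ?E = "expectation (\<lambda>d. F y (J d))"
      note cc = concentration[OF finite_idx I In, where F="F y" and a="a y" and L="c / sqrt (real N)", OF Fm am sub La[OF y] L0 dep]
      have y2: "(\<Sum>i<N. (y i)\<^sup>2) = real N" using T y by auto
      have fi: "integrable M (\<lambda>d. (F y (J d))\<^sup>2)"
        unfolding F2 frobH_def hess_Ham_linear
        by (intro Bochner_Integration.integrable_sum expectation_linear_sq finite_idx I)
      have "expectation (\<lambda>d. (F y (J d))\<^sup>2) = (\<Sum>i<N. \<Sum>j<N. \<Sum>is\<in>?I. (?al y i j is)\<^sup>2)"
        unfolding F2 frobH_def hess_Ham_linear
        by (simp add: Bochner_Integration.integral_sum expectation_linear_sq[OF finite_idx I])
      also have "\<dots> = (Hscale N p)\<^sup>2 * (\<Sum>i<N. \<Sum>j<N. \<Sum>is\<in>?I. (pd i (pd j (mon p is)) y)\<^sup>2)"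
        by (simp add: power_mult_distrib sum_distrib_left)
      also have "\<dots> = ((Hscale N p)\<^sup>2 * real N ^ (p - 1)) * (c / real N * (real (p - 2) * real (p - 3) + real (p - 2) * (2 * real N + 2) + (real N)\<^sup>2 + real N))"
      proof -
        have "p - 1 = Suc (p - 2)" using p by simp
        then show ?thesis unfolding sum_hess_mon_sq[OF p] y2 c(2) using N1 by (simp add: mult_ac)
      qed
      finally have EF2: "expectation (\<lambda>d. (F y (J d))\<^sup>2) = c / real N * (real (p - 2) * real (p - 3) + real (p - 2) * (2 * real N + 2) + (real N)\<^sup>2 + real N)"
        using Hscale_sq[of N p] N1 p by simp
      have v: "variance (\<lambda>d. F y (J d)) = expectation (\<lambda>d. (F y (J d))\<^sup>2) - ?E\<^sup>2"
        by (rule variance_eq[OF cc(1) fi])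
      have v2: "0 \<le> variance (\<lambda>d. F y (J d))" by (rule variance_positive)
      have v3: "variance (\<lambda>d. F y (J d)) \<le> 2 * exp 2 * c\<^sup>2 / real N" using cc(4) by (simp add: power_divide)
      define R where "R = real (p - 2) * real (p - 3) + real (p - 2) * (2 * real N + 2) + real N"
      have R: "0 \<le> R" "R \<le> ((real p)\<^sup>2 + 4 * real p + 1) * real N"
      proof -
        show "0 \<le> R" unfolding R_def by simp
        have "real (p - 2) * real (p - 3) \<le> real p * real p" by (intro mult_mono) auto
        also have "\<dots> \<le> (real p)\<^sup>2 * real N" using mult_left_mono[of 1 "real N" "(real p)\<^sup>2"] N1 by (simp add: power2_eq_square)
        finally have 1: "real (p - 2) * real (p - 3) \<le> (real p)\<^sup>2 * real N" .
        have "real (p - 2) * (2 * real N + 2) \<le> real p * (4 * real N)" using N1 by (intro mult_mono) auto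
        then show "R \<le> ((real p)\<^sup>2 + 4 * real p + 1) * real N" unfolding R_def using 1 by (simp add: algebra_simps)
      qed
      have q: "real (p - 2) * real (p - 3) + real (p - 2) * (2 * real N + 2) + (real N)\<^sup>2 + real N = R + (real N)\<^sup>2"
        unfolding R_def by simp
      have "?E\<^sup>2 = c / real N * (R + (real N)\<^sup>2) - variance (\<lambda>d. F y (J d))"
        using v unfolding EF2 q by linarith
      then have "?E\<^sup>2 / real N = c / (real N * real N) * (R + (real N)\<^sup>2) - variance (\<lambda>d. F y (J d)) / real N"
        by (simp only: diff_divide_distrib) simp
      also have "\<dots> = c + (c * R / (real N * real N) - variance (\<lambda>d. F y (J d)) / real N)"
        using N1 by (simp add: distrib_left power2_eq_square)
      finally have eq: "?E\<^sup>2 / real N - c = c * R / (real N * real N) - variance (\<lambda>d. F y (J d)) / real N" by simp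
      have u1: "c * R / (real N * real N) \<le> c * ((real p)\<^sup>2 + 4 * real p + 1) / real N"
      proof -
        have "c * R \<le> c * (((real p)\<^sup>2 + 4 * real p + 1) * real N)" using R c by (intro mult_left_mono) auto
        then have "c * R / (real N * real N) \<le> c * (((real p)\<^sup>2 + 4 * real p + 1) * real N) / (real N * real N)" by (intro divide_right_mono) auto
        then show ?thesis using N1 by (simp add: mult.assoc)
      qed
      have u2: "variance (\<lambda>d. F y (J d)) / real N \<le> 2 * exp 2 * c\<^sup>2 / real N"
      proof -
        have "2 * exp 2 * c\<^sup>2 / real N \<le> 2 * exp 2 * c\<^sup>2 / 1" using N1 by (intro divide_left_mono) auto
        then show ?thesis using v3 by (intro divide_right_mono) auto
      qed
      have u3: "0 \<le> c * R / (real N * real N)" "0 \<le> variance (\<lambda>d. F y (J d)) / real N" using R c v2 by auto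
      have "c * ((real p)\<^sup>2 + 4 * real p + 1) / real N + 2 * exp 2 * c\<^sup>2 / real N = K / real N"
        unfolding K_def by (simp add: add_divide_distrib)
      also have "\<dots> \<le> \<eta>"
      proof -
        have "K / \<eta> \<le> real N" using N0(2) Nr by linarith
        then show ?thesis using \<eta> N1 by (simp add: field_simps)
      qed
      finally have u4: "c * ((real p)\<^sup>2 + 4 * real p + 1) / real N + 2 * exp 2 * c\<^sup>2 / real N \<le> \<eta>" .
      have "0 \<le> c * ((real p)\<^sup>2 + 4 * real p + 1) / real N" "0 \<le> 2 * exp 2 * c\<^sup>2 / real N" using c by auto
      then show ?thesis unfolding eq using u1 u2 u3 u4 by linarith
    qed
    have "\<bar>frobH N p (J d) y / real N - c\<bar> \<le> \<eta> * (2 * c + 4)" if d: "d \<in> space M - B" "y \<in> T" for d y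
    proof -
      define f m where "f = F y (J d) / sqrt (real N)" and "m = expectation (\<lambda>d. F y (J d)) / sqrt (real N)"
      have s: "sqrt (real N) > 0" using N1 by simp
      have fm: "\<bar>f - m\<bar> \<le> \<eta>"
        using B(3)[OF d] s unfolding f_def m_def by (simp add: diff_divide_distrib[symmetric] field_simps)
      have m2: "\<bar>m\<^sup>2 - c\<bar> \<le> \<eta>" using mean[OF d(2)] unfolding m_def by (simp add: power_divide)
      have m0: "0 \<le> m" unfolding m_def using F0 by (simp add: integral_nonneg_AE)
      have "m\<^sup>2 \<le> c + 1" using m2 \<eta> by linarith
      also have "\<dots> \<le> (c + 1)\<^sup>2" using c(1) by (simp add: power2_eq_square algebra_simps)
      finally have m1: "m \<le> c + 1" using c(1) by (intro power2_le_imp_le[of m "c + 1"]) auto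
      \<comment> \<open>Back from the norm to its square: |f^2 - m^2| \<le> \<eta> (2c + 3), and one
        more \<eta> for m^2 versus c gives the constant 2c + 4.\<close>
      have "f\<^sup>2 - m\<^sup>2 = (f - m) * ((f - m) + 2 * m)" by (simp add: power2_eq_square algebra_simps)
      then have "\<bar>f\<^sup>2 - m\<^sup>2\<bar> = \<bar>f - m\<bar> * \<bar>(f - m) + 2 * m\<bar>" by (simp add: abs_mult)
      also have "\<dots> \<le> \<eta> * (\<eta> + 2 * (c + 1))" using fm m0 m1 \<eta> by (intro mult_mono) auto
      also have "\<dots> \<le> \<eta> * (1 + 2 * (c + 1))" using \<eta> by (intro mult_left_mono) auto
      finally have "\<bar>f\<^sup>2 - c\<bar> \<le> \<eta> * (1 + 2 * (c + 1)) + \<eta>" using m2 by linarith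
      moreover have "f\<^sup>2 = frobH N p (J d) y / real N" unfolding f_def F2[symmetric] by (simp add: power_divide)
      ultimately show ?thesis by (simp add: algebra_simps)
    qed
    then show "\<exists>B\<in>events. prob B \<le> 2 * exp (- real N) \<and>
      (\<forall>d\<in>space M - B. \<forall>y\<in>T. \<bar>frobH N p (J d) y / real N - real p * (real p - 1)\<bar> \<le> \<eta> * (2 * (real p * (real p - 1)) + 4))"
      using B(1,2) unfolding c_def by blast
  qed (rule N0)
qed


lemma idx_sub: "idx N p \<subseteq> {is. length is = p}" by auto

text \<open>Variance N against deviations t N gives an exponent only linear in N, the same order as
  the logarithm of the size of the net. Hence the mesh is fixed beforehand and \<open>t\<close> is
  chosen large in terms of the base \<open>A\<close>.\<close>

lemma AE_Hbounded: "\<exists>C>0. AE d in M. eventually (\<lambda>N. Hbounded N p (J d) C) sequentially"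
proof -
  define \<delta> where "\<delta> = 1 / (2 * Mk p * 2 ^ p)"
  have \<delta>: "\<delta> > 0" using Mk(1)[of p] unfolding \<delta>_def by simp
  obtain A where A: "A \<ge> 1" "\<And>N S. S \<subseteq> {x. nrm N x \<le> sqrt (real N)} \<Longrightarrow>
     (\<exists>T\<subseteq>S. finite T \<and> real (card T) \<le> A ^ N \<and> (\<forall>x\<in>S. \<exists>y\<in>T. nrm N (\<lambda>i. x i - y i) \<le> \<delta> * sqrt (real N)))"
    using sphere_net[OF \<delta>] by blast
  define t where "t = sqrt (8 * (ln A + 1))"
  have "0 < 8 * (ln A + 1)" using ln_ge_zero[OF A(1)] by (intro mult_pos_pos add_nonneg_pos) auto
  then have t: "t > 0" "t\<^sup>2 = 8 * (ln A + 1)" unfolding t_def by (auto intro: real_sqrt_pow2)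
  have "AE d in M. eventually (\<lambda>N. Hbounded N p (J d) (4 ^ p * (2 * t))) sequentially"
  proof (rule AE_eventually_outside[of 1])
    fix N :: nat assume N: "1 \<le> N"
    let ?S = "{x. nrm N x \<le> sqrt (real N)}"
    obtain T where T: "T \<subseteq> ?S" "finite T" "real (card T) \<le> A ^ N" "\<And>x. x \<in> ?S \<Longrightarrow> \<exists>y\<in>T. nrm N (\<lambda>i. x i - y i) \<le> \<delta> * sqrt (real N)"
      using A(2)[OF order_refl, of N] by blast
    have "\<exists>B\<in>events. prob B \<le> 2 * exp (- real N) \<and> (\<forall>d\<in>space M - B. \<forall>y\<in>T. \<bar>\<Sum>is\<in>idx N p. J d is * (Hscale N p * mon p is y)\<bar> < t * real N)"
    proof (rule net_event_linear[OF finite_idx idx_sub idx_nonempty[OF N] T(2,3) A(1), where L="sqrt (real N)"])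
      show "(\<Sum>is\<in>idx N p. (Hscale N p * mon p is y)\<^sup>2) \<le> (sqrt (real N))\<^sup>2" if "y \<in> T" for y
        using T(1) that p N by (intro Ham_coeff_sq_le) auto
      show "real N * (ln A + 1) \<le> (t * real N)\<^sup>2 / (8 * (sqrt (real N))\<^sup>2)"
        using t(2) N by (simp add: power_mult_distrib) (simp add: power2_eq_square)
    qed (use t N in auto)
    then obtain B where B: "B \<in> events" "prob B \<le> 2 * exp (- real N)" "\<And>d y. d \<in> space M - B \<Longrightarrow> y \<in> T \<Longrightarrow> \<bar>Ham N p (J d) y\<bar> < t * real N"
      unfolding Ham_linear by blast
    have "Hbounded N p (J d) (4 ^ p * (2 * t))" if "d \<in> space M - B" for d
      using T(1) T(4)[unfolded \<delta>_def] B(3)[OF that] p t N by (intro Hbounded_of_net[of _ _ t T]) (auto simp: less_imp_le)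
    then show "\<exists>B\<in>events. prob B \<le> 2 * exp (- real N) \<and> (\<forall>d\<in>space M - B. Hbounded N p (J d) (4 ^ p * (2 * t)))"
      using B by blast
  qed
  then show ?thesis using t by (intro exI[of _ "4 ^ p * (2 * t)"]) auto
qed

text \<open>At each point the trace is centred with variance of order 1. The extension from the net
  to the sphere uses the Lipschitz bound supplied by \<open>Hbounded\<close>, which is kept as a
  premise inside so that the probability estimate concerns the net alone.\<close>

lemma AE_trH:
  assumes \<epsilon>: "\<epsilon> > 0"
  shows "AE d in M. eventually (\<lambda>N. Hbounded N p (J d) C \<longrightarrow> (\<forall>x. (\<Sum>i<N. (x i)\<^sup>2) = real N \<longrightarrow> \<bar>trH N p (J d) x\<bar> \<le> \<epsilon> * real N)) sequentially"
proof -
  define D where "D = Mk p * (Mk p * \<bar>C\<bar> / 2) + 1"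
  have D: "D > 0" using Mk(1)[of p] unfolding D_def by (intro add_nonneg_pos) auto
  define \<delta> where "\<delta> = \<epsilon> / (2 * D)"
  have \<delta>: "\<delta> > 0" using \<epsilon> D unfolding \<delta>_def by simp
  obtain A where A: "A \<ge> 1" "\<And>N S. S \<subseteq> {x. nrm N x \<le> sqrt (real N)} \<Longrightarrow>
     (\<exists>T\<subseteq>S. finite T \<and> real (card T) \<le> A ^ N \<and> (\<forall>x\<in>S. \<exists>y\<in>T. nrm N (\<lambda>i. x i - y i) \<le> \<delta> * sqrt (real N)))"
    using sphere_net[OF \<delta>] by blast
  define c where "c = real p * real (p - 1)"
  have c: "c > 0" using p unfolding c_def by auto
  obtain N0 :: nat where N0: "real N0 \<ge> 32 * c\<^sup>2 * (ln A + 1) / \<epsilon>\<^sup>2" using real_arch_simple by blast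
  show ?thesis
  proof (rule AE_eventually_outside[of "max 1 N0"])
    fix N :: nat assume "max 1 N0 \<le> N"
    then have N: "1 \<le> N" "real N \<ge> 32 * c\<^sup>2 * (ln A + 1) / \<epsilon>\<^sup>2" using N0 by auto
    let ?S = "{x. (\<Sum>i<N. (x i)\<^sup>2) = real N}"
    have S: "?S \<subseteq> {x. nrm N x \<le> sqrt (real N)}" using nrm_sphere by auto
    obtain T where T: "T \<subseteq> ?S" "finite T" "real (card T) \<le> A ^ N" "\<And>x. x \<in> ?S \<Longrightarrow> \<exists>y\<in>T. nrm N (\<lambda>i. x i - y i) \<le> \<delta> * sqrt (real N)"
      using A(2)[OF S] by blast
    let ?b = "\<lambda>i j. if i = j then 1 else 0 :: real"
    have "\<exists>B\<in>events. prob B \<le> 2 * exp (- real N) \<and> (\<forall>d\<in>space M - B. \<forall>y\<in>T. \<bar>\<Sum>is\<in>idx N p. J d is * (Hscale N p * D2m N p ?b is y)\<bar> < \<epsilon> / 2 * real N)"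
    proof (rule net_event_linear[OF finite_idx idx_sub idx_nonempty[OF N(1)] T(2,3) A(1), where L=c])
      show "(\<Sum>is\<in>idx N p. (Hscale N p * D2m N p ?b is y)\<^sup>2) \<le> c\<^sup>2" if "y \<in> T" for y
      proof -
        have "(\<Sum>is\<in>idx N p. (Hscale N p * D2m N p ?b is y)\<^sup>2) \<le> c\<^sup>2 / real N * (\<Sum>i<N. \<Sum>j<N. (?b i j)\<^sup>2)"
          unfolding c_def using T(1) that p N by (intro D2m_coeff_sq_le) auto
        also have "(\<Sum>i<N. \<Sum>j<N. (?b i j)\<^sup>2) = real N" unfolding power2_eq_square Dirac_matrix_sum by simp
        finally show ?thesis using N by simp
      qed
      have "32 * c\<^sup>2 * (ln A + 1) \<le> real N * \<epsilon>\<^sup>2" using N(2) \<epsilon> by (simp add: pos_divide_le_eq)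
      then have "real N * (32 * c\<^sup>2 * (ln A + 1)) \<le> real N * (real N * \<epsilon>\<^sup>2)" by (rule mult_left_mono) simp
      moreover have "(\<epsilon> / 2 * real N)\<^sup>2 / (8 * c\<^sup>2) = real N * (real N * \<epsilon>\<^sup>2) / (32 * c\<^sup>2)" by (simp add: power2_eq_square)
      moreover have "0 < 32 * c\<^sup>2" using c by simp
      ultimately show "real N * (ln A + 1) \<le> (\<epsilon> / 2 * real N)\<^sup>2 / (8 * c\<^sup>2)" by (simp only: pos_le_divide_eq mult_ac)
    qed (use c \<epsilon> in auto)
    then obtain B where B: "B \<in> events" "prob B \<le> 2 * exp (- real N)" "\<And>d y. d \<in> space M - B \<Longrightarrow> y \<in> T \<Longrightarrow> \<bar>trH N p (J d) y\<bar> < \<epsilon> / 2 * real N"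
      unfolding bil_Ham_linear[symmetric] Dirac_matrix_sum trH_def by blast
    have "\<bar>trH N p (J d) x\<bar> \<le> \<epsilon> * real N" if d: "d \<in> space M - B" and H: "Hbounded N p (J d) C" and x: "(\<Sum>i<N. (x i)\<^sup>2) = real N" for d x
    proof -
      obtain y where y: "y \<in> T" "nrm N (\<lambda>i. x i - y i) \<le> \<delta> * sqrt (real N)" using T(4) x by blast
      have "\<bar>trH N p (J d) x - trH N p (J d) y\<bar> \<le> Mk p * (real N * (Mk p * C / 2)) * \<delta>"
        using y T(1) x by (intro lip_sphere[OF pol_trH N(1) trH_frobH_bound(1)[OF H N(1)]]) auto
      also have "\<dots> = real N * (Mk p * (Mk p * C / 2) * \<delta>)" by simp
      also have "\<dots> \<le> real N * (D * \<delta>)"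
        unfolding D_def using \<delta> Mk(1)[of p] Hbounded_nonneg[OF H N(1)] by (intro mult_left_mono mult_right_mono) auto
      also have "D * \<delta> = \<epsilon> / 2" using D unfolding \<delta>_def by simp
      finally have "\<bar>trH N p (J d) x - trH N p (J d) y\<bar> \<le> \<epsilon> / 2 * real N" by (simp add: mult.commute)
      moreover have "\<bar>trH N p (J d) x\<bar> \<le> \<bar>trH N p (J d) x - trH N p (J d) y\<bar> + \<bar>trH N p (J d) y\<bar>" by linarith
      moreover have "\<epsilon> * real N = \<epsilon> / 2 * real N + \<epsilon> / 2 * real N" by simp
      ultimately show ?thesis using B(3)[OF d y(1)] by linarith
    qed
    then show "\<exists>B\<in>events. prob B \<le> 2 * exp (- real N) \<and> (\<forall>d\<in>space M - B. Hbounded N p (J d) C \<longrightarrow> (\<forall>x. (\<Sum>i<N. (x i)\<^sup>2) = real N \<longrightarrow> \<bar>trH N p (J d) x\<bar> \<le> \<epsilon> * real N))"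
      using B(1,2) by blast
  qed
qed

text \<open>Half of \<epsilon> pays for the deviation at the points of the net, half for the passage
  from the net to the sphere.\<close>

lemma AE_frobH:
  assumes \<epsilon>: "\<epsilon> > 0"
  shows "AE d in M. eventually (\<lambda>N. Hbounded N p (J d) C \<longrightarrow> (\<forall>x. (\<Sum>i<N. (x i)\<^sup>2) = real N \<longrightarrow> \<bar>frobH N p (J d) x / real N - real p * (real p - 1)\<bar> \<le> \<epsilon>)) sequentially"
proof -
  define D where "D = Mk (2 * p) * (Mk p * \<bar>C\<bar> / 2)\<^sup>2 + 1"
  have D: "D > 0" using Mk(1)[of "2 * p"] unfolding D_def by (intro add_nonneg_pos) auto
  define \<delta> where "\<delta> = \<epsilon> / (2 * D)"
  have \<delta>: "\<delta> > 0" using \<epsilon> D unfolding \<delta>_def by simp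
  obtain A where A: "A \<ge> 1" "\<And>N S. S \<subseteq> {x. nrm N x \<le> sqrt (real N)} \<Longrightarrow>
     (\<exists>T\<subseteq>S. finite T \<and> real (card T) \<le> A ^ N \<and> (\<forall>x\<in>S. \<exists>y\<in>T. nrm N (\<lambda>i. x i - y i) \<le> \<delta> * sqrt (real N)))"
    using sphere_net[OF \<delta>] by blast
  define c where "c = 2 * (real p * (real p - 1)) + 4"
  have c: "c > 0" using p unfolding c_def by (intro add_nonneg_pos) auto
  define \<eta> where "\<eta> = min 1 (\<epsilon> / (2 * c))"
  have \<eta>: "0 < \<eta>" "\<eta> \<le> 1" "\<eta> * c \<le> \<epsilon> / 2"
  proof -
    have "\<eta> * c \<le> \<epsilon> / (2 * c) * c" unfolding \<eta>_def using c by (intro mult_right_mono) auto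
    then show "\<eta> * c \<le> \<epsilon> / 2" using c by simp
  qed (use \<epsilon> c in \<open>auto simp: \<eta>_def\<close>)
  have "\<exists>N0\<ge>1. \<forall>N\<ge>N0. \<forall>T. finite T \<longrightarrow> real (card T) \<le> A ^ N \<longrightarrow> T \<subseteq> {x. (\<Sum>i<N. (x i)\<^sup>2) = real N} \<longrightarrow>
    (\<exists>B\<in>events. prob B \<le> 2 * exp (- real N) \<and> (\<forall>d\<in>space M - B. \<forall>y\<in>T. \<bar>frobH N p (J d) y / real N - real p * (real p - 1)\<bar> \<le> \<eta> * c))"
    unfolding c_def by (rule frobH_event[OF \<eta>(1,2) A(1)])
  then obtain N0 where N0: "N0 \<ge> 1" and N0': "\<forall>N\<ge>N0. \<forall>T. finite T \<longrightarrow> real (card T) \<le> A ^ N \<longrightarrow> T \<subseteq> {x. (\<Sum>i<N. (x i)\<^sup>2) = real N} \<longrightarrow>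
    (\<exists>B\<in>events. prob B \<le> 2 * exp (- real N) \<and> (\<forall>d\<in>space M - B. \<forall>y\<in>T. \<bar>frobH N p (J d) y / real N - real p * (real p - 1)\<bar> \<le> \<eta> * c))"
    by (elim exE conjE)
  show ?thesis
  proof (rule AE_eventually_outside[of N0])
    fix N :: nat assume NN: "N0 \<le> N"
    then have N: "1 \<le> N" using N0 by auto
    let ?S = "{x. (\<Sum>i<N. (x i)\<^sup>2) = real N}"
    have S: "?S \<subseteq> {x. nrm N x \<le> sqrt (real N)}" using nrm_sphere by auto
    obtain T where T: "T \<subseteq> ?S" "finite T" "real (card T) \<le> A ^ N" "\<And>x. x \<in> ?S \<Longrightarrow> \<exists>y\<in>T. nrm N (\<lambda>i. x i - y i) \<le> \<delta> * sqrt (real N)"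
      using A(2)[OF S] by blast
    obtain B where B: "B \<in> events" "prob B \<le> 2 * exp (- real N)" "\<And>d y. d \<in> space M - B \<Longrightarrow> y \<in> T \<Longrightarrow> \<bar>frobH N p (J d) y / real N - real p * (real p - 1)\<bar> \<le> \<eta> * c"
      using N0'[rule_format, OF NN T(2,3,1)] by (elim bexE conjE) blast
    have "\<bar>frobH N p (J d) x / real N - real p * (real p - 1)\<bar> \<le> \<epsilon>" if d: "d \<in> space M - B" and H: "Hbounded N p (J d) C" and x: "(\<Sum>i<N. (x i)\<^sup>2) = real N" for d x
    proof -
      obtain y where y: "y \<in> T" "nrm N (\<lambda>i. x i - y i) \<le> \<delta> * sqrt (real N)" using T(4) x by blast
      have "\<bar>frobH N p (J d) x / real N - frobH N p (J d) y / real N\<bar> \<le> Mk (2 * p) * (Mk p * C / 2)\<^sup>2 * \<delta>"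
      proof (rule lip_sphere[OF pol_divide[OF pol_frobH] N])
        show "\<bar>frobH N p (J d) z / real N\<bar> \<le> (Mk p * C / 2)\<^sup>2" if "nrm N z \<le> 2 * sqrt (real N)" for z
          using trH_frobH_bound(2,3)[OF H N that] N by (simp add: pos_divide_le_eq mult.commute)
      qed (use x y T in auto)
      also have "\<dots> \<le> D * \<delta>"
        unfolding D_def using \<delta> Mk(1)[of p] Hbounded_nonneg[OF H N] by (intro mult_right_mono) auto
      also have "D * \<delta> = \<epsilon> / 2" using D unfolding \<delta>_def by simp
      finally show ?thesis using B(3)[OF d y(1)] \<eta>(3) by linarith
    qed
    then show "\<exists>B\<in>events. prob B \<le> 2 * exp (- real N) \<and> (\<forall>d\<in>space M - B. Hbounded N p (J d) C \<longrightarrow> (\<forall>x. (\<Sum>i<N. (x i)\<^sup>2) = real N \<longrightarrow> \<bar>frobH N p (J d) x / real N - real p * (real p - 1)\<bar> \<le> \<epsilon>))"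
      using B(1,2) by blast
  qed
qed

end

section \<open>Concentration of the supremum of |G|\<close>

lemma pol_continuous: "pol N d f \<Longrightarrow> continuous_on UNIV f"
proof (induction rule: pol.induct)
  case (pol_var i d)
  show ?case by (rule continuous_on_product_coordinates)
qed (auto intro: continuous_intros)

context gaussian_family
begin

definition lform :: "'i set \<Rightarrow> (nat \<Rightarrow> 'i \<Rightarrow> real) \<Rightarrow> nat \<Rightarrow> ('i \<Rightarrow> real) \<Rightarrow> real" where
  "lform I c m X = (\<Sum>i\<in>I. X i * c m i)"

text \<open>A maximum of linear forms is convex, and the coefficient vector of a maximizer is a
  subgradient. Choosing the least maximizing index makes this selection measurable.\<close>

lemma max_linear_concentration:
  assumes fin: "finite I" "I \<subseteq> S" "I \<noteq> {}"
    and L: "\<And>m. (\<Sum>i\<in>I. (c m i)\<^sup>2) \<le> L\<^sup>2" "L > 0"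
  shows "integrable M (\<lambda>d. Max ((\<lambda>m. lform I c m (J d)) ` {..n}))"
    and "e \<ge> 0 \<Longrightarrow> prob {d\<in>space M. Max ((\<lambda>m. lform I c m (J d)) ` {..n}) - expectation (\<lambda>d. Max ((\<lambda>m. lform I c m (J d)) ` {..n})) \<ge> e} \<le> exp (- (e\<^sup>2 / (8 * L\<^sup>2)))"
proof -
  define F where "F X = Max ((\<lambda>m. lform I c m X) ` {..n})" for X
  define k where "k Z = (LEAST m. m \<le> n \<and> lform I c m Z = F Z)" for Z
  define a where "a i Z = c (k Z) i" for i Z
  have [measurable]: "lform I c m \<in> borel_measurable (gaussn I)" for m
    unfolding lform_def[abs_def] by (rule measurable_linear[OF fin(1)])
  have [measurable]: "F \<in> borel_measurable (gaussn I)"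
    unfolding F_def[abs_def] by (rule borel_measurable_Max) auto
  have [measurable]: "k \<in> measurable (gaussn I) (count_space UNIV)"
  proof -
    have "Measurable.pred (gaussn I) (\<lambda>Z. m \<le> n \<and> lform I c m Z = F Z)" for m
      unfolding pred_def by (cases "m \<le> n") (auto intro: borel_measurable_eq)
    then show ?thesis unfolding k_def[abs_def] by (rule measurable_Least)
  qed
  have am: "a i \<in> borel_measurable (gaussn I)" for i
    unfolding a_def[abs_def] by (rule measurable_compose[of k _ "count_space UNIV"]) auto
  have k: "k Z \<le> n \<and> lform I c (k Z) Z = F Z" for Z
  proof -
    have "F Z \<in> (\<lambda>m. lform I c m Z) ` {..n}" unfolding F_def by (rule Max_in) auto
    then obtain m where "m \<le> n \<and> lform I c m Z = F Z" by auto
    then show ?thesis unfolding k_def by (rule LeastI)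
  qed
  have sub: "F X \<ge> F Z + (\<Sum>i\<in>I. a i Z * (X i - Z i))" for X Z
  proof -
    have "(\<Sum>i\<in>I. a i Z * (X i - Z i)) = lform I c (k Z) X - lform I c (k Z) Z"
      unfolding a_def lform_def sum_subtractf[symmetric] by (intro sum.cong) (auto simp: algebra_simps)
    moreover have "lform I c (k Z) X \<le> F X" unfolding F_def using k[of Z] by (intro Max_ge) auto
    ultimately show ?thesis using k[of Z] by simp
  qed
  have dep: "F (restrict X I) = F X" for X
  proof -
    have "lform I c m (restrict X I) = lform I c m X" for m unfolding lform_def by (rule sum.cong) auto
    then show ?thesis unfolding F_def by simp
  qed
  have La: "(\<Sum>i\<in>I. (a i Z)\<^sup>2) \<le> L\<^sup>2" for Z unfolding a_def by (rule L)
  note cc = concentration[OF fin \<open>F \<in> borel_measurable (gaussn I)\<close> am sub La L(2) dep]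
  show "integrable M (\<lambda>d. Max ((\<lambda>m. lform I c m (J d)) ` {..n}))" using cc(1) unfolding F_def .
  show "prob {d\<in>space M. Max ((\<lambda>m. lform I c m (J d)) ` {..n}) - expectation (\<lambda>d. Max ((\<lambda>m. lform I c m (J d)) ` {..n})) \<ge> e} \<le> exp (- (e\<^sup>2 / (8 * L\<^sup>2)))"
    if "e \<ge> 0" using cc(2)[OF that] unfolding F_def .
qed

lemma lform_bound:
  assumes L: "\<And>m. (\<Sum>i\<in>I. (c m i)\<^sup>2) \<le> L\<^sup>2" "L > 0"
  shows "\<bar>lform I c m X\<bar> \<le> L * (\<Sum>i\<in>I. \<bar>X i\<bar>)"
proof -
  have "\<bar>lform I c m X\<bar> \<le> (\<Sum>i\<in>I. \<bar>X i\<bar> * \<bar>c m i\<bar>)"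
    unfolding lform_def by (rule order_trans[OF sum_abs]) (simp add: abs_mult)
  also have "\<dots> \<le> L2_set X I * L2_set (c m) I" by (rule L2_set_mult_ineq)
  also have "\<dots> \<le> (\<Sum>i\<in>I. \<bar>X i\<bar>) * L"
  proof (intro mult_mono L2_set_le_sum_abs)
    show "L2_set (c m) I \<le> L" using real_sqrt_le_mono[OF L(1)[of m]] L(2) by (simp add: L2_set_def)
  qed (auto intro: sum_nonneg)
  finally show ?thesis by (simp add: mult.commute)
qed

text \<open>Limit along increasing finite maxima. In the upper tail their means may be replaced by
  the larger mean of the supremum, so one threshold serves all \<open>n\<close> and the events
  increase.\<close>

lemma sup_linear_concentration:
  assumes fin: "finite I" "I \<subseteq> S" "I \<noteq> {}"
    and L: "\<And>m. (\<Sum>i\<in>I. (c m i)\<^sup>2) \<le> L\<^sup>2" "L > 0" and e: "e \<ge> 0"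
  shows "{d\<in>space M. (SUP m. lform I c m (J d)) > expectation (\<lambda>d. SUP m. lform I c m (J d)) + e} \<in> events"
    and "prob {d\<in>space M. (SUP m. lform I c m (J d)) > expectation (\<lambda>d. SUP m. lform I c m (J d)) + e} \<le> exp (- (e\<^sup>2 / (8 * L\<^sup>2)))"
proof -
  define F where "F d = (SUP m. lform I c m (J d))" for d
  define Fn where "Fn n d = Max ((\<lambda>m. lform I c m (J d)) ` {..n})" for n d
  have lb: "\<bar>lform I c m X\<bar> \<le> L * (\<Sum>i\<in>I. \<bar>X i\<bar>)" for m X by (rule lform_bound[OF L])
  have [measurable]: "(\<lambda>d. lform I c m (J d)) \<in> borel_measurable M" for m
    unfolding lform_def using fin measurable_J by (intro borel_measurable_sum borel_measurable_times) auto
  have bdd: "bdd_above (range (\<lambda>m. lform I c m (J d)))" for d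
    by (rule bdd_aboveI2[where M="L * (\<Sum>i\<in>I. \<bar>J d i\<bar>)"]) (rule abs_le_D1[OF lb])
  have [measurable]: "F \<in> borel_measurable M" unfolding F_def[abs_def] using bdd by (intro borel_measurable_cSUP) auto
  have upper: "lform I c m (J d) \<le> F d" for m d unfolding F_def using bdd by (intro cSUP_upper) auto
  have "\<bar>F d\<bar> \<le> L * (\<Sum>i\<in>I. \<bar>J d i\<bar>)" for d
  proof -
    have "F d \<le> L * (\<Sum>i\<in>I. \<bar>J d i\<bar>)" unfolding F_def using lb by (intro cSUP_least) (auto dest: abs_le_D1)
    moreover have "- (L * (\<Sum>i\<in>I. \<bar>J d i\<bar>)) \<le> lform I c 0 (J d)" using lb[of 0 "J d"] by linarith
    ultimately show ?thesis using upper[of 0 d] by linarith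
  qed
  moreover have "integrable M (\<lambda>d. L * (\<Sum>i\<in>I. \<bar>J d i\<bar>))"
    using fin integrable_J by (intro integrable_mult_right Bochner_Integration.integrable_sum integrable_abs) auto
  ultimately have Fi: "integrable M F"
    by (rule_tac Bochner_Integration.integrable_bound[where f="\<lambda>d. L * (\<Sum>i\<in>I. \<bar>J d i\<bar>)"]) (auto intro!: AE_I2 order_trans[OF _ abs_ge_self])
  have Fni: "integrable M (Fn n)" for n unfolding Fn_def[abs_def] by (rule max_linear_concentration(1)[OF fin L])
  have Fn_le: "Fn n d \<le> F d" for n d unfolding Fn_def by (intro Max.boundedI) (auto intro: upper)
  have En: "expectation (Fn n) \<le> expectation F" for n by (rule integral_mono[OF Fni Fi Fn_le])
  have Fn_mono: "Fn n d \<le> Fn (Suc n) d" for n d unfolding Fn_def by (intro Max_mono) auto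
  define A where "A n = {d\<in>space M. Fn n d > expectation F + e}" for n
  have [measurable]: "Fn n \<in> borel_measurable M" for n using Fni by auto
  have Am: "A n \<in> events" for n unfolding A_def by measurable
  have inc: "incseq A" using Fn_mono unfolding A_def by (intro incseq_SucI) (force intro: less_le_trans)
  have U: "{d\<in>space M. F d > expectation F + e} = (\<Union>n. A n)"
  proof (intro set_eqI iffI)
    fix d assume "d \<in> {d\<in>space M. F d > expectation F + e}"
    then have d: "d \<in> space M" "F d > expectation F + e" by auto
    then obtain m where "lform I c m (J d) > expectation F + e"
      unfolding F_def[of d] using less_cSUP_iff[OF _ bdd] by auto
    moreover have "lform I c m (J d) \<le> Fn m d" unfolding Fn_def by (intro Max_ge) auto
    ultimately have "d \<in> A m" using d unfolding A_def by simp
    then show "d \<in> (\<Union>n. A n)" by blast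
  next
    fix d assume "d \<in> (\<Union>n. A n)"
    then obtain n where "d \<in> space M" "Fn n d > expectation F + e" unfolding A_def by auto
    then show "d \<in> {d\<in>space M. F d > expectation F + e}" using Fn_le[of n d] by auto
  qed
  have pA: "prob (A n) \<le> exp (- (e\<^sup>2 / (8 * L\<^sup>2)))" for n
  proof -
    have "prob (A n) \<le> prob {d\<in>space M. Fn n d - expectation (Fn n) \<ge> e}"
      unfolding A_def using En[of n] by (intro finite_measure_mono) auto
    also have "\<dots> \<le> exp (- (e\<^sup>2 / (8 * L\<^sup>2)))" unfolding Fn_def by (rule max_linear_concentration(2)[OF fin L e])
    finally show ?thesis .
  qed
  have "(\<lambda>n. prob (A n)) \<longlonglongrightarrow> prob (\<Union>n. A n)" using Am inc by (intro finite_Lim_measure_incseq) auto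
  then have "prob (\<Union>n. A n) \<le> exp (- (e\<^sup>2 / (8 * L\<^sup>2)))" by (rule LIMSEQ_le_const2) (use pA in auto)
  then show "prob {d\<in>space M. (SUP m. lform I c m (J d)) > expectation (\<lambda>d. SUP m. lform I c m (J d)) + e} \<le> exp (- (e\<^sup>2 / (8 * L\<^sup>2)))"
    unfolding U[symmetric] F_def[symmetric] .
  show "{d\<in>space M. (SUP m. lform I c m (J d)) > expectation (\<lambda>d. SUP m. lform I c m (J d)) + e} \<in> events"
    unfolding F_def[symmetric] by measurable
qed

end

definition tangent_pairs :: "nat \<Rightarrow> ((nat \<Rightarrow> real) \<times> (nat \<Rightarrow> real) \<times> (nat \<Rightarrow> real)) set" where
  "tangent_pairs N = {(x, u, w). x \<in> sphereN N \<and> u \<in> tangent_unit N x \<and> w \<in> tangent_unit N x}"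

definition Gform :: "nat \<Rightarrow> nat \<Rightarrow> (nat list \<Rightarrow> real) \<Rightarrow> (nat \<Rightarrow> real) \<times> (nat \<Rightarrow> real) \<times> (nat \<Rightarrow> real) \<Rightarrow> real" where
  "Gform N p J = (\<lambda>(x, u, w). ehess (Ham N p J) x u w)"

definition Gcoef :: "nat \<Rightarrow> nat \<Rightarrow> (nat \<Rightarrow> real) \<times> (nat \<Rightarrow> real) \<times> (nat \<Rightarrow> real) \<Rightarrow> nat list \<Rightarrow> real" where
  "Gcoef N p = (\<lambda>(x, u, w) is. Hscale N p * D2m N p (\<lambda>i j. u i * w j) is x)"

lemma Gform_linear: "Gform N p J \<theta> = (\<Sum>is\<in>idx N p. J is * Gcoef N p \<theta> is)"
  unfolding Gform_def Gcoef_def split_beta ehess_pol[OF pol_Ham] by (simp only: bil_Ham_linear)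

lemma Gcoef_sq_le:
  assumes \<theta>: "\<theta> \<in> tangent_pairs N" and N: "N \<ge> 1" and p: "p \<ge> 3"
  shows "(\<Sum>is\<in>idx N p. (Gcoef N p \<theta> is)\<^sup>2) \<le> (real p * real (p - 1) / sqrt (real N))\<^sup>2"
proof -
  obtain x u w where t: "\<theta> = (x, u, w)" by (cases \<theta>)
  have h: "(\<Sum>i<N. (x i)\<^sup>2) = real N" "(\<Sum>i<N. (u i)\<^sup>2) = 1" "(\<Sum>i<N. (w i)\<^sup>2) = 1"
    using \<theta> unfolding t tangent_pairs_def sphereN_def tangent_unit_def by auto
  have "(\<Sum>i<N. \<Sum>j<N. (u i * w j)\<^sup>2) = 1"
    unfolding power_mult_distrib sum_product[symmetric] h by simp
  then show ?thesis
    using D2m_coeff_sq_le[OF N p h(1), of "\<lambda>i j. u i * w j"] unfolding t Gcoef_def by (simp add: power_divide)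
qed

lemma continuous_Gform: "continuous_on UNIV (Gform N p J)"
proof -
  have 1: "continuous_on UNIV (\<lambda>\<theta> :: (nat \<Rightarrow> real) \<times> (nat \<Rightarrow> real) \<times> (nat \<Rightarrow> real). pd i (pd j (Ham N p J)) (fst \<theta>))" for i j
    by (rule continuous_on_compose2[OF pol_continuous[OF pol_pd[OF pol_pd[OF pol_Ham]]] _ subset_UNIV]) (intro continuous_intros)
  have 2: "continuous_on UNIV (\<lambda>\<theta> :: (nat \<Rightarrow> real) \<times> (nat \<Rightarrow> real) \<times> (nat \<Rightarrow> real). fst (snd \<theta>) i)"
    "continuous_on UNIV (\<lambda>\<theta> :: (nat \<Rightarrow> real) \<times> (nat \<Rightarrow> real) \<times> (nat \<Rightarrow> real). snd (snd \<theta>) i)" for i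
    by (rule continuous_on_compose2[OF continuous_on_product_coordinates[of i] _ subset_UNIV], intro continuous_intros)+
  show ?thesis unfolding Gform_def split_beta ehess_pol[OF pol_Ham] by (intro continuous_on_sum continuous_on_mult 1 2)
qed

text \<open>Turn the first two coordinates of x by a right angle. Without a unit tangent vector the
  \<open>Sup\<close> in \<open>G_opnorm\<close> would range over the empty set; this is the source
  of the condition N \<ge> 2.\<close>

lemma tangent_unit_nonempty:
  assumes N: "N \<ge> 2"
  shows "tangent_unit N x \<noteq> {}"
proof (cases "x 0 = 0 \<and> x 1 = 0")
  case True
  have "(\<Sum>i<N. (unitv 0 i)\<^sup>2) = 1" using N nrm_sq[of "unitv 0" N] nrm_unitv[of 0 N] by simp
  moreover have "(\<Sum>i<N. x i * unitv 0 i) = 0" using True by (simp add: sum_unitv')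
  moreover have "unitv 0 i = 0" if "i \<ge> N" for i using that N by (simp add: unitv_def)
  ultimately have "unitv 0 \<in> tangent_unit N x" unfolding tangent_unit_def by simp
  then show ?thesis by blast
next
  case False
  define r where "r = sqrt ((x 0)\<^sup>2 + (x 1)\<^sup>2)"
  have r2: "r\<^sup>2 = (x 0)\<^sup>2 + (x 1)\<^sup>2" unfolding r_def by simp
  have r: "r\<^sup>2 > 0" unfolding r2 using False by (simp add: sum_power2_gt_zero_iff)
  define u where "u i = (if i = 0 then x 1 / r else if i = 1 then - x 0 / r else 0)" for i :: nat
  have s: "(\<Sum>i<N. f i) = f 0 + f 1" if "\<And>i. i \<noteq> 0 \<Longrightarrow> i \<noteq> 1 \<Longrightarrow> f i = (0::real)" for f :: "nat \<Rightarrow> real"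
  proof -
    have "(\<Sum>i<N. f i) = (\<Sum>i\<in>{0, 1}. f i)" using N that by (intro sum.mono_neutral_right) auto
    then show ?thesis by simp
  qed
  have "(\<Sum>i<N. (u i)\<^sup>2) = (u 0)\<^sup>2 + (u 1)\<^sup>2" by (rule s) (auto simp: u_def)
  also have "\<dots> = ((x 0)\<^sup>2 + (x 1)\<^sup>2) / r\<^sup>2" unfolding u_def by (simp add: power_divide add_divide_distrib)
  also have "\<dots> = 1" using r unfolding r2[symmetric] by simp
  finally have 1: "(\<Sum>i<N. (u i)\<^sup>2) = 1" .
  have "(\<Sum>i<N. x i * u i) = x 0 * u 0 + x 1 * u 1" by (rule s) (auto simp: u_def)
  also have "\<dots> = 0" unfolding u_def by simp
  finally have "u \<in> tangent_unit N x" using 1 N unfolding tangent_unit_def by (auto simp: u_def)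
  then show ?thesis by blast
qed

lemma sphereN_nonempty: "N \<ge> 1 \<Longrightarrow> sphereN N \<noteq> {}"
proof -
  assume N: "N \<ge> 1"
  have "(\<Sum>i<N. (sqrt (real N) * unitv 0 i)\<^sup>2) = (sqrt (real N))\<^sup>2 * (nrm N (unitv 0))\<^sup>2"
    unfolding nrm_sq by (simp add: power_mult_distrib sum_distrib_left)
  then have "(\<lambda>i. sqrt (real N) * unitv 0 i) \<in> sphereN N" using N nrm_unitv[of 0 N] by (simp add: sphereN_def unitv_def)
  then show ?thesis by blast
qed

lemma Gform_abs_le:
  assumes "\<theta> \<in> tangent_pairs N" "N \<ge> 1" "p \<ge> 3"
  shows "\<bar>Gform N p J \<theta>\<bar> \<le> L2_set J (idx N p) * (real p * real (p - 1) / sqrt (real N))"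
proof -
  have "\<bar>Gform N p J \<theta>\<bar> \<le> (\<Sum>is\<in>idx N p. \<bar>J is\<bar> * \<bar>Gcoef N p \<theta> is\<bar>)"
    unfolding Gform_linear by (rule order_trans[OF sum_abs]) (simp add: abs_mult)
  also have "\<dots> \<le> L2_set J (idx N p) * L2_set (Gcoef N p \<theta>) (idx N p)" by (rule L2_set_mult_ineq)
  also have "L2_set (Gcoef N p \<theta>) (idx N p) \<le> real p * real (p - 1) / sqrt (real N)"
    using real_sqrt_le_mono[OF Gcoef_sq_le[OF assms]] by (simp add: L2_set_def)
  finally show ?thesis by (simp add: mult_left_mono)
qed

text \<open>\<open>Sup\<close> on the reals is informative only for nonempty bounded sets. Both
  properties are checked for the inner and the outer supremum, which then merge into one over all
  triples.\<close>

lemma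
  assumes N: "N \<ge> 2" and p: "p \<ge> 3"
  shows sup_G_opnorm_eq: "sup_G_opnorm N p J = (SUP \<theta>\<in>tangent_pairs N. \<bar>Gform N p J \<theta>\<bar>)"
    and Gform_le_sup: "\<And>\<theta>. \<theta> \<in> tangent_pairs N \<Longrightarrow> \<bar>Gform N p J \<theta>\<bar> \<le> sup_G_opnorm N p J"
proof -
  let ?K = "L2_set J (idx N p) * (real p * real (p - 1) / sqrt (real N))"
  let ?S = "SUP \<theta>\<in>tangent_pairs N. \<bar>Gform N p J \<theta>\<bar>"
  have N1: "N \<ge> 1" using N by simp
  have bdd: "bdd_above ((\<lambda>\<theta>. \<bar>Gform N p J \<theta>\<bar>) ` tangent_pairs N)"
    using Gform_abs_le[OF _ N1 p] by (intro bdd_aboveI2) auto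
  have le: "\<bar>Gform N p J \<theta>\<bar> \<le> ?S" if "\<theta> \<in> tangent_pairs N" for \<theta> using that bdd by (intro cSUP_upper) auto
  have Gx: "G_opnorm N p J x = Sup {\<bar>Gform N p J (x, u, w)\<bar> | u w. u \<in> tangent_unit N x \<and> w \<in> tangent_unit N x}" for x
    unfolding G_opnorm_def Gform_def by simp
  have G_le: "G_opnorm N p J x \<le> ?S" if x: "x \<in> sphereN N" for x
    unfolding Gx
  proof (rule cSup_least)
    show "{\<bar>Gform N p J (x, u, w)\<bar> | u w. u \<in> tangent_unit N x \<and> w \<in> tangent_unit N x} \<noteq> {}"
      using tangent_unit_nonempty[OF N, of x] by blast
  qed (use x le in \<open>auto simp: tangent_pairs_def\<close>)
  have G_ge: "\<bar>Gform N p J (x, u, w)\<bar> \<le> G_opnorm N p J x" if "(x, u, w) \<in> tangent_pairs N" for x u w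
    unfolding Gx using that le
    by (intro cSup_upper) (auto simp: tangent_pairs_def intro!: bdd_aboveI[of _ ?S])
  have bG: "bdd_above {G_opnorm N p J x | x. x \<in> sphereN N}" using G_le by (intro bdd_aboveI[of _ ?S]) auto
  have up: "sup_G_opnorm N p J \<le> ?S"
    unfolding sup_G_opnorm_def using G_le sphereN_nonempty[OF N1] by (intro cSup_least) auto
  show lo: "\<bar>Gform N p J \<theta>\<bar> \<le> sup_G_opnorm N p J" if "\<theta> \<in> tangent_pairs N" for \<theta>
  proof -
    obtain x u w where t: "\<theta> = (x, u, w)" by (cases \<theta>)
    have "G_opnorm N p J x \<le> sup_G_opnorm N p J"
      unfolding sup_G_opnorm_def using that bG unfolding t by (intro cSup_upper) (auto simp: tangent_pairs_def)
    then show ?thesis using G_ge that unfolding t by fastforce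
  qed
  have ne: "tangent_pairs N \<noteq> {}" using sphereN_nonempty[OF N1] tangent_unit_nonempty[OF N] unfolding tangent_pairs_def by fast
  have "?S \<le> sup_G_opnorm N p J" using ne lo by (intro cSUP_least) auto
  then show "sup_G_opnorm N p J = ?S" using up by simp
qed

text \<open>By density and continuity of \<open>Gform\<close>, the supremum over a continuum becomes
  one over countably many linear forms in the disorder. Even and odd indices carry the two signs,
  which accounts for the absolute value.\<close>

lemma sup_G_opnorm_countable:
  assumes N: "N \<ge> 2" and p: "p \<ge> 3"
  shows "\<exists>c :: nat \<Rightarrow> nat list \<Rightarrow> real.
    (\<forall>m. (\<Sum>is\<in>idx N p. (c m is)\<^sup>2) \<le> (real p * real (p - 1) / sqrt (real N))\<^sup>2) \<and>
    (\<forall>J. sup_G_opnorm N p J = (SUP m. \<Sum>is\<in>idx N p. J is * c m is))"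
proof -
  have N1: "N \<ge> 1" using N by simp
  obtain D where D: "countable D" "D \<subseteq> tangent_pairs N" "tangent_pairs N \<subseteq> closure D" using separable[of "tangent_pairs N"] by blast
  have ne: "tangent_pairs N \<noteq> {}" using sphereN_nonempty[OF N1] tangent_unit_nonempty[OF N] unfolding tangent_pairs_def by fast
  then have Dne: "D \<noteq> {}" using D by auto
  define c where "c m is = (if even m then 1 else - 1) * Gcoef N p (from_nat_into D (m div 2)) is" for m "is"
  have Din: "from_nat_into D k \<in> tangent_pairs N" for k using from_nat_into[OF Dne] D by auto
  have lf: "(\<Sum>is\<in>idx N p. J is * c m is) = (if even m then 1 else - 1) * Gform N p J (from_nat_into D (m div 2))" for J m
    unfolding c_def Gform_linear by (auto simp: sum_negf)
  show ?thesis
  proof (intro exI[of _ c] conjI allI)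
    fix m
    have "(c m is)\<^sup>2 = (Gcoef N p (from_nat_into D (m div 2)) is)\<^sup>2" for "is" unfolding c_def by (simp add: power_mult_distrib)
    then show "(\<Sum>is\<in>idx N p. (c m is)\<^sup>2) \<le> (real p * real (p - 1) / sqrt (real N))\<^sup>2"
      using Gcoef_sq_le[OF Din N1 p] by simp
  next
    fix J
    have bdd: "bdd_above (range (\<lambda>m. \<Sum>is\<in>idx N p. J is * c m is))"
    proof (rule bdd_aboveI2)
      fix m show "(\<Sum>is\<in>idx N p. J is * c m is) \<le> L2_set J (idx N p) * (real p * real (p - 1) / sqrt (real N))"
        unfolding lf using Gform_abs_le[OF Din[of "m div 2"] N1 p, of J] by (auto simp: abs_le_iff)
    qed
    let ?s = "SUP m. \<Sum>is\<in>idx N p. J is * c m is"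
    have "\<bar>Gform N p J \<theta>\<bar> \<le> ?s" if th: "\<theta> \<in> D" for \<theta>
    proof -
      obtain k where k: "\<theta> = from_nat_into D k" using from_nat_into_surj[OF D(1) th] by metis
      have "(\<Sum>is\<in>idx N p. J is * c (2 * k) is) \<le> ?s" "(\<Sum>is\<in>idx N p. J is * c (2 * k + 1) is) \<le> ?s"
        using bdd by (auto intro!: cSUP_upper)
      then show ?thesis unfolding lf k by (simp add: abs_le_iff)
    qed
    moreover have "closed {\<theta>. \<bar>Gform N p J \<theta>\<bar> \<le> ?s}"
      by (intro closed_Collect_le continuous_intros continuous_Gform)
    ultimately have "closure D \<subseteq> {\<theta>. \<bar>Gform N p J \<theta>\<bar> \<le> ?s}" by (intro closure_minimal) auto
    then have "sup_G_opnorm N p J \<le> ?s"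
      unfolding sup_G_opnorm_eq[OF N p] using ne D(3) by (intro cSUP_least) auto
    moreover have "?s \<le> sup_G_opnorm N p J"
    proof (rule cSUP_least)
      fix m show "(\<Sum>is\<in>idx N p. J is * c m is) \<le> sup_G_opnorm N p J"
        unfolding lf using Gform_le_sup[OF N p Din[of "m div 2"], of J] by (auto simp: abs_le_iff)
    qed simp
    ultimately show "sup_G_opnorm N p J = ?s" by simp
  qed
qed

context spin_glass
begin

text \<open>The strict inequality in the hypothesis leaves a gap e between the means and \<Lambda>.
  The Lipschitz constant is of order N^(-1/2), so the gap is exceeded with probability exponentially
  small in N.\<close>

lemma AE_sup_G_opnorm:
  assumes L: "limsup (\<lambda>N. ereal (expectation (\<lambda>d. sup_G_opnorm N p (J d)))) < ereal \<Lambda>"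
  shows "AE d in M. eventually (\<lambda>N. sup_G_opnorm N p (J d) \<le> \<Lambda>) sequentially"
proof -
  obtain \<Lambda>' where l: "limsup (\<lambda>N. ereal (expectation (\<lambda>d. sup_G_opnorm N p (J d)))) < ereal \<Lambda>'" "ereal \<Lambda>' < ereal \<Lambda>"
    using ereal_dense2[OF L] by blast
  have "eventually (\<lambda>N. ereal (expectation (\<lambda>d. sup_G_opnorm N p (J d))) < ereal \<Lambda>') sequentially"
    using l(1) by (rule Limsup_lessD)
  then obtain N0 where N0: "\<And>N. N \<ge> N0 \<Longrightarrow> expectation (\<lambda>d. sup_G_opnorm N p (J d)) < \<Lambda>'"
    unfolding eventually_sequentially by auto
  define e where "e = \<Lambda> - \<Lambda>'"
  have e: "e > 0" using l(2) unfolding e_def by simp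
  define c where "c = real p * real (p - 1)"
  have c: "c > 0" using p unfolding c_def by auto
  define h where "h N = 1 * exp (- (e\<^sup>2 / (8 * c\<^sup>2) * real N))" for N :: nat
  show ?thesis
  proof (rule AE_eventually_outside_summable[of h "max 2 N0"])
    show "summable h" unfolding h_def using e c by (intro summable_exp_neg) simp
    fix N assume "max 2 N0 \<le> N"
    then have N: "N \<ge> 2" "N \<ge> N0" "N \<ge> 1" by auto
    obtain cc :: "nat \<Rightarrow> nat list \<Rightarrow> real" where
      "(\<forall>m. (\<Sum>is\<in>idx N p. (cc m is)\<^sup>2) \<le> (real p * real (p - 1) / sqrt (real N))\<^sup>2) \<and>
       (\<forall>J. sup_G_opnorm N p J = (SUP m. \<Sum>is\<in>idx N p. J is * cc m is))"
      using sup_G_opnorm_countable[OF N(1) p] ..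
    then have cc: "\<And>m. (\<Sum>is\<in>idx N p. (cc m is)\<^sup>2) \<le> (c / sqrt (real N))\<^sup>2"
      "\<And>J. sup_G_opnorm N p J = (SUP m. \<Sum>is\<in>idx N p. J is * cc m is)" unfolding c_def by auto
    have L0: "c / sqrt (real N) > 0" using c N by simp
    have eq: "sup_G_opnorm N p J = (SUP m. lform (idx N p) cc m J)" for J unfolding cc(2) lform_def ..
    let ?B = "{d\<in>space M. sup_G_opnorm N p (J d) > expectation (\<lambda>d. sup_G_opnorm N p (J d)) + e}"
    have B1: "?B \<in> events" unfolding eq
      by (rule sup_linear_concentration(1)[OF finite_idx idx_sub idx_nonempty[OF N(3)] cc(1) L0]) (use e in simp)
    have "prob ?B \<le> exp (- (e\<^sup>2 / (8 * (c / sqrt (real N))\<^sup>2)))" unfolding eq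
      by (rule sup_linear_concentration(2)[OF finite_idx idx_sub idx_nonempty[OF N(3)] cc(1) L0]) (use e in simp)
    also have "exp (- (e\<^sup>2 / (8 * (c / sqrt (real N))\<^sup>2))) = h N" unfolding h_def by (simp add: power_divide)
    finally have B2: "prob ?B \<le> h N" .
    have B3: "sup_G_opnorm N p (J d) \<le> \<Lambda>" if "d \<in> space M - ?B" for d
      using that N0[OF N(2)] unfolding e_def by auto
    show "\<exists>B\<in>events. prob B \<le> h N \<and> (\<forall>d\<in>space M - B. sup_G_opnorm N p (J d) \<le> \<Lambda>)"
      using B1 B2 B3 by blast
  qed
qed

end

text \<open>The part of the drift of v that depends on (u,v) alone; the bounds \<open>F2L\<close>
  and \<open>F2U\<close> differ from it by 2 \<beta> \<Lambda> v.\<close>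

definition Fc :: "nat \<Rightarrow> real \<Rightarrow> real \<Rightarrow> real \<Rightarrow> real" where
  "Fc p \<beta> u v = 2 * real p * (real p - 1) - 2 * (real p - 1) * v + 2 * real p * u * (real p * u - \<beta> * v)"

text \<open>The interface between disorder and dynamics: once the processes enter, these
  inequalities are all that is known about J. The constant C will be chosen before N and \<epsilon>;
  the bound C/N concerns twice the carre du champ of each observable.\<close>

definition good :: "nat \<Rightarrow> nat \<Rightarrow> real \<Rightarrow> real \<Rightarrow> (nat list \<Rightarrow> real) \<Rightarrow> real \<Rightarrow> real \<Rightarrow> bool" where
  "good N p \<beta> \<Lambda> J C \<epsilon> \<longleftrightarrow> (\<forall>x\<in>sphereN N.
     (\<forall>f\<in>{uh N p J, vh N p J, wh N p J}. \<bar>f x\<bar> \<le> C \<and> \<bar>gen N p \<beta> J f x\<bar> \<le> C \<and>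
        \<bar>gen N p \<beta> J (\<lambda>x. (f x)\<^sup>2) x\<bar> \<le> C \<and>
        \<bar>gen N p \<beta> J (\<lambda>x. (f x)\<^sup>2) x - 2 * f x * gen N p \<beta> J f x\<bar> \<le> C / real N) \<and>
     0 \<le> vh N p J x \<and> \<bar>wh N p J x\<bar> \<le> \<Lambda> * vh N p J x \<and>
     \<bar>gen N p \<beta> J (uh N p J) x - F1 p \<beta> (uh N p J x) (vh N p J x)\<bar> \<le> \<epsilon> \<and>
     \<bar>gen N p \<beta> J (vh N p J) x - (Fc p \<beta> (uh N p J x) (vh N p J x) - 2 * \<beta> * wh N p J x)\<bar> \<le> \<epsilon>)"

lemma good_mono: "good N p \<beta> \<Lambda> J C \<epsilon> \<Longrightarrow> \<epsilon> \<le> \<epsilon>' \<Longrightarrow> good N p \<beta> \<Lambda> J C \<epsilon>'"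
  unfolding good_def by fastforce

section \<open>The generator on the observables, given a bound on H\<close>

lemma pd_square: "pol N d f \<Longrightarrow> pd i (\<lambda>x. (f x)\<^sup>2) x = 2 * f x * pd i f x"
  by (simp add: pd_power)

lemma pd2_square:
  assumes f: "pol N d f"
  shows "pd i (pd j (\<lambda>x. (f x)\<^sup>2)) x = 2 * pd i f x * pd j f x + 2 * f x * pd i (pd j f) x"
proof -
  have "pd j (\<lambda>x. (f x)\<^sup>2) = (\<lambda>x. 2 * (f x * pd j f x))" using pd_square[OF f] by auto
  then show ?thesis by (simp add: pd_cmult[OF pol_mult[OF f pol_pd[OF f]]] pd_mult[OF f pol_pd[OF f]])
qed

text \<open>For a diffusion generator, L(f^2) - 2 f L f is twice the squared length of the gradient,
  here the tangential one: the radial derivative is subtracted from the Euclidean gradient.\<close>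

lemma gen_square:
  assumes f: "pol N d f" and N: "N \<ge> 1" and p: "p \<ge> 3" and x: "(\<Sum>i<N. (x i)\<^sup>2) = real N"
  shows "gen N p \<beta> J (\<lambda>x. (f x)\<^sup>2) x = 2 * f x * gen N p \<beta> J f x + 2 * ((\<Sum>i<N. (pd i f x)\<^sup>2) - (\<Sum>i<N. x i * pd i f x)\<^sup>2 / real N)"
proof -
  have f2: "pol N (d * 2) (\<lambda>x. (f x)\<^sup>2)" by (rule pol_power[OF f])
  have a: "(\<Sum>i<N. g i * pd i (\<lambda>x. (f x)\<^sup>2) x) = 2 * f x * (\<Sum>i<N. g i * pd i f x)" for g
    unfolding pd_square[OF f] by (simp add: sum_distrib_left mult_ac)
  have b: "(\<Sum>i<N. pd i (pd i (\<lambda>x. (f x)\<^sup>2)) x) = 2 * (\<Sum>i<N. (pd i f x)\<^sup>2) + 2 * f x * (\<Sum>i<N. pd i (pd i f) x)"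
    unfolding pd2_square[OF f] by (simp add: sum.distrib sum_distrib_left power2_eq_square mult_ac)
  have c: "ehess (\<lambda>x. (f x)\<^sup>2) x x x = 2 * (\<Sum>i<N. x i * pd i f x)\<^sup>2 + 2 * f x * ehess f x x x"
  proof -
    have "ehess (\<lambda>x. (f x)\<^sup>2) x x x = (\<Sum>i<N. \<Sum>j<N. 2 * ((x i * pd i f x) * (x j * pd j f x)) + 2 * f x * (x i * x j * pd i (pd j f) x))"
      unfolding ehess_pol[OF f2] pd2_square[OF f] by (intro sum.cong refl) (simp add: algebra_simps)
    also have "\<dots> = 2 * (\<Sum>i<N. \<Sum>j<N. (x i * pd i f x) * (x j * pd j f x)) + 2 * f x * (\<Sum>i<N. \<Sum>j<N. x i * x j * pd i (pd j f) x)"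
      by (simp only: sum.distrib sum_distrib_left[symmetric])
    finally show ?thesis unfolding ehess_pol[OF f] by (simp only: power2_eq_square sum_product)
  qed
  define T E R G where "T = (\<Sum>i<N. pd i (pd i f) x)" and "E = ehess f x x x" and "R = (\<Sum>i<N. x i * pd i f x)"
    and "G = (\<Sum>i<N. gv N p J i x * pd i f x)"
  show ?thesis
    unfolding gen_pol[OF p N x f2] gen_pol[OF p N x f] slap_pol[OF f2] slap_pol[OF f] a b c
      T_def[symmetric] E_def[symmetric] R_def[symmetric] G_def[symmetric]
    by (simp add: add_divide_distrib diff_divide_distrib algebra_simps)
qed

context
  fixes N p :: nat and \<beta> C :: real and J :: "nat list \<Rightarrow> real"
  assumes p: "p \<ge> 3" and N: "N \<ge> 1" and H: "Hbounded N p J C"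
begin

text \<open>\<open>MH\<close> bounds both the operator norm of the Hessian of H and the length of
  its gradient divided by sqrt N, up to radius 2 sqrt N; \<open>MG\<close> bounds the length of
  \<open>gv\<close> divided by sqrt N there.\<close>

definition MH where "MH = Mk p * C / 2"
definition MG where "MG = MH + 2 * real p * C"

lemma C0: "C \<ge> 0" by (rule Hbounded_nonneg[OF H N])

lemma MH0: "MH \<ge> 0" unfolding MH_def using C0 Mk(1)[of p] by simp

lemma MG0: "MG \<ge> 0" unfolding MG_def using C0 MH0 by simp

lemma uh_bound: "nrm N x \<le> 2 * sqrt (real N) \<Longrightarrow> \<bar>uh N p J x\<bar> \<le> C"
proof -
  assume "nrm N x \<le> 2 * sqrt (real N)"
  then have "nrm N x \<le> 4 * sqrt (real N)" using real_sqrt_ge_zero[of "real N"] by linarith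
  then have "\<bar>Ham N p J x\<bar> \<le> C * real N" using H unfolding Hbounded_def by blast
  then show ?thesis unfolding uh_def using N by (simp add: pos_divide_le_eq)
qed

lemma vh_bound: "nrm N x \<le> 2 * sqrt (real N) \<Longrightarrow> \<bar>vh N p J x\<bar> \<le> MH\<^sup>2 + (real p)\<^sup>2 * C\<^sup>2"
proof -
  assume x: "nrm N x \<le> 2 * sqrt (real N)"
  have "(nrm N (\<lambda>i. pd i (Ham N p J) x))\<^sup>2 \<le> (MH * sqrt (real N))\<^sup>2"
    using grad_Ham_bound[OF H N x] unfolding MH_def by (intro power_mono) auto
  then have "(\<Sum>i<N. (pd i (Ham N p J) x)\<^sup>2) \<le> MH\<^sup>2 * real N" unfolding nrm_sq by (simp add: power_mult_distrib)
  then have 1: "(\<Sum>i<N. (pd i (Ham N p J) x)\<^sup>2) / real N \<le> MH\<^sup>2" using N by (simp add: pos_divide_le_eq)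
  have 2: "0 \<le> (\<Sum>i<N. (pd i (Ham N p J) x)\<^sup>2) / real N" by (simp add: sum_nonneg)
  have "\<bar>uh N p J x\<bar>\<^sup>2 \<le> C\<^sup>2" using uh_bound[OF x] by (intro power_mono) auto
  then have 3: "(real p)\<^sup>2 * (uh N p J x)\<^sup>2 \<le> (real p)\<^sup>2 * C\<^sup>2" by (intro mult_left_mono) auto
  have "vh N p J x = (\<Sum>i<N. (pd i (Ham N p J) x)\<^sup>2) / real N - (real p)\<^sup>2 * (uh N p J x)\<^sup>2"
    unfolding vh_def uh_def by (simp add: power_divide)
  moreover have "0 \<le> (real p)\<^sup>2 * (uh N p J x)\<^sup>2" by simp
  ultimately show ?thesis using 1 2 3 zero_le_power2[of MH] by linarith
qed

lemma gv_bound: "nrm N x \<le> 2 * sqrt (real N) \<Longrightarrow> nrm N (\<lambda>i. gv N p J i x) \<le> MG * sqrt (real N)"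
proof -
  assume x: "nrm N x \<le> 2 * sqrt (real N)"
  have g: "(\<lambda>i. gv N p J i x) = (\<lambda>i. pd i (Ham N p J) x + (real p * uh N p J x) * x i)"
    unfolding gv_def uh_def by auto
  have "nrm N (\<lambda>i. gv N p J i x) \<le> nrm N (\<lambda>i. pd i (Ham N p J) x) + nrm N (\<lambda>i. (real p * uh N p J x) * x i)"
    unfolding g by (rule L2_set_triangle_ineq)
  also have "\<dots> \<le> MH * sqrt (real N) + real p * C * (2 * sqrt (real N))"
  proof (rule add_mono)
    show "nrm N (\<lambda>i. pd i (Ham N p J) x) \<le> MH * sqrt (real N)" unfolding MH_def by (rule grad_Ham_bound[OF H N x])
    show "nrm N (\<lambda>i. (real p * uh N p J x) * x i) \<le> real p * C * (2 * sqrt (real N))"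
      unfolding nrm_scale abs_mult using uh_bound[OF x] x C0 by (intro mult_mono) auto
  qed
  finally show ?thesis unfolding MG_def by (simp add: algebra_simps)
qed

lemma wh_bound: "nrm N x \<le> 2 * sqrt (real N) \<Longrightarrow> \<bar>wh N p J x\<bar> \<le> MH * MG\<^sup>2"
proof -
  assume x: "nrm N x \<le> 2 * sqrt (real N)"
  let ?g = "\<lambda>i. gv N p J i x"
  have w: "wh N p J x = bil N (\<lambda>i j. pd i (pd j (Ham N p J)) x) ?g ?g / real N" unfolding wh_def bil_def ..
  have "\<bar>bil N (\<lambda>i j. pd i (pd j (Ham N p J)) x) ?g ?g\<bar> \<le> MH * nrm N ?g * nrm N ?g"
    unfolding MH_def by (rule hess_Ham_bound[OF H N x])
  also have "\<dots> \<le> MH * (MG * sqrt (real N)) * (MG * sqrt (real N))"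
    using gv_bound[OF x] MH0 MG0 by (intro mult_mono mult_left_mono) auto
  also have "\<dots> = MH * MG\<^sup>2 * real N" by (simp add: power2_eq_square)
  finally show ?thesis unfolding w using N by (simp add: pos_divide_le_eq)
qed

text \<open>Cauchy estimates at depth sqrt N make the gradient of order N^(-1/2) and the Hessian of
  order 1/N. Hence the generator is of order 1 and the carre du champ of order 1/N. The 5 is 2 for
  the trace, 2 for the radial second derivative and 1 for the radial first derivative.\<close>

lemma gen_bound:
  assumes f: "pol N d f" and B: "\<And>y. nrm N y \<le> 2 * sqrt (real N) \<Longrightarrow> \<bar>f y\<bar> \<le> B" and x: "(\<Sum>i<N. (x i)\<^sup>2) = real N" and b: "\<beta> > 0"
  shows "\<bar>f x\<bar> \<le> B" "\<bar>gen N p \<beta> J f x\<bar> \<le> Mk d * B * (5 + \<beta> * MG)"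
    "\<bar>gen N p \<beta> J (\<lambda>x. (f x)\<^sup>2) x - 2 * f x * gen N p \<beta> J f x\<bar> \<le> 2 * (Mk d * B)\<^sup>2 / real N"
proof -
  have s: "sqrt (real N) > 0" using N by simp
  have nx: "nrm N x = sqrt (real N)" by (rule nrm_sphere[OF x])
  have nx2: "nrm N x \<le> 2 * sqrt (real N)" using nx s by simp
  show fB: "\<bar>f x\<bar> \<le> B" using B nx2 by blast
  then have B0: "B \<ge> 0" by linarith
  define m where "m = Mk d * B"
  have m0: "m \<ge> 0" unfolding m_def using B0 Mk(1)[of d] by simp
  have gr: "nrm N (\<lambda>i. pd i f x) \<le> m / sqrt (real N)"
    using grad_bound[OF f B _ s, where x=x] nx unfolding m_def by simp
  have he: "\<bar>bil N (\<lambda>i j. pd i (pd j f) x) u w\<bar> \<le> (2 * m / real N) * nrm N u * nrm N w" for u w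
    using hess_bound[OF f B _ s, where x=x and u=u and w=w] nx unfolding m_def by (simp add: mult.assoc)
  have tr: "\<bar>\<Sum>i<N. pd i (pd i f) x\<bar> \<le> 2 * m"
    using bil_frob_bound(2)[OF he] N by simp
  have ex: "\<bar>ehess f x x x / real N\<bar> \<le> 2 * m"
  proof -
    have "ehess f x x x = bil N (\<lambda>i j. pd i (pd j f) x) x x" unfolding ehess_pol[OF f] bil_def ..
    then have "\<bar>ehess f x x x\<bar> \<le> 2 * m / real N * sqrt (real N) * sqrt (real N)" using he[of x x] nx by simp
    also have "\<dots> = 2 * m" using N by (simp add: mult.assoc)
    finally have "\<bar>ehess f x x x\<bar> / real N \<le> 2 * m / real N" by (rule divide_right_mono) simp
    also have "\<dots> \<le> 2 * m / 1" using N m0 by (intro divide_left_mono) auto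
    finally show ?thesis by simp
  qed
  have in_b: "\<bar>\<Sum>i<N. u i * pd i f x\<bar> \<le> c * m" if "nrm N u \<le> c * sqrt (real N)" "c \<ge> 0" for u c
  proof -
    have "\<bar>\<Sum>i<N. u i * pd i f x\<bar> \<le> nrm N u * nrm N (\<lambda>i. pd i f x)" by (rule inner_le_nrm)
    also have "\<dots> \<le> (c * sqrt (real N)) * (m / sqrt (real N))" using that gr m0 by (intro mult_mono) auto
    also have "\<dots> = c * m" using s by simp
    finally show ?thesis .
  qed
  have xr: "\<bar>\<Sum>i<N. x i * pd i f x\<bar> \<le> m" using in_b[of x 1] nx by simp
  have gg: "\<bar>\<Sum>i<N. gv N p J i x * pd i f x\<bar> \<le> MG * m" using in_b[OF gv_bound[OF nx2] MG0] .
  have t1: "\<bar>(real N - 1) / real N * (\<Sum>i<N. x i * pd i f x)\<bar> \<le> 1 * m"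
    unfolding abs_mult using N xr by (intro mult_mono) auto
  have t2: "\<bar>\<beta> * (\<Sum>i<N. gv N p J i x * pd i f x)\<bar> \<le> \<beta> * (MG * m)"
    using b gg by (simp add: abs_mult)
  have tri: "\<bar>a - b - c - d\<bar> \<le> \<bar>a\<bar> + \<bar>b\<bar> + \<bar>c\<bar> + \<bar>d\<bar>" for a b c d :: real by linarith
  have "\<bar>gen N p \<beta> J f x\<bar> \<le> 2 * m + 2 * m + 1 * m + \<beta> * (MG * m)"
    unfolding gen_pol[OF p N x f] slap_pol[OF f] by (rule order_trans[OF tri]) (intro add_mono tr ex t1 t2)
  then show "\<bar>gen N p \<beta> J f x\<bar> \<le> Mk d * B * (5 + \<beta> * MG)" unfolding m_def by (simp add: algebra_simps)
  have g2: "(\<Sum>i<N. (pd i f x)\<^sup>2) \<le> m\<^sup>2 / real N"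
  proof -
    have "(nrm N (\<lambda>i. pd i f x))\<^sup>2 \<le> (m / sqrt (real N))\<^sup>2" using gr by (intro power_mono) auto
    then show ?thesis unfolding nrm_sq by (simp add: power_divide)
  qed
  have x2: "(\<Sum>i<N. x i * pd i f x)\<^sup>2 / real N \<le> m\<^sup>2 / real N"
  proof -
    have "\<bar>\<Sum>i<N. x i * pd i f x\<bar>\<^sup>2 \<le> m\<^sup>2" using xr by (intro power_mono) auto
    then show ?thesis by (intro divide_right_mono) auto
  qed
  have ge: "0 \<le> (\<Sum>i<N. (pd i f x)\<^sup>2)" "0 \<le> (\<Sum>i<N. x i * pd i f x)\<^sup>2 / real N" by (auto intro: sum_nonneg)
  have aux: "\<bar>2 * (a - b)\<bar> \<le> 2 * c" if "0 \<le> a" "0 \<le> b" "a \<le> c" "b \<le> c" for a b c :: real using that by (simp add: abs_le_iff)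
  have "\<bar>2 * ((\<Sum>i<N. (pd i f x)\<^sup>2) - (\<Sum>i<N. x i * pd i f x)\<^sup>2 / real N)\<bar> \<le> 2 * (m\<^sup>2 / real N)" by (rule aux[OF ge g2 x2])
  then show "\<bar>gen N p \<beta> J (\<lambda>x. (f x)\<^sup>2) x - 2 * f x * gen N p \<beta> J f x\<bar> \<le> 2 * (Mk d * B)\<^sup>2 / real N"
    unfolding gen_square[OF f N p x] m_def[symmetric] by simp
qed

text \<open>Smallness of \<open>trH\<close> on the sphere spreads by homogeneity to the ball of
  radius 2 sqrt N, where a Cauchy estimate turns it into smallness of the gradient.\<close>

lemma grad_trH_bound:
  assumes T: "\<And>y. (\<Sum>i<N. (y i)\<^sup>2) = real N \<Longrightarrow> \<bar>trH N p J y\<bar> \<le> \<epsilon> * real N" and x: "(\<Sum>i<N. (x i)\<^sup>2) = real N"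
  shows "\<bar>\<Sum>k<N. pd k (Ham N p J) x * pd k (trH N p J) x\<bar> / real N \<le> MH * (Mk p * 2 ^ p * \<epsilon>)"
proof -
  have s: "sqrt (real N) > 0" using N by simp
  have nx: "nrm N x = sqrt (real N)" by (rule nrm_sphere[OF x])
  have e0: "\<epsilon> \<ge> 0" using order_trans[OF abs_ge_zero T[OF x]] N by (simp add: zero_le_mult_iff)
  have hT: "hom (p - 2) (trH N p J)"
  proof -
    have e: "Suc (Suc (p - 2)) = p" using p by simp
    have "hom (Suc (Suc (p - 2))) (Ham N p J)" by (subst e, rule hom_Ham)
    then have h: "hom (p - 2) (pd i (pd i (Ham N p J)))" for i by (rule hom_pd[OF pol_pd[OF pol_Ham] hom_pd[OF pol_Ham]])
    show ?thesis unfolding hom_def trH_def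
    proof (intro allI impI)
      fix c :: real and y :: "nat \<Rightarrow> real" assume "c > 0"
      then have "pd i (pd i (Ham N p J)) (\<lambda>i. c * y i) = c ^ (p - 2) * pd i (pd i (Ham N p J)) y" for i
        using h[of i] unfolding hom_def by blast
      then show "(\<Sum>i<N. pd i (pd i (Ham N p J)) (\<lambda>i. c * y i)) = c ^ (p - 2) * (\<Sum>i<N. pd i (pd i (Ham N p J)) y)"
        by (simp only: sum_distrib_left)
    qed
  qed
  have ball: "\<bar>trH N p J y\<bar> \<le> 2 ^ p * \<epsilon> * real N" if y: "nrm N y \<le> 2 * sqrt (real N)" for y
  proof (cases "nrm N y = 0")
    \<comment> \<open>At the origin homogeneity of degree p - 2 \<ge> 1 forces the value 0.\<close>
    case True
    then have y0: "trH N p J y = trH N p J (\<lambda>_. 0)" by (intro pol_cong_dep[OF pol_trH]) (auto dest: nrm_eq_0)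
    have "\<forall>x. trH N p J (\<lambda>i. 2 * x i) = 2 ^ (p - 2) * trH N p J x" using hT unfolding hom_def by simp
    from spec[OF this, of "\<lambda>_. 0"] have "trH N p J (\<lambda>_. 0) = 2 ^ (p - 2) * trH N p J (\<lambda>_. 0)" by simp
    then have "trH N p J (\<lambda>_. 0) * (2 ^ (p - 2) - 1) = 0" by (simp add: algebra_simps)
    moreover have "(1::real) < 2 ^ (p - 2)" using p by (intro one_less_power) auto
    then have "(2::real) ^ (p - 2) - 1 \<noteq> 0" by linarith
    ultimately show ?thesis using y0 e0 by simp
  next
    case False
    define c where "c = nrm N y / sqrt (real N)"
    have "nrm N y > 0" using False L2_set_nonneg[of y "{..<N}"] by linarith
    then have c: "c > 0" "c \<le> 2" using s y unfolding c_def by (auto simp: pos_divide_le_eq)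
    define z where "z i = (1 / c) * y i" for i
    have "nrm N z = sqrt (real N)" unfolding z_def nrm_scale using c False s by (simp add: c_def)
    then have "(\<Sum>i<N. (z i)\<^sup>2) = real N" using nrm_sq[of z N] by simp
    from T[OF this] have z: "\<bar>trH N p J z\<bar> \<le> \<epsilon> * real N" .
    have "y = (\<lambda>i. c * z i)" using c unfolding z_def by auto
    then have "trH N p J y = c ^ (p - 2) * trH N p J z" using hT[unfolded hom_def, rule_format, OF c(1), of z] by simp
    then have "\<bar>trH N p J y\<bar> = c ^ (p - 2) * \<bar>trH N p J z\<bar>" using c by (simp add: abs_mult)
    also have "\<dots> \<le> 2 ^ (p - 2) * (\<epsilon> * real N)" using c z by (intro mult_mono power_mono) auto
    also have "\<dots> \<le> 2 ^ p * (\<epsilon> * real N)" using e0 by (intro mult_right_mono power_increasing) auto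
    finally show ?thesis by simp
  qed
  have g: "nrm N (\<lambda>k. pd k (trH N p J) x) \<le> Mk p * (2 ^ p * \<epsilon> * real N) / sqrt (real N)"
    using grad_bound[OF pol_trH ball _ s, where x=x] nx by simp
  have h: "nrm N (\<lambda>k. pd k (Ham N p J) x) \<le> MH * sqrt (real N)"
    unfolding MH_def using nx s by (intro grad_Ham_bound[OF H N]) simp
  have "\<bar>\<Sum>k<N. pd k (Ham N p J) x * pd k (trH N p J) x\<bar> \<le> nrm N (\<lambda>k. pd k (Ham N p J) x) * nrm N (\<lambda>k. pd k (trH N p J) x)"
    by (rule inner_le_nrm)
  also have "\<dots> \<le> (MH * sqrt (real N)) * (Mk p * (2 ^ p * \<epsilon> * real N) / sqrt (real N))"
    using g h MH0 by (intro mult_mono) auto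
  also have "\<dots> = MH * (Mk p * 2 ^ p * \<epsilon>) * real N" using s by simp
  finally show ?thesis using N by (simp add: pos_divide_le_eq)
qed

text \<open>The error terms of \<open>gen_uh\<close> and \<open>gen_vh\<close> are estimated one by
  one; those with an explicit 1/N only crudely, which is what the factor 20 stands for.\<close>

lemma drift_bounds:
  assumes T: "\<And>y. (\<Sum>i<N. (y i)\<^sup>2) = real N \<Longrightarrow> \<bar>trH N p J y\<bar> \<le> \<epsilon> * real N"
    and Fr: "\<And>y. (\<Sum>i<N. (y i)\<^sup>2) = real N \<Longrightarrow> \<bar>frobH N p J y / real N - real p * (real p - 1)\<bar> \<le> \<epsilon>"
    and x: "(\<Sum>i<N. (x i)\<^sup>2) = real N"
  shows "\<bar>gen N p \<beta> J (uh N p J) x - F1 p \<beta> (uh N p J x) (vh N p J x)\<bar> \<le> \<epsilon> + (real p)\<^sup>2 * C / real N"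
    and "\<bar>gen N p \<beta> J (vh N p J) x - (Fc p \<beta> (uh N p J x) (vh N p J x) - 2 * \<beta> * wh N p J x)\<bar>
      \<le> (2 + 2 * (MH * (Mk p * 2 ^ p)) + 2 * (real p)\<^sup>2 * C) * \<epsilon>
        + 20 * (real p)^4 * (MH\<^sup>2 + 4 * (real p)\<^sup>2 * C\<^sup>2) / real N"
proof -
  let ?u = "uh N p J x" and ?v = "vh N p J x" and ?w = "wh N p J x"
  have s: "sqrt (real N) > 0" using N by simp
  have nx: "nrm N x \<le> 2 * sqrt (real N)" using nrm_sphere[OF x] s by simp
  have u: "\<bar>?u\<bar> \<le> C" by (rule uh_bound[OF nx])
  have v: "\<bar>?v\<bar> \<le> MH\<^sup>2 + (real p)\<^sup>2 * C\<^sup>2" by (rule vh_bound[OF nx])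
  have t: "\<bar>trH N p J x / real N\<bar> \<le> \<epsilon>" using T[OF x] N by (simp add: pos_divide_le_eq)
  have p1: "real p \<ge> 3" using p by simp
  have "\<bar>real p * (real p - 2) * ?u\<bar> \<le> (real p)\<^sup>2 * C"
    unfolding abs_mult power2_eq_square using u p1 C0 by (intro mult_mono) auto
  then have "\<bar>real p * (real p - 2) * ?u / real N\<bar> \<le> (real p)\<^sup>2 * C / real N" by (simp add: divide_right_mono)
  then show "\<bar>gen N p \<beta> J (uh N p J) x - F1 p \<beta> ?u ?v\<bar> \<le> \<epsilon> + (real p)\<^sup>2 * C / real N"
    unfolding gen_uh[OF p N x] using t by linarith
  define D where "D = (\<Sum>k<N. pd k (Ham N p J) x * pd k (trH N p J) x) / real N"
  have D: "\<bar>D\<bar> \<le> MH * (Mk p * 2 ^ p * \<epsilon>)" using grad_trH_bound[OF T x] unfolding D_def by simp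
  define F where "F = frobH N p J x / real N - real p * (real p - 1)"
  have F: "\<bar>F\<bar> \<le> \<epsilon>" unfolding F_def by (rule Fr[OF x])
  define t' where "t' = trH N p J x / real N"
  define z where "z = ?v + (real p)\<^sup>2 * ?u\<^sup>2"
  define Q where "Q = (2 * real p - 2) * z - (2 * real p - 2) * (2 * real p - 3) * z - 2 * (real p)\<^sup>2 * z + (real p)^3 * (4 * real p - 4) * ?u\<^sup>2"
  have u2: "?u\<^sup>2 \<le> C\<^sup>2" using u C0 by (simp add: abs_le_square_iff[symmetric])
  have pu2: "(real p)\<^sup>2 * ?u\<^sup>2 \<le> (real p)\<^sup>2 * C\<^sup>2" using u2 by (intro mult_left_mono) auto
  define Z where "Z = MH\<^sup>2 + 4 * (real p)\<^sup>2 * C\<^sup>2"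
  have pC: "0 \<le> (real p)\<^sup>2 * C\<^sup>2" "0 \<le> (real p)\<^sup>2 * ?u\<^sup>2" by simp_all
  have zZ: "\<bar>z\<bar> \<le> Z"
  proof -
    have "Z = MH\<^sup>2 + 4 * ((real p)\<^sup>2 * C\<^sup>2)" unfolding Z_def by simp
    then show ?thesis unfolding z_def using v pu2 pC by linarith
  qed
  have Z0: "Z \<ge> 0" using zZ by linarith
  have p4: "(real p)\<^sup>2 \<le> (real p)^4" "real p \<le> (real p)^4" using p1 by (auto intro: power_increasing self_le_power)
  have Qb: "\<bar>Q\<bar> \<le> 20 * (real p)^4 * Z"
  proof -
    have "\<bar>Q\<bar> \<le> \<bar>(2 * real p - 2) * z\<bar> + \<bar>(2 * real p - 2) * (2 * real p - 3) * z\<bar> + \<bar>2 * (real p)\<^sup>2 * z\<bar> + \<bar>(real p)^3 * (4 * real p - 4) * ?u\<^sup>2\<bar>"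
      unfolding Q_def by linarith
    also have "\<dots> \<le> (2 * (real p)^4) * Z + (4 * (real p)^4) * Z + (2 * (real p)^4) * Z + (4 * (real p)^4) * Z"
    proof (intro add_mono)
      have "2 * real p - 2 \<le> 2 * (real p)^4" using p4 by linarith
      then show "\<bar>(2 * real p - 2) * z\<bar> \<le> (2 * (real p)^4) * Z" unfolding abs_mult using zZ p1 by (intro mult_mono) auto
      have "(2 * real p - 2) * (2 * real p - 3) \<le> (2 * real p) * (2 * real p)" using p1 by (intro mult_mono) auto
      also have "\<dots> \<le> 4 * (real p)^4" using p4 by (simp add: power2_eq_square)
      finally show "\<bar>(2 * real p - 2) * (2 * real p - 3) * z\<bar> \<le> (4 * (real p)^4) * Z"
        unfolding abs_mult[of "(2 * real p - 2) * (2 * real p - 3)"] using zZ p1 by (intro mult_mono) auto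
      show "\<bar>2 * (real p)\<^sup>2 * z\<bar> \<le> (2 * (real p)^4) * Z" unfolding abs_mult[of "2 * (real p)\<^sup>2"] using zZ p4 by (intro mult_mono) auto
      have "(real p)^3 * (4 * real p - 4) \<le> (real p)^3 * (4 * real p)" by (intro mult_left_mono) auto
      also have "\<dots> = 4 * (real p)^4" by (simp add: power_numeral_reduce)
      finally have 1: "(real p)^3 * (4 * real p - 4) \<le> 4 * (real p)^4" .
      have "?u\<^sup>2 \<le> (real p)\<^sup>2 * ?u\<^sup>2" using mult_right_mono[of 1 "(real p)\<^sup>2" "?u\<^sup>2"] p1 by (simp add: one_le_power)
      then have "?u\<^sup>2 \<le> Z" unfolding Z_def using pu2 pC zero_le_power2[of MH] by linarith
      then show "\<bar>(real p)^3 * (4 * real p - 4) * ?u\<^sup>2\<bar> \<le> (4 * (real p)^4) * Z"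
        unfolding abs_mult[of "(real p)^3 * (4 * real p - 4)"] using 1 p1 by (intro mult_mono) auto
    qed
    also have "\<dots> = 12 * (real p)^4 * Z" by simp
    also have "\<dots> \<le> 20 * (real p)^4 * Z" using Z0 by (intro mult_right_mono) auto
    finally show ?thesis .
  qed
  have ut: "\<bar>2 * (real p)\<^sup>2 * ?u * t'\<bar> \<le> 2 * (real p)\<^sup>2 * C * \<epsilon>"
    unfolding abs_mult t'_def using u t C0 by (intro mult_mono) auto
  have "gen N p \<beta> J (vh N p J) x - (Fc p \<beta> ?u ?v - 2 * \<beta> * ?w) = 2 * F + 2 * D + 2 * (real p)\<^sup>2 * ?u * t' + Q / real N"
    unfolding gen_vh[OF p N x] Fc_def F_def D_def t'_def Q_def z_def by simp
  moreover have "\<bar>Q / real N\<bar> \<le> 20 * (real p)^4 * Z / real N" using Qb by (simp add: divide_right_mono)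
  ultimately have "\<bar>gen N p \<beta> J (vh N p J) x - (Fc p \<beta> ?u ?v - 2 * \<beta> * ?w)\<bar> \<le> 2 * \<epsilon> + 2 * (MH * (Mk p * 2 ^ p * \<epsilon>)) + 2 * (real p)\<^sup>2 * C * \<epsilon> + 20 * (real p)^4 * Z / real N"
    using F D ut by linarith
  then show "\<bar>gen N p \<beta> J (vh N p J) x - (Fc p \<beta> ?u ?v - 2 * \<beta> * ?w)\<bar>
      \<le> (2 + 2 * (MH * (Mk p * 2 ^ p)) + 2 * (real p)\<^sup>2 * C) * \<epsilon>
        + 20 * (real p)^4 * (MH\<^sup>2 + 4 * (real p)\<^sup>2 * C\<^sup>2) / real N"
    unfolding Z_def by (simp add: algebra_simps)
qed

text \<open>Away from zeros of the gradient, \<open>gv\<close> divided by its length is a unit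
  tangent vector, and \<open>wh\<close> is \<open>vh\<close> times the value of G on it.\<close>

lemma wh_le:
  assumes N2: "N \<ge> 2" and L: "sup_G_opnorm N p J \<le> \<Lambda>" and x: "x \<in> sphereN N"
  shows "0 \<le> vh N p J x" "\<bar>wh N p J x\<bar> \<le> \<Lambda> * vh N p J x"
proof -
  have x2: "(\<Sum>i<N. (x i)\<^sup>2) = real N" using x by (simp add: sphereN_def)
  let ?g = "\<lambda>i. gv N p J i x"
  let ?A = "\<lambda>i j. pd i (pd j (Ham N p J)) x"
  note gsq = gv_sq[OF p N x2]
  have "0 \<le> real N * vh N p J x" unfolding gsq[symmetric] by (simp add: sum_nonneg)
  then show v0: "0 \<le> vh N p J x" using N by (simp add: zero_le_mult_iff)
  have w: "wh N p J x = bil N ?A ?g ?g / real N" unfolding wh_def bil_def ..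
  show "\<bar>wh N p J x\<bar> \<le> \<Lambda> * vh N p J x"
  proof (cases "nrm N ?g = 0")
    case True
    then have "bil N ?A ?g ?g = 0" using nrm_eq_0[OF True] by (simp add: bil_def)
    moreover have "vh N p J x = 0" using gsq True nrm_sq[of ?g N] N by simp
    ultimately show ?thesis unfolding w by simp
  next
    case False
    define r where "r = nrm N ?g"
    have r: "r > 0" using False L2_set_nonneg[of ?g "{..<N}"] unfolding r_def by linarith
    have r2: "r\<^sup>2 = real N * vh N p J x" unfolding r_def nrm_sq by (rule gsq)
    define u where "u i = (if i < N then ?g i / r else 0)" for i
    have "(\<Sum>i<N. (u i)\<^sup>2) = (\<Sum>i<N. (?g i)\<^sup>2) / r\<^sup>2" unfolding u_def by (simp add: power_divide sum_divide_distrib)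
    also have "\<dots> = 1" unfolding gsq r2[symmetric] using r by simp
    finally have u1: "(\<Sum>i<N. (u i)\<^sup>2) = 1" .
    have "(\<Sum>i<N. x i * u i) = (\<Sum>i<N. x i * ?g i) / r" unfolding u_def by (simp add: sum_divide_distrib)
    also have "\<dots> = 0" unfolding x_gv[OF p N x2] by simp
    finally have "u \<in> tangent_unit N x" using u1 unfolding tangent_unit_def u_def by auto
    then have "(x, u, u) \<in> tangent_pairs N" using x unfolding tangent_pairs_def by simp
    from Gform_le_sup[OF N2 p this, of J] have e: "\<bar>ehess (Ham N p J) x u u\<bar> \<le> \<Lambda>" using L unfolding Gform_def by simp
    have "bil N ?A ?g ?g = bil N ?A (\<lambda>i. r * u i) (\<lambda>i. r * u i)" unfolding bil_def u_def using r by (intro sum.cong refl) auto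
    also have "\<dots> = r\<^sup>2 * ehess (Ham N p J) x u u" unfolding bil_scale ehess_pol[OF pol_Ham] bil_def by (simp add: power2_eq_square)
    finally have "wh N p J x = vh N p J x * ehess (Ham N p J) x u u" unfolding w r2 using N by simp
    then have "\<bar>wh N p J x\<bar> = vh N p J x * \<bar>ehess (Ham N p J) x u u\<bar>" using v0 by (simp add: abs_mult)
    also have "\<dots> \<le> vh N p J x * \<Lambda>" using e v0 by (intro mult_left_mono)
    finally show ?thesis by (simp add: mult.commute)
  qed
qed

end

text \<open>The order of quantifiers is the content: the constants depend on p, \<beta> and C, but
  not on N, the disorder, \<epsilon> or \<Lambda>.\<close>

lemma ex_good_constants:
  assumes p: "p \<ge> 3" and b: "\<beta> > 0" and C: "C > 0"
  shows "\<exists>C'>0. \<exists>K>0. \<forall>N J \<epsilon> \<Lambda>. N \<ge> 2 \<longrightarrow> Hbounded N p J C \<longrightarrow> sup_G_opnorm N p J \<le> \<Lambda> \<longrightarrow>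
     (\<forall>x. (\<Sum>i<N. (x i)\<^sup>2) = real N \<longrightarrow> \<bar>trH N p J x\<bar> \<le> \<epsilon> * real N) \<longrightarrow>
     (\<forall>x. (\<Sum>i<N. (x i)\<^sup>2) = real N \<longrightarrow> \<bar>frobH N p J x / real N - real p * (real p - 1)\<bar> \<le> \<epsilon>) \<longrightarrow>
     good N p \<beta> \<Lambda> J C' (K * (\<epsilon> + 1 / real N))"
proof -
  define H G where "H = Mk p * C / 2" and "G = H + 2 * real p * C"
  define B where "B = C + (H\<^sup>2 + (real p)\<^sup>2 * C\<^sup>2) + H * G\<^sup>2"
  \<comment> \<open>The largest degree bound among the three observables, so that one constant
    \<open>m\<close> serves them all.\<close>
  define D where "D = 3 * p + 2"
  define m where "m = Mk D * B"
  define C' where "C' = B + m * (5 + \<beta> * G) + 2 * m\<^sup>2 + 2 * B * (m * (5 + \<beta> * G))"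
  define K where "K = 1 + (real p)\<^sup>2 * C + (2 + 2 * (H * (Mk p * 2 ^ p)) + 2 * (real p)\<^sup>2 * C) + 20 * (real p)^4 * (H\<^sup>2 + 4 * (real p)\<^sup>2 * C\<^sup>2)"
  have H0: "H \<ge> 0" and G0: "G \<ge> 0" using C Mk(1)[of p] by (auto simp: H_def G_def)
  have H2: "H\<^sup>2 + (real p)\<^sup>2 * C\<^sup>2 \<ge> 0" and HG: "H * G\<^sup>2 \<ge> 0" using H0 by auto
  have B: "B > 0" unfolding B_def using C H2 HG by linarith
  have m: "m > 0" unfolding m_def using B Mk(1)[of D] by simp
  have g5: "5 + \<beta> * G > 0" using b G0 by (intro add_pos_nonneg) auto
  have C's: "0 \<le> m * (5 + \<beta> * G)" "0 \<le> 2 * m\<^sup>2" "0 \<le> 2 * B * (m * (5 + \<beta> * G))" using m g5 B by auto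
  have C'0: "C' > 0" unfolding C'_def using B C's by linarith
  have Ks: "0 \<le> (real p)\<^sup>2 * C" "0 \<le> 2 * (H * (Mk p * 2 ^ p))" "0 \<le> 20 * (real p)^4 * (H\<^sup>2 + 4 * (real p)\<^sup>2 * C\<^sup>2)"
    using C H0 Mk(1)[of p] by auto
  have K0: "K > 0" unfolding K_def using Ks by linarith
  show ?thesis
  proof (rule exI[of _ C'], rule conjI[OF C'0], rule exI[of _ K], rule conjI[OF K0], intro allI impI)
    fix N J \<epsilon> \<Lambda>
    assume N2: "N \<ge> 2" and Hb: "Hbounded N p J C" and L: "sup_G_opnorm N p J \<le> \<Lambda>"
      and T: "\<forall>x. (\<Sum>i<N. (x i)\<^sup>2) = real N \<longrightarrow> \<bar>trH N p J x\<bar> \<le> \<epsilon> * real N"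
      and Fr: "\<forall>x. (\<Sum>i<N. (x i)\<^sup>2) = real N \<longrightarrow> \<bar>frobH N p J x / real N - real p * (real p - 1)\<bar> \<le> \<epsilon>"
    have N: "N \<ge> 1" using N2 by simp
    have HM: "MH p C = H" "MG p C = G" unfolding H_def G_def MH_def[OF p N Hb] MG_def[OF p N Hb] by simp_all
    show "good N p \<beta> \<Lambda> J C' (K * (\<epsilon> + 1 / real N))"
      unfolding good_def
    proof (rule ballI)
      fix x assume xs: "x \<in> sphereN N"
      then have x: "(\<Sum>i<N. (x i)\<^sup>2) = real N" by (simp add: sphereN_def)
      have f: "\<bar>f x\<bar> \<le> C' \<and> \<bar>gen N p \<beta> J f x\<bar> \<le> C' \<and> \<bar>gen N p \<beta> J (\<lambda>x. (f x)\<^sup>2) x\<bar> \<le> C' \<and>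
         \<bar>gen N p \<beta> J (\<lambda>x. (f x)\<^sup>2) x - 2 * f x * gen N p \<beta> J f x\<bar> \<le> C' / real N"
        if fp: "pol N D f" and fb: "\<And>y. nrm N y \<le> 2 * sqrt (real N) \<Longrightarrow> \<bar>f y\<bar> \<le> B" for f
      proof -
        note gb = gen_bound[OF p N Hb fp fb x b, unfolded HM, folded m_def]
        have 2: "\<bar>2 * f x * gen N p \<beta> J f x\<bar> \<le> 2 * B * (m * (5 + \<beta> * G))"
          unfolding abs_mult using gb(1,2) B by (intro mult_mono) auto
        have 3: "2 * m\<^sup>2 / real N \<le> C' / real N" unfolding C'_def using B C's by (intro divide_right_mono) auto
        have 4: "2 * m\<^sup>2 / real N \<le> 2 * m\<^sup>2 / 1" using N by (intro divide_left_mono) auto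
        have 5: "\<bar>gen N p \<beta> J (\<lambda>x. (f x)\<^sup>2) x\<bar> \<le> 2 * m\<^sup>2 + 2 * B * (m * (5 + \<beta> * G))" using gb(3) 2 4 by linarith
        show ?thesis using gb 3 5 C's B unfolding C'_def by (intro conjI; linarith)
      qed
      have fu: "pol N D (uh N p J)" "pol N D (vh N p J)" "pol N D (wh N p J)"
        unfolding D_def by (rule pol_mono[OF pol_uh], simp) (rule pol_mono[OF pol_vh], simp, rule pol_wh)
      have bu: "\<bar>uh N p J y\<bar> \<le> B" "\<bar>vh N p J y\<bar> \<le> B" "\<bar>wh N p J y\<bar> \<le> B" if y: "nrm N y \<le> 2 * sqrt (real N)" for y
        using uh_bound[OF p N Hb y] vh_bound[OF p N Hb y] wh_bound[OF p N Hb y] H2 HG C unfolding HM B_def by linarith+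
      have e0: "\<epsilon> \<ge> 0" using Fr[rule_format, OF x] by linarith
      have N0: "1 / real N \<ge> 0" by simp
      note dr = drift_bounds[OF p N Hb T[rule_format] Fr[rule_format] x, unfolded HM]
      have k1: "\<epsilon> + (real p)\<^sup>2 * C / real N \<le> K * (\<epsilon> + 1 / real N)"
      proof -
        have "1 \<le> K" using Ks unfolding K_def by linarith
        then have "1 * \<epsilon> \<le> K * \<epsilon>" by (rule mult_right_mono[OF _ e0])
        moreover have "(real p)\<^sup>2 * C * (1 / real N) \<le> K * (1 / real N)" using Ks unfolding K_def by (intro mult_right_mono N0) linarith
        ultimately show ?thesis by (simp add: algebra_simps)
      qed
      have k2: "(2 + 2 * (H * (Mk p * 2 ^ p)) + 2 * (real p)\<^sup>2 * C) * \<epsilon> + 20 * (real p)^4 * (H\<^sup>2 + 4 * (real p)\<^sup>2 * C\<^sup>2) / real N \<le> K * (\<epsilon> + 1 / real N)"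
      proof -
        have "(2 + 2 * (H * (Mk p * 2 ^ p)) + 2 * (real p)\<^sup>2 * C) * \<epsilon> \<le> K * \<epsilon>" using Ks unfolding K_def by (intro mult_right_mono e0) linarith
        moreover have "20 * (real p)^4 * (H\<^sup>2 + 4 * (real p)\<^sup>2 * C\<^sup>2) * (1 / real N) \<le> K * (1 / real N)" using Ks unfolding K_def by (intro mult_right_mono N0) linarith
        ultimately show ?thesis by (simp add: distrib_left)
      qed
      show "(\<forall>f\<in>{uh N p J, vh N p J, wh N p J}. \<bar>f x\<bar> \<le> C' \<and> \<bar>gen N p \<beta> J f x\<bar> \<le> C' \<and>
        \<bar>gen N p \<beta> J (\<lambda>x. (f x)\<^sup>2) x\<bar> \<le> C' \<and>
        \<bar>gen N p \<beta> J (\<lambda>x. (f x)\<^sup>2) x - 2 * f x * gen N p \<beta> J f x\<bar> \<le> C' / real N) \<and>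
     0 \<le> vh N p J x \<and> \<bar>wh N p J x\<bar> \<le> \<Lambda> * vh N p J x \<and>
     \<bar>gen N p \<beta> J (uh N p J) x - F1 p \<beta> (uh N p J x) (vh N p J x)\<bar> \<le> K * (\<epsilon> + 1 / real N) \<and>
     \<bar>gen N p \<beta> J (vh N p J) x - (Fc p \<beta> (uh N p J x) (vh N p J x) - 2 * \<beta> * wh N p J x)\<bar> \<le> K * (\<epsilon> + 1 / real N)"
        using f[OF fu(1) bu(1)] f[OF fu(2) bu(2)] f[OF fu(3) bu(3)] wh_le[OF p N Hb N2 L xs] order_trans[OF dr(1) k1] order_trans[OF dr(2) k2]
        by simp
    qed
  qed
qed

text \<open>Only the countably many tolerances 1/(k+1) are used, which keeps the exceptional set
  null; monotonicity in \<epsilon> covers the others.\<close>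

lemma (in spin_glass) AE_good:
  assumes b: "\<beta> > 0" and L: "limsup (\<lambda>N. ereal (expectation (\<lambda>d. sup_G_opnorm N p (J d)))) < ereal \<Lambda>"
  shows "\<exists>C>0. AE d in M. \<forall>\<epsilon>>0. eventually (\<lambda>N. good N p \<beta> \<Lambda> (J d) C \<epsilon>) sequentially"
proof -
  obtain C where C: "C > 0" "AE d in M. eventually (\<lambda>N. Hbounded N p (J d) C) sequentially" using AE_Hbounded by blast
  obtain C' K where CK: "C' > 0" "K > 0" and CK3: "\<forall>N J \<epsilon> \<Lambda>. N \<ge> 2 \<longrightarrow> Hbounded N p J C \<longrightarrow> sup_G_opnorm N p J \<le> \<Lambda> \<longrightarrow>
     (\<forall>x. (\<Sum>i<N. (x i)\<^sup>2) = real N \<longrightarrow> \<bar>trH N p J x\<bar> \<le> \<epsilon> * real N) \<longrightarrow>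
     (\<forall>x. (\<Sum>i<N. (x i)\<^sup>2) = real N \<longrightarrow> \<bar>frobH N p J x / real N - real p * (real p - 1)\<bar> \<le> \<epsilon>) \<longrightarrow>
     good N p \<beta> \<Lambda> J C' (K * (\<epsilon> + 1 / real N))"
    using ex_good_constants[OF p b C(1)] by (elim exE conjE)
  have tr: "AE d in M. \<forall>k. eventually (\<lambda>N. Hbounded N p (J d) C \<longrightarrow> (\<forall>x. (\<Sum>i<N. (x i)\<^sup>2) = real N \<longrightarrow> \<bar>trH N p (J d) x\<bar> \<le> 1 / real (Suc k) * real N)) sequentially"
    unfolding AE_all_countable by (intro allI AE_trH) simp
  have fr: "AE d in M. \<forall>k. eventually (\<lambda>N. Hbounded N p (J d) C \<longrightarrow> (\<forall>x. (\<Sum>i<N. (x i)\<^sup>2) = real N \<longrightarrow> \<bar>frobH N p (J d) x / real N - real p * (real p - 1)\<bar> \<le> 1 / real (Suc k))) sequentially"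
    unfolding AE_all_countable by (intro allI AE_frobH) simp
  have "AE d in M. \<forall>\<epsilon>>0. eventually (\<lambda>N. good N p \<beta> \<Lambda> (J d) C' \<epsilon>) sequentially"
    using C(2) tr fr AE_sup_G_opnorm[OF L]
  proof eventually_elim
    fix d
    assume h: "eventually (\<lambda>N. Hbounded N p (J d) C) sequentially"
      "\<forall>k. eventually (\<lambda>N. Hbounded N p (J d) C \<longrightarrow> (\<forall>x. (\<Sum>i<N. (x i)\<^sup>2) = real N \<longrightarrow> \<bar>trH N p (J d) x\<bar> \<le> 1 / real (Suc k) * real N)) sequentially"
      "\<forall>k. eventually (\<lambda>N. Hbounded N p (J d) C \<longrightarrow> (\<forall>x. (\<Sum>i<N. (x i)\<^sup>2) = real N \<longrightarrow> \<bar>frobH N p (J d) x / real N - real p * (real p - 1)\<bar> \<le> 1 / real (Suc k))) sequentially"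
      "eventually (\<lambda>N. sup_G_opnorm N p (J d) \<le> \<Lambda>) sequentially"
    show "\<forall>\<epsilon>>0. eventually (\<lambda>N. good N p \<beta> \<Lambda> (J d) C' \<epsilon>) sequentially"
    proof (intro allI impI)
      fix \<epsilon> :: real assume e: "\<epsilon> > 0"
      obtain k where k: "1 / real (Suc k) < \<epsilon> / (2 * K)" using reals_Archimedean[of "\<epsilon> / (2 * K)"] e CK(2) by (auto simp: inverse_eq_divide)
      show "eventually (\<lambda>N. good N p \<beta> \<Lambda> (J d) C' \<epsilon>) sequentially"
        using h(1) h(2)[rule_format, of k] h(3)[rule_format, of k] h(4) eventually_ge_at_top[of "max 2 (Suc k)"]
      proof eventually_elim
        case (elim N)
        have "good N p \<beta> \<Lambda> (J d) C' (K * (1 / real (Suc k) + 1 / real N))" using elim by (intro CK3[rule_format]) auto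
        moreover have "K * (1 / real (Suc k) + 1 / real N) \<le> \<epsilon>"
        proof -
          have "1 / real N \<le> 1 / real (Suc k)" using elim by (intro divide_left_mono) auto
          then have "1 / real (Suc k) + 1 / real N \<le> \<epsilon> / K" using k by (simp add: field_simps)
          then have "K * (1 / real (Suc k) + 1 / real N) \<le> K * (\<epsilon> / K)" using CK(2) by (intro mult_left_mono) auto
          then show ?thesis using CK(2) by simp
        qed
        ultimately show ?case by (rule good_mono)
      qed
    qed
  qed
  then show ?thesis using CK(1) by blast
qed

section \<open>Martingales of the Langevin dynamics\<close>

text \<open>Both limits rest on uniform continuity. The first is the error of freezing
  \<open>g\<close> at the left end of each cell of a partition; the second makes integrals along
  paths limits of finite sums.\<close>

lemma riemann_sum_limit:
  fixes g :: "real \<Rightarrow> real"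
  assumes g: "continuous_on {a..b} g" and ab: "a \<le> b"
  shows "(\<lambda>n. \<Sum>j<n. integral {a + real j * ((b - a) / real n)..a + real (Suc j) * ((b - a) / real n)} (\<lambda>s. \<bar>g s - g (a + real j * ((b - a) / real n))\<bar>)) \<longlonglongrightarrow> 0"
    and "(\<lambda>n. \<Sum>j<n. ((b - a) / real n) * g (a + real j * ((b - a) / real n))) \<longlonglongrightarrow> integral {a..b} g"
proof -
  define h where "h n = (b - a) / real n" for n
  define D where "D n = (\<Sum>j<n. integral {a + real j * h n..a + real (Suc j) * h n} (\<lambda>s. \<bar>g s - g (a + real j * h n)\<bar>))" for n
  define R where "R n = (\<Sum>j<n. h n * g (a + real j * h n))" for n
  have h0: "h n \<ge> 0" for n unfolding h_def using ab by simp
  have sub: "{a + real j * h n..a + real (Suc j) * h n} \<subseteq> {a..b}" if "j < n" for j n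
  proof -
    have "real (Suc j) * h n \<le> real n * h n" using that h0[of n] by (intro mult_right_mono) auto
    also have "\<dots> = b - a" using that unfolding h_def by simp
    finally show ?thesis using h0[of n] by auto
  qed
  have D0: "D n \<ge> 0" for n unfolding D_def
    by (intro sum_nonneg integral_nonneg integrable_continuous_real continuous_intros continuous_on_subset[OF g] sub) auto
  have RD: "\<bar>R n - integral {a..b} g\<bar> \<le> D n" if n: "n \<ge> 1" for n
  proof -
    have "k \<le> n \<Longrightarrow> \<bar>(\<Sum>j<k. h n * g (a + real j * h n)) - integral {a..a + real k * h n} g\<bar>
       \<le> (\<Sum>j<k. integral {a + real j * h n..a + real (Suc j) * h n} (\<lambda>s. \<bar>g s - g (a + real j * h n)\<bar>))" for k
    proof (induction k)
      case (Suc k)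
      let ?c = "a + real k * h n" and ?d = "a + real (Suc k) * h n"
      have cd: "a \<le> ?c" "?c \<le> ?d" "?d - ?c = h n" using h0[of n] by (auto simp: algebra_simps)
      have k: "k < n" using Suc by simp
      have "{a..?d} \<subseteq> {a..b}" using sub[OF k] cd by auto
      then have gi: "g integrable_on {a..?d}" by (intro integrable_continuous_real continuous_on_subset[OF g])
      have gk: "continuous_on {?c..?d} g" by (rule continuous_on_subset[OF g sub[OF k]])
      have "integral {a..?d} g = integral {a..?c} g + integral {?c..?d} g"
        using Henstock_Kurzweil_Integration.integral_combine[OF cd(1,2) gi] by simp
      moreover have "h n * g ?c - integral {?c..?d} g = integral {?c..?d} (\<lambda>s. g ?c - g s)"
        using gk cd by (subst integral_diff) (auto intro: integrable_continuous_real)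
      moreover have "\<bar>integral {?c..?d} (\<lambda>s. g ?c - g s)\<bar> \<le> integral {?c..?d} (\<lambda>s. \<bar>g s - g ?c\<bar>)"
        using integral_norm_bound_integral[of "\<lambda>s. g ?c - g s" "{?c..?d}" "\<lambda>s. \<bar>g s - g ?c\<bar>"] gk
        by (simp add: integrable_continuous_real continuous_intros abs_minus_commute)
      ultimately show ?case using Suc by simp
    qed simp
    from this[of n] show ?thesis using n unfolding R_def D_def h_def by simp
  qed
  have D: "D \<longlonglongrightarrow> 0"
  proof (rule LIMSEQ_I)
    fix e :: real assume e: "e > 0"
    define e' where "e' = e / (2 * (b - a + 1))"
    have e': "e' > 0" using e ab unfolding e'_def by simp
    have "uniformly_continuous_on {a..b} g" using g by (intro compact_uniformly_continuous) auto
    then obtain d where d: "d > 0" "\<And>s t. s \<in> {a..b} \<Longrightarrow> t \<in> {a..b} \<Longrightarrow> dist t s < d \<Longrightarrow> dist (g t) (g s) < e'"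
      unfolding uniformly_continuous_on_def using e' by metis
    obtain n0 where n0: "real n0 > (b - a) / d" using reals_Archimedean2 by blast
    have "norm (D n - 0) < e" if n: "n \<ge> max 1 n0" for n
    proof -
      have hn: "h n < d"
      proof -
        have "(b - a) / d < real n" using n0 n by linarith
        then show ?thesis unfolding h_def using d(1) n by (simp add: field_simps)
      qed
      have "D n \<le> (\<Sum>j<n. e' * h n)" unfolding D_def
      proof (rule sum_mono)
        fix j assume "j \<in> {..<n}"
        then have j: "j < n" by simp
        let ?c = "a + real j * h n" and ?d = "a + real (Suc j) * h n"
        have cd: "?c \<le> ?d" "?d - ?c = h n" using h0[of n] by (auto simp: algebra_simps)
        have "norm (integral {?c..?d} (\<lambda>s. \<bar>g s - g ?c\<bar>)) \<le> e' * (?d - ?c)"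
        proof (rule integral_bound[OF cd(1)])
          show "continuous_on {?c..?d} (\<lambda>s. \<bar>g s - g ?c\<bar>)" by (intro continuous_intros continuous_on_subset[OF g sub[OF j]])
          fix s assume s: "s \<in> {?c..?d}"
          then have "dist s ?c < d" using hn cd by (simp add: dist_real_def)
          moreover have "s \<in> {a..b}" by (rule subsetD[OF sub[OF j] s])
          moreover have "?c \<in> {a..b}" by (rule subsetD[OF sub[OF j]]) (use cd in simp)
          ultimately show "norm \<bar>g s - g ?c\<bar> \<le> e'" using d(2)[of ?c s] by (simp add: dist_real_def)
        qed
        then show "integral {?c..?d} (\<lambda>s. \<bar>g s - g ?c\<bar>) \<le> e' * h n" unfolding cd(2) by simp
      qed
      also have "\<dots> = e' * (b - a)" using n unfolding h_def by simp
      also have "\<dots> \<le> e' * (b - a + 1)" using e' by simp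
      also have "\<dots> = e / 2" unfolding e'_def using ab by (simp add: field_simps)
      also have "\<dots> < e" using e by simp
      finally show ?thesis using D0[of n] by simp
    qed
    then show "\<exists>no. \<forall>n\<ge>no. norm (D n - 0) < e" by blast
  qed
  then show "(\<lambda>n. \<Sum>j<n. integral {a + real j * ((b - a) / real n)..a + real (Suc j) * ((b - a) / real n)} (\<lambda>s. \<bar>g s - g (a + real j * ((b - a) / real n))\<bar>)) \<longlonglongrightarrow> 0"
    unfolding D_def h_def .
  have "(\<lambda>n. R n - integral {a..b} g) \<longlonglongrightarrow> 0"
    by (rule Lim_null_comparison[OF _ D]) (use RD in \<open>auto intro: eventually_sequentiallyI[of 1]\<close>)
  then have "R \<longlonglongrightarrow> integral {a..b} g" by (rule LIM_zero_cancel)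
  then show "(\<lambda>n. \<Sum>j<n. ((b - a) / real n) * g (a + real j * ((b - a) / real n))) \<longlonglongrightarrow> integral {a..b} g"
    unfolding R_def h_def .
qed

text \<open>A pointwise limit of Riemann sums, each of which involves finitely many times.\<close>

lemma measurable_path_integral:
  fixes \<phi> :: "'w \<Rightarrow> real \<Rightarrow> real"
  assumes m: "\<And>s. a \<le> s \<Longrightarrow> s \<le> b \<Longrightarrow> (\<lambda>\<omega>. \<phi> \<omega> s) \<in> borel_measurable M"
    and c: "\<And>\<omega>. \<omega> \<in> space M \<Longrightarrow> continuous_on {a..b} (\<phi> \<omega>)"
  shows "(\<lambda>\<omega>. integral {a..b} (\<phi> \<omega>)) \<in> borel_measurable M"
proof (cases "a \<le> b")
  case True
  show ?thesis
  proof (rule borel_measurable_LIMSEQ_real)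
    show "(\<lambda>n. \<Sum>j<n. ((b - a) / real n) * \<phi> \<omega> (a + real j * ((b - a) / real n))) \<longlonglongrightarrow> integral {a..b} (\<phi> \<omega>)" if "\<omega> \<in> space M" for \<omega>
      by (rule riemann_sum_limit(2)[OF c[OF that] True])
    fix n
    show "(\<lambda>\<omega>. \<Sum>j<n. ((b - a) / real n) * \<phi> \<omega> (a + real j * ((b - a) / real n))) \<in> borel_measurable M"
    proof (intro borel_measurable_sum borel_measurable_times borel_measurable_const m)
      fix j assume j: "j \<in> {..<n}"
      show "a \<le> a + real j * ((b - a) / real n)" using True by simp
      have "real j * ((b - a) / real n) \<le> real n * ((b - a) / real n)" using True j by (intro mult_right_mono) auto
      also have "\<dots> = b - a" using j by simp
      finally show "a + real j * ((b - a) / real n) \<le> b" by simp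
    qed
  qed
qed simp

section \<open>Polynomials as test functions of the martingale problem\<close>

lemma poly_test_add: "poly_test N f \<Longrightarrow> poly_test N g \<Longrightarrow> poly_test N (\<lambda>x. f x + g x)"
proof -
  assume "poly_test N f" "poly_test N g"
  then obtain E c E' c' where f: "finite E" "f = (\<lambda>x. \<Sum>e\<in>E. c e * (\<Prod>i<N. x i ^ e i))"
    and g: "finite E'" "g = (\<lambda>x. \<Sum>e\<in>E'. c' e * (\<Prod>i<N. x i ^ e i))" unfolding poly_test_def by (elim exE conjE)
  have "(\<Sum>e\<in>E. c e * q e) = (\<Sum>e\<in>E \<union> E'. (if e \<in> E then c e else 0) * q e)" for q :: "_ \<Rightarrow> real"
    using f g by (intro sum.mono_neutral_cong_left) auto
  moreover have "(\<Sum>e\<in>E'. c' e * q e) = (\<Sum>e\<in>E \<union> E'. (if e \<in> E' then c' e else 0) * q e)" for q :: "_ \<Rightarrow> real"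
    using f g by (intro sum.mono_neutral_cong_left) auto
  ultimately have "(\<lambda>x. f x + g x) = (\<lambda>x. \<Sum>e\<in>E \<union> E'. ((if e \<in> E then c e else 0) + (if e \<in> E' then c' e else 0)) * (\<Prod>i<N. x i ^ e i))"
    unfolding f(2) g(2) by (simp only: distrib_right sum.distrib)
  moreover have "finite (E \<union> E')" using f g by simp
  ultimately show ?thesis unfolding poly_test_def by (intro exI conjI)
qed

lemma poly_test_sum: "finite K \<Longrightarrow> (\<And>k. k \<in> K \<Longrightarrow> poly_test N (f k)) \<Longrightarrow> poly_test N (\<lambda>x. \<Sum>k\<in>K. f k x)"
proof (induction K rule: finite_induct)
  case empty
  show ?case unfolding poly_test_def by (intro exI[of _ "{}"]) auto
next
  case (insert k K)
  then show ?case using poly_test_add[of N "f k" "\<lambda>x. \<Sum>k\<in>K. f k x"] by simp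
qed

text \<open>Multiplication by a monomial shifts all exponents by \<open>d\<close>; the shift is
  injective, so the coefficients can be transported along its inverse without collisions.\<close>

lemma poly_test_mono_mult:
  assumes "poly_test N g"
  shows "poly_test N (\<lambda>x. (a * (\<Prod>i<N. x i ^ d i)) * g x)"
proof -
  obtain E c where g: "finite E" "g = (\<lambda>x. \<Sum>e\<in>E. c e * (\<Prod>i<N. x i ^ e i))" using assms unfolding poly_test_def by blast
  let ?s = "\<lambda>e i. d i + e i"
  have inj: "inj ?s" by (rule injI) (auto simp: fun_eq_iff)
  have "(a * (\<Prod>i<N. x i ^ d i)) * g x = (\<Sum>e\<in>?s ` E. (a * c (inv ?s e)) * (\<Prod>i<N. x i ^ e i))" for x
    unfolding g(2) by (subst sum.reindex) (auto intro: inj_on_subset[OF inj] simp: inv_f_f[OF inj] sum_distrib_left power_add prod.distrib mult_ac)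
  then show ?thesis unfolding poly_test_def using g(1) by (intro exI[of _ "?s ` E"] exI[of _ "\<lambda>e. a * c (inv ?s e)"]) auto
qed

lemma pol_poly_test: "pol N d f \<Longrightarrow> poly_test N f"
proof (induction rule: pol.induct)
  case (pol_const d c)
  show ?case unfolding poly_test_def by (intro exI[of _ "{\<lambda>_. 0}"] exI[of _ "\<lambda>_. c"]) auto
next
  case (pol_var i d)
  have "(\<Prod>j<N. x j ^ (if j = i then 1 else 0)) = x i" for x :: "nat \<Rightarrow> real"
    using pol_var by (simp add: power_0 if_distrib[of "\<lambda>e. _ ^ e"] cong: if_cong)
  then show ?case unfolding poly_test_def by (intro exI[of _ "{\<lambda>j. if j = i then 1 else 0}"] exI[of _ "\<lambda>_. 1"]) auto
next
  case (pol_add d f g)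
  then show ?case by (intro poly_test_add)
next
  case (pol_mult_le d f e g m)
  then obtain E c where f: "finite E" "f = (\<lambda>x. \<Sum>e\<in>E. c e * (\<Prod>i<N. x i ^ e i))" unfolding poly_test_def by blast
  have "(\<lambda>x. f x * g x) = (\<lambda>x. \<Sum>e\<in>E. (c e * (\<Prod>i<N. x i ^ e i)) * g x)" unfolding f(2) by (simp add: sum_distrib_right)
  then show ?case using f(1) pol_mult_le by (simp only:) (intro poly_test_sum poly_test_mono_mult)
qed

text \<open>The drift of a polynomial observable is again polynomial, hence continuous along paths
  and measurable at fixed times.\<close>

lemma pol_gen:
  assumes f: "pol N d f"
  shows "\<exists>d'. pol N d' (gen N p \<beta> J f)"
proof -
  have xg: "pol N (Suc e) (\<lambda>x. \<Sum>j<N. x j * pd j q x)" if "pol N e q" for e q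
    by (intro pol_sum pol_mult_le[where d=1 and e=e] pol_var pol_pd that) auto
  have sg: "pol N (e + 2) (\<lambda>x. sgrad N q x i)" if "pol N e q" "i < N" for e q i
    unfolding sgrad_def[abs_def]
    by (intro pol_diff pol_mult_le[where d="Suc e" and e=1] pol_divide xg pol_var that pol_mono[OF pol_pd[OF that(1)]]) (auto simp: that)
  have "pol N (d + 2) (slap N f)"
  proof -
    have "slap N f = (\<lambda>x. (\<Sum>i<N. pd i (pd i f) x) - (\<Sum>i<N. \<Sum>j<N. x i * x j * pd i (pd j f) x) / real N - (real N - 1) / real N * (\<Sum>i<N. x i * pd i f x))"
      using slap_pol[OF f] ehess_pol[OF f] by auto
    moreover have "pol N (d + 2) (\<lambda>x. x i * x j * pd i (pd j f) x)" if "i < N" "j < N" for i j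
      by (intro pol_mult_le[where d=2 and e=d] pol_mult_le[where d=1 and e=1] pol_var pol_pd f) (auto simp: that)
    ultimately show ?thesis
      by (simp only:) (intro pol_diff pol_divide pol_cmult pol_sum pol_mono[OF xg[OF f]] pol_mono[OF pol_pd[OF pol_pd[OF f]]]; simp)
  qed
  then have "pol N ((p + 2) + (d + 2)) (gen N p \<beta> J f)"
    unfolding gen_def[abs_def]
    by (intro pol_diff pol_cmult pol_sum pol_mult[OF sg[OF pol_Ham] sg[OF f]]) (auto intro: pol_mono)
  then show ?thesis by blast
qed


locale langevin_process =
  fixes N p :: nat and \<beta> :: real and J :: "nat list \<Rightarrow> real" and x0 :: "nat \<Rightarrow> real"
    and M :: "'w measure" and X :: "'w \<Rightarrow> real \<Rightarrow> nat \<Rightarrow> real"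
  assumes lang: "langevin N p \<beta> J x0 M X"

sublocale langevin_process \<subseteq> prob_space M
  using lang unfolding langevin_def by blast

section \<open>Paths, filtration and orthogonality of increments\<close>

context langevin_process
begin

lemma X_sphere: "\<omega> \<in> space M \<Longrightarrow> t \<ge> 0 \<Longrightarrow> X \<omega> t \<in> sphereN N"
  and X_cont: "\<omega> \<in> space M \<Longrightarrow> i < N \<Longrightarrow> continuous_on {0..} (\<lambda>t. X \<omega> t i)"
  and X_meas: "t \<ge> 0 \<Longrightarrow> i < N \<Longrightarrow> (\<lambda>\<omega>. X \<omega> t i) \<in> borel_measurable M"
  and X_mart: "poly_test N f \<Longrightarrow> ct_martingale M (nat_filt M X N)
          (\<lambda>\<omega> t. f (X \<omega> t) - f (X \<omega> 0) - integral {0..t} (\<lambda>s. gen N p \<beta> J f (X \<omega> s)))"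
  using lang unfolding langevin_def by blast+

lemma pol_path_cont: "pol N d f \<Longrightarrow> \<omega> \<in> space M \<Longrightarrow> continuous_on {0..} (\<lambda>t. f (X \<omega> t))"
  by (induction rule: pol.induct) (auto intro!: continuous_intros X_cont)

lemma pol_path_meas: "pol N d f \<Longrightarrow> t \<ge> 0 \<Longrightarrow> (\<lambda>\<omega>. f (X \<omega> t)) \<in> borel_measurable M"
  by (induction rule: pol.induct) (auto intro!: X_meas)

abbreviation "Filt \<equiv> nat_filt M X N"

lemma Filt_gen_sub: "{(\<lambda>\<omega>. X \<omega> r i) -` A \<inter> space M | r i A. 0 \<le> r \<and> r \<le> s \<and> i < N \<and> A \<in> sets borel} \<subseteq> sets M"
  using X_meas by (auto intro: measurable_sets)

lemma space_Filt [simp]: "space (Filt s) = space M"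
  unfolding nat_filt_def by (intro space_measure_of) auto

lemma sets_Filt: "sets (Filt s) = sigma_sets (space M) {(\<lambda>\<omega>. X \<omega> r i) -` A \<inter> space M | r i A. 0 \<le> r \<and> r \<le> s \<and> i < N \<and> A \<in> sets borel}"
  unfolding nat_filt_def by (intro sets_measure_of) auto

lemma subalg_Filt: "subalgebra M (Filt s)"
  unfolding subalgebra_def sets_Filt using sets.sigma_sets_subset[OF Filt_gen_sub] by simp

lemma subalg_Filt_mono: "s \<le> t \<Longrightarrow> subalgebra (Filt t) (Filt s)"
  unfolding subalgebra_def sets_Filt space_Filt by (intro conjI refl sigma_sets_subseteq) force

lemma X_meas_Filt: "0 \<le> r \<Longrightarrow> r \<le> s \<Longrightarrow> i < N \<Longrightarrow> (\<lambda>\<omega>. X \<omega> r i) \<in> borel_measurable (Filt s)"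
  by (rule measurableI) (auto simp: sets_Filt intro!: sigma_sets.Basic)

lemma pol_path_meas_Filt: "pol N d f \<Longrightarrow> 0 \<le> r \<Longrightarrow> r \<le> s \<Longrightarrow> (\<lambda>\<omega>. f (X \<omega> r)) \<in> borel_measurable (Filt s)"
  by (induction rule: pol.induct) (auto intro!: X_meas_Filt)

definition mart :: "((nat \<Rightarrow> real) \<Rightarrow> real) \<Rightarrow> 'w \<Rightarrow> real \<Rightarrow> real" where
  "mart f \<omega> t = f (X \<omega> t) - f (X \<omega> 0) - integral {0..t} (\<lambda>s. gen N p \<beta> J f (X \<omega> s))"

lemma gen_path_cont: "pol N d f \<Longrightarrow> \<omega> \<in> space M \<Longrightarrow> continuous_on {0..} (\<lambda>t. gen N p \<beta> J f (X \<omega> t))"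
  using pol_gen[of N d f p \<beta> J] pol_path_cont by blast

lemma gen_path_meas: "pol N d f \<Longrightarrow> t \<ge> 0 \<Longrightarrow> (\<lambda>\<omega>. gen N p \<beta> J f (X \<omega> t)) \<in> borel_measurable M"
  using pol_gen[of N d f p \<beta> J] pol_path_meas by blast

lemma mart_props:
  assumes f: "pol N d f"
  shows "t \<ge> 0 \<Longrightarrow> integrable M (\<lambda>\<omega>. mart f \<omega> t)" "t \<ge> 0 \<Longrightarrow> (\<lambda>\<omega>. mart f \<omega> t) \<in> borel_measurable (Filt t)"
    "0 \<le> s \<Longrightarrow> s \<le> t \<Longrightarrow> AE \<omega> in M. real_cond_exp M (Filt s) (\<lambda>\<omega>. mart f \<omega> t) \<omega> = mart f \<omega> s"
  using X_mart[OF pol_poly_test[OF f]] unfolding ct_martingale_def mart_def by auto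

lemma mart_meas: "pol N d f \<Longrightarrow> t \<ge> 0 \<Longrightarrow> (\<lambda>\<omega>. mart f \<omega> t) \<in> borel_measurable M"
  using mart_props(1) by blast

text \<open>The form in which the martingale property is used below: increments are orthogonal to
  bounded functions of the past, and conditional expectations disappear from view.\<close>

lemma mart_orth:
  assumes f: "pol N d f" and st: "0 \<le> s" "s \<le> t"
    and Z: "Z \<in> borel_measurable (Filt s)" "\<And>\<omega>. \<omega> \<in> space M \<Longrightarrow> \<bar>Z \<omega>\<bar> \<le> B"
  shows "integrable M (\<lambda>\<omega>. Z \<omega> * (mart f \<omega> t - mart f \<omega> s))" "expectation (\<lambda>\<omega>. Z \<omega> * (mart f \<omega> t - mart f \<omega> s)) = 0"
proof -
  interpret S: finite_measure_subalgebra M "Filt s"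
    by unfold_locales (rule subalg_Filt)
  have ZM [measurable]: "Z \<in> borel_measurable M" by (rule measurable_from_subalg[OF subalg_Filt Z(1)])
  have i: "integrable M (\<lambda>\<omega>. Z \<omega> * mart f \<omega> r)" if "r \<ge> 0" for r
  proof (rule Bochner_Integration.integrable_bound[where f="\<lambda>\<omega>. B * mart f \<omega> r"])
    show "integrable M (\<lambda>\<omega>. B * mart f \<omega> r)" using mart_props(1)[OF f that] by simp
    show "(\<lambda>\<omega>. Z \<omega> * mart f \<omega> r) \<in> borel_measurable M" using mart_meas[OF f that] by simp
    show "AE \<omega> in M. norm (Z \<omega> * mart f \<omega> r) \<le> norm (B * mart f \<omega> r)"
    proof (rule AE_I2)
      fix \<omega> assume "\<omega> \<in> space M"
      then have "\<bar>Z \<omega>\<bar> \<le> \<bar>B\<bar>" using Z(2) abs_ge_self order_trans by blast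
      then show "norm (Z \<omega> * mart f \<omega> r) \<le> norm (B * mart f \<omega> r)" by (simp add: abs_mult mult_right_mono)
    qed
  qed
  have t0: "t \<ge> 0" using st by simp
  note int = S.real_cond_exp_intg[OF i[OF t0] Z(1) mart_meas[OF f t0]]
  have "expectation (\<lambda>\<omega>. Z \<omega> * mart f \<omega> t) = expectation (\<lambda>\<omega>. Z \<omega> * real_cond_exp M (Filt s) (\<lambda>\<omega>. mart f \<omega> t) \<omega>)"
    using int(2) by simp
  also have "\<dots> = expectation (\<lambda>\<omega>. Z \<omega> * mart f \<omega> s)"
    using mart_props(3)[OF f st] mart_meas[OF f st(1)] by (intro integral_cong_AE) auto
  finally show "expectation (\<lambda>\<omega>. Z \<omega> * (mart f \<omega> t - mart f \<omega> s)) = 0"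
    using i[OF t0] i[OF st(1)] by (simp add: right_diff_distrib)
  show "integrable M (\<lambda>\<omega>. Z \<omega> * (mart f \<omega> t - mart f \<omega> s))"
    using i[OF t0] i[OF st(1)] by (simp add: right_diff_distrib)
qed

lemma gen_integral_split:
  assumes f: "pol N d f" and w: "\<omega> \<in> space M" and st: "0 \<le> s" "s \<le> t"
  shows "integral {0..t} (\<lambda>s. gen N p \<beta> J f (X \<omega> s)) = integral {0..s} (\<lambda>s. gen N p \<beta> J f (X \<omega> s)) + integral {s..t} (\<lambda>s. gen N p \<beta> J f (X \<omega> s))"
  using Henstock_Kurzweil_Integration.integral_combine[OF st, of "\<lambda>s. gen N p \<beta> J f (X \<omega> s)"]
    integrable_continuous_real[OF continuous_on_subset[OF gen_path_cont[OF f w]], of 0 t] by simp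

lemma mart_diff:
  assumes f: "pol N d f" and w: "\<omega> \<in> space M" and st: "0 \<le> s" "s \<le> t"
  shows "mart f \<omega> t - mart f \<omega> s = f (X \<omega> t) - f (X \<omega> s) - integral {s..t} (\<lambda>r. gen N p \<beta> J f (X \<omega> r))"
  unfolding mart_def gen_integral_split[OF assms] by simp

lemma gen_integral_bound:
  assumes f: "pol N d f" and w: "\<omega> \<in> space M" and st: "0 \<le> s" "s \<le> t" and C: "\<And>x. x \<in> sphereN N \<Longrightarrow> \<bar>gen N p \<beta> J f x\<bar> \<le> C"
  shows "\<bar>integral {s..t} (\<lambda>r. gen N p \<beta> J f (X \<omega> r))\<bar> \<le> C * (t - s)"
  using integral_bound[OF st(2) continuous_on_subset[OF gen_path_cont[OF f w]], of C] C X_sphere[OF w] st by auto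

lemma mart_bound:
  assumes f: "pol N d f" and w: "\<omega> \<in> space M" and t: "0 \<le> t"
    and C: "\<And>x. x \<in> sphereN N \<Longrightarrow> \<bar>f x\<bar> \<le> C" "\<And>x. x \<in> sphereN N \<Longrightarrow> \<bar>gen N p \<beta> J f x\<bar> \<le> C"
  shows "\<bar>mart f \<omega> t\<bar> \<le> 2 * C + C * t"
  using gen_integral_bound[OF f w order_refl t C(2)] C(1)[OF X_sphere[OF w t]] C(1)[OF X_sphere[OF w order_refl]]
  unfolding mart_def by (simp add: abs_le_iff)

lemma mart_path_cont:
  assumes f: "pol N d f" and w: "\<omega> \<in> space M"
  shows "continuous_on {0..} (mart f \<omega>)"
proof -
  have "continuous_on {0..} (\<lambda>t. integral {0..t} (\<lambda>s. gen N p \<beta> J f (X \<omega> s)))"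
  proof (rule continuous_on_eq_continuous_within[THEN iffD2], rule ballI)
    fix t :: real assume t: "t \<in> {0..}"
    have "continuous_on {0..t + 1} (\<lambda>t. integral {0..t} (\<lambda>s. gen N p \<beta> J f (X \<omega> s)))"
      by (intro indefinite_integral_continuous_1 integrable_continuous_real continuous_on_subset[OF gen_path_cont[OF f w]]) auto
    then have "continuous (at t within {0..t + 1}) (\<lambda>t. integral {0..t} (\<lambda>s. gen N p \<beta> J f (X \<omega> s)))"
      using t by (auto simp: continuous_on_eq_continuous_within)
    \<comment> \<open>Near t the half-line and the compact interval coincide, so continuity passes
      from one to the other.\<close>
    moreover have "at t within {0..t + 1} = at t within {0..}"
      using t by (intro at_within_nhd[of t "{t - 1<..<t + 1}"]) auto
    ultimately show "continuous (at t within {0..}) (\<lambda>t. integral {0..t} (\<lambda>s. gen N p \<beta> J f (X \<omega> s)))"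
      unfolding continuous_within by simp
  qed
  then show ?thesis unfolding mart_def[abs_def] by (intro continuous_intros pol_path_cont[OF f w])
qed


text \<open>A common bound C for quantities that merely have to stay bounded, and a separate
  \<kappa> for twice the carre du champ, which will be of order 1/N.\<close>

definition var_consts :: "((nat \<Rightarrow> real) \<Rightarrow> real) \<Rightarrow> real \<Rightarrow> real \<Rightarrow> bool" where
  "var_consts f C \<kappa> \<longleftrightarrow> (\<forall>x\<in>sphereN N. \<bar>f x\<bar> \<le> C \<and> \<bar>gen N p \<beta> J f x\<bar> \<le> C \<and> \<bar>gen N p \<beta> J (\<lambda>x. (f x)\<^sup>2) x\<bar> \<le> C \<and>
     \<bar>gen N p \<beta> J (\<lambda>x. (f x)\<^sup>2) x - 2 * f x * gen N p \<beta> J f x\<bar> \<le> \<kappa>)"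

lemma sphere_nonempty: "sphereN N \<noteq> {}"
  using X_sphere[of _ 0] not_empty by blast

text \<open>Testing the martingale problem with both \<open>f\<close> and \<open>f\<^sup>2\<close> controls the quadratic variation by \<open>\<kappa>\<close>;
  freezing \<open>f\<close> at time \<open>s\<close> costs terms that vanish when the partition of \<open>[0, T]\<close> is refined.\<close>

lemma mart_increment_sq:
  assumes f: "pol N d f" and C: "var_consts f C \<kappa>" and st: "0 \<le> s" "s \<le> t"
  shows "integrable M (\<lambda>\<omega>. (mart f \<omega> t - mart f \<omega> s)\<^sup>2)"
    and "integrable M (\<lambda>\<omega>. integral {s..t} (\<lambda>r. \<bar>f (X \<omega> r) - f (X \<omega> s)\<bar>))"
    and "expectation (\<lambda>\<omega>. (mart f \<omega> t - mart f \<omega> s)\<^sup>2) \<le> 2 * \<kappa> * (t - s)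
      + 4 * C * expectation (\<lambda>\<omega>. integral {s..t} (\<lambda>r. \<bar>f (X \<omega> r) - f (X \<omega> s)\<bar>)) + 2 * C\<^sup>2 * (t - s)\<^sup>2"
proof -
  have f2: "pol N (d * 2) (\<lambda>x. (f x)\<^sup>2)" by (rule pol_power[OF f])
  have t0: "0 \<le> t" using st by simp
  have c: "\<And>x. x \<in> sphereN N \<Longrightarrow> \<bar>f x\<bar> \<le> C" "\<And>x. x \<in> sphereN N \<Longrightarrow> \<bar>gen N p \<beta> J f x\<bar> \<le> C"
    "\<And>x. x \<in> sphereN N \<Longrightarrow> \<bar>gen N p \<beta> J (\<lambda>x. (f x)\<^sup>2) x\<bar> \<le> C"
    "\<And>x. x \<in> sphereN N \<Longrightarrow> \<bar>gen N p \<beta> J (\<lambda>x. (f x)\<^sup>2) x - 2 * f x * gen N p \<beta> J f x\<bar> \<le> \<kappa>"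
    using C unfolding var_consts_def by auto
  have C0: "C \<ge> 0" using sphere_nonempty c(1) abs_ge_zero order_trans by blast
  let ?Lf = "\<lambda>\<omega> r. gen N p \<beta> J f (X \<omega> r)" and ?L2 = "\<lambda>\<omega> r. gen N p \<beta> J (\<lambda>x. (f x)\<^sup>2) (X \<omega> r)"
  let ?D = "\<lambda>\<omega>. integral {s..t} (\<lambda>r. \<bar>f (X \<omega> r) - f (X \<omega> s)\<bar>)"
  have cf: "continuous_on {s..t} (\<lambda>r. f (X \<omega> r))" if "\<omega> \<in> space M" for \<omega>
    by (rule continuous_on_subset[OF pol_path_cont[OF f that]]) (use st in auto)
  have cg: "continuous_on {s..t} (?Lf \<omega>)" if "\<omega> \<in> space M" for \<omega>
    by (rule continuous_on_subset[OF gen_path_cont[OF f that]]) (use st in auto)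
  have cg2: "continuous_on {s..t} (?L2 \<omega>)" if "\<omega> \<in> space M" for \<omega>
    by (rule continuous_on_subset[OF gen_path_cont[OF f2 that]]) (use st in auto)
  have mf [measurable]: "(\<lambda>\<omega>. f (X \<omega> s)) \<in> borel_measurable M" "(\<lambda>\<omega>. f (X \<omega> t)) \<in> borel_measurable M"
    using pol_path_meas[OF f] st by auto
  have mM [measurable]: "(\<lambda>\<omega>. mart f \<omega> t) \<in> borel_measurable M" "(\<lambda>\<omega>. mart f \<omega> s) \<in> borel_measurable M"
    using mart_meas[OF f] st by auto
  have mD [measurable]: "?D \<in> borel_measurable M"
    by (rule measurable_path_integral) (use st pol_path_meas[OF f] cf in \<open>auto intro!: continuous_intros\<close>)
  have mI [measurable]: "(\<lambda>\<omega>. integral {s..t} (?Lf \<omega>)) \<in> borel_measurable M"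
    by (rule measurable_path_integral) (use st gen_path_meas[OF f] cg in auto)
  have mI2 [measurable]: "(\<lambda>\<omega>. integral {s..t} (?L2 \<omega>)) \<in> borel_measurable M"
    by (rule measurable_path_integral) (use st gen_path_meas[OF f2] cg2 in auto)
  have bI: "\<bar>integral {s..t} (?Lf \<omega>)\<bar> \<le> C * (t - s)" if "\<omega> \<in> space M" for \<omega> by (rule gen_integral_bound[OF f that st c(2)])
  have bI2: "\<bar>integral {s..t} (?L2 \<omega>)\<bar> \<le> C * (t - s)" if "\<omega> \<in> space M" for \<omega> by (rule gen_integral_bound[OF f2 that st c(3)])
  have bf: "\<bar>f (X \<omega> r)\<bar> \<le> C" if "\<omega> \<in> space M" "r \<ge> 0" for \<omega> r using c(1) X_sphere that by auto
  have bD: "\<bar>?D \<omega>\<bar> \<le> 2 * C * (t - s)" if w: "\<omega> \<in> space M" for \<omega>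
  proof -
    have "norm (?D \<omega>) \<le> 2 * C * (t - s)"
    proof (rule integral_bound[OF st(2)])
      show "continuous_on {s..t} (\<lambda>r. \<bar>f (X \<omega> r) - f (X \<omega> s)\<bar>)" using cf[OF w] by (intro continuous_intros)
      fix r assume "r \<in> {s..t}"
      then have "r \<ge> 0" using st by auto
      then show "norm \<bar>f (X \<omega> r) - f (X \<omega> s)\<bar> \<le> 2 * C"
        using bf[OF w, of r] bf[OF w st(1)] abs_triangle_ineq4[of "f (X \<omega> r)" "f (X \<omega> s)"] by simp
    qed
    then show ?thesis by simp
  qed
  show iD: "integrable M ?D" using bD by (intro integrable_const_bound[where B="2 * C * (t - s)"]) auto
  have dm: "\<bar>mart f \<omega> t - mart f \<omega> s\<bar> \<le> 2 * C + C * (t - s)" if w: "\<omega> \<in> space M" for \<omega>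
    unfolding mart_diff[OF f w st] using bI[OF w] bf[OF w t0] bf[OF w st(1)] by (simp add: abs_le_iff)
  show "integrable M (\<lambda>\<omega>. (mart f \<omega> t - mart f \<omega> s)\<^sup>2)"
  proof (rule integrable_const_bound[where B="(2 * C + C * (t - s))\<^sup>2"])
    show "AE \<omega> in M. norm ((mart f \<omega> t - mart f \<omega> s)\<^sup>2) \<le> (2 * C + C * (t - s))\<^sup>2"
      using dm C0 st by (intro AE_I2) (simp add: abs_le_square_iff[symmetric])
  qed simp
  note im = this
  have fi: "integrable M (\<lambda>\<omega>. f (X \<omega> s))" using bf st by (intro integrable_const_bound[where B=C]) auto
  have ii: "integrable M (\<lambda>\<omega>. f (X \<omega> s) * integral {s..t} (?Lf \<omega>))"
  proof (rule integrable_const_bound[where B="C * (C * (t - s))"])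
    show "AE \<omega> in M. norm (f (X \<omega> s) * integral {s..t} (?Lf \<omega>)) \<le> C * (C * (t - s))"
      using bf bI st C0 by (intro AE_I2) (auto simp: abs_mult intro!: mult_mono)
  qed simp
  have ii2: "integrable M (\<lambda>\<omega>. integral {s..t} (?L2 \<omega>))" using bI2 by (intro integrable_const_bound[where B="C * (t - s)"]) auto
  note o1 = mart_orth[OF f st pol_path_meas_Filt[OF f st(1) order_refl], of C]
  note o2 = mart_orth[OF f2 st, of "\<lambda>_. 1" 1]
  have pt: "(mart f \<omega> t - mart f \<omega> s)\<^sup>2 \<le> 2 * ((mart (\<lambda>x. (f x)\<^sup>2) \<omega> t - mart (\<lambda>x. (f x)\<^sup>2) \<omega> s) - 2 * (f (X \<omega> s) * (mart f \<omega> t - mart f \<omega> s)))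
      + 2 * (\<kappa> * (t - s) + 2 * C * ?D \<omega>) + 2 * C\<^sup>2 * (t - s)\<^sup>2" if w: "\<omega> \<in> space M" for \<omega>
  proof -
    define a where "a = f (X \<omega> t)"
    define b where "b = f (X \<omega> s)"
    define I where "I = integral {s..t} (?Lf \<omega>)"
    define I2 where "I2 = integral {s..t} (?L2 \<omega>)"
    have m1: "mart f \<omega> t - mart f \<omega> s = a - b - I" unfolding mart_diff[OF f w st] a_def b_def I_def ..
    have m2: "mart (\<lambda>x. (f x)\<^sup>2) \<omega> t - mart (\<lambda>x. (f x)\<^sup>2) \<omega> s = a\<^sup>2 - b\<^sup>2 - I2" unfolding mart_diff[OF f2 w st] a_def b_def I2_def ..
    have "I2 - 2 * b * I = integral {s..t} (\<lambda>r. ?L2 \<omega> r - 2 * b * ?Lf \<omega> r)"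
      unfolding I2_def I_def using cg[OF w] cg2[OF w]
      by (subst integral_diff) (auto intro!: integrable_continuous_real continuous_intros)
    also have "\<dots> \<le> integral {s..t} (\<lambda>r. \<kappa> + 2 * C * \<bar>f (X \<omega> r) - b\<bar>)"
    proof (rule integral_le)
      show "(\<lambda>r. ?L2 \<omega> r - 2 * b * ?Lf \<omega> r) integrable_on {s..t}" using cg[OF w] cg2[OF w]
        by (intro integrable_continuous_real continuous_intros)
      show "(\<lambda>r. \<kappa> + 2 * C * \<bar>f (X \<omega> r) - b\<bar>) integrable_on {s..t}" using cf[OF w]
        by (intro integrable_continuous_real continuous_intros)
      fix r assume r: "r \<in> {s..t}"
      then have xr: "X \<omega> r \<in> sphereN N" using X_sphere[OF w] st by auto
      have "?L2 \<omega> r - 2 * b * ?Lf \<omega> r = (?L2 \<omega> r - 2 * f (X \<omega> r) * ?Lf \<omega> r) + 2 * ((f (X \<omega> r) - b) * ?Lf \<omega> r)"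
        by (simp add: algebra_simps)
      moreover have "(f (X \<omega> r) - b) * ?Lf \<omega> r \<le> \<bar>f (X \<omega> r) - b\<bar> * C"
        using mult_left_mono[OF c(2)[OF xr], of "\<bar>f (X \<omega> r) - b\<bar>"] abs_ge_self[of "(f (X \<omega> r) - b) * ?Lf \<omega> r"] by (simp add: abs_mult)
      ultimately show "?L2 \<omega> r - 2 * b * ?Lf \<omega> r \<le> \<kappa> + 2 * C * \<bar>f (X \<omega> r) - b\<bar>"
        using c(4)[OF xr] by (simp add: abs_le_iff mult.commute)
    qed
    also have "\<dots> = \<kappa> * (t - s) + 2 * C * ?D \<omega>"
      unfolding b_def using cf[OF w] st
      by (subst integral_add) (auto intro!: integrable_continuous_real continuous_intros simp: mult.commute)
    finally have 1: "I2 - 2 * b * I \<le> \<kappa> * (t - s) + 2 * C * ?D \<omega>" .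
    have "I\<^sup>2 \<le> (C * (t - s))\<^sup>2" using bI[OF w] C0 st unfolding I_def by (simp add: abs_le_square_iff[symmetric])
    then have 2: "I\<^sup>2 \<le> C\<^sup>2 * (t - s)\<^sup>2" by (simp add: power_mult_distrib)
    have 3: "(a - b - I)\<^sup>2 \<le> 2 * (a - b)\<^sup>2 + 2 * I\<^sup>2"
      using zero_le_power2[of "a - b + I"] by (simp add: power2_eq_square algebra_simps)
    have "(a - b)\<^sup>2 = (a\<^sup>2 - b\<^sup>2 - I2) - 2 * (b * (a - b - I)) + (I2 - 2 * b * I)" by (simp add: power2_eq_square algebra_simps)
    moreover have aux: "R \<le> 2 * A + 2 * q + 2 * r" if "R \<le> 2 * P + 2 * i" "P = A + E" "E \<le> q" "i \<le> r" for R P A E q i r :: real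
      using that by linarith
    ultimately show ?thesis unfolding m1 m2 b_def[symmetric] mult.assoc[of 2 "C\<^sup>2"] using 1[folded b_def] 2 3 by (intro aux)
  qed
  define U where "U \<omega> = 1 * (mart (\<lambda>x. (f x)\<^sup>2) \<omega> t - mart (\<lambda>x. (f x)\<^sup>2) \<omega> s)" for \<omega>
  define V where "V \<omega> = f (X \<omega> s) * (mart f \<omega> t - mart f \<omega> s)" for \<omega>
  define D where "D \<omega> = ?D \<omega>" for \<omega>
  have iU: "integrable M U" "expectation U = 0" unfolding U_def[abs_def] using o2 by auto
  have iV: "integrable M V" "expectation V = 0" unfolding V_def[abs_def] using o1 bf st by auto
  have iD': "integrable M D" unfolding D_def[abs_def] by (rule iD)
  have "expectation (\<lambda>\<omega>. (mart f \<omega> t - mart f \<omega> s)\<^sup>2) \<le> expectation (\<lambda>\<omega>. 2 * (U \<omega> - 2 * V \<omega>) + 2 * (\<kappa> * (t - s) + 2 * C * D \<omega>) + 2 * C\<^sup>2 * (t - s)\<^sup>2)"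
  proof (rule integral_mono[OF im])
    show "integrable M (\<lambda>\<omega>. 2 * (U \<omega> - 2 * V \<omega>) + 2 * (\<kappa> * (t - s) + 2 * C * D \<omega>) + 2 * C\<^sup>2 * (t - s)\<^sup>2)"
      using iU(1) iV(1) iD' by auto
    show "(mart f \<omega> t - mart f \<omega> s)\<^sup>2 \<le> 2 * (U \<omega> - 2 * V \<omega>) + 2 * (\<kappa> * (t - s) + 2 * C * D \<omega>) + 2 * C\<^sup>2 * (t - s)\<^sup>2" if "\<omega> \<in> space M" for \<omega>
      using pt[OF that] unfolding U_def V_def D_def by simp
  qed
  also have "\<dots> = 2 * \<kappa> * (t - s) + 4 * C * expectation D + 2 * C\<^sup>2 * (t - s)\<^sup>2"
    using iU iV iD' by (simp add: prob_space)
  finally show "expectation (\<lambda>\<omega>. (mart f \<omega> t - mart f \<omega> s)\<^sup>2) \<le> 2 * \<kappa> * (t - s) + 4 * C * expectation ?D + 2 * C\<^sup>2 * (t - s)\<^sup>2"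
    unfolding D_def[abs_def] .
qed

lemma mart_0 [simp]: "mart f \<omega> 0 = 0"
  unfolding mart_def by simp

text \<open>Increments over a partition are orthogonal, so second moments add. The freezing errors
  vanish by dominated convergence and the squared drift integrals sum to order 1/n. What remains is
  \<kappa> T, doubled when the drift is split off each squared increment.\<close>

lemma mart_second_moment:
  assumes f: "pol N d f" and C: "var_consts f C \<kappa>" and T: "0 \<le> T"
  shows "integrable M (\<lambda>\<omega>. (mart f \<omega> T)\<^sup>2)" "expectation (\<lambda>\<omega>. (mart f \<omega> T)\<^sup>2) \<le> 2 * \<kappa> * T"
proof -
  show "integrable M (\<lambda>\<omega>. (mart f \<omega> T)\<^sup>2)"
    using mart_increment_sq(1)[OF f C order_refl T] by simp
  have c: "\<And>x. x \<in> sphereN N \<Longrightarrow> \<bar>f x\<bar> \<le> C" "\<And>x. x \<in> sphereN N \<Longrightarrow> \<bar>gen N p \<beta> J f x\<bar> \<le> C"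
    using C unfolding var_consts_def by auto
  have C0: "C \<ge> 0" using sphere_nonempty c(1) abs_ge_zero order_trans by blast
  define h where "h n = (T - 0) / real n" for n
  define D where "D n \<omega> = (\<Sum>j<n. integral {0 + real j * h n..0 + real (Suc j) * h n} (\<lambda>r. \<bar>f (X \<omega> r) - f (X \<omega> (0 + real j * h n))\<bar>))" for n \<omega>
  have h0: "h n \<ge> 0" for n unfolding h_def using T by simp
  have st: "0 \<le> 0 + real j * h n" "0 + real j * h n \<le> 0 + real (Suc j) * h n" for j n
    using h0[of n] by (auto simp: algebra_simps)
  have df: "0 + real (Suc j) * h n - (0 + real j * h n) = h n" for j n by (simp add: algebra_simps)
  note inc = mart_increment_sq[OF f C st]
  have sq: "expectation (\<lambda>\<omega>. (mart f \<omega> (0 + real k * h n))\<^sup>2) = (\<Sum>j<k. expectation (\<lambda>\<omega>. (mart f \<omega> (0 + real (Suc j) * h n) - mart f \<omega> (0 + real j * h n))\<^sup>2))" for k n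
  proof (induction k)
    case (Suc k)
    let ?s = "0 + real k * h n" and ?t = "0 + real (Suc k) * h n"
    note o = mart_orth[OF f st mart_props(2)[OF f st(1)] mart_bound[OF f _ st(1) c]]
    have isq: "integrable M (\<lambda>\<omega>. (mart f \<omega> ?s)\<^sup>2)" using mart_increment_sq(1)[OF f C order_refl st(1)] by simp
    have "(mart f \<omega> ?t)\<^sup>2 = (mart f \<omega> ?s)\<^sup>2 + (2 * (mart f \<omega> ?s * (mart f \<omega> ?t - mart f \<omega> ?s)) + (mart f \<omega> ?t - mart f \<omega> ?s)\<^sup>2)" for \<omega>
      by (simp add: power2_eq_square algebra_simps)
    then have "expectation (\<lambda>\<omega>. (mart f \<omega> ?t)\<^sup>2) = expectation (\<lambda>\<omega>. (mart f \<omega> ?s)\<^sup>2 + (2 * (mart f \<omega> ?s * (mart f \<omega> ?t - mart f \<omega> ?s)) + (mart f \<omega> ?t - mart f \<omega> ?s)\<^sup>2))"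
      by (simp only:)
    also have "\<dots> = expectation (\<lambda>\<omega>. (mart f \<omega> ?s)\<^sup>2) + (2 * expectation (\<lambda>\<omega>. mart f \<omega> ?s * (mart f \<omega> ?t - mart f \<omega> ?s)) + expectation (\<lambda>\<omega>. (mart f \<omega> ?t - mart f \<omega> ?s)\<^sup>2))"
    proof -
      define U V W where "U \<omega> = (mart f \<omega> ?s)\<^sup>2" and "V \<omega> = mart f \<omega> ?s * (mart f \<omega> ?t - mart f \<omega> ?s)" and "W \<omega> = (mart f \<omega> ?t - mart f \<omega> ?s)\<^sup>2" for \<omega>
      have 1: "integrable M U" unfolding U_def[abs_def] by (rule isq)
      have 2: "integrable M V" unfolding V_def[abs_def] by (rule o(1))
      have 3: "integrable M W" unfolding W_def[abs_def] by (rule mart_increment_sq(1)[OF f C]) (rule st)+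
      from 1 2 3 have "expectation (\<lambda>\<omega>. U \<omega> + (2 * V \<omega> + W \<omega>)) = expectation U + (2 * expectation V + expectation W)" by simp
      then show ?thesis unfolding U_def[abs_def] V_def[abs_def] W_def[abs_def] .
    qed
    moreover have "expectation (\<lambda>\<omega>. mart f \<omega> ?s * (mart f \<omega> ?t - mart f \<omega> ?s)) = 0" by (rule o(2))
    ultimately show ?case using Suc by (simp only: sum.lessThan_Suc)
  qed simp
  have iD: "integrable M (D n)" for n unfolding D_def[abs_def] by (intro Bochner_Integration.integrable_sum inc(2))
  have bound: "expectation (\<lambda>\<omega>. (mart f \<omega> T)\<^sup>2) \<le> 2 * \<kappa> * T + 4 * C * expectation (D n) + 2 * C\<^sup>2 * T\<^sup>2 / real n" if n: "n \<ge> 1" for n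
  proof -
    have "T = 0 + real n * h n" unfolding h_def using n by simp
    then have "expectation (\<lambda>\<omega>. (mart f \<omega> T)\<^sup>2) = (\<Sum>j<n. expectation (\<lambda>\<omega>. (mart f \<omega> (0 + real (Suc j) * h n) - mart f \<omega> (0 + real j * h n))\<^sup>2))"
      using sq[of n n] by simp
    also have "\<dots> \<le> (\<Sum>j<n. 2 * \<kappa> * h n + 4 * C * expectation (\<lambda>\<omega>. integral {0 + real j * h n..0 + real (Suc j) * h n} (\<lambda>r. \<bar>f (X \<omega> r) - f (X \<omega> (0 + real j * h n))\<bar>)) + 2 * C\<^sup>2 * (h n)\<^sup>2)"
      by (intro sum_mono inc(3)[unfolded df])
    also have "\<dots> = real n * (2 * \<kappa> * h n) + 4 * C * expectation (D n) + real n * (2 * C\<^sup>2 * (h n)\<^sup>2)"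
      unfolding D_def[abs_def] by (subst Bochner_Integration.integral_sum[OF inc(2)]) (simp add: sum.distrib sum_distrib_left)
    also have "real n * (2 * \<kappa> * h n) = 2 * \<kappa> * T" unfolding h_def using n by simp
    also have "real n * (2 * C\<^sup>2 * (h n)\<^sup>2) = 2 * C\<^sup>2 * T\<^sup>2 / real n" unfolding h_def using n by (simp add: power2_eq_square)
    finally show ?thesis .
  qed
  have lim: "(\<lambda>n. expectation (D n)) \<longlonglongrightarrow> expectation (\<lambda>_. 0)"
  proof (rule integral_dominated_convergence[where w="\<lambda>_. 2 * C * T"])
    show "AE \<omega> in M. (\<lambda>n. D n \<omega>) \<longlonglongrightarrow> 0"
    proof (rule AE_I2)
      fix \<omega> assume w: "\<omega> \<in> space M"
      show "(\<lambda>n. D n \<omega>) \<longlonglongrightarrow> 0"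
        unfolding D_def h_def by (rule riemann_sum_limit(1)[OF continuous_on_subset[OF pol_path_cont[OF f w]] T]) auto
    qed
    fix n
    show "AE \<omega> in M. norm (D n \<omega>) \<le> 2 * C * T"
    proof (rule AE_I2)
      fix \<omega> assume w: "\<omega> \<in> space M"
      show "norm (D n \<omega>) \<le> 2 * C * T"
      proof (cases "n = 0")
        case True then show ?thesis using C0 T by (simp add: D_def)
      next
        case False
        have "\<bar>D n \<omega>\<bar> \<le> (\<Sum>j<n. 2 * C * h n)" unfolding D_def
        proof (rule order_trans[OF sum_abs], rule sum_mono)
          fix j
          let ?s = "0 + real j * h n" and ?t = "0 + real (Suc j) * h n"
          have "norm (integral {?s..?t} (\<lambda>r. \<bar>f (X \<omega> r) - f (X \<omega> ?s)\<bar>)) \<le> 2 * C * (?t - ?s)"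
          proof (rule integral_bound[OF st(2)])
            show "continuous_on {?s..?t} (\<lambda>r. \<bar>f (X \<omega> r) - f (X \<omega> ?s)\<bar>)"
              using st(1)[of j n] by (intro continuous_intros continuous_on_subset[OF pol_path_cont[OF f w]]) auto
            fix r assume "r \<in> {?s..?t}"
            then have "r \<ge> 0" using st(1)[of j n] by auto
            then show "norm \<bar>f (X \<omega> r) - f (X \<omega> ?s)\<bar> \<le> 2 * C"
              using c(1)[OF X_sphere[OF w], of r] c(1)[OF X_sphere[OF w st(1)], of j n] abs_triangle_ineq4[of "f (X \<omega> r)" "f (X \<omega> ?s)"] by simp
          qed
          then show "\<bar>integral {?s..?t} (\<lambda>r. \<bar>f (X \<omega> r) - f (X \<omega> ?s)\<bar>)\<bar> \<le> 2 * C * h n" unfolding df by simp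
        qed
        also have "\<dots> = 2 * C * T" unfolding h_def using False by simp
        finally show ?thesis by simp
      qed
    qed
  qed (use iD in auto)
  have "(\<lambda>n. 2 * \<kappa> * T + 4 * C * expectation (D n) + 2 * C\<^sup>2 * T\<^sup>2 / real n) \<longlonglongrightarrow> 2 * \<kappa> * T + 4 * C * 0 + 0"
    using lim by (intro tendsto_add tendsto_mult tendsto_const real_tendsto_divide_at_top[OF tendsto_const filterlim_real_sequentially]) simp
  then show "expectation (\<lambda>\<omega>. (mart f \<omega> T)\<^sup>2) \<le> 2 * \<kappa> * T"
    using bound by (intro LIMSEQ_le_const[where X="\<lambda>n. 2 * \<kappa> * T + 4 * C * expectation (D n) + 2 * C\<^sup>2 * T\<^sup>2 / real n"]) auto
qed

text \<open>Kolmogorov's inequality by first passage: \<open>A j\<close> is the event that the level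
  is first exceeded at time \<open>ts j\<close>. It belongs to the past of that time, so the later
  increment is orthogonal to the value there, and on \<open>A j\<close> the second moment at T
  dominates \<epsilon>^2 times the probability.\<close>

lemma mart_maximal_discrete:
  fixes ts :: "nat \<Rightarrow> real" and n :: nat
  assumes f: "pol N d f" and C: "var_consts f C \<kappa>" and ts: "mono_on {..n} ts" "\<And>j. j \<le> n \<Longrightarrow> 0 \<le> ts j \<and> ts j \<le> T" and e: "\<epsilon> > 0"
  shows "{\<omega>\<in>space M. \<exists>j\<le>n. \<bar>mart f \<omega> (ts j)\<bar> > \<epsilon>} \<in> events"
    "prob {\<omega>\<in>space M. \<exists>j\<le>n. \<bar>mart f \<omega> (ts j)\<bar> > \<epsilon>} \<le> 2 * \<kappa> * T / \<epsilon>\<^sup>2"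
proof -
  have T: "0 \<le> T" using ts(2)[of 0] by auto
  have c: "\<And>x. x \<in> sphereN N \<Longrightarrow> \<bar>f x\<bar> \<le> C" "\<And>x. x \<in> sphereN N \<Longrightarrow> \<bar>gen N p \<beta> J f x\<bar> \<le> C"
    using C unfolding var_consts_def by auto
  have C0: "C \<ge> 0" using sphere_nonempty c(1) abs_ge_zero order_trans by blast
  define A where "A j = {\<omega>\<in>space M. \<bar>mart f \<omega> (ts j)\<bar> > \<epsilon> \<and> (\<forall>i<j. \<bar>mart f \<omega> (ts i)\<bar> \<le> \<epsilon>)}" for j
  have mF: "(\<lambda>\<omega>. mart f \<omega> (ts i)) \<in> borel_measurable (Filt (ts j))" if "i \<le> j" "j \<le> n" for i j
  proof -
    have "ts i \<le> ts j" using ts(1) that by (auto simp: mono_on_def)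
    moreover have "0 \<le> ts i" using ts(2)[of i] that by auto
    ultimately show ?thesis using measurable_from_subalg[OF subalg_Filt_mono mart_props(2)[OF f]] by blast
  qed
  have AF: "A j \<in> sets (Filt (ts j))" if j: "j \<le> n" for j
  proof -
    have [measurable]: "(\<lambda>\<omega>. mart f \<omega> (ts j)) \<in> borel_measurable (Filt (ts j))" by (rule mF[OF order_refl j])
    have m: "{\<omega> \<in> space (Filt (ts j)). \<bar>mart f \<omega> (ts i)\<bar> \<le> \<epsilon>} \<in> sets (Filt (ts j))" if "i \<in> {..<j}" for i
    proof -
      have [measurable]: "(\<lambda>\<omega>. mart f \<omega> (ts i)) \<in> borel_measurable (Filt (ts j))" using that by (intro mF j) auto
      show ?thesis by measurable
    qed
    have "{\<omega> \<in> space (Filt (ts j)). \<forall>i\<in>{..<j}. \<bar>mart f \<omega> (ts i)\<bar> \<le> \<epsilon>} \<in> sets (Filt (ts j))"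
      by (rule sets.sets_Collect_finite_All[OF m]) auto
    moreover have "{\<omega> \<in> space (Filt (ts j)). \<bar>mart f \<omega> (ts j)\<bar> > \<epsilon>} \<in> sets (Filt (ts j))" by measurable
    ultimately have "{\<omega> \<in> space (Filt (ts j)). \<bar>mart f \<omega> (ts j)\<bar> > \<epsilon>} \<inter> {\<omega> \<in> space (Filt (ts j)). \<forall>i\<in>{..<j}. \<bar>mart f \<omega> (ts i)\<bar> \<le> \<epsilon>} \<in> sets (Filt (ts j))" by auto
    also have "{\<omega> \<in> space (Filt (ts j)). \<bar>mart f \<omega> (ts j)\<bar> > \<epsilon>} \<inter> {\<omega> \<in> space (Filt (ts j)). \<forall>i\<in>{..<j}. \<bar>mart f \<omega> (ts i)\<bar> \<le> \<epsilon>} = A j"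
      unfolding A_def by auto
    finally show ?thesis .
  qed
  have AM: "A j \<in> events" if "j \<le> n" for j using AF[OF that] subalg_Filt unfolding subalgebra_def by auto
  have U: "{\<omega>\<in>space M. \<exists>j\<le>n. \<bar>mart f \<omega> (ts j)\<bar> > \<epsilon>} = (\<Union>j\<in>{..n}. A j)"
  proof (intro set_eqI iffI)
    fix \<omega> assume "\<omega> \<in> {\<omega>\<in>space M. \<exists>j\<le>n. \<bar>mart f \<omega> (ts j)\<bar> > \<epsilon>}"
    then obtain j where j: "\<omega> \<in> space M" "j \<le> n" "\<bar>mart f \<omega> (ts j)\<bar> > \<epsilon>" by auto
    define k where "k = (LEAST j. \<bar>mart f \<omega> (ts j)\<bar> > \<epsilon>)"
    have "\<bar>mart f \<omega> (ts k)\<bar> > \<epsilon>" unfolding k_def using j(3) by (rule LeastI)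
    moreover have "k \<le> n" using Least_le[of "\<lambda>j. \<bar>mart f \<omega> (ts j)\<bar> > \<epsilon>", OF j(3)] j(2) unfolding k_def by simp
    moreover have "\<forall>i<k. \<bar>mart f \<omega> (ts i)\<bar> \<le> \<epsilon>" unfolding k_def using not_less_Least by (auto simp: not_less[symmetric])
    ultimately show "\<omega> \<in> (\<Union>j\<in>{..n}. A j)" using j(1) unfolding A_def by auto
  qed (auto simp: A_def)
  show "{\<omega>\<in>space M. \<exists>j\<le>n. \<bar>mart f \<omega> (ts j)\<bar> > \<epsilon>} \<in> events" unfolding U using AM by (intro sets.finite_UN) auto
  have disj: "disjoint_family_on A {..n}"
    unfolding disjoint_family_on_def A_def by (auto) (metis linorder_neqE_nat not_less)
  note iT = mart_second_moment(1)[OF f C T]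
  have step: "\<epsilon>\<^sup>2 * prob (A j) \<le> expectation (\<lambda>\<omega>. indicator (A j) \<omega> * (mart f \<omega> T)\<^sup>2)" and ij: "integrable M (\<lambda>\<omega>. indicator (A j) \<omega> * (mart f \<omega> T)\<^sup>2)" if j: "j \<le> n" for j
  proof -
    have tj: "0 \<le> ts j" "ts j \<le> T" using ts(2)[OF j] by auto
    let ?Z = "\<lambda>\<omega>. indicator (A j) \<omega> * mart f \<omega> (ts j)"
    have Zm: "?Z \<in> borel_measurable (Filt (ts j))" using AF[OF j] mF[OF order_refl j] by (intro borel_measurable_times borel_measurable_indicator)
    have Zb: "\<bar>?Z \<omega>\<bar> \<le> 2 * C + C * ts j" if "\<omega> \<in> space M" for \<omega>
      using mart_bound[OF f that tj(1) c] C0 tj by (auto simp: indicator_def)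
    note o = mart_orth[OF f tj Zm Zb]
    have [measurable]: "A j \<in> events" by (rule AM[OF j])
    show i: "integrable M (\<lambda>\<omega>. indicator (A j) \<omega> * (mart f \<omega> T)\<^sup>2)"
      using integrable_mult_indicator[OF AM[OF j] iT] by (simp add: mult.commute)
    have "\<epsilon>\<^sup>2 * prob (A j) = expectation (\<lambda>\<omega>. \<epsilon>\<^sup>2 * indicator (A j) \<omega> + 2 * (?Z \<omega> * (mart f \<omega> T - mart f \<omega> (ts j))))"
      using o by (subst Bochner_Integration.integral_add) (auto simp: less_top[symmetric])
    also have "\<dots> \<le> expectation (\<lambda>\<omega>. indicator (A j) \<omega> * (mart f \<omega> T)\<^sup>2)"
    proof (rule integral_mono[OF _ i])
      show "integrable M (\<lambda>\<omega>. \<epsilon>\<^sup>2 * indicator (A j) \<omega> + 2 * (?Z \<omega> * (mart f \<omega> T - mart f \<omega> (ts j))))"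
        using o(1) by (intro Bochner_Integration.integrable_add integrable_mult_right) (auto simp: less_top[symmetric])
      fix \<omega>
      show "\<epsilon>\<^sup>2 * indicator (A j) \<omega> + 2 * (?Z \<omega> * (mart f \<omega> T - mart f \<omega> (ts j))) \<le> indicator (A j) \<omega> * (mart f \<omega> T)\<^sup>2"
      proof (cases "\<omega> \<in> A j")
        case True
        then have "\<epsilon>\<^sup>2 \<le> (mart f \<omega> (ts j))\<^sup>2" using e unfolding A_def by (auto simp: abs_le_square_iff[symmetric])
        moreover have "(mart f \<omega> T)\<^sup>2 = (mart f \<omega> (ts j))\<^sup>2 + 2 * (mart f \<omega> (ts j) * (mart f \<omega> T - mart f \<omega> (ts j))) + (mart f \<omega> T - mart f \<omega> (ts j))\<^sup>2"
          by (simp add: power2_eq_square algebra_simps)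
        ultimately have "\<epsilon>\<^sup>2 + 2 * (mart f \<omega> (ts j) * (mart f \<omega> T - mart f \<omega> (ts j))) \<le> (mart f \<omega> T)\<^sup>2"
          using zero_le_power2[of "mart f \<omega> T - mart f \<omega> (ts j)"] by linarith
        then show ?thesis using True by simp
      qed simp
    qed
    finally show "\<epsilon>\<^sup>2 * prob (A j) \<le> expectation (\<lambda>\<omega>. indicator (A j) \<omega> * (mart f \<omega> T)\<^sup>2)" .
  qed
  have "\<epsilon>\<^sup>2 * prob (\<Union>j\<in>{..n}. A j) = (\<Sum>j\<le>n. \<epsilon>\<^sup>2 * prob (A j))"
    using AM disj by (subst finite_measure_finite_Union) (auto simp: sum_distrib_left)
  also have "\<dots> \<le> (\<Sum>j\<le>n. expectation (\<lambda>\<omega>. indicator (A j) \<omega> * (mart f \<omega> T)\<^sup>2))" by (intro sum_mono step) auto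
  also have "\<dots> = expectation (\<lambda>\<omega>. \<Sum>j\<le>n. indicator (A j) \<omega> * (mart f \<omega> T)\<^sup>2)"
    using ij by (intro Bochner_Integration.integral_sum[symmetric]) auto
  also have "\<dots> \<le> expectation (\<lambda>\<omega>. (mart f \<omega> T)\<^sup>2)"
  proof (rule integral_mono[OF _ iT])
    show "integrable M (\<lambda>\<omega>. \<Sum>j\<le>n. indicator (A j) \<omega> * (mart f \<omega> T)\<^sup>2)" using ij by (intro Bochner_Integration.integrable_sum) auto
    fix \<omega>
    have "(\<Sum>j\<le>n. indicator (A j) \<omega> * (mart f \<omega> T)\<^sup>2) = indicator (\<Union>j\<in>{..n}. A j) \<omega> * (mart f \<omega> T)\<^sup>2"
      by (subst indicator_UN_disjoint[OF _ disj]) (auto simp: sum_distrib_right)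
    also have "\<dots> \<le> (mart f \<omega> T)\<^sup>2" by (simp add: indicator_def)
    finally show "(\<Sum>j\<le>n. indicator (A j) \<omega> * (mart f \<omega> T)\<^sup>2) \<le> (mart f \<omega> T)\<^sup>2" .
  qed
  also have "\<dots> \<le> 2 * \<kappa> * T" by (rule mart_second_moment(2)[OF f C T])
  finally show "prob {\<omega>\<in>space M. \<exists>j\<le>n. \<bar>mart f \<omega> (ts j)\<bar> > \<epsilon>} \<le> 2 * \<kappa> * T / \<epsilon>\<^sup>2"
    unfolding U using e by (simp add: pos_le_divide_eq mult.commute)
qed

text \<open>Dyadic partitions are nested, so the bad events increase and their union obeys the same
  bound. Off the union, continuity of the path extends the estimate from dyadic to all
  times.\<close>

lemma mart_maximal:
  assumes f: "pol N d f" and C: "var_consts f C \<kappa>" and T: "0 \<le> T" and e: "\<epsilon> > 0"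
  shows "\<exists>B\<in>events. prob B \<le> 2 * \<kappa> * T / \<epsilon>\<^sup>2 \<and> (\<forall>\<omega>\<in>space M - B. \<forall>t\<in>{0..T}. \<bar>mart f \<omega> t\<bar> \<le> \<epsilon>)"
proof -
  define ts where "ts m j = T * real j / 2 ^ m" for m j :: nat
  have ts: "mono_on {..2 ^ m} (ts m)" "\<And>j. j \<le> 2 ^ m \<Longrightarrow> 0 \<le> ts m j \<and> ts m j \<le> T" for m
  proof -
    show "mono_on {..2 ^ m} (ts m)" unfolding ts_def using T by (intro mono_onI divide_right_mono mult_left_mono) auto
    fix j :: nat assume "j \<le> 2 ^ m"
    then have "real j \<le> 2 ^ m" using of_nat_mono[of _ "2 ^ m", where 'a=real] by fastforce
    then have "T * real j \<le> T * 2 ^ m" using T by (intro mult_left_mono) auto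
    then show "0 \<le> ts m j \<and> ts m j \<le> T" unfolding ts_def using T by (simp add: pos_divide_le_eq)
  qed
  define B where "B m = {\<omega>\<in>space M. \<exists>j\<le>2 ^ m. \<bar>mart f \<omega> (ts m j)\<bar> > \<epsilon>}" for m
  have Bm: "B m \<in> events" "prob (B m) \<le> 2 * \<kappa> * T / \<epsilon>\<^sup>2" for m
    unfolding B_def by (rule mart_maximal_discrete[OF f C ts e]; assumption)+
  have inc: "incseq B"
  proof (rule incseq_SucI)
    fix m show "B m \<subseteq> B (Suc m)"
    proof
      fix \<omega> assume "\<omega> \<in> B m"
      then obtain j where j: "\<omega> \<in> space M" "j \<le> 2 ^ m" "\<bar>mart f \<omega> (ts m j)\<bar> > \<epsilon>" unfolding B_def by auto
      have "ts (Suc m) (2 * j) = ts m j" unfolding ts_def by simp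
      then show "\<omega> \<in> B (Suc m)" unfolding B_def using j by (auto intro!: exI[of _ "2 * j"])
    qed
  qed
  have "(\<lambda>m. prob (B m)) \<longlonglongrightarrow> prob (\<Union>m. B m)" using Bm inc by (intro finite_Lim_measure_incseq) auto
  then have p: "prob (\<Union>m. B m) \<le> 2 * \<kappa> * T / \<epsilon>\<^sup>2" by (rule LIMSEQ_le_const2) (use Bm in auto)
  have "\<bar>mart f \<omega> t\<bar> \<le> \<epsilon>" if w: "\<omega> \<in> space M - (\<Union>m. B m)" and t: "t \<in> {0..T}" for \<omega> t
  proof (cases "T = 0")
    case True then show ?thesis using t e by simp
  next
    case False
    then have Tp: "T > 0" using T by simp
    define j where "j m = nat \<lfloor>t * 2 ^ m / T\<rfloor>" for m :: nat
    have fl: "real (j m) = real_of_int \<lfloor>t * 2 ^ m / T\<rfloor>" for m unfolding j_def using t Tp by simp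
    have le: "ts m (j m) \<le> t" for m
    proof -
      have "real (j m) \<le> t * 2 ^ m / T" unfolding fl by (rule of_int_floor_le)
      then show ?thesis unfolding ts_def using Tp by (simp add: field_simps)
    qed
    have ge: "t - T / 2 ^ m \<le> ts m (j m)" for m
    proof -
      have "t * 2 ^ m / T - 1 \<le> real (j m)" unfolding fl by linarith
      then have "t * 2 ^ m - T \<le> T * real (j m)" using Tp by (simp add: field_simps)
      then have "(t * 2 ^ m - T) / 2 ^ m \<le> T * real (j m) / 2 ^ m" by (intro divide_right_mono) auto
      then show ?thesis unfolding ts_def by (simp add: diff_divide_distrib)
    qed
    have j2: "j m \<le> 2 ^ m" for m
    proof -
      have "t * 2 ^ m / T \<le> 2 ^ m" using t Tp by (simp add: field_simps)
      then have "real (j m) \<le> 2 ^ m" unfolding fl by linarith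
      then show ?thesis using of_nat_mono[of _ "2 ^ m", where 'a=real] by fastforce
    qed
    have conv: "(\<lambda>m. ts m (j m)) \<longlonglongrightarrow> t"
    proof (rule tendsto_sandwich[of "\<lambda>m. t - T / 2 ^ m" _ _ "\<lambda>_. t"])
      have "(\<lambda>m. T * (1/2) ^ m) \<longlonglongrightarrow> T * 0" by (intro tendsto_mult tendsto_const LIMSEQ_realpow_zero) auto
      then have "(\<lambda>m. t - T * (1/2) ^ m) \<longlonglongrightarrow> t - T * 0" by (rule tendsto_diff[OF tendsto_const])
      then show "(\<lambda>m. t - T / 2 ^ m) \<longlonglongrightarrow> t" by (simp add: power_divide)
    qed (use le ge in auto)
    have "(\<lambda>m. mart f \<omega> (ts m (j m))) \<longlonglongrightarrow> mart f \<omega> t"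
      using w t ts(2)[OF j2] by (intro continuous_on_tendsto_compose[OF mart_path_cont[OF f] conv]) auto
    then have "(\<lambda>m. \<bar>mart f \<omega> (ts m (j m))\<bar>) \<longlonglongrightarrow> \<bar>mart f \<omega> t\<bar>" by (rule tendsto_rabs)
    moreover have "\<bar>mart f \<omega> (ts m (j m))\<bar> \<le> \<epsilon>" for m using w j2[of m] unfolding B_def by (auto simp: not_less)
    ultimately show ?thesis by (intro LIMSEQ_le_const2) auto
  qed
  then show ?thesis using p Bm by (intro bexI[of _ "\<Union>m. B m"]) auto
qed

end

section \<open>Path space\<close>

type_synonym path = "(real, real \<times> real) bcontfun"

text \<open>The retraction of the line to [0,T]. \<open>Upath\<close> is a path on [0,T] composed
  with it, and a path unchanged by it is determined by its values on [0,T].\<close>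

definition clip :: "real \<Rightarrow> real \<Rightarrow> real" where
  "clip T t = max 0 (min T t)"

lemma clip_in: "0 \<le> T \<Longrightarrow> clip T t \<in> {0..T}"
  and clip_id: "t \<in> {0..T} \<Longrightarrow> clip T t = t"
  and clip_dist: "\<bar>clip T s - clip T t\<bar> \<le> \<bar>s - t\<bar>"
  and clip_cont [continuous_intros]: "continuous_on A (clip T)"
  unfolding clip_def[abs_def] by (auto intro!: continuous_intros)

lemma clip_clip [simp]: "0 \<le> T \<Longrightarrow> clip T (clip T t) = clip T t"
  by (rule clip_id[OF clip_in])

lemma apply_Bcontfun_clip:
  fixes g :: "real \<Rightarrow> 'b::metric_space"
  assumes T: "0 \<le> T" and g: "continuous_on {0..T} g"
  shows "apply_bcontfun (Bcontfun (\<lambda>t. g (clip T t))) t = g (clip T t)"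
proof -
  have "continuous_on UNIV (\<lambda>t. g (clip T t))"
    by (rule continuous_on_compose2[OF g clip_cont]) (use clip_in[OF T] in blast)
  moreover have "bounded (range (\<lambda>t. g (clip T t)))"
    by (rule bounded_subset[OF compact_imp_bounded[OF compact_continuous_image[OF g compact_Icc]]])
      (use clip_in[OF T] in blast)
  ultimately show ?thesis by (subst Bcontfun_inverse) (auto simp: bcontfun_def)
qed

text \<open>The usual proof that a sum of measurable functions is measurable needs a countable base,
  which the space of paths does not have. Here each summand takes countably many values and the sum
  is treated case by case.\<close>

lemma measurable_sum_discrete:
  fixes G :: "nat \<Rightarrow> 'i::countable \<Rightarrow> 'b::real_normed_vector"
  assumes z: "\<And>j. z j \<in> measurable M (count_space UNIV)"
  shows "(\<lambda>\<omega>. c + (\<Sum>j<k. G j (z j \<omega>))) \<in> borel_measurable M"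
proof (induction k arbitrary: c)
  case (Suc k)
  have "(\<lambda>\<omega>. (\<lambda>i \<omega>. (c + G k i) + (\<Sum>j<k. G j (z j \<omega>))) (z k \<omega>) \<omega>) \<in> borel_measurable M"
    by (rule measurable_compose_countable[OF Suc z])
  then show ?case by (simp add: algebra_simps)
qed simp

text \<open>Rounding the coefficients to multiples of 1/(n+1) costs at most 1/(n+1), because the
  Bernstein weights are nonnegative and sum to 1.\<close>

lemma Bernstein_floor_approx:
  fixes g :: "real \<Rightarrow> real"
  assumes g: "continuous_on {0..1} g" and e: "e > 0"
  shows "\<exists>N. \<forall>n\<ge>N. \<forall>x\<in>{0..1}. \<bar>g x - (\<Sum>k\<le>Suc n. real_of_int \<lfloor>real (Suc n) * g (real k / real (Suc n))\<rfloor> / real (Suc n) * Bernstein (Suc n) k x)\<bar> < e"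
proof -
  have e2: "e / 2 > 0" using e by simp
  obtain N1 where N1: "\<And>n x. N1 \<le> n \<Longrightarrow> x \<in> {0..1} \<Longrightarrow> \<bar>g x - (\<Sum>k\<le>n. g(k/n) * Bernstein n k x)\<bar> < e / 2"
    using Bernstein_Weierstrass[OF g e2] by blast
  obtain N2 where N2: "inverse (real (Suc N2)) < e / 2" using reals_Archimedean[OF e2] by blast
  have "\<bar>g x - (\<Sum>k\<le>Suc n. real_of_int \<lfloor>real (Suc n) * g (real k / real (Suc n))\<rfloor> / real (Suc n) * Bernstein (Suc n) k x)\<bar> < e"
    if n: "n \<ge> max N1 N2" and x: "x \<in> {0..1}" for n x
  proof -
    let ?n = "Suc n"
    let ?a = "\<lambda>k. real_of_int \<lfloor>real ?n * g (real k / real ?n)\<rfloor> / real ?n"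
    have r: "\<bar>g (real k / real ?n) - ?a k\<bar> \<le> 1 / real ?n" for k
    proof -
      define y where "y = real ?n * g (real k / real ?n)"
      have y: "g (real k / real ?n) = y / real ?n" unfolding y_def by simp
      have "\<bar>y - real_of_int \<lfloor>y\<rfloor>\<bar> \<le> 1" by linarith
      then have "\<bar>y - real_of_int \<lfloor>y\<rfloor>\<bar> / real ?n \<le> 1 / real ?n" by (intro divide_right_mono) auto
      moreover have "y / real ?n - real_of_int \<lfloor>y\<rfloor> / real ?n = (y - real_of_int \<lfloor>y\<rfloor>) / real ?n" by (simp add: diff_divide_distrib)
      ultimately show ?thesis unfolding y_def[symmetric] y by simp
    qed
    have "\<bar>(\<Sum>k\<le>?n. g (real k / real ?n) * Bernstein ?n k x) - (\<Sum>k\<le>?n. ?a k * Bernstein ?n k x)\<bar>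
        = \<bar>\<Sum>k\<le>?n. (g (real k / real ?n) - ?a k) * Bernstein ?n k x\<bar>"
      by (simp only: sum_subtractf[symmetric] left_diff_distrib)
    also have "\<dots> \<le> (\<Sum>k\<le>?n. 1 / real ?n * Bernstein ?n k x)"
    proof (rule order_trans[OF sum_abs sum_mono])
      fix k
      have "0 \<le> Bernstein ?n k x" using x by (intro Bernstein_nonneg) auto
      then show "\<bar>(g (real k / real ?n) - ?a k) * Bernstein ?n k x\<bar> \<le> 1 / real ?n * Bernstein ?n k x"
        unfolding abs_mult using r[of k] by (simp only: abs_of_nonneg) (rule mult_right_mono)
    qed
    also have "\<dots> = 1 / real ?n" by (simp only: sum_distrib_left[symmetric] sum_Bernstein mult_1_right)
    also have "\<dots> < e / 2"
    proof -
      have "1 / real ?n \<le> inverse (real (Suc N2))" using n by (simp add: field_simps)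
      then show ?thesis using N2 by linarith
    qed
    finally have "\<bar>(\<Sum>k\<le>?n. g (real k / real ?n) * Bernstein ?n k x) - (\<Sum>k\<le>?n. ?a k * Bernstein ?n k x)\<bar> < e / 2" .
    moreover have "\<bar>g x - (\<Sum>k\<le>?n. g (real k / real ?n) * Bernstein ?n k x)\<bar> < e / 2"
      by (rule N1) (use n x in auto)
    ultimately show ?thesis by linarith
  qed
  then show ?thesis by blast
qed

lemma apply_bcontfun_sum:
  fixes F :: "'i \<Rightarrow> ('a::topological_space, 'b::real_normed_vector) bcontfun"
  shows "apply_bcontfun (\<Sum>i\<in>A. F i) t = (\<Sum>i\<in>A. apply_bcontfun (F i) t)"
  by (induction A rule: infinite_finite_induct) auto

lemma dist_pair_le:
  fixes x y :: "real \<times> real"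
  shows "dist x y \<le> \<bar>fst x - fst y\<bar> + \<bar>snd x - snd y\<bar>"
  unfolding dist_prod_def dist_real_def by (rule order_trans[OF sqrt_sum_squares_le_sum_abs]) simp

text \<open>The space of bounded continuous functions is not separable, so measurability of a random path
  does not follow from measurability of its coordinates by a general principle; here the path is
  a uniform limit of Bernstein polynomials with coefficients rounded to a countable set.\<close>

lemma measurable_random_path:
  fixes Y :: "'w \<Rightarrow> path"
  assumes T: "0 < T" and m: "\<And>t. t \<in> {0..T} \<Longrightarrow> (\<lambda>\<omega>. apply_bcontfun (Y \<omega>) t) \<in> borel_measurable M"
    and cl: "\<And>\<omega> t. \<omega> \<in> space M \<Longrightarrow> apply_bcontfun (Y \<omega>) (clip T t) = apply_bcontfun (Y \<omega>) t"
  shows "Y \<in> borel_measurable M"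
proof -
  \<comment> \<open>The inner \<open>clip\<close> acts only for indices k > n + 1, where the
    sampling point would leave [0,T].\<close>
  define z where "z n k \<omega> = (\<lfloor>real (Suc n) * fst (apply_bcontfun (Y \<omega>) (clip T (T * (real k / real (Suc n)))))\<rfloor>,
      \<lfloor>real (Suc n) * snd (apply_bcontfun (Y \<omega>) (clip T (T * (real k / real (Suc n)))))\<rfloor>)" for n k \<omega>
  define G where "G n k ij = Bcontfun (\<lambda>t. (\<lambda>s. Bernstein (Suc n) k (s / T) *\<^sub>R (real_of_int (fst ij) / real (Suc n), real_of_int (snd ij) / real (Suc n))) (clip T t))"
    for n k and ij :: "int \<times> int"
  have Ga: "apply_bcontfun (G n k ij) t = Bernstein (Suc n) k (clip T t / T) *\<^sub>R (real_of_int (fst ij) / real (Suc n), real_of_int (snd ij) / real (Suc n))" for n k ij t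
    unfolding G_def by (rule apply_Bcontfun_clip) (use T in \<open>auto simp: Bernstein_def intro!: continuous_intros\<close>)
  have zm: "z n k \<in> measurable M (count_space UNIV)" for n k
  proof -
    let ?f = "\<lambda>\<omega>. \<lfloor>real (Suc n) * fst (apply_bcontfun (Y \<omega>) (clip T (T * (real k / real (Suc n)))))\<rfloor>"
    let ?g = "\<lambda>\<omega>. \<lfloor>real (Suc n) * snd (apply_bcontfun (Y \<omega>) (clip T (T * (real k / real (Suc n)))))\<rfloor>"
    have Ym [measurable]: "(\<lambda>\<omega>. apply_bcontfun (Y \<omega>) (clip T (T * (real k / real (Suc n))))) \<in> borel_measurable M"
      using clip_in[of T] T by (intro m) auto
    have [measurable]: "fst \<in> borel_measurable (borel :: (real \<times> real) measure)" "snd \<in> borel_measurable (borel :: (real \<times> real) measure)"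
      by (auto intro!: borel_measurable_continuous_onI continuous_intros)
    have f: "?f \<in> measurable M (count_space UNIV)" by measurable
    have g: "?g \<in> measurable M (count_space UNIV)" by measurable
    have "(\<lambda>\<omega>. (\<lambda>i \<omega>. (i, ?g \<omega>)) (?f \<omega>) \<omega>) \<in> measurable M (count_space UNIV)"
    proof (rule measurable_compose_countable[OF _ f])
      fix i show "(\<lambda>\<omega>. (i, ?g \<omega>)) \<in> measurable M (count_space UNIV)"
        by (rule measurable_compose[OF g]) simp
    qed
    then show ?thesis unfolding z_def[abs_def] .
  qed
  define Yn where "Yn n \<omega> = 0 + (\<Sum>k<Suc (Suc n). G n k (z n k \<omega>))" for n \<omega>
  have Ym: "Yn n \<in> borel_measurable M" for n
    unfolding Yn_def[abs_def] by (rule measurable_sum_discrete) (rule zm)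
  have Ya: "apply_bcontfun (Yn n \<omega>) t = (\<Sum>k\<le>Suc n. Bernstein (Suc n) k (clip T t / T) *\<^sub>R
      (real_of_int (fst (z n k \<omega>)) / real (Suc n), real_of_int (snd (z n k \<omega>)) / real (Suc n)))" for n \<omega> t
    unfolding Yn_def add_0_left apply_bcontfun_sum Ga lessThan_Suc_atMost ..
  show ?thesis
  proof (rule borel_measurable_LIMSEQ_metric[OF Ym])
    fix \<omega> assume w: "\<omega> \<in> space M"
    have Tx: "clip T (T * x) = T * x" if "x \<in> {0..1}" for x using that T by (intro clip_id) (auto simp: mult_le_cancel_left1)
    have c: "continuous_on {0..1} (\<lambda>x. apply_bcontfun (Y \<omega>) (T * x))"
      by (rule continuous_on_compose2[OF continuous_on_apply_bcontfun[of UNIV]]) (auto intro!: continuous_intros)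
    show "(\<lambda>n. Yn n \<omega>) \<longlonglongrightarrow> Y \<omega>"
    proof (rule metric_LIMSEQ_I)
      fix e :: real assume e: "e > 0"
      then have e4: "e / 4 > 0" by simp
      obtain N1 where N1: "\<And>n x. n \<ge> N1 \<Longrightarrow> x \<in> {0..1} \<Longrightarrow> \<bar>fst (apply_bcontfun (Y \<omega>) (T * x)) - (\<Sum>k\<le>Suc n. real_of_int \<lfloor>real (Suc n) * fst (apply_bcontfun (Y \<omega>) (T * (real k / real (Suc n))))\<rfloor> / real (Suc n) * Bernstein (Suc n) k x)\<bar> < e / 4"
        using Bernstein_floor_approx[OF continuous_on_fst[OF c] e4] by blast
      obtain N2 where N2: "\<And>n x. n \<ge> N2 \<Longrightarrow> x \<in> {0..1} \<Longrightarrow> \<bar>snd (apply_bcontfun (Y \<omega>) (T * x)) - (\<Sum>k\<le>Suc n. real_of_int \<lfloor>real (Suc n) * snd (apply_bcontfun (Y \<omega>) (T * (real k / real (Suc n))))\<rfloor> / real (Suc n) * Bernstein (Suc n) k x)\<bar> < e / 4"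
        using Bernstein_floor_approx[OF continuous_on_snd[OF c] e4] by blast
      have "dist (Yn n \<omega>) (Y \<omega>) < e" if n: "n \<ge> max N1 N2" for n
      proof -
        have "dist (Yn n \<omega>) (Y \<omega>) \<le> e / 2"
        proof (rule dist_bound)
          fix t
          define x where "x = clip T t / T"
          have x: "x \<in> {0..1}" using clip_in[of T t] T unfolding x_def by auto
          have Yx: "apply_bcontfun (Y \<omega>) t = apply_bcontfun (Y \<omega>) (T * x)" using cl[OF w, of t] T unfolding x_def by simp
          have zk: "z n k \<omega> = (\<lfloor>real (Suc n) * fst (apply_bcontfun (Y \<omega>) (T * (real k / real (Suc n))))\<rfloor>,
            \<lfloor>real (Suc n) * snd (apply_bcontfun (Y \<omega>) (T * (real k / real (Suc n))))\<rfloor>)" for k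
            unfolding z_def cl[OF w] ..
          have "dist (apply_bcontfun (Yn n \<omega>) t) (apply_bcontfun (Y \<omega>) t)
            \<le> \<bar>fst (apply_bcontfun (Yn n \<omega>) t) - fst (apply_bcontfun (Y \<omega>) t)\<bar> + \<bar>snd (apply_bcontfun (Yn n \<omega>) t) - snd (apply_bcontfun (Y \<omega>) t)\<bar>"
            by (rule dist_pair_le)
          also have "\<dots> \<le> e / 4 + e / 4"
          proof (intro add_mono less_imp_le)
            show "\<bar>fst (apply_bcontfun (Yn n \<omega>) t) - fst (apply_bcontfun (Y \<omega>) t)\<bar> < e / 4"
              using N1[OF _ x, of n] n unfolding Yx Ya x_def[symmetric] fst_sum fst_scaleR zk fst_conv
              by (simp only: real_scaleR_def abs_minus_commute mult.commute)
            show "\<bar>snd (apply_bcontfun (Yn n \<omega>) t) - snd (apply_bcontfun (Y \<omega>) t)\<bar> < e / 4"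
              using N2[OF _ x, of n] n unfolding Yx Ya x_def[symmetric] snd_sum snd_scaleR zk snd_conv
              by (simp only: real_scaleR_def abs_minus_commute mult.commute)
          qed
          finally show "dist (apply_bcontfun (Yn n \<omega>) t) (apply_bcontfun (Y \<omega>) t) \<le> e / 2" by simp
        qed
        then show ?thesis using e by simp
      qed
      then show "\<exists>no. \<forall>n\<ge>no. dist (Yn n \<omega>) (Y \<omega>) < e" by blast
    qed
  qed
qed

text \<open>Half of the error comes from the uniform distance of the paths, half from continuity of
  the limit path. Joint continuity in path and time makes conditions on values of paths
  closed.\<close>

lemma continuous_on_eval [continuous_intros]:
  fixes f :: "'c::topological_space \<Rightarrow> ('a::topological_space, 'b::metric_space) bcontfun"
  assumes f: "continuous_on A f" and g: "continuous_on A g"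
  shows "continuous_on A (\<lambda>x. apply_bcontfun (f x) (g x))"
  unfolding continuous_on_def
proof
  fix x assume x: "x \<in> A"
  show "((\<lambda>x. apply_bcontfun (f x) (g x)) \<longlongrightarrow> apply_bcontfun (f x) (g x)) (at x within A)"
  proof (rule tendstoI)
    fix e :: real assume "e > 0"
    then have e2: "e / 2 > 0" by simp
    have "continuous_on A (\<lambda>y. apply_bcontfun (f x) (g y))"
      by (rule continuous_on_compose2[OF continuous_on_apply_bcontfun[of UNIV] g]) auto
    from tendstoD[OF bspec[OF this[unfolded continuous_on_def] x] e2]
    have "\<forall>\<^sub>F y in at x within A. dist (apply_bcontfun (f x) (g y)) (apply_bcontfun (f x) (g x)) < e / 2" .
    moreover from tendstoD[OF bspec[OF f[unfolded continuous_on_def] x] e2]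
    have "\<forall>\<^sub>F y in at x within A. dist (f y) (f x) < e / 2" .
    ultimately show "\<forall>\<^sub>F y in at x within A. dist (apply_bcontfun (f y) (g y)) (apply_bcontfun (f x) (g x)) < e"
    proof eventually_elim
      case (elim y)
      have "dist (apply_bcontfun (f y) (g y)) (apply_bcontfun (f x) (g y)) \<le> dist (f y) (f x)" by (rule dist_bounded)
      then show ?case using elim dist_triangle[of "apply_bcontfun (f y) (g y)" "apply_bcontfun (f x) (g x)" "apply_bcontfun (f x) (g y)"] by linarith
    qed
  qed
qed

text \<open>The sets of the Arzela-Ascoli theorem: paths constant outside [0,T], with a common bound
  and a modulus of continuity prescribed at the levels 1/(m+1).\<close>

definition path_box :: "real \<Rightarrow> real \<Rightarrow> (nat \<Rightarrow> real) \<Rightarrow> path set" where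
  "path_box T B \<delta> = {f. (\<forall>t. apply_bcontfun f (clip T t) = apply_bcontfun f t) \<and> (\<forall>t. norm (apply_bcontfun f t) \<le> B) \<and>
     (\<forall>m s t. \<bar>s - t\<bar> < \<delta> m \<longrightarrow> dist (apply_bcontfun f s) (apply_bcontfun f t) \<le> 1 / real (Suc m))}"

lemma closed_path_box: "closed (path_box T B \<delta>)"
  unfolding path_box_def
  by (intro closed_Collect_conj closed_Collect_all closed_Collect_imp closed_Collect_le closed_Collect_eq continuous_intros continuous_on_id) auto

text \<open>Arzela-Ascoli on [0,T]; composition with \<open>clip\<close> turns the limit into a
  bounded continuous function on the line, and uniform convergence on [0,T] into convergence in the
  space of paths.\<close>

lemma compact_path_box:
  assumes T: "0 \<le> T" and d: "\<And>m. \<delta> m > 0"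
  shows "compact (path_box T B \<delta>)"
  unfolding compact_eq_seq_compact_metric
proof (rule seq_compactI)
  fix F :: "nat \<Rightarrow> path" assume F: "\<forall>n. F n \<in> path_box T B \<delta>"
  have "\<exists>(g :: real \<Rightarrow> real \<times> real) (k :: nat \<Rightarrow> nat). continuous_on {0..T} g \<and> strict_mono k \<and>
    (\<forall>e>0. \<exists>N. \<forall>n x. n \<ge> N \<and> x \<in> {0..T} \<longrightarrow> norm (apply_bcontfun (F (k n)) x - g x) < e)"
  proof (rule Arzela_Ascoli[of "{0..T}" "\<lambda>n. apply_bcontfun (F n)" B])
    show "compact {0..T}" by simp
    show "norm (apply_bcontfun (F n) x) \<le> B" for n x using F unfolding path_box_def by auto
    fix x e :: real assume "e > 0"
    then obtain m where m: "inverse (real (Suc m)) < e" using reals_Archimedean by blast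
    have "norm (apply_bcontfun (F n) x - apply_bcontfun (F n) y) < e" if "norm (x - y) < \<delta> m" for n y
    proof -
      have "dist (apply_bcontfun (F n) x) (apply_bcontfun (F n) y) \<le> 1 / real (Suc m)" using F that unfolding path_box_def by auto
      then show ?thesis using m by (simp add: dist_norm inverse_eq_divide)
    qed
    then show "\<exists>d>0. \<forall>n y. y \<in> {0..T} \<and> norm (x - y) < d \<longrightarrow> norm (apply_bcontfun (F n) x - apply_bcontfun (F n) y) < e"
      using d[of m] by blast
  next
    fix g :: "real \<Rightarrow> real \<times> real" and k :: "nat \<Rightarrow> nat"
    assume "continuous_on {0..T} g" "strict_mono k"
      "\<And>e. 0 < e \<Longrightarrow> \<exists>N. \<forall>n x. n \<ge> N \<and> x \<in> {0..T} \<longrightarrow> norm (apply_bcontfun (F (k n)) x - g x) < e"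
    then show ?thesis by (intro exI[of _ g] exI[of _ k] conjI allI impI)
  qed
  then obtain g :: "real \<Rightarrow> real \<times> real" and k :: "nat \<Rightarrow> nat" where g: "continuous_on {0..T} g" "strict_mono k"
    "\<And>e. 0 < e \<Longrightarrow> \<exists>N. \<forall>n x. n \<ge> N \<and> x \<in> {0..T} \<longrightarrow> norm (apply_bcontfun (F (k n)) x - g x) < e" by blast
  define h where "h = Bcontfun (\<lambda>t. g (clip T t))"
  have h: "apply_bcontfun h t = g (clip T t)" for t unfolding h_def by (rule apply_Bcontfun_clip[OF T g(1)])
  have lim: "(F \<circ> k) \<longlonglongrightarrow> h"
  proof (rule metric_LIMSEQ_I)
    fix e :: real assume e: "e > 0"
    then obtain N where N: "\<And>n x. n \<ge> N \<Longrightarrow> x \<in> {0..T} \<Longrightarrow> norm (apply_bcontfun (F (k n)) x - g x) < e / 2"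
      using g(3)[of "e / 2"] by auto
    have "dist ((F \<circ> k) n) h < e" if "n \<ge> N" for n
    proof -
      have "dist (F (k n)) h \<le> e / 2"
      proof (rule dist_bound)
        fix t
        have "apply_bcontfun (F (k n)) t = apply_bcontfun (F (k n)) (clip T t)" using F unfolding path_box_def by auto
        then show "dist (apply_bcontfun (F (k n)) t) (apply_bcontfun h t) \<le> e / 2"
          using N[OF that clip_in[OF T, of t]] unfolding h by (simp add: dist_norm)
      qed
      then show ?thesis using e by simp
    qed
    then show "\<exists>no. \<forall>n\<ge>no. dist ((F \<circ> k) n) h < e" by blast
  qed
  have "h \<in> path_box T B \<delta>" by (rule closed_sequentially[OF closed_path_box _ lim]) (use F in auto)
  then show "\<exists>l\<in>path_box T B \<delta>. \<exists>r. strict_mono r \<and> (F \<circ> r) \<longlonglongrightarrow> l" using g(2) lim by blast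
qed

text \<open>\<open>tight_seq\<close> demands its bound for every index, while the estimates hold for
  large N only. Each of the finitely many remaining laws gives mass close to 1 to some
  \<open>E k\<close>, as these sets exhaust all values, and monotonicity in k allows one common
  k.\<close>

lemma uniform_in_index:
  fixes Y :: "nat \<Rightarrow> 'w \<Rightarrow> 'b::metric_space"
  assumes P: "\<And>N. prob_space (M N)" and m: "\<And>N. Y N \<in> borel_measurable (M N)"
    and E: "\<And>k. closed (E k)" "incseq E" "\<And>N \<omega>. \<omega> \<in> space (M N) \<Longrightarrow> \<exists>k. Y N \<omega> \<in> E k"
    and ev: "\<exists>k N0. \<forall>N\<ge>N0. \<exists>A\<in>sets (M N). measure (M N) A \<le> \<eta> \<and> (\<forall>\<omega>\<in>space (M N) - A. Y N \<omega> \<in> E k)" and \<eta>: "\<eta> > 0"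
  shows "\<exists>k. \<forall>N. measure (M N) {\<omega>\<in>space (M N). Y N \<omega> \<notin> E k} \<le> \<eta>"
proof -
  have s: "{\<omega>\<in>space (M N). Y N \<omega> \<notin> E k} \<in> sets (M N)" for N k
  proof -
    have "E k \<in> sets borel" using E(1) by simp
    then have "Y N -` (- E k) \<inter> space (M N) \<in> sets (M N)" by (intro measurable_sets[OF m]) auto
    also have "Y N -` (- E k) \<inter> space (M N) = {\<omega>\<in>space (M N). Y N \<omega> \<notin> E k}" by auto
    finally show ?thesis .
  qed
  have mono: "measure (M N) {\<omega>\<in>space (M N). Y N \<omega> \<notin> E l} \<le> measure (M N) {\<omega>\<in>space (M N). Y N \<omega> \<notin> E k}" if "k \<le> l" for N k l
  proof -
    interpret prob_space "M N" by (rule P)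
    show ?thesis using s[of N k] E(2) that by (intro finite_measure_mono) (auto simp: incseq_def)
  qed
  have "\<exists>k. measure (M N) {\<omega>\<in>space (M N). Y N \<omega> \<notin> E k} \<le> \<eta>" for N
  proof -
    interpret prob_space "M N" by (rule P)
    have "(\<lambda>k. prob {\<omega>\<in>space (M N). Y N \<omega> \<notin> E k}) \<longlonglongrightarrow> prob (\<Inter>k. {\<omega>\<in>space (M N). Y N \<omega> \<notin> E k})"
      using s[of N] E(2) by (intro finite_Lim_measure_decseq) (auto simp: incseq_def decseq_def)
    moreover have "(\<Inter>k. {\<omega>\<in>space (M N). Y N \<omega> \<notin> E k}) = {}" using E(3) by auto
    ultimately have "(\<lambda>k. prob {\<omega>\<in>space (M N). Y N \<omega> \<notin> E k}) \<longlonglongrightarrow> 0" by simp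
    then have "\<forall>\<^sub>F k in sequentially. prob {\<omega>\<in>space (M N). Y N \<omega> \<notin> E k} < \<eta>" by (rule order_tendstoD(2)[OF _ \<eta>])
    then show ?thesis by (auto simp: eventually_sequentially intro: less_imp_le)
  qed
  then obtain kf where kf: "\<And>N. measure (M N) {\<omega>\<in>space (M N). Y N \<omega> \<notin> E (kf N)} \<le> \<eta>" by metis
  obtain k0 N0 where k0: "\<And>N. N \<ge> N0 \<Longrightarrow> \<exists>A\<in>sets (M N). measure (M N) A \<le> \<eta> \<and> (\<forall>\<omega>\<in>space (M N) - A. Y N \<omega> \<in> E k0)" using ev by blast
  have k0': "measure (M N) {\<omega>\<in>space (M N). Y N \<omega> \<notin> E k0} \<le> \<eta>" if N: "N \<ge> N0" for N
  proof -
    interpret prob_space "M N" by (rule P)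
    obtain A where A: "A \<in> sets (M N)" "measure (M N) A \<le> \<eta>" "\<forall>\<omega>\<in>space (M N) - A. Y N \<omega> \<in> E k0" using k0[OF N] by blast
    have "prob {\<omega>\<in>space (M N). Y N \<omega> \<notin> E k0} \<le> prob A" using A by (intro finite_measure_mono) auto
    then show ?thesis using A by simp
  qed
  define K where "K = Max (insert k0 (kf ` {..<N0}))"
  have "measure (M N) {\<omega>\<in>space (M N). Y N \<omega> \<notin> E K} \<le> \<eta>" for N
  proof (cases "N \<ge> N0")
    case True
    have "k0 \<le> K" unfolding K_def by simp
    then show ?thesis using mono[of k0 K N] k0'[OF True] by simp
  next
    case False
    then have "kf N \<le> K" unfolding K_def by simp
    then show ?thesis using mono[of "kf N" K N] kf[of N] by simp
  qed
  then show ?thesis by blast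
qed

text \<open>Half of \<epsilon> is spent on the uniform bound, half on the moduli of continuity at
  the levels 1/(j+1), with geometric shares; the intersection of these conditions is an
  Arzela-Ascoli set.\<close>

lemma tight_paths:
  fixes Y :: "nat \<Rightarrow> 'w \<Rightarrow> path"
  assumes P: "\<And>N. prob_space (M N)" and m: "\<And>N. Y N \<in> borel_measurable (M N)" and T: "0 < T"
    and cl: "\<And>N \<omega> t. \<omega> \<in> space (M N) \<Longrightarrow> apply_bcontfun (Y N \<omega>) (clip T t) = apply_bcontfun (Y N \<omega>) t"
    and bd: "\<And>\<eta>. \<eta> > 0 \<Longrightarrow> \<exists>B N0. \<forall>N\<ge>N0. \<exists>A\<in>sets (M N). measure (M N) A \<le> \<eta> \<and> (\<forall>\<omega>\<in>space (M N) - A. \<forall>t. norm (apply_bcontfun (Y N \<omega>) t) \<le> B)"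
    and eq: "\<And>e \<eta>. e > 0 \<Longrightarrow> \<eta> > 0 \<Longrightarrow> \<exists>\<delta>>0. \<exists>N0. \<forall>N\<ge>N0. \<exists>A\<in>sets (M N). measure (M N) A \<le> \<eta> \<and>
      (\<forall>\<omega>\<in>space (M N) - A. \<forall>s t. \<bar>s - t\<bar> < \<delta> \<longrightarrow> dist (apply_bcontfun (Y N \<omega>) s) (apply_bcontfun (Y N \<omega>) t) \<le> e)"
  shows "tight_seq M Y"
  unfolding tight_seq_def
proof (intro allI impI)
  fix \<epsilon> :: real assume e: "\<epsilon> > 0"
  have T0: "0 \<le> T" using T by simp
  define E0 where "E0 k = {f :: path. \<forall>t. norm (apply_bcontfun f t) \<le> real k}" for k
  define E where "E m k = {f :: path. \<forall>s t. \<bar>s - t\<bar> < 1 / real (Suc k) \<longrightarrow> dist (apply_bcontfun f s) (apply_bcontfun f t) \<le> 1 / real (Suc m)}" for m k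
  have cE: "closed (E0 k)" "closed (E m k)" for m k unfolding E0_def E_def
    by (intro closed_Collect_conj closed_Collect_all closed_Collect_imp closed_Collect_le closed_Collect_eq continuous_intros continuous_on_id; auto)+
  have iE0: "incseq E0" unfolding E0_def incseq_def by (auto intro: order_trans)
  have iE: "incseq (E m)" for m
  proof (rule incseq_SucI)
    fix k
    have "1 / real (Suc (Suc k)) \<le> 1 / real (Suc k)" by (simp add: frac_le)
    then show "E m k \<subseteq> E m (Suc k)" unfolding E_def by (auto intro: less_le_trans)
  qed
  have "\<exists>k. \<forall>N. measure (M N) {\<omega>\<in>space (M N). Y N \<omega> \<notin> E0 k} \<le> \<epsilon> / 2"
  proof (rule uniform_in_index[OF P m cE(1) iE0])
    show "\<exists>k. Y N \<omega> \<in> E0 k" for N \<omega>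
    proof -
      obtain k :: nat where "norm (Y N \<omega>) \<le> real k" using real_arch_simple by blast
      then have "Y N \<omega> \<in> E0 k" unfolding E0_def using norm_bounded[of "Y N \<omega>"] by (auto intro: order_trans)
      then show ?thesis ..
    qed
    obtain B N0 where B: "\<And>N. N \<ge> N0 \<Longrightarrow> \<exists>A\<in>sets (M N). measure (M N) A \<le> \<epsilon> / 2 \<and> (\<forall>\<omega>\<in>space (M N) - A. \<forall>t. norm (apply_bcontfun (Y N \<omega>) t) \<le> B)"
      using bd[of "\<epsilon> / 2"] e by auto
    obtain k :: nat where k: "B \<le> real k" using real_arch_simple by blast
    have "\<exists>A\<in>sets (M N). measure (M N) A \<le> \<epsilon> / 2 \<and> (\<forall>\<omega>\<in>space (M N) - A. Y N \<omega> \<in> E0 k)" if NN: "N \<ge> N0" for N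
    proof -
      obtain A where "A \<in> sets (M N)" "measure (M N) A \<le> \<epsilon> / 2" "\<forall>\<omega>\<in>space (M N) - A. \<forall>t. norm (apply_bcontfun (Y N \<omega>) t) \<le> B" using B[OF NN] by blast
      then show ?thesis unfolding E0_def using k by (intro bexI[of _ A]) (auto intro: order_trans)
    qed
    then show "\<exists>k N0. \<forall>N\<ge>N0. \<exists>A\<in>sets (M N). measure (M N) A \<le> \<epsilon> / 2 \<and> (\<forall>\<omega>\<in>space (M N) - A. Y N \<omega> \<in> E0 k)" by blast
  qed (use e in auto)
  then obtain k0 where k0: "\<And>N. measure (M N) {\<omega>\<in>space (M N). Y N \<omega> \<notin> E0 k0} \<le> \<epsilon> / 2" by blast
  define \<eta> where "\<eta> j = \<epsilon> / 4 * (1 / 2) ^ j" for j :: nat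
  have \<eta>: "\<eta> j > 0" for j unfolding \<eta>_def using e by simp
  have \<eta>s: "\<eta> sums (\<epsilon> / 2)" unfolding \<eta>_def[abs_def] using sums_mult[OF geometric_sums[of "1/2::real"], of "\<epsilon> / 4"] by simp
  have "\<exists>k. \<forall>N. measure (M N) {\<omega>\<in>space (M N). Y N \<omega> \<notin> E j k} \<le> \<eta> j" for j
  proof (rule uniform_in_index[OF P m cE(2) iE _ _ \<eta>])
    show "\<exists>k. Y N \<omega> \<in> E j k" if w: "\<omega> \<in> space (M N)" for N \<omega>
    proof -
      have "uniformly_continuous_on {0..T} (apply_bcontfun (Y N \<omega>))" by (rule compact_uniformly_continuous) auto
      then obtain d where d: "d > 0" "\<And>s t. s \<in> {0..T} \<Longrightarrow> t \<in> {0..T} \<Longrightarrow> dist s t < d \<Longrightarrow> dist (apply_bcontfun (Y N \<omega>) s) (apply_bcontfun (Y N \<omega>) t) < 1 / real (Suc j)"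
        unfolding uniformly_continuous_on_def by (metis of_nat_0_less_iff zero_less_Suc zero_less_divide_1_iff)
      obtain k where k: "inverse (real (Suc k)) < d" using reals_Archimedean[OF d(1)] by blast
      have "dist (apply_bcontfun (Y N \<omega>) s) (apply_bcontfun (Y N \<omega>) t) \<le> 1 / real (Suc j)" if st: "\<bar>s - t\<bar> < 1 / real (Suc k)" for s t
      proof -
        have "dist (clip T s) (clip T t) < d" using clip_dist[of T s t] st k by (simp add: dist_real_def inverse_eq_divide)
        then show ?thesis using d(2)[OF clip_in[OF T0] clip_in[OF T0]] cl[OF w] by (metis less_imp_le)
      qed
      then show ?thesis unfolding E_def by blast
    qed
    obtain d N0 where d: "d > 0" "\<And>N. N \<ge> N0 \<Longrightarrow> \<exists>A\<in>sets (M N). measure (M N) A \<le> \<eta> j \<and>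
      (\<forall>\<omega>\<in>space (M N) - A. \<forall>s t. \<bar>s - t\<bar> < d \<longrightarrow> dist (apply_bcontfun (Y N \<omega>) s) (apply_bcontfun (Y N \<omega>) t) \<le> 1 / real (Suc j))"
      using eq[of "1 / real (Suc j)" "\<eta> j"] \<eta>[of j] by auto
    obtain k where k: "inverse (real (Suc k)) < d" using reals_Archimedean[OF d(1)] by blast
    have "\<exists>A\<in>sets (M N). measure (M N) A \<le> \<eta> j \<and> (\<forall>\<omega>\<in>space (M N) - A. Y N \<omega> \<in> E j k)" if NN: "N \<ge> N0" for N
    proof -
      obtain A where A: "A \<in> sets (M N)" "measure (M N) A \<le> \<eta> j"
        "\<forall>\<omega>\<in>space (M N) - A. \<forall>s t. \<bar>s - t\<bar> < d \<longrightarrow> dist (apply_bcontfun (Y N \<omega>) s) (apply_bcontfun (Y N \<omega>) t) \<le> 1 / real (Suc j)" using d(2)[OF NN] by blast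
      have "1 / real (Suc k) \<le> d" using k by (simp add: inverse_eq_divide)
      then have "\<forall>\<omega>\<in>space (M N) - A. Y N \<omega> \<in> E j k" unfolding E_def using A(3) less_le_trans by blast
      then show ?thesis using A by blast
    qed
    then show "\<exists>k N0. \<forall>N\<ge>N0. \<exists>A\<in>sets (M N). measure (M N) A \<le> \<eta> j \<and> (\<forall>\<omega>\<in>space (M N) - A. Y N \<omega> \<in> E j k)" by blast
  qed
  then obtain k where k: "\<And>j N. measure (M N) {\<omega>\<in>space (M N). Y N \<omega> \<notin> E j (k j)} \<le> \<eta> j" by metis
  let ?K = "path_box T (real k0) (\<lambda>j. 1 / real (Suc (k j)))"
  have "measure (M N) {\<omega>\<in>space (M N). Y N \<omega> \<in> ?K} \<ge> 1 - \<epsilon>" for N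
  proof -
    interpret prob_space "M N" by (rule P)
    have s: "{\<omega>\<in>space (M N). Y N \<omega> \<in> C} \<in> events" if "closed C" for C
    proof -
      have "Y N -` C \<inter> space (M N) \<in> events" by (intro measurable_sets[OF m]) (use that in auto)
      also have "Y N -` C \<inter> space (M N) = {\<omega>\<in>space (M N). Y N \<omega> \<in> C}" by auto
      finally show ?thesis .
    qed
    have s': "{\<omega>\<in>space (M N). Y N \<omega> \<notin> C} \<in> events" if "closed C" for C
      using sets.compl_sets[OF s[OF that]] by (rule back_subst) auto
    have sE: "{\<omega>\<in>space (M N). Y N \<omega> \<notin> E0 k0} \<in> events" "{\<omega>\<in>space (M N). Y N \<omega> \<notin> E j (k j)} \<in> events" for j
      by (intro s' cE)+
    have sm: "summable (\<lambda>j. prob {\<omega>\<in>space (M N). Y N \<omega> \<notin> E j (k j)})"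
      by (rule summable_comparison_test'[OF sums_summable[OF \<eta>s]]) (use k in auto)
    have "prob (\<Union>j. {\<omega>\<in>space (M N). Y N \<omega> \<notin> E j (k j)}) \<le> (\<Sum>j. prob {\<omega>\<in>space (M N). Y N \<omega> \<notin> E j (k j)})"
      using sE(2) sm by (intro finite_measure_subadditive_countably) auto
    also have "\<dots> \<le> (\<Sum>j. \<eta> j)" by (rule suminf_le[OF k sm sums_summable[OF \<eta>s]])
    also have "\<dots> = \<epsilon> / 2" using \<eta>s by (rule sums_unique[symmetric])
    finally have U: "prob (\<Union>j. {\<omega>\<in>space (M N). Y N \<omega> \<notin> E j (k j)}) \<le> \<epsilon> / 2" .
    have "1 = prob (space (M N))" by (simp add: prob_space)
    also have "\<dots> \<le> prob ({\<omega>\<in>space (M N). Y N \<omega> \<in> ?K} \<union> ({\<omega>\<in>space (M N). Y N \<omega> \<notin> E0 k0} \<union> (\<Union>j. {\<omega>\<in>space (M N). Y N \<omega> \<notin> E j (k j)})))"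
    proof (rule finite_measure_mono)
      show "space (M N) \<subseteq> {\<omega>\<in>space (M N). Y N \<omega> \<in> ?K} \<union> ({\<omega>\<in>space (M N). Y N \<omega> \<notin> E0 k0} \<union> (\<Union>j. {\<omega>\<in>space (M N). Y N \<omega> \<notin> E j (k j)}))"
      proof
        fix \<omega> assume w: "\<omega> \<in> space (M N)"
        show "\<omega> \<in> {\<omega>\<in>space (M N). Y N \<omega> \<in> ?K} \<union> ({\<omega>\<in>space (M N). Y N \<omega> \<notin> E0 k0} \<union> (\<Union>j. {\<omega>\<in>space (M N). Y N \<omega> \<notin> E j (k j)}))"
        proof (rule ccontr)
          assume n: "\<omega> \<notin> {\<omega>\<in>space (M N). Y N \<omega> \<in> ?K} \<union> ({\<omega>\<in>space (M N). Y N \<omega> \<notin> E0 k0} \<union> (\<Union>j. {\<omega>\<in>space (M N). Y N \<omega> \<notin> E j (k j)}))"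
          then have "Y N \<omega> \<in> E0 k0" "\<And>j. Y N \<omega> \<in> E j (k j)" using w by auto
          then have "Y N \<omega> \<in> ?K" unfolding path_box_def E0_def E_def using cl[OF w] by auto
          then show False using n w by auto
        qed
      qed
    qed (use s[OF closed_path_box] sE in auto)
    also have "\<dots> \<le> prob {\<omega>\<in>space (M N). Y N \<omega> \<in> ?K} + prob ({\<omega>\<in>space (M N). Y N \<omega> \<notin> E0 k0} \<union> (\<Union>j. {\<omega>\<in>space (M N). Y N \<omega> \<notin> E j (k j)}))"
      by (rule measure_Un_le) (use s[OF closed_path_box] sE in auto)
    also have "\<dots> \<le> prob {\<omega>\<in>space (M N). Y N \<omega> \<in> ?K} + (prob {\<omega>\<in>space (M N). Y N \<omega> \<notin> E0 k0} + prob (\<Union>j. {\<omega>\<in>space (M N). Y N \<omega> \<notin> E j (k j)}))"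
      by (intro add_left_mono measure_Un_le) (use sE in auto)
    finally show ?thesis using U k0[of N] by linarith
  qed
  moreover have "compact ?K" by (rule compact_path_box[OF T0]) simp
  ultimately show "\<exists>K. compact K \<and> (\<forall>N. measure (M N) {\<omega>\<in>space (M N). Y N \<omega> \<in> K} \<ge> 1 - \<epsilon>)" by blast
qed

text \<open>One half of the portmanteau theorem. The continuous function max(0, 1 - dist(f, A))
  takes the place of the indicator of \<open>A\<close>: its mean under the limit is at least 1 -
  \<eta> for every \<eta> > 0, so it equals 1 almost surely, and that happens only on the closed set
  \<open>A\<close>.\<close>

lemma weak_limit_closed:
  fixes Y :: "nat \<Rightarrow> 'w \<Rightarrow> 'b::metric_space"
  assumes P: "\<And>N. prob_space (M N)" and m: "\<And>N. Y N \<in> borel_measurable (M N)" and w: "weak_limit_point M Y \<mu>" and A: "closed A"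
    and ev: "\<And>\<eta>. \<eta> > 0 \<Longrightarrow> \<exists>N0. \<forall>N\<ge>N0. \<exists>B\<in>sets (M N). measure (M N) B \<le> \<eta> \<and> (\<forall>\<omega>\<in>space (M N) - B. Y N \<omega> \<in> A)"
  shows "AE f in \<mu>. f \<in> A"
proof -
  interpret mu: prob_space \<mu> using w unfolding weak_limit_point_def by blast
  have sm: "sets \<mu> = sets borel" using w unfolding weak_limit_point_def by blast
  obtain r where r: "strict_mono r" "\<And>g :: 'b \<Rightarrow> real. continuous_on UNIV g \<Longrightarrow> bounded (range g) \<Longrightarrow>
           (\<lambda>k. integral\<^sup>L (M (r k)) (\<lambda>\<omega>. g (Y (r k) \<omega>))) \<longlonglongrightarrow> integral\<^sup>L \<mu> g" using w unfolding weak_limit_point_def by blast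
  define g where "g f = max 0 (1 - infdist f A)" for f
  have gc: "continuous_on UNIV g" unfolding g_def[abs_def] by (intro continuous_intros)
  have g01: "0 \<le> g f" "g f \<le> 1" for f unfolding g_def using infdist_nonneg[of f A] by auto
  have gb: "bounded (range g)" using g01 by (intro boundedI[of _ 1]) auto
  have gm: "g \<in> borel_measurable borel" by (rule borel_measurable_continuous_onI[OF gc])
  have gmu: "g \<in> borel_measurable \<mu>" using gm measurable_cong_sets[OF sm refl] by blast
  have gi: "integrable \<mu> g" using g01 gmu by (intro mu.integrable_const_bound[of _ 1]) auto
  have low: "1 - \<eta> \<le> integral\<^sup>L \<mu> g" if \<eta>: "\<eta> > 0" for \<eta>
  proof -
    obtain N0 where N0: "\<And>N. N \<ge> N0 \<Longrightarrow> \<exists>B\<in>sets (M N). measure (M N) B \<le> \<eta> \<and> (\<forall>\<omega>\<in>space (M N) - B. Y N \<omega> \<in> A)" using ev[OF \<eta>] by blast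
    have "1 - \<eta> \<le> integral\<^sup>L (M (r k)) (\<lambda>\<omega>. g (Y (r k) \<omega>))" if k: "k \<ge> N0" for k
    proof -
      interpret prob_space "M (r k)" by (rule P)
      have "r k \<ge> N0" using k seq_suble[OF r(1), of k] by simp
      then obtain B where B: "B \<in> events" "prob B \<le> \<eta>" "\<forall>\<omega>\<in>space (M (r k)) - B. Y (r k) \<omega> \<in> A" using N0 by blast
      have "1 - \<eta> \<le> expectation (\<lambda>\<omega>. 1 - indicator B \<omega>)"
        using B by (subst Bochner_Integration.integral_diff) (auto simp: prob_space less_top[symmetric])
      also have "\<dots> \<le> expectation (\<lambda>\<omega>. g (Y (r k) \<omega>))"
      proof (rule integral_mono)
        show "integrable (M (r k)) (\<lambda>\<omega>. 1 - indicator B \<omega> :: real)" using B by (intro Bochner_Integration.integrable_diff) (auto simp: less_top[symmetric])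
        show "integrable (M (r k)) (\<lambda>\<omega>. g (Y (r k) \<omega>))"
          using g01 measurable_compose[OF m gm] by (intro integrable_const_bound[of _ 1]) auto
        fix \<omega> assume w: "\<omega> \<in> space (M (r k))"
        show "1 - indicator B \<omega> \<le> g (Y (r k) \<omega>)"
        proof (cases "\<omega> \<in> B")
          case False
          then have "infdist (Y (r k) \<omega>) A = 0" using B(3) w by (intro infdist_zero) auto
          then show ?thesis using False unfolding g_def by simp
        qed (use g01 in auto)
      qed
      finally show ?thesis .
    qed
    then show ?thesis by (intro LIMSEQ_le_const[OF r(2)[OF gc gb]]) blast
  qed
  \<comment> \<open>\<open>infdist\<close> to the empty set is 0 by convention, so nonemptiness has
    to be extracted from the bounds on the probabilities.\<close>
  have "A \<noteq> {}"
  proof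
    assume e: "A = {}"
    obtain N0 where N0: "\<And>N. N \<ge> N0 \<Longrightarrow> \<exists>B\<in>sets (M N). measure (M N) B \<le> 1/2 \<and> (\<forall>\<omega>\<in>space (M N) - B. Y N \<omega> \<in> A)" using ev[of "1/2"] by auto
    from N0[OF order_refl] obtain B where B: "B \<in> sets (M N0)" "measure (M N0) B \<le> 1/2" "\<forall>\<omega>\<in>space (M N0) - B. Y N0 \<omega> \<in> A" by blast
    have sB: "space (M N0) \<subseteq> B" using B(3) unfolding e by blast
    interpret prob_space "M N0" by (rule P)
    have "prob (space (M N0)) \<le> prob B" by (rule finite_measure_mono[OF sB B(1)])
    then show False using B by (simp add: prob_space)
  qed
  have "1 \<le> integral\<^sup>L \<mu> g"
  proof (rule field_le_epsilon)
    fix e :: real assume "0 < e"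
    from low[OF this] show "1 \<le> integral\<^sup>L \<mu> g + e" by linarith
  qed
  then have "integral\<^sup>L \<mu> (\<lambda>f. 1 - g f) \<le> 0" using gi by (simp add: mu.prob_space)
  moreover have "0 \<le> integral\<^sup>L \<mu> (\<lambda>f. 1 - g f)" using g01 by (intro Bochner_Integration.integral_nonneg) auto
  ultimately have "integral\<^sup>L \<mu> (\<lambda>f. 1 - g f) = 0" by simp
  then have "AE f in \<mu>. 1 - g f = 0" using gi g01 by (subst (asm) integral_nonneg_eq_0_iff_AE) auto
  then show ?thesis
  proof eventually_elim
    case (elim f)
    then have "infdist f A = 0" unfolding g_def using infdist_nonneg[of f A] by (simp split: if_splits add: max_def)
    then show ?case using in_closed_iff_infdist_zero[OF A \<open>A \<noteq> {}\<close>] by blast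
  qed
qed

section \<open>The differential inclusion as a closed condition\<close>

text \<open>The increment of v minus its explicit drift. For the processes it is close to the
  integral of -2 \<beta> w, but it is expressed by (u,v) alone.\<close>

definition v_defect :: "nat \<Rightarrow> real \<Rightarrow> path \<Rightarrow> real \<Rightarrow> real \<Rightarrow> real" where
  "v_defect p \<beta> f s t = snd (apply_bcontfun f t) - snd (apply_bcontfun f s)
     - integral {s..t} (\<lambda>r. Fc p \<beta> (fst (apply_bcontfun f r)) (snd (apply_bcontfun f r)))"

text \<open>The third condition bounds second differences of the unknown part of the drift of \<open>v\<close>; it is what
  makes limit points continuously differentiable. Everything is written in integrated form without
  quotients, so that the set is closed and the slack \<open>\<delta>\<close> is uniform in the time parameters.\<close>

definition approx_sols :: "real \<Rightarrow> nat \<Rightarrow> real \<Rightarrow> real \<Rightarrow> real \<Rightarrow> real \<Rightarrow> path set" where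
  "approx_sols T p \<beta> \<Lambda> L \<delta> = {f.
     (\<forall>s t. 0 \<le> s \<and> s \<le> t \<and> t \<le> T \<longrightarrow>
        \<bar>fst (apply_bcontfun f t) - fst (apply_bcontfun f s) - integral {s..t} (\<lambda>r. F1 p \<beta> (fst (apply_bcontfun f r)) (snd (apply_bcontfun f r)))\<bar> \<le> \<delta> \<and>
        \<bar>v_defect p \<beta> f s t\<bar> \<le> 2 * \<beta> * \<Lambda> * integral {s..t} (\<lambda>r. snd (apply_bcontfun f r)) + \<delta>) \<and>
     (\<forall>a b c d. 0 \<le> a \<and> a \<le> b \<and> b \<le> T \<and> 0 \<le> c \<and> c \<le> d \<and> d \<le> T \<longrightarrow>
        \<bar>(d - c) * v_defect p \<beta> f a b - (b - a) * v_defect p \<beta> f c d\<bar> \<le> L * (max b d - min a c) * (b - a) * (d - c) + \<delta>)}"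

text \<open>For fixed limits of integration, the integral depends continuously on the path; this
  makes the integral conditions below closed.\<close>

lemma continuous_on_integral_eval:
  fixes \<phi> :: "real \<times> real \<Rightarrow> real"
  assumes \<phi>: "continuous_on UNIV \<phi>"
  shows "continuous_on A (\<lambda>f :: path. integral {s..t} (\<lambda>r. \<phi> (apply_bcontfun f r)))"
proof -
  have "continuous_on (A \<times> cbox s t) (\<lambda>(f :: path, r). \<phi> (apply_bcontfun f r))"
    unfolding case_prod_beta
    by (rule continuous_on_compose2[OF \<phi> continuous_on_eval[OF continuous_on_fst[OF continuous_on_id] continuous_on_snd[OF continuous_on_id]]]) auto
  from integral_continuous_on_param[OF this] show ?thesis by (simp add: cbox_interval)
qed

lemma Fc_cont: "continuous_on UNIV (\<lambda>z. Fc p \<beta> (fst z) (snd z))"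
  and F1_cont: "continuous_on UNIV (\<lambda>z. F1 p \<beta> (fst z) (snd z))"
  unfolding Fc_def F1_def by (intro continuous_intros)+

lemma F_path_cont:
  "continuous_on A (\<lambda>r. Fc p \<beta> (fst (apply_bcontfun f r)) (snd (apply_bcontfun f r)))"
  "continuous_on A (\<lambda>r. F1 p \<beta> (fst (apply_bcontfun f r)) (snd (apply_bcontfun f r)))"
  "continuous_on A (\<lambda>r. fst (apply_bcontfun f r))" "continuous_on A (\<lambda>r. snd (apply_bcontfun f r))"
  unfolding Fc_def F1_def by (intro continuous_intros continuous_on_apply_bcontfun)+

lemma closed_approx_sols: "closed (approx_sols T p \<beta> \<Lambda> L \<delta>)"
proof -
  note i1 = continuous_on_integral_eval[OF F1_cont] and i2 = continuous_on_integral_eval[OF Fc_cont]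
    and i3 = continuous_on_integral_eval[OF continuous_on_snd[OF continuous_on_id]]
  show ?thesis unfolding approx_sols_def v_defect_def
    by (intro closed_Collect_conj closed_Collect_all closed_Collect_imp closed_Collect_le
        continuous_intros continuous_on_id i1 i2 i3; simp)
qed

lemma approx_sols_limit:
  assumes "\<And>n. f \<in> approx_sols T p \<beta> \<Lambda> L (1 / real (Suc n))"
  shows "f \<in> approx_sols T p \<beta> \<Lambda> L 0"
proof -
  have le: "x \<le> y + 0" if "\<And>n. x \<le> y + 1 / real (Suc n)" for x y :: real
  proof (rule field_le_epsilon)
    fix e :: real assume "0 < e"
    then obtain n where "inverse (real (Suc n)) < e" using reals_Archimedean by blast
    then show "x \<le> y + 0 + e" using that[of n] by (simp add: inverse_eq_divide)
  qed
  have le0: "x \<le> 0" if "\<And>n. x \<le> 1 / real (Suc n)" for x :: real using le[of x 0] that by simp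
  show ?thesis using assms unfolding approx_sols_def
    apply (intro CollectI conjI allI impI)
    subgoal by (rule le0) auto
    subgoal by (rule le) auto
    subgoal by (rule le) auto
    done
qed

text \<open>Quotients over nearby short intervals nearly agree, so \<open>Q t s\<close> satisfies a
  Cauchy condition as s tends to t, with rate L |s - t|. Comparing the limits at t and s through the
  common quotient \<open>Q t s = Q s t\<close> shows that the derivative is Lipschitz with constant
  2 L.\<close>

lemma differentiable_of_difference_quotients:
  fixes V :: "real \<Rightarrow> real"
  assumes T: "T > 0" and L: "L \<ge> 0"
    and q: "\<And>a b c d. 0 \<le> a \<Longrightarrow> a < b \<Longrightarrow> b \<le> T \<Longrightarrow> 0 \<le> c \<Longrightarrow> c < d \<Longrightarrow> d \<le> T \<Longrightarrow>
      \<bar>(V b - V a) / (b - a) - (V d - V c) / (d - c)\<bar> \<le> L * (max b d - min a c)"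
  shows "\<exists>w. continuous_on {0..T} w \<and> (\<forall>t\<in>{0..T}. (V has_real_derivative w t) (at t within {0..T}))"
proof -
  define Q where "Q t s = (V s - V t) / (s - t)" for t s
  have Qs: "Q t s = Q s t" for t s unfolding Q_def by (metis minus_diff_eq minus_divide_divide)
  have Q: "\<bar>Q t s - Q t s'\<bar> \<le> L * (\<bar>s - t\<bar> + \<bar>s' - t\<bar>)"
    if "t \<in> {0..T}" "s \<in> {0..T}" "s' \<in> {0..T}" "s \<noteq> t" "s' \<noteq> t" for t s s'
  proof -
    have e: "Q t x = (V (max x t) - V (min x t)) / (max x t - min x t)" for x
      using Qs[of t x] unfolding Q_def by (auto simp: max_def min_def)
    have "\<bar>Q t s - Q t s'\<bar> \<le> L * (max (max s t) (max s' t) - min (min s t) (min s' t))"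
      unfolding e by (rule q) (use that in \<open>auto simp: max_def min_def\<close>)
    also have "\<dots> \<le> L * (\<bar>s - t\<bar> + \<bar>s' - t\<bar>)" using L by (intro mult_left_mono) (auto simp: max_def min_def)
    finally show ?thesis .
  qed
  \<comment> \<open>The limit of the quotients as a supremum: by the Cauchy condition, each lower
    estimate \<open>Q t s - L * \<bar>s - t\<bar>\<close> lies below each upper estimate
    \<open>Q t r + L * \<bar>r - t\<bar>\<close>.\<close>
  define w where "w t = (SUP s\<in>{0..T} - {t}. Q t s - L * \<bar>s - t\<bar>)" for t
  have w: "\<bar>Q t s - w t\<bar> \<le> L * \<bar>s - t\<bar>" if ts: "t \<in> {0..T}" "s \<in> {0..T}" "s \<noteq> t" for t s
  proof -
    have up: "Q t r - L * \<bar>r - t\<bar> \<le> Q t s + L * \<bar>s - t\<bar>" if "r \<in> {0..T} - {t}" for r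
    proof -
      have "\<bar>Q t r - Q t s\<bar> \<le> L * (\<bar>r - t\<bar> + \<bar>s - t\<bar>)" using that ts by (intro Q) auto
      then show ?thesis by (simp add: distrib_left)
    qed
    have "w t \<le> Q t s + L * \<bar>s - t\<bar>" unfolding w_def using up ts by (intro cSUP_least) auto
    moreover have "Q t s - L * \<bar>s - t\<bar> \<le> w t" unfolding w_def
      by (rule cSUP_upper[OF _ bdd_aboveI2[of _ _ "Q t s + L * \<bar>s - t\<bar>"]]) (use up ts in auto)
    ultimately show ?thesis by linarith
  qed
  have wl: "\<bar>w s - w t\<bar> \<le> 2 * L * \<bar>s - t\<bar>" if "t \<in> {0..T}" "s \<in> {0..T}" for s t
  proof (cases "s = t")
    case False
    then show ?thesis using w[of t s] w[of s t] that Qs[of t s] by (simp add: abs_minus_commute)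
  qed simp
  have small: "\<exists>d>0. \<forall>s. \<bar>s - t\<bar> < d \<longrightarrow> 2 * L * \<bar>s - t\<bar> < e" if "e > 0" for e t :: real
  proof (intro exI[of _ "e / (2 * L + 1)"] conjI allI impI)
    show "0 < e / (2 * L + 1)" using that L by simp
    fix s assume "\<bar>s - t\<bar> < e / (2 * L + 1)"
    then have "(2 * L + 1) * \<bar>s - t\<bar> < e" using L by (simp add: pos_less_divide_eq mult.commute)
    then show "2 * L * \<bar>s - t\<bar> < e" by (simp add: distrib_right)
  qed
  show ?thesis
  proof (intro exI[of _ w] conjI ballI)
    show "continuous_on {0..T} w"
    proof (rule continuous_onI)
      fix t e :: real assume t: "t \<in> {0..T}" and e: "e > 0"
      obtain d where "d > 0" "\<And>s. \<bar>s - t\<bar> < d \<Longrightarrow> 2 * L * \<bar>s - t\<bar> < e" using small[OF e] by blast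
      then show "\<exists>d>0. \<forall>s\<in>{0..T}. dist s t < d \<longrightarrow> dist (w s) (w t) \<le> e"
        using wl[OF t] unfolding dist_real_def by (meson less_imp_le order_trans)
    qed
    fix t assume t: "t \<in> {0..T}"
    show "(V has_real_derivative w t) (at t within {0..T})"
      unfolding has_field_derivative_iff
    proof (rule tendstoI)
      fix e :: real assume e: "e > 0"
      obtain d where d: "d > 0" "\<And>s. \<bar>s - t\<bar> < d \<Longrightarrow> 2 * L * \<bar>s - t\<bar> < e" using small[OF e] by blast
      have "dist ((V s - V t) / (s - t)) (w t) < e" if "s \<in> {0..T}" "s \<noteq> t" "dist s t < d" for s
      proof -
        have "0 \<le> L * \<bar>s - t\<bar>" using L by simp
        then show ?thesis using w[OF t that(1,2)] d(2)[of s] that(3) unfolding Q_def dist_real_def by linarith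
      qed
      then show "\<forall>\<^sub>F s in at t within {0..T}. dist ((V s - V t) / (s - t)) (w t) < e"
        unfolding eventually_at using d(1) by blast
    qed
  qed
qed

lemma derivative_nonneg_of_mono:
  fixes g :: "real \<Rightarrow> real"
  assumes g: "(g has_real_derivative D) (at t within {0..T})" and t: "t \<in> {0..T}" and T: "T > 0"
    and m: "\<And>s t. 0 \<le> s \<Longrightarrow> s \<le> t \<Longrightarrow> t \<le> T \<Longrightarrow> g s \<le> g t"
  shows "0 \<le> D"
proof (rule tendsto_lowerbound)
  show "((\<lambda>s. (g s - g t) / (s - t)) \<longlongrightarrow> D) (at t within {0..T})" using g unfolding has_field_derivative_iff .
  have "0 \<le> (g s - g t) / (s - t)" if "s \<in> {0..T}" for s
  proof (cases "s \<le> t")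
    case True
    then show ?thesis using m[of s t] that t by (intro divide_nonpos_nonpos) auto
  next
    case False
    then show ?thesis using m[of t s] that t by (intro divide_nonneg_nonneg) auto
  qed
  then show "\<forall>\<^sub>F s in at t within {0..T}. 0 \<le> (g s - g t) / (s - t)" unfolding eventually_at by (intro exI[of _ 1]) auto
  show "at t within {0..T} \<noteq> bot" using t T by (simp add: trivial_limit_within islimpt_Icc)
qed

text \<open>\<open>V\<close> accumulates the defect, and the condition on second differences makes
  it C^1. The bound on the defect says that the integral of 2 \<beta> \<Lambda> v plus or minus
  \<open>V\<close> is nondecreasing, which bounds the derivative of \<open>V\<close>. The remaining
  condition is the integral equation for u.\<close>

lemma C1_ode_of_approx_sols:
  assumes f: "f \<in> approx_sols T p \<beta> \<Lambda> L 0" and T: "T > 0" and L: "L \<ge> 0"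
  shows "C1_ode p \<beta> \<Lambda> T f"
proof -
  define u where "u t = fst (apply_bcontfun f t)" for t
  define v where "v t = snd (apply_bcontfun f t)" for t
  have cF: "continuous_on A (\<lambda>r. Fc p \<beta> (u r) (v r))" "continuous_on A (\<lambda>r. F1 p \<beta> (u r) (v r))" "continuous_on A u" "continuous_on A v" for A
    unfolding u_def[abs_def] v_def[abs_def] by (rule F_path_cont)+
  have int: "g integrable_on {a..b}" if "\<And>A. continuous_on A g" for g :: "real \<Rightarrow> real" and a b
    by (rule integrable_continuous_real[OF that])
  have split: "integral {0..t} g - integral {0..s} g = integral {s..t} g" if "\<And>A. continuous_on A g" "0 \<le> s" "s \<le> t" for g :: "real \<Rightarrow> real" and s t
    using Henstock_Kurzweil_Integration.integral_combine[OF that(2,3) int[OF that(1)]] by simp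
  have d: "((\<lambda>s. integral {0..s} g) has_real_derivative g t) (at t within {0..T})" if "\<And>A. continuous_on A g" "t \<in> {0..T}" for g :: "real \<Rightarrow> real" and t
    by (rule integral_has_real_derivative[OF that])
  define V where "V t = v t - v 0 - integral {0..t} (\<lambda>r. Fc p \<beta> (u r) (v r))" for t
  have R: "v_defect p \<beta> f s t = V t - V s" if "0 \<le> s" "s \<le> t" for s t
    unfolding V_def v_defect_def u_def[symmetric] v_def[symmetric] using split[OF cF(1) that] by simp
  note f' = f[unfolded approx_sols_def mem_Collect_eq u_def[symmetric] v_def[symmetric]]
  have h1: "u t = u 0 + integral {0..t} (\<lambda>r. F1 p \<beta> (u r) (v r))" if "t \<in> {0..T}" for t
    using f'[THEN conjunct1, rule_format, of 0 t] that by simp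
  have h2: "\<bar>V t - V s\<bar> \<le> 2 * \<beta> * \<Lambda> * integral {s..t} v" if "0 \<le> s" "s \<le> t" "t \<le> T" for s t
    using f'[THEN conjunct1, rule_format, of s t] that R[OF that(1,2)] by simp
  have h3: "\<bar>(d - c) * (V b - V a) - (b - a) * (V d - V c)\<bar> \<le> L * (max b d - min a c) * (b - a) * (d - c)"
    if "0 \<le> a" "a \<le> b" "b \<le> T" "0 \<le> c" "c \<le> d" "d \<le> T" for a b c d
    using f'[THEN conjunct2, rule_format, of a b c d] that R[OF that(1,2)] R[OF that(4,5)] by simp
  have "\<exists>w. continuous_on {0..T} w \<and> (\<forall>t\<in>{0..T}. (V has_real_derivative w t) (at t within {0..T}))"
  proof (rule differentiable_of_difference_quotients[OF T L])
    fix a b c d assume *: "0 \<le> a" "a < b" "b \<le> T" "0 \<le> c" "c < d" "d \<le> T"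
    have pos: "(b - a) * (d - c) > 0" using * by simp
    have "(V b - V a) / (b - a) - (V d - V c) / (d - c) = ((d - c) * (V b - V a) - (b - a) * (V d - V c)) / ((b - a) * (d - c))"
      using * by (subst diff_frac_eq) (auto simp: mult.commute)
    then have "\<bar>(V b - V a) / (b - a) - (V d - V c) / (d - c)\<bar> = \<bar>(d - c) * (V b - V a) - (b - a) * (V d - V c)\<bar> / ((b - a) * (d - c))"
      using pos by (simp only: abs_divide abs_of_pos)
    also have "\<dots> \<le> L * (max b d - min a c)"
      unfolding pos_divide_le_eq[OF pos] using h3[of a b c d] * by (simp add: mult.assoc)
    finally show "\<bar>(V b - V a) / (b - a) - (V d - V c) / (d - c)\<bar> \<le> L * (max b d - min a c)" .
  qed
  then obtain w where w: "continuous_on {0..T} w" "\<And>t. t \<in> {0..T} \<Longrightarrow> (V has_real_derivative w t) (at t within {0..T})" by blast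
  have wb: "w t \<le> 2 * \<beta> * \<Lambda> * v t" "- (2 * \<beta> * \<Lambda> * v t) \<le> w t" if t: "t \<in> {0..T}" for t
  proof -
    have W: "((\<lambda>t. 2 * \<beta> * \<Lambda> * integral {0..t} v) has_real_derivative 2 * \<beta> * \<Lambda> * v t) (at t within {0..T})"
      by (rule DERIV_cmult[OF d[OF cF(4) t]])
    have m: "2 * \<beta> * \<Lambda> * integral {0..t} v - 2 * \<beta> * \<Lambda> * integral {0..s} v = 2 * \<beta> * \<Lambda> * integral {s..t} v" if "0 \<le> s" "s \<le> t" for s t
      unfolding right_diff_distrib[symmetric] split[OF cF(4) that] ..
    have "0 \<le> 2 * \<beta> * \<Lambda> * v t - w t"
    proof (rule derivative_nonneg_of_mono[OF DERIV_diff[OF W w(2)[OF t]] t T])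
      fix s t assume "0 \<le> s" "s \<le> t" "t \<le> T"
      then show "2 * \<beta> * \<Lambda> * integral {0..s} v - V s \<le> 2 * \<beta> * \<Lambda> * integral {0..t} v - V t"
        using h2[of s t] m[of s t] by linarith
    qed
    then show "w t \<le> 2 * \<beta> * \<Lambda> * v t" by simp
    have "0 \<le> 2 * \<beta> * \<Lambda> * v t + w t"
    proof (rule derivative_nonneg_of_mono[OF DERIV_add[OF W w(2)[OF t]] t T])
      fix s t assume "0 \<le> s" "s \<le> t" "t \<le> T"
      then show "2 * \<beta> * \<Lambda> * integral {0..s} v + V s \<le> 2 * \<beta> * \<Lambda> * integral {0..t} v + V t"
        using h2[of s t] m[of s t] by linarith
    qed
    then show "- (2 * \<beta> * \<Lambda> * v t) \<le> w t" by simp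
  qed
  have du: "(u has_real_derivative F1 p \<beta> (u t) (v t)) (at t within {0..T})" if t: "t \<in> {0..T}" for t
  proof (rule has_field_derivative_transform_within[where d=1])
    show "((\<lambda>t. u 0 + integral {0..t} (\<lambda>r. F1 p \<beta> (u r) (v r))) has_real_derivative F1 p \<beta> (u t) (v t)) (at t within {0..T})"
      using DERIV_add[OF DERIV_const d[OF cF(2) t]] by simp
  qed (use t in \<open>auto intro: h1[symmetric]\<close>)
  have dv: "(v has_real_derivative Fc p \<beta> (u t) (v t) + w t) (at t within {0..T})" if t: "t \<in> {0..T}" for t
  proof (rule has_field_derivative_transform_within[where d=1])
    show "((\<lambda>t. v 0 + (integral {0..t} (\<lambda>r. Fc p \<beta> (u r) (v r)) + V t)) has_real_derivative Fc p \<beta> (u t) (v t) + w t) (at t within {0..T})"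
      using DERIV_add[OF DERIV_const DERIV_add[OF d[OF cF(1) t] w(2)[OF t]]] by simp
  qed (use t in \<open>auto simp: V_def\<close>)
  show ?thesis unfolding C1_ode_def u_def[symmetric, abs_def] v_def[symmetric, abs_def]
  proof (rule exI[of _ "\<lambda>t. F1 p \<beta> (u t) (v t)"], rule exI[of _ "\<lambda>t. Fc p \<beta> (u t) (v t) + w t"], intro conjI ballI)
    show "continuous_on {0..T} (\<lambda>t. F1 p \<beta> (u t) (v t))" by (rule cF)
    show "continuous_on {0..T} (\<lambda>t. Fc p \<beta> (u t) (v t) + w t)" by (intro continuous_on_add cF w)
    fix t assume t: "t \<in> {0..T}"
    show "((\<lambda>s. u s) has_real_derivative F1 p \<beta> (u t) (v t)) (at t within {0..T})" using du[OF t] .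
    show "((\<lambda>s. v s) has_real_derivative Fc p \<beta> (u t) (v t) + w t) (at t within {0..T})" using dv[OF t] .
    show "F2L p \<beta> \<Lambda> (u t) (v t) \<le> Fc p \<beta> (u t) (v t) + w t" using wb[OF t] unfolding F2L_def Fc_def by linarith
    show "Fc p \<beta> (u t) (v t) + w t \<le> F2U p \<beta> \<Lambda> (u t) (v t)" using wb[OF t] unfolding F2U_def Fc_def by linarith
  qed simp
qed

lemma integral_diff_bound:
  fixes g h :: "real \<Rightarrow> real"
  assumes "continuous_on {s..t} g" "continuous_on {s..t} h" "s \<le> t" "\<And>r. r \<in> {s..t} \<Longrightarrow> \<bar>g r - h r\<bar> \<le> B"
  shows "\<bar>integral {s..t} g - integral {s..t} h\<bar> \<le> B * (t - s)"
proof -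
  have "integral {s..t} g - integral {s..t} h = integral {s..t} (\<lambda>r. g r - h r)"
    using assms by (intro Henstock_Kurzweil_Integration.integral_diff[symmetric] integrable_continuous_real)
  moreover have "norm (integral {s..t} (\<lambda>r. g r - h r)) \<le> B * (t - s)"
    using assms by (intro integral_bound continuous_on_diff) auto
  ultimately show ?thesis by simp
qed

text \<open>This is where the third observable is eliminated: \<open>w\<close> is any function
  bounded by \<Lambda> v that varies slowly, and the conclusion no longer mentions it. The slope 6
  \<beta> C is 2 \<beta> times three replacements, each costing C times the length of the hull of
  the two intervals.\<close>

lemma approx_solsI:
  fixes f :: path and w gu gv gw :: "real \<Rightarrow> real"
  assumes pos: "T \<ge> 0" "\<beta> \<ge> 0" "C \<ge> 0" "\<epsilon> \<ge> 0"
    and c: "continuous_on {0..T} w" "continuous_on {0..T} gu" "continuous_on {0..T} gv" "continuous_on {0..T} gw"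
    and b: "\<And>r. r \<in> {0..T} \<Longrightarrow> \<bar>w r\<bar> \<le> \<Lambda> * snd (apply_bcontfun f r)"
      "\<And>r. r \<in> {0..T} \<Longrightarrow> \<bar>gu r - F1 p \<beta> (fst (apply_bcontfun f r)) (snd (apply_bcontfun f r))\<bar> \<le> \<epsilon>"
      "\<And>r. r \<in> {0..T} \<Longrightarrow> \<bar>gv r - (Fc p \<beta> (fst (apply_bcontfun f r)) (snd (apply_bcontfun f r)) - 2 * \<beta> * w r)\<bar> \<le> \<epsilon>"
      "\<And>r. r \<in> {0..T} \<Longrightarrow> \<bar>gw r\<bar> \<le> C"
    and m: "\<And>s t. 0 \<le> s \<Longrightarrow> s \<le> t \<Longrightarrow> t \<le> T \<Longrightarrow> \<bar>fst (apply_bcontfun f t) - fst (apply_bcontfun f s) - integral {s..t} gu\<bar> \<le> 2 * \<epsilon>"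
      "\<And>s t. 0 \<le> s \<Longrightarrow> s \<le> t \<Longrightarrow> t \<le> T \<Longrightarrow> \<bar>snd (apply_bcontfun f t) - snd (apply_bcontfun f s) - integral {s..t} gv\<bar> \<le> 2 * \<epsilon>"
      "\<And>s t. 0 \<le> s \<Longrightarrow> s \<le> t \<Longrightarrow> t \<le> T \<Longrightarrow> \<bar>w t - w s - integral {s..t} gw\<bar> \<le> 2 * \<epsilon>"
  shows "f \<in> approx_sols T p \<beta> \<Lambda> (6 * \<beta> * C) ((12 * \<beta> * T\<^sup>2 + 2 * T * (2 + T) + (2 + T)) * \<epsilon>)"
proof -
  define K where "K = (12 * \<beta> * T\<^sup>2 + 2 * T * (2 + T) + (2 + T)) * \<epsilon>"
  have cs: "continuous_on {s..t} w" "continuous_on {s..t} gu" "continuous_on {s..t} gv" "continuous_on {s..t} gw"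
    if "0 \<le> s" "t \<le> T" for s t
    using c that by (auto elim: continuous_on_subset)
  have eT: "\<epsilon> * (t - s) \<le> \<epsilon> * T" if "0 \<le> s" "t \<le> T" for s t using that pos by (intro mult_left_mono) auto
  have K1: "2 * \<epsilon> + \<epsilon> * T \<le> K"
  proof -
    have "0 \<le> (12 * \<beta> * T\<^sup>2 + 2 * T * (2 + T)) * \<epsilon>" using pos by simp
    then show ?thesis unfolding K_def by (simp add: algebra_simps)
  qed
  have D: "\<bar>v_defect p \<beta> f s t + 2 * \<beta> * integral {s..t} w\<bar> \<le> 2 * \<epsilon> + \<epsilon> * T" if st: "0 \<le> s" "s \<le> t" "t \<le> T" for s t
  proof -
    let ?F = "\<lambda>r. Fc p \<beta> (fst (apply_bcontfun f r)) (snd (apply_bcontfun f r))"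
    have "\<bar>integral {s..t} gv - integral {s..t} (\<lambda>r. ?F r - 2 * \<beta> * w r)\<bar> \<le> \<epsilon> * (t - s)"
      using st b(3) by (intro integral_diff_bound cs continuous_on_diff continuous_on_mult continuous_on_const F_path_cont) auto
    moreover have "integral {s..t} (\<lambda>r. ?F r - 2 * \<beta> * w r) = integral {s..t} ?F - 2 * \<beta> * integral {s..t} w"
      using st by (subst Henstock_Kurzweil_Integration.integral_diff)
        (auto intro!: integrable_continuous_real cs continuous_on_mult continuous_on_const F_path_cont)
    ultimately show ?thesis using m(2)[OF st] eT[OF st(1,3)] unfolding v_defect_def by linarith
  qed
  have A1: "\<bar>fst (apply_bcontfun f t) - fst (apply_bcontfun f s) - integral {s..t} (\<lambda>r. F1 p \<beta> (fst (apply_bcontfun f r)) (snd (apply_bcontfun f r)))\<bar> \<le> K"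
    if st: "0 \<le> s" "s \<le> t" "t \<le> T" for s t
  proof -
    have "\<bar>integral {s..t} gu - integral {s..t} (\<lambda>r. F1 p \<beta> (fst (apply_bcontfun f r)) (snd (apply_bcontfun f r)))\<bar> \<le> \<epsilon> * (t - s)"
      using st b(2) by (intro integral_diff_bound cs F_path_cont) auto
    then show ?thesis using m(1)[OF st] eT[OF st(1,3)] K1 by linarith
  qed
  have A2: "\<bar>v_defect p \<beta> f s t\<bar> \<le> 2 * \<beta> * \<Lambda> * integral {s..t} (\<lambda>r. snd (apply_bcontfun f r)) + K" if st: "0 \<le> s" "s \<le> t" "t \<le> T" for s t
  proof -
    have "norm (integral {s..t} w) \<le> integral {s..t} (\<lambda>r. \<Lambda> * snd (apply_bcontfun f r))"
      by (rule integral_norm_bound_integral) (use st b(1) in \<open>auto intro!: integrable_continuous_real cs continuous_on_mult continuous_on_const F_path_cont\<close>)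
    then have "2 * \<beta> * \<bar>integral {s..t} w\<bar> \<le> 2 * \<beta> * (\<Lambda> * integral {s..t} (\<lambda>r. snd (apply_bcontfun f r)))"
      using pos by (intro mult_left_mono) auto
    moreover have "\<bar>2 * \<beta> * integral {s..t} w\<bar> = 2 * \<beta> * \<bar>integral {s..t} w\<bar>" using pos by (simp add: abs_mult)
    ultimately show ?thesis using D[OF st] K1 by (simp add: mult.assoc)
  qed
  have A3: "\<bar>(d - c) * v_defect p \<beta> f a b - (b - a) * v_defect p \<beta> f c d\<bar> \<le> 6 * \<beta> * C * (max b d - min a c) * (b - a) * (d - c) + K"
    if *: "0 \<le> a" "a \<le> b" "b \<le> T" "0 \<le> c" "c \<le> d" "d \<le> T" for a b c d
  proof -
    \<comment> \<open>The length of the hull of both intervals; \<open>E\<close> then bounds the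
      oscillation of \<open>w\<close> on it.\<close>
    define l where "l = max b d - min a c"
    define E where "E = C * l + 2 * \<epsilon>"
    have wE: "\<bar>w r - w s\<bar> \<le> E" if rs: "min a c \<le> s" "s \<le> max b d" "min a c \<le> r" "r \<le> max b d" for r s
    proof -
      have aux: "\<bar>w y - w x\<bar> \<le> E" if xy: "min a c \<le> x" "x \<le> y" "y \<le> max b d" for x y
      proof -
        have xy0: "0 \<le> x" "y \<le> T" using xy * by auto
        have "norm (integral {x..y} gw) \<le> C * (y - x)"
          by (rule integral_bound) (use xy xy0 b(4) in \<open>auto intro!: cs\<close>)
        moreover have "C * (y - x) \<le> C * l" using xy pos unfolding l_def by (intro mult_left_mono) auto
        ultimately show ?thesis using m(3)[OF xy0(1) xy(2) xy0(2)] unfolding E_def by (simp add: abs_le_iff)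
      qed
      show ?thesis using aux[of s r] aux[of r s] rs by (cases "s \<le> r") (auto simp: abs_minus_commute)
    qed
    have av: "\<bar>integral {x..y} w - w x * (y - x)\<bar> \<le> E * (y - x)" if xy: "min a c \<le> x" "x \<le> y" "y \<le> max b d" for x y
    proof -
      have xy0: "0 \<le> x" "y \<le> T" using xy * by auto
      have "\<bar>integral {x..y} w - integral {x..y} (\<lambda>_. w x)\<bar> \<le> E * (y - x)"
        by (rule integral_diff_bound) (use xy xy0 wE in \<open>auto intro!: cs\<close>)
      then show ?thesis using xy by (simp add: mult.commute)
    qed
    \<comment> \<open>The three replacements: each integral by the value of \<open>w\<close> at its
      left end, then one of these values by the other.\<close>
    define P where "P = integral {a..b} w - w a * (b - a)"
    define S where "S = integral {c..d} w - w c * (d - c)"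
    have P: "\<bar>P\<bar> \<le> E * (b - a)" unfolding P_def by (rule av) (use * in auto)
    have S: "\<bar>S\<bar> \<le> E * (d - c)" unfolding S_def by (rule av) (use * in auto)
    have wac: "\<bar>w a - w c\<bar> \<le> E" by (rule wE) (use * in auto)
    have "\<bar>(d - c) * P\<bar> \<le> (d - c) * (E * (b - a))" unfolding abs_mult using * P by (simp add: mult_left_mono)
    moreover have "\<bar>(b - a) * S\<bar> \<le> (b - a) * (E * (d - c))" unfolding abs_mult using * S by (simp add: mult_left_mono)
    moreover have "\<bar>(b - a) * (d - c) * (w a - w c)\<bar> \<le> (b - a) * (d - c) * E" unfolding abs_mult using * wac by (simp add: mult_left_mono)
    moreover have "(d - c) * integral {a..b} w - (b - a) * integral {c..d} w = (d - c) * P - (b - a) * S + (b - a) * (d - c) * (w a - w c)"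
      unfolding P_def S_def by (simp add: algebra_simps)
    moreover have "(d - c) * (E * (b - a)) + (b - a) * (E * (d - c)) + (b - a) * (d - c) * E = 3 * (E * ((b - a) * (d - c)))" by (simp add: algebra_simps)
    ultimately have I: "\<bar>(d - c) * integral {a..b} w - (b - a) * integral {c..d} w\<bar> \<le> 3 * (E * ((b - a) * (d - c)))" by linarith
    define X where "X = v_defect p \<beta> f a b + 2 * \<beta> * integral {a..b} w"
    define Y where "Y = v_defect p \<beta> f c d + 2 * \<beta> * integral {c..d} w"
    have e0: "0 \<le> 2 * \<epsilon> + \<epsilon> * T" using pos by simp
    have X: "\<bar>(d - c) * X\<bar> \<le> T * (2 * \<epsilon> + \<epsilon> * T)" unfolding abs_mult X_def using * D[of a b] e0 by (intro mult_mono) auto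
    have Y: "\<bar>(b - a) * Y\<bar> \<le> T * (2 * \<epsilon> + \<epsilon> * T)" unfolding abs_mult Y_def using * D[of c d] e0 by (intro mult_mono) auto
    have "(d - c) * v_defect p \<beta> f a b - (b - a) * v_defect p \<beta> f c d
      = (d - c) * X - (b - a) * Y - 2 * \<beta> * ((d - c) * integral {a..b} w - (b - a) * integral {c..d} w)"
      unfolding X_def Y_def by (simp add: algebra_simps)
    moreover have "\<bar>2 * \<beta> * ((d - c) * integral {a..b} w - (b - a) * integral {c..d} w)\<bar> \<le> 2 * \<beta> * (3 * (E * ((b - a) * (d - c))))"
      unfolding abs_mult[of "2 * \<beta>"] using pos by (intro mult_mono I) auto
    ultimately have "\<bar>(d - c) * v_defect p \<beta> f a b - (b - a) * v_defect p \<beta> f c d\<bar> \<le> 2 * (T * (2 * \<epsilon> + \<epsilon> * T)) + 2 * \<beta> * (3 * (E * ((b - a) * (d - c))))"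
      using X Y by linarith
    also have "2 * \<beta> * (3 * (E * ((b - a) * (d - c)))) = 6 * \<beta> * C * l * (b - a) * (d - c) + 12 * \<beta> * \<epsilon> * ((b - a) * (d - c))"
      unfolding E_def by (simp add: algebra_simps)
    also have "12 * \<beta> * \<epsilon> * ((b - a) * (d - c)) \<le> 12 * \<beta> * \<epsilon> * (T * T)"
      using * pos by (intro mult_left_mono mult_mono) auto
    finally have "\<bar>(d - c) * v_defect p \<beta> f a b - (b - a) * v_defect p \<beta> f c d\<bar>
      \<le> 6 * \<beta> * C * l * (b - a) * (d - c) + (2 * (T * (2 * \<epsilon> + \<epsilon> * T)) + 12 * \<beta> * \<epsilon> * (T * T))" by simp
    moreover have "2 * (T * (2 * \<epsilon> + \<epsilon> * T)) + 12 * \<beta> * \<epsilon> * (T * T) \<le> K"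
    proof -
      have "K = 2 * (T * (2 * \<epsilon> + \<epsilon> * T)) + 12 * \<beta> * \<epsilon> * (T * T) + (2 * \<epsilon> + \<epsilon> * T)" unfolding K_def by (simp add: power2_eq_square algebra_simps)
      then show ?thesis using e0 by linarith
    qed
    ultimately show ?thesis unfolding l_def by linarith
  qed
  show ?thesis unfolding K_def[symmetric] unfolding approx_sols_def using A1 A2 A3 by blast
qed

section \<open>The observables along the dynamics\<close>

lemma sgrad_norm2_vh_if:
  assumes p: "p \<ge> 3" and x: "x \<in> sphereN N"
  shows "sgrad_norm2 N (Ham N p J) x / real N = (if N = 0 then 0 else vh N p J x)"
proof (cases "N = 0")
  case False
  then have N: "N \<ge> 1" by simp
  have "(\<Sum>i<N. (x i)\<^sup>2) = real N" using x unfolding sphereN_def by simp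
  from sgrad_norm2_vh[OF p N this] show ?thesis using False by simp
qed simp

lemma pol_vh_if: "pol N (2 * p) (\<lambda>x. if N = 0 then 0 else vh N p J x)"
  using pol_vh[of N p J] by (cases "N = 0") (simp_all add: pol_const)

context langevin_process
begin

text \<open>Tightness is asserted for every N, so N = 0 occurs as well; there division by N gives 0,
  which the conditional records.\<close>

lemma Upath_apply:
  assumes p: "p \<ge> 3" and T: "0 \<le> T" and w: "\<omega> \<in> space M"
  shows "apply_bcontfun (Upath N p J T (X \<omega>)) t = (uh N p J (X \<omega> (clip T t)), if N = 0 then 0 else vh N p J (X \<omega> (clip T t)))"
proof -
  define g where "g s = (- Ham N p J (X \<omega> s) / real N, sgrad_norm2 N (Ham N p J) (X \<omega> s) / real N)" for s
  have g: "g s = (uh N p J (X \<omega> s), if N = 0 then 0 else vh N p J (X \<omega> s))" if "s \<in> {0..T}" for s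
    unfolding g_def uh_def using sgrad_norm2_vh_if[OF p X_sphere[OF w], of s J] that by simp
  have c: "continuous_on {0..T} (\<lambda>s. (uh N p J (X \<omega> s), if N = 0 then 0 else vh N p J (X \<omega> s)))"
    by (rule continuous_on_subset[of "{0..}"])
      (intro continuous_on_Pair pol_path_cont[OF pol_uh w] pol_path_cont[OF pol_vh_if w], auto)
  have "continuous_on {0..T} g" using c by (subst continuous_on_cong[OF refl g]) auto
  from apply_Bcontfun_clip[OF T this, of t]
  have "apply_bcontfun (Upath N p J T (X \<omega>)) t = g (clip T t)"
    unfolding Upath_def Let_def g_def clip_def .
  then show ?thesis using g[OF clip_in[OF T]] by simp
qed

lemma Upath_clip:
  assumes p: "p \<ge> 3" and T: "0 \<le> T" and w: "\<omega> \<in> space M"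
  shows "apply_bcontfun (Upath N p J T (X \<omega>)) (clip T t) = apply_bcontfun (Upath N p J T (X \<omega>)) t"
  unfolding Upath_apply[OF p T w] using T by simp

lemma Upath_measurable:
  assumes p: "p \<ge> 3" and T: "0 < T"
  shows "(\<lambda>\<omega>. Upath N p J T (X \<omega>)) \<in> borel_measurable M"
proof (rule measurable_random_path[OF T])
  have T0: "0 \<le> T" using T by simp
  fix t assume "t \<in> {0..T}"
  then have t: "clip T t \<ge> 0" using clip_in[OF T0] by auto
  have "(\<lambda>\<omega>. (uh N p J (X \<omega> (clip T t)), if N = 0 then 0 else vh N p J (X \<omega> (clip T t)))) \<in> borel_measurable M"
    by (intro borel_measurable_Pair pol_path_meas[OF pol_uh t] pol_path_meas[OF pol_vh_if t])
  then show "(\<lambda>\<omega>. apply_bcontfun (Upath N p J T (X \<omega>)) t) \<in> borel_measurable M"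
    using Upath_apply[OF p T0] by (subst measurable_cong) auto
next
  fix \<omega> s assume "\<omega> \<in> space M"
  then show "apply_bcontfun (Upath N p J T (X \<omega>)) (clip T s) = apply_bcontfun (Upath N p J T (X \<omega>)) s" using T by (intro Upath_clip[OF p]) auto
qed

text \<open>Kolmogorov's inequality with \<kappa> = C/N for each of the three martingales; three
  times 2 C T / (N \<epsilon>^2) explains the 6. Off the exceptional event the argument is
  deterministic: drifts are bounded by C and martingales by \<epsilon>.\<close>

lemma good_event:
  assumes p: "p \<ge> 3" and T: "0 < T" and \<beta>: "\<beta> > 0" and N: "N \<ge> 1" and C: "C > 0" and \<epsilon>: "\<epsilon> > 0"
    and good: "good N p \<beta> \<Lambda> J C \<epsilon>"
  shows "\<exists>B\<in>events. prob B \<le> 6 * C * T / (\<epsilon>\<^sup>2 * real N) \<and> (\<forall>\<omega>\<in>space M - B.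
     (\<forall>t. norm (apply_bcontfun (Upath N p J T (X \<omega>)) t) \<le> 2 * C) \<and>
     (\<forall>s t. dist (apply_bcontfun (Upath N p J T (X \<omega>)) s) (apply_bcontfun (Upath N p J T (X \<omega>)) t) \<le> 2 * C * \<bar>s - t\<bar> + 4 * \<epsilon>) \<and>
     Upath N p J T (X \<omega>) \<in> approx_sols T p \<beta> \<Lambda> (6 * \<beta> * C) ((12 * \<beta> * T\<^sup>2 + 2 * T * (2 + T) + (2 + T)) * \<epsilon>))"
proof -
  have T0: "0 \<le> T" using T by simp
  let ?S = "{uh N p J, vh N p J, wh N p J}"
  have P: "\<exists>d. pol N d f" if "f \<in> ?S" for f using that pol_uh[of N p J] pol_vh[of N p J] pol_wh[of N p J] by auto
  have V: "var_consts f C (C / real N)" if "f \<in> ?S" for f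
    unfolding var_consts_def using good that unfolding good_def by blast
  have fb: "\<bar>f x\<bar> \<le> C" "\<bar>gen N p \<beta> J f x\<bar> \<le> C" if "f \<in> ?S" "x \<in> sphereN N" for f x
    using V[OF that(1)] that(2) unfolding var_consts_def by auto
  have g: "\<bar>wh N p J x\<bar> \<le> \<Lambda> * vh N p J x"
    "\<bar>gen N p \<beta> J (uh N p J) x - F1 p \<beta> (uh N p J x) (vh N p J x)\<bar> \<le> \<epsilon>"
    "\<bar>gen N p \<beta> J (vh N p J) x - (Fc p \<beta> (uh N p J x) (vh N p J x) - 2 * \<beta> * wh N p J x)\<bar> \<le> \<epsilon>" if "x \<in> sphereN N" for x
    using good that unfolding good_def by auto
  have "\<exists>B\<in>events. prob B \<le> 2 * (C / real N) * T / \<epsilon>\<^sup>2 \<and> (\<forall>\<omega>\<in>space M - B. \<forall>t\<in>{0..T}. \<bar>mart f \<omega> t\<bar> \<le> \<epsilon>)" if "f \<in> ?S" for f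
    using P[OF that] mart_maximal[OF _ V[OF that] T0 \<epsilon>] by blast
  then obtain Bf where Bf: "\<And>f. f \<in> ?S \<Longrightarrow> Bf f \<in> events" "\<And>f. f \<in> ?S \<Longrightarrow> prob (Bf f) \<le> 2 * (C / real N) * T / \<epsilon>\<^sup>2"
    "\<And>f \<omega> t. f \<in> ?S \<Longrightarrow> \<omega> \<in> space M - Bf f \<Longrightarrow> t \<in> {0..T} \<Longrightarrow> \<bar>mart f \<omega> t\<bar> \<le> \<epsilon>" by metis
  define B where "B = Bf (uh N p J) \<union> (Bf (vh N p J) \<union> Bf (wh N p J))"
  have BM: "B \<in> events" unfolding B_def using Bf(1) by auto
  have "prob B \<le> prob (Bf (uh N p J)) + (prob (Bf (vh N p J)) + prob (Bf (wh N p J)))"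
    unfolding B_def using Bf(1) by (intro order_trans[OF measure_Un_le] add_left_mono measure_Un_le) auto
  also have "\<dots> \<le> 2 * (C / real N) * T / \<epsilon>\<^sup>2 + (2 * (C / real N) * T / \<epsilon>\<^sup>2 + 2 * (C / real N) * T / \<epsilon>\<^sup>2)"
    using Bf(2) by (intro add_mono) auto
  also have "\<dots> = 6 * C * T / (\<epsilon>\<^sup>2 * real N)" using N \<epsilon> by (simp add: field_simps)
  finally have pB: "prob B \<le> 6 * C * T / (\<epsilon>\<^sup>2 * real N)" .
  have main: "(\<forall>t. norm (apply_bcontfun (Upath N p J T (X \<omega>)) t) \<le> 2 * C) \<and>
     (\<forall>s t. dist (apply_bcontfun (Upath N p J T (X \<omega>)) s) (apply_bcontfun (Upath N p J T (X \<omega>)) t) \<le> 2 * C * \<bar>s - t\<bar> + 4 * \<epsilon>) \<and>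
     Upath N p J T (X \<omega>) \<in> approx_sols T p \<beta> \<Lambda> (6 * \<beta> * C) ((12 * \<beta> * T\<^sup>2 + 2 * T * (2 + T) + (2 + T)) * \<epsilon>)"
    if w: "\<omega> \<in> space M - B" for \<omega>
  proof -
    have w1: "\<omega> \<in> space M" using w by simp
    have Xs: "X \<omega> r \<in> sphereN N" if "0 \<le> r" for r by (rule X_sphere[OF w1 that])
    define F where "F = Upath N p J T (X \<omega>)"
    have Fa: "apply_bcontfun F t = (uh N p J (X \<omega> (clip T t)), vh N p J (X \<omega> (clip T t)))" for t
      unfolding F_def Upath_apply[OF p T0 w1] using N by simp
    have Fi: "fst (apply_bcontfun F t) = uh N p J (X \<omega> t)" "snd (apply_bcontfun F t) = vh N p J (X \<omega> t)" if "t \<in> {0..T}" for t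
      unfolding Fa clip_id[OF that] by simp_all
    have md: "\<bar>f (X \<omega> t) - f (X \<omega> s) - integral {s..t} (\<lambda>r. gen N p \<beta> J f (X \<omega> r))\<bar> \<le> 2 * \<epsilon>"
      if f: "f \<in> ?S" and st: "0 \<le> s" "s \<le> t" "t \<le> T" for f s t
    proof -
      obtain d where d: "pol N d f" using P[OF f] by blast
      have "\<omega> \<in> space M - Bf f" using w f unfolding B_def by auto
      then have "\<bar>mart f \<omega> t\<bar> \<le> \<epsilon>" "\<bar>mart f \<omega> s\<bar> \<le> \<epsilon>" using Bf(3)[OF f] st by auto
      then show ?thesis unfolding mart_diff[OF d w1 st(1,2), symmetric] by linarith
    qed
    have inc: "\<bar>f (X \<omega> t) - f (X \<omega> s)\<bar> \<le> C * \<bar>t - s\<bar> + 2 * \<epsilon>" if f: "f \<in> ?S" and st: "s \<in> {0..T}" "t \<in> {0..T}" for f s t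
    proof -
      obtain d where d: "pol N d f" using P[OF f] by blast
      have aux: "\<bar>f (X \<omega> b) - f (X \<omega> a)\<bar> \<le> C * (b - a) + 2 * \<epsilon>" if ab: "0 \<le> a" "a \<le> b" "b \<le> T" for a b
        using gen_integral_bound[OF d w1 ab(1,2) fb(2)[OF f]] md[OF f ab] by linarith
      show ?thesis using aux[of s t] aux[of t s] st by (cases "s \<le> t") (auto simp: abs_minus_commute)
    qed
    have n: "norm (apply_bcontfun F t) \<le> 2 * C" for t
    proof -
      have ct: "0 \<le> clip T t" using clip_in[OF T0, of t] by simp
      have "norm (apply_bcontfun F t) \<le> \<bar>fst (apply_bcontfun F t)\<bar> + \<bar>snd (apply_bcontfun F t)\<bar>"
        using dist_pair_le[of "apply_bcontfun F t" 0] by simp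
      also have "\<dots> \<le> C + C" unfolding Fa fst_conv snd_conv by (intro add_mono fb(1) Xs[OF ct]) auto
      finally show ?thesis by simp
    qed
    have m: "dist (apply_bcontfun F s) (apply_bcontfun F t) \<le> 2 * C * \<bar>s - t\<bar> + 4 * \<epsilon>" for s t
    proof -
      have cc: "C * \<bar>clip T s - clip T t\<bar> \<le> C * \<bar>s - t\<bar>" using C clip_dist[of T s t] by (intro mult_left_mono) auto
      have "dist (apply_bcontfun F s) (apply_bcontfun F t) \<le> (C * \<bar>clip T s - clip T t\<bar> + 2 * \<epsilon>) + (C * \<bar>clip T s - clip T t\<bar> + 2 * \<epsilon>)"
        by (rule order_trans[OF dist_pair_le], unfold Fa fst_conv snd_conv, intro add_mono inc clip_in[OF T0]) auto
      then show ?thesis using cc by linarith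
    qed
    have a: "F \<in> approx_sols T p \<beta> \<Lambda> (6 * \<beta> * C) ((12 * \<beta> * T\<^sup>2 + 2 * T * (2 + T) + (2 + T)) * \<epsilon>)"
    proof (rule approx_solsI[where w="\<lambda>r. wh N p J (X \<omega> r)" and gu="\<lambda>r. gen N p \<beta> J (uh N p J) (X \<omega> r)"
          and gv="\<lambda>r. gen N p \<beta> J (vh N p J) (X \<omega> r)" and gw="\<lambda>r. gen N p \<beta> J (wh N p J) (X \<omega> r)"])
      have sub: "continuous_on {0..} h \<Longrightarrow> continuous_on {0..T} h" for h :: "real \<Rightarrow> real" by (erule continuous_on_subset) auto
      show "continuous_on {0..T} (\<lambda>r. wh N p J (X \<omega> r))" by (rule sub[OF pol_path_cont[OF pol_wh w1]])
      show "continuous_on {0..T} (\<lambda>r. gen N p \<beta> J (uh N p J) (X \<omega> r))" by (rule sub[OF gen_path_cont[OF pol_uh w1]])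
      show "continuous_on {0..T} (\<lambda>r. gen N p \<beta> J (vh N p J) (X \<omega> r))" by (rule sub[OF gen_path_cont[OF pol_vh w1]])
      show "continuous_on {0..T} (\<lambda>r. gen N p \<beta> J (wh N p J) (X \<omega> r))" by (rule sub[OF gen_path_cont[OF pol_wh w1]])
      fix r assume r: "r \<in> {0..T}"
      then have x: "X \<omega> r \<in> sphereN N" using Xs by simp
      show "\<bar>wh N p J (X \<omega> r)\<bar> \<le> \<Lambda> * snd (apply_bcontfun F r)" unfolding Fi[OF r] by (rule g(1)[OF x])
      show "\<bar>gen N p \<beta> J (uh N p J) (X \<omega> r) - F1 p \<beta> (fst (apply_bcontfun F r)) (snd (apply_bcontfun F r))\<bar> \<le> \<epsilon>" unfolding Fi[OF r] by (rule g(2)[OF x])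
      show "\<bar>gen N p \<beta> J (vh N p J) (X \<omega> r) - (Fc p \<beta> (fst (apply_bcontfun F r)) (snd (apply_bcontfun F r)) - 2 * \<beta> * wh N p J (X \<omega> r))\<bar> \<le> \<epsilon>"
        unfolding Fi[OF r] by (rule g(3)[OF x])
      show "\<bar>gen N p \<beta> J (wh N p J) (X \<omega> r)\<bar> \<le> C" by (rule fb(2)[OF _ x]) simp
    next
      fix s t assume st: "0 \<le> s" "s \<le> t" "t \<le> T"
      then have i: "s \<in> {0..T}" "t \<in> {0..T}" by auto
      show "\<bar>fst (apply_bcontfun F t) - fst (apply_bcontfun F s) - integral {s..t} (\<lambda>r. gen N p \<beta> J (uh N p J) (X \<omega> r))\<bar> \<le> 2 * \<epsilon>"
        unfolding Fi(1)[OF i(1)] Fi(1)[OF i(2)] by (rule md[OF _ st]) simp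
      show "\<bar>snd (apply_bcontfun F t) - snd (apply_bcontfun F s) - integral {s..t} (\<lambda>r. gen N p \<beta> J (vh N p J) (X \<omega> r))\<bar> \<le> 2 * \<epsilon>"
        unfolding Fi(2)[OF i(1)] Fi(2)[OF i(2)] by (rule md[OF _ st]) simp
      show "\<bar>wh N p J (X \<omega> t) - wh N p J (X \<omega> s) - integral {s..t} (\<lambda>r. gen N p \<beta> J (wh N p J) (X \<omega> r))\<bar> \<le> 2 * \<epsilon>"
        by (rule md[OF _ st]) simp
    qed (use T \<beta> C \<epsilon> in auto)
    show ?thesis unfolding F_def[symmetric] using n m a by blast
  qed
  show ?thesis using BM pB main by blast
qed

end

text \<open>For a fixed disorder. The slope 6 \<beta> C in the condition on second differences stays
  the same while the slack tends to 0; this uniformity becomes differentiability in the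
  limit.\<close>

lemma tight_and_limit_points:
  fixes M :: "nat \<Rightarrow> 'w measure"
  assumes p: "p \<ge> 3" and T: "0 < T" and \<beta>: "\<beta> > 0" and C: "C > 0"
    and good: "\<And>\<epsilon>. \<epsilon> > 0 \<Longrightarrow> eventually (\<lambda>N. good N p \<beta> \<Lambda> J C \<epsilon>) sequentially"
    and lang: "\<And>N. langevin N p \<beta> J (x N) (M N) (X N)"
  shows "tight_seq M (\<lambda>N \<omega>. Upath N p J T (X N \<omega>)) \<and>
    (\<forall>\<mu>. weak_limit_point M (\<lambda>N \<omega>. Upath N p J T (X N \<omega>)) \<mu> \<longrightarrow> (AE f in \<mu>. C1_ode p \<beta> \<Lambda> T f))"
proof -
  have lp: "langevin_process N p \<beta> J (x N) (M N) (X N)" for N by (rule langevin_process.intro[OF lang])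
  have T0: "0 \<le> T" using T by simp
  let ?Y = "\<lambda>N \<omega>. Upath N p J T (X N \<omega>)"
  have P: "prob_space (M N)" for N using lang[of N] unfolding langevin_def by blast
  have m: "?Y N \<in> borel_measurable (M N)" for N by (rule langevin_process.Upath_measurable[OF lp p T])
  define K where "K = 12 * \<beta> * T\<^sup>2 + 2 * T * (2 + T) + (2 + T)"
  have K: "K > 0" unfolding K_def using T \<beta> by (intro add_nonneg_pos add_nonneg_nonneg) auto
  have ev: "\<exists>N0. \<forall>N\<ge>N0. \<exists>B\<in>sets (M N). measure (M N) B \<le> \<eta> \<and> (\<forall>\<omega>\<in>space (M N) - B.
     (\<forall>t. norm (apply_bcontfun (?Y N \<omega>) t) \<le> 2 * C) \<and>
     (\<forall>s t. dist (apply_bcontfun (?Y N \<omega>) s) (apply_bcontfun (?Y N \<omega>) t) \<le> 2 * C * \<bar>s - t\<bar> + 4 * \<epsilon>) \<and>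
     ?Y N \<omega> \<in> approx_sols T p \<beta> \<Lambda> (6 * \<beta> * C) (K * \<epsilon>))" if \<epsilon>: "\<epsilon> > 0" and \<eta>: "\<eta> > 0" for \<epsilon> \<eta>
  proof -
    obtain N1 where N1: "\<And>N. N \<ge> N1 \<Longrightarrow> good N p \<beta> \<Lambda> J C \<epsilon>" using good[OF \<epsilon>] unfolding eventually_sequentially by blast
    obtain N2 :: nat where N2: "6 * C * T / (\<epsilon>\<^sup>2 * \<eta>) \<le> real N2" using real_arch_simple by blast
    show ?thesis
    proof (intro exI[of _ "max 1 (max N1 N2)"] allI impI)
      fix N assume N: "max 1 (max N1 N2) \<le> N"
      then have n1: "N \<ge> 1" "N \<ge> N1" "N \<ge> N2" by auto
      obtain B where B: "B \<in> sets (M N)" "measure (M N) B \<le> 6 * C * T / (\<epsilon>\<^sup>2 * real N)" "\<forall>\<omega>\<in>space (M N) - B.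
         (\<forall>t. norm (apply_bcontfun (?Y N \<omega>) t) \<le> 2 * C) \<and>
         (\<forall>s t. dist (apply_bcontfun (?Y N \<omega>) s) (apply_bcontfun (?Y N \<omega>) t) \<le> 2 * C * \<bar>s - t\<bar> + 4 * \<epsilon>) \<and>
         ?Y N \<omega> \<in> approx_sols T p \<beta> \<Lambda> (6 * \<beta> * C) (K * \<epsilon>)"
        using langevin_process.good_event[OF lp p T \<beta> n1(1) C \<epsilon> N1[OF n1(2)]] unfolding K_def by blast
      have "6 * C * T / (\<epsilon>\<^sup>2 * \<eta>) \<le> real N" using N2 n1(3) by linarith
      then have "6 * C * T \<le> real N * (\<epsilon>\<^sup>2 * \<eta>)" using \<epsilon> \<eta> by (simp add: pos_divide_le_eq)
      then have "6 * C * T / (\<epsilon>\<^sup>2 * real N) \<le> \<eta>" using \<epsilon> n1(1) by (simp add: pos_divide_le_eq mult_ac)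
      then show "\<exists>B\<in>sets (M N). measure (M N) B \<le> \<eta> \<and> (\<forall>\<omega>\<in>space (M N) - B.
         (\<forall>t. norm (apply_bcontfun (?Y N \<omega>) t) \<le> 2 * C) \<and>
         (\<forall>s t. dist (apply_bcontfun (?Y N \<omega>) s) (apply_bcontfun (?Y N \<omega>) t) \<le> 2 * C * \<bar>s - t\<bar> + 4 * \<epsilon>) \<and>
         ?Y N \<omega> \<in> approx_sols T p \<beta> \<Lambda> (6 * \<beta> * C) (K * \<epsilon>))"
        using B by (intro bexI[of _ B] conjI) auto
    qed
  qed
  have weaken: "\<exists>N0. \<forall>N\<ge>N0. \<exists>B\<in>sets (M N). measure (M N) B \<le> \<eta> \<and> (\<forall>\<omega>\<in>space (M N) - B. S N \<omega>)"
    if "\<exists>N0. \<forall>N\<ge>N0. \<exists>B\<in>sets (M N). measure (M N) B \<le> \<eta> \<and> (\<forall>\<omega>\<in>space (M N) - B. R N \<omega>)" "\<And>N \<omega>. R N \<omega> \<Longrightarrow> S N \<omega>"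
    for \<eta> and R S :: "nat \<Rightarrow> 'w \<Rightarrow> bool" using that by meson
  have "tight_seq M ?Y"
  proof (rule tight_paths[OF P m T])
    show "apply_bcontfun (?Y N \<omega>) (clip T t) = apply_bcontfun (?Y N \<omega>) t" if "\<omega> \<in> space (M N)" for N \<omega> t
      by (rule langevin_process.Upath_clip[OF lp p T0 that])
    show "\<exists>B N0. \<forall>N\<ge>N0. \<exists>A\<in>sets (M N). measure (M N) A \<le> \<eta> \<and> (\<forall>\<omega>\<in>space (M N) - A. \<forall>t. norm (apply_bcontfun (?Y N \<omega>) t) \<le> B)"
      if "\<eta> > 0" for \<eta> by (rule exI[of _ "2 * C"], rule weaken[OF ev[OF zero_less_one that]], elim conjE)
    show "\<exists>\<delta>>0. \<exists>N0. \<forall>N\<ge>N0. \<exists>A\<in>sets (M N). measure (M N) A \<le> \<eta> \<and>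
      (\<forall>\<omega>\<in>space (M N) - A. \<forall>s t. \<bar>s - t\<bar> < \<delta> \<longrightarrow> dist (apply_bcontfun (?Y N \<omega>) s) (apply_bcontfun (?Y N \<omega>) t) \<le> e)"
      if e: "e > 0" and \<eta>: "\<eta> > 0" for e \<eta>
    \<comment> \<open>Half of e is left to the Lipschitz part and half to the martingale errors 4
      \<epsilon>, hence \<epsilon> = e/8.\<close>
    proof (intro exI[of _ "e / (4 * C)"] conjI)
      show "e / (4 * C) > 0" using e C by simp
      have le: "2 * C * \<bar>s - t\<bar> + 4 * (e / 8) \<le> e" if "\<bar>s - t\<bar> < e / (4 * C)" for s t
        using that C by (simp add: pos_less_divide_eq mult_ac)
      have "e / 8 > 0" using e by simp
      show "\<exists>N0. \<forall>N\<ge>N0. \<exists>A\<in>sets (M N). measure (M N) A \<le> \<eta> \<and>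
        (\<forall>\<omega>\<in>space (M N) - A. \<forall>s t. \<bar>s - t\<bar> < e / (4 * C) \<longrightarrow> dist (apply_bcontfun (?Y N \<omega>) s) (apply_bcontfun (?Y N \<omega>) t) \<le> e)"
        by (rule weaken[OF ev[OF \<open>e / 8 > 0\<close> \<eta>]]) (use le order_trans in blast)
    qed
  qed
  moreover have "AE f in \<mu>. C1_ode p \<beta> \<Lambda> T f" if \<mu>: "weak_limit_point M ?Y \<mu>" for \<mu>
  proof -
    have "AE f in \<mu>. f \<in> approx_sols T p \<beta> \<Lambda> (6 * \<beta> * C) (1 / real (Suc n))" for n
    proof (rule weak_limit_closed[OF P m \<mu> closed_approx_sols])
      fix \<eta> :: real assume \<eta>: "\<eta> > 0"
      have e: "1 / real (Suc n) / K > 0" using K by simp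
      have Ke: "K * (1 / real (Suc n) / K) = 1 / real (Suc n)" using K by simp
      show "\<exists>N0. \<forall>N\<ge>N0. \<exists>B\<in>sets (M N). measure (M N) B \<le> \<eta> \<and> (\<forall>\<omega>\<in>space (M N) - B. ?Y N \<omega> \<in> approx_sols T p \<beta> \<Lambda> (6 * \<beta> * C) (1 / real (Suc n)))"
        by (rule weaken[OF ev[OF e \<eta>, unfolded Ke]]) (elim conjE)
    qed
    then have "AE f in \<mu>. \<forall>n. f \<in> approx_sols T p \<beta> \<Lambda> (6 * \<beta> * C) (1 / real (Suc n))" unfolding AE_all_countable by blast
    then show ?thesis
    proof eventually_elim
      case (elim f)
      have "0 \<le> 6 * \<beta> * C" using \<beta> C by simp
      from C1_ode_of_approx_sols[OF approx_sols_limit[OF elim[rule_format]] T this] show ?case .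
    qed
  qed
  ultimately show ?thesis by blast
qed

theorem mainTheorem1:
  fixes P :: "'d measure" and J :: "'d \<Rightarrow> nat list \<Rightarrow> real"
    and p :: nat and \<beta> T \<Lambda> :: real and x :: "nat \<Rightarrow> nat \<Rightarrow> real"
  assumes "prob_space P"
    and "prob_space.indep_vars P (\<lambda>_. borel) (\<lambda>is d. J d is) {is. length is = p}"
    and "\<And>is. length is = p \<Longrightarrow> distributed P lborel (\<lambda>d. J d is) std_normal_density"
    and "p \<ge> 3" and "\<beta> > 0" and "T > 0"
    and "limsup (\<lambda>N. ereal (integral\<^sup>L P (\<lambda>d. sup_G_opnorm N p (J d)))) < ereal \<Lambda>"
    and "\<And>N. x N \<in> sphereN N"
  shows "AE d in P. \<forall>(M :: nat \<Rightarrow> 'w measure) X.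
           (\<forall>N. langevin N p \<beta> (J d) (x N) (M N) (X N)) \<longrightarrow>
           (tight_seq M (\<lambda>N \<omega>. Upath N p (J d) T (X N \<omega>)) \<and>
            (\<forall>\<mu>. weak_limit_point M (\<lambda>N \<omega>. Upath N p (J d) T (X N \<omega>)) \<mu> \<longrightarrow>
                  (AE f in \<mu>. C1_ode p \<beta> \<Lambda> T f)))"
proof -
  interpret spin_glass P J p
    by (intro spin_glass.intro gaussian_family.intro gaussian_family_axioms.intro spin_glass_axioms.intro assms) (simp add: assms)
  \<comment> \<open>\<open>C\<close> is deterministic, and the null set depends neither on the
    starting points nor on the processes, so the quantifier over \<open>M\<close> and
    \<open>X\<close> can stay inside the almost sure statement.\<close>
  obtain C where C: "C > 0" and AE: "AE d in P. \<forall>\<epsilon>>0. eventually (\<lambda>N. good N p \<beta> \<Lambda> (J d) C \<epsilon>) sequentially"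
    using AE_good[OF assms(5,7)] by blast
  from AE show ?thesis
  proof eventually_elim
    case (elim d)
    show ?case
    proof (intro allI impI)
      fix M :: "nat \<Rightarrow> 'w measure" and X
      assume "\<forall>N. langevin N p \<beta> (J d) (x N) (M N) (X N)"
      then show "tight_seq M (\<lambda>N \<omega>. Upath N p (J d) T (X N \<omega>)) \<and>
            (\<forall>\<mu>. weak_limit_point M (\<lambda>N \<omega>. Upath N p (J d) T (X N \<omega>)) \<mu> \<longrightarrow> (AE f in \<mu>. C1_ode p \<beta> \<Lambda> T f))"
        using elim by (intro tight_and_limit_points[OF assms(4,6,5) C]) auto
    qed
  qed
qed

end
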